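(* Let $n\ge1$. Suppose $V=\bar V\cap(\mathbb{C}^\times)^{2n}$, where $\bar V\subset\mathbb{CP}^{2n}$ is an $n$-dimensional complete intersection of $n$ hypersurfaces of degrees $d_1,\dots,d_n$ in $\mathbb{CP}^{2n}$. Then the amoeba $\mathcal{A}=\operatorname{Log}(V)$ is covered by the amoeba map $\operatorname{Log}|_V$ at most $$\frac{(2n)!}{(n!)^2}\prod_{j=1}^nd_j^2$$ times, while the rolled coamoeba $\mathcal{B}_\pi=\operatorname{Arg}_\pi(V)$ (as well as the coamoeba $\mathcal{B}=\operatorname{Arg}(V)$ itself) is covered at most $\prod_{j=1}^nd_j^2$ times by the map $\operatorname{Arg}_\pi|_V$ (respectively $\operatorname{Arg}|_V$). Furthermore, $$\operatorname{Vol}(\mathcal{A})\le\frac{\pi^{2n}}{2}\prod_{j=1}^nd_j^2.$$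
   Context: $(\mathbb{C}^\times)^{2n}\subset\mathbb{CP}^{2n}$ is the complement of the coordinate hyperplanes. $\operatorname{Log}(z_1,\dots,z_{2n})=(\log|z_1|,\dots,\log|z_{2n}|)\in\mathbb{R}^{2n}$; $\operatorname{Arg}(z_1,\dots,z_{2n})=(\arg z_1,\dots,\arg z_{2n})\in(\mathbb{R}/2\pi\mathbb{Z})^{2n}$; $\operatorname{Arg}_\pi(z)\in(\mathbb{R}/\pi\mathbb{Z})^{2n}$ is the reduction of $\operatorname{Arg}(z)$ mod $\pi$ in each coordinate. $\operatorname{Vol}$ is Lebesgue measure on $\mathbb{R}^{2n}$. "Covers at most $m$ times": let $A$ be a (possibly singular) real or complex algebraic variety, stratified into smooth manifolds, let $B$ be a smooth manifold with $\dim_{\mathbb{R}}A=\dim_{\mathbb{R}}B$, and let $f:A\to B$ be a map whose restriction to each stratum is smooth. Then $f$ covers its image at most $m$ times if for every $p\in B$ the inverse image $f^{-1}(p)$ consists of at most $m$ points, unless $p$ is a critical value of $f|_\Sigma$ for some stratum $\Sigma$ of the stratification (a point of $f(\Sigma)$ is a critical value of $f|_\Sigma$ if it is the image of a point of $\Sigma$ where the differential of $f|_\Sigma$ is not surjective onto the tangent space of $B$). *)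

theory Defs
  imports "HOL-Analysis.Analysis" "HOL-Library.Poly_Mapping" "HOL-Library.Real_Mod"
begin

type_synonym 'k cpoly = "('k \<Rightarrow>\<^sub>0 nat) \<Rightarrow>\<^sub>0 complex"

definition poly_eval :: "'k::finite cpoly \<Rightarrow> complex ^ 'k \<Rightarrow> complex" where
  "poly_eval P x =
     (\<Sum>m\<in>Poly_Mapping.keys P.
        Poly_Mapping.lookup P m * (\<Prod>i\<in>UNIV. (x $ i) ^ Poly_Mapping.lookup m i))"

definition homogeneous :: "nat \<Rightarrow> 'k::finite cpoly \<Rightarrow> bool" where
  "homogeneous d P \<longleftrightarrow>
     (\<forall>m\<in>Poly_Mapping.keys P. (\<Sum>i\<in>UNIV. Poly_Mapping.lookup m i) = d)"

text \<open>Points of projective space are the complex lines through the origin; with index type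
  \<open>'k\<close> the projective dimension is \<open>CARD('k) - 1\<close>.\<close>

definition proj_space :: "(complex ^ 'k) set set" where
  "proj_space = {L. vec.subspace L \<and> vec.dim L = 1}"

definition proj_zeros :: "'k::finite cpoly set \<Rightarrow> (complex ^ 'k) set set" where
  "proj_zeros T = {L \<in> proj_space. \<forall>P\<in>T. \<forall>x\<in>L. poly_eval P x = 0}"

definition zariski_closed :: "(complex ^ 'k::finite) set set \<Rightarrow> bool" where
  "zariski_closed X \<longleftrightarrow> (\<exists>T. (\<forall>P\<in>T. \<exists>d. homogeneous d P) \<and> X = proj_zeros T)"

definition zariski_irreducible :: "(complex ^ 'k::finite) set set \<Rightarrow> bool" where
  "zariski_irreducible X \<longleftrightarrow> zariski_closed X \<and> X \<noteq> {} \<and>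
     (\<forall>Y Z. zariski_closed Y \<longrightarrow> zariski_closed Z \<longrightarrow> X = Y \<union> Z \<longrightarrow> X = Y \<or> X = Z)"

definition irreducible_chain :: "(complex ^ 'k::finite) set set \<Rightarrow> nat \<Rightarrow> bool" where
  "irreducible_chain X n \<longleftrightarrow>
     (\<exists>C. (\<forall>i\<le>n. zariski_irreducible (C i) \<and> C i \<subseteq> X) \<and> (\<forall>i<n. C i \<subset> C (Suc i)))"

text \<open>Krull dimension: the largest \<open>n\<close> admitting a chain
  \<open>C 0 \<subset> \<dots> \<subset> C n\<close> of irreducible closed subsets (initial segments of
  chains are chains, so excluding length \<open>Suc n\<close> excludes all longer ones).\<close>

definition has_proj_dim :: "(complex ^ 'k::finite) set set \<Rightarrow> nat \<Rightarrow> bool" where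
  "has_proj_dim X n \<longleftrightarrow> irreducible_chain X n \<and> \<not> irreducible_chain X (Suc n)"

text \<open>The hypersurface of degree \<open>d\<close> cut out by the form \<open>P\<close>; \<open>P\<close> need not be
  square-free, so multiple components are counted in the degree.\<close>

definition hypersurface :: "nat \<Rightarrow> 'k::finite cpoly \<Rightarrow> (complex ^ 'k) set set \<Rightarrow> bool" where
  "hypersurface d P H \<longleftrightarrow> d \<ge> 1 \<and> P \<noteq> 0 \<and> homogeneous d P \<and> H = proj_zeros {P}"

definition ctorus :: "(complex ^ 'm) set" where
  "ctorus = {z. \<forall>i. z $ i \<noteq> 0}"

text \<open>The affine chart \<open>z \<mapsto> [1 : z]\<close>, with \<open>None\<close> the index of the additional
  homogeneous coordinate.\<close>

definition proj_point :: "complex ^ 'm::finite \<Rightarrow> (complex ^ 'm option) set" where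
  "proj_point z = vec.span {\<chi> i. case i of None \<Rightarrow> 1 | Some j \<Rightarrow> z $ j}"

definition torus_part :: "(complex ^ 'm::finite option) set set \<Rightarrow> (complex ^ 'm) set" where
  "torus_part X = {z \<in> ctorus. proj_point z \<in> X}"

text \<open>Elements of \<open>\<real> / L\<int>\<close> are represented as cosets.\<close>

definition residue :: "real \<Rightarrow> real \<Rightarrow> real set" where
  "residue L x = {y. [y = x] (rmod L)}"

definition residue_vec :: "real \<Rightarrow> real ^ 'm \<Rightarrow> real set ^ 'm" where
  "residue_vec L v = (\<chi> i. residue L (v $ i))"

definition Log_map :: "complex ^ 'm \<Rightarrow> real ^ 'm" where
  "Log_map z = (\<chi> i. ln (norm (z $ i)))"

definition Arg_map :: "complex ^ 'm \<Rightarrow> real set ^ 'm" where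
  "Arg_map z = residue_vec (2 * pi) (\<chi> i. Arg (z $ i))"

definition Arg_pi_map :: "complex ^ 'm \<Rightarrow> real set ^ 'm" where
  "Arg_pi_map z = residue_vec pi (\<chi> i. Arg (z $ i))"

primrec Ck_on :: "nat \<Rightarrow> 'a::real_normed_vector set \<Rightarrow> ('a \<Rightarrow> 'b::real_normed_vector) \<Rightarrow> bool" where
  "Ck_on 0 U f \<longleftrightarrow> continuous_on U f"
| "Ck_on (Suc k) U f \<longleftrightarrow>
     (\<forall>x\<in>U. f differentiable (at x)) \<and> (\<forall>v. Ck_on k U (\<lambda>x. frechet_derivative f (at x) v))"

definition smooth_on :: "'a::real_normed_vector set \<Rightarrow> ('a \<Rightarrow> 'b::real_normed_vector) \<Rightarrow> bool" where
  "smooth_on U f \<longleftrightarrow> open U \<and> (\<forall>k. Ck_on k U f)"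

definition smooth_submanifold :: "nat \<Rightarrow> 'a::euclidean_space set \<Rightarrow> bool" where
  "smooth_submanifold k S \<longleftrightarrow>
     (\<forall>x\<in>S. \<exists>U W \<phi> \<psi> (E :: 'a set). x \<in> U \<and> smooth_on U \<phi> \<and> smooth_on W \<psi> \<and>
        homeomorphism U W \<phi> \<psi> \<and> subspace E \<and> dim E = k \<and> \<phi> ` (S \<inter> U) = W \<inter> E)"

text \<open>A locally finite partition into smooth submanifolds, where a stratum can meet the closure
  of another one only if its dimension is smaller. The nonempty strata \<open>A\<^sub>k - A\<^sub>k\<^sub>-\<^sub>1\<close>
  of a filtration by closed subsets, or their connected components when these are locally finite,
  form a stratification in this sense.\<close>

definition stratification :: "'a::euclidean_space set set \<Rightarrow> 'a set \<Rightarrow> bool" where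
  "stratification \<S> A \<longleftrightarrow>
     disjoint \<S> \<and> {} \<notin> \<S> \<and> \<Union>\<S> = A \<and>
     (\<forall>x\<in>A. \<exists>U. open U \<and> x \<in> U \<and> finite {S \<in> \<S>. S \<inter> U \<noteq> {}}) \<and>
     (\<exists>dm. (\<forall>S\<in>\<S>. smooth_submanifold (dm S) S) \<and>
        (\<forall>S\<in>\<S>. \<forall>T\<in>\<S>. S \<noteq> T \<longrightarrow> S \<inter> closure T \<noteq> {} \<longrightarrow> dm S < dm T))"

text \<open>The target manifold \<open>B\<close> is presented by a parametrization \<open>q\<close> of Euclidean space
  onto \<open>B\<close> that is a local diffeomorphism: the identity for Euclidean space itself and
  \<open>residue_vec L\<close> for the torus. All tangent spaces of \<open>B\<close> are thereby identified
  with the Euclidean space. The image of the differential of \<open>f\<close> restricted to \<open>S\<close> at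
  \<open>x\<close> consists of the velocities at \<open>0\<close> of \<open>f \<circ> \<gamma>\<close>, read off from a local lift
  \<open>g\<close> through \<open>q\<close>, for the smooth curves \<open>\<gamma>\<close> in \<open>S\<close> through \<open>x\<close>.\<close>

definition differential_image ::
  "('e::euclidean_space \<Rightarrow> 'b) \<Rightarrow> ('a::euclidean_space \<Rightarrow> 'b) \<Rightarrow> 'a set \<Rightarrow> 'a \<Rightarrow> 'e set" where
  "differential_image q f S x =
     {vector_derivative g (at 0) |g \<gamma> \<epsilon>. \<epsilon> > 0 \<and>
        smooth_on {-\<epsilon><..<\<epsilon>} \<gamma> \<and> \<gamma> ` {-\<epsilon><..<\<epsilon>} \<subseteq> S \<and> \<gamma> 0 = x \<and>
        smooth_on {-\<epsilon><..<\<epsilon>} g \<and> (\<forall>t\<in>{-\<epsilon><..<\<epsilon>}. f (\<gamma> t) = q (g t))}"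

definition critical_values ::
  "('e::euclidean_space \<Rightarrow> 'b) \<Rightarrow> ('a::euclidean_space \<Rightarrow> 'b) \<Rightarrow> 'a set \<Rightarrow> 'b set" where
  "critical_values q f S = f ` {x \<in> S. differential_image q f S x \<noteq> UNIV}"

definition covers_at_most ::
  "('e::euclidean_space \<Rightarrow> 'b) \<Rightarrow> ('a::euclidean_space \<Rightarrow> 'b) \<Rightarrow> 'a set \<Rightarrow> 'a set set \<Rightarrow> real \<Rightarrow> bool"
  where
  "covers_at_most q f A \<S> N \<longleftrightarrow>
     (\<forall>p\<in>range q. (\<forall>S\<in>\<S>. p \<notin> critical_values q f S) \<longrightarrow>
        finite {x \<in> A. f x = p} \<and> real (card {x \<in> A. f x = p}) \<le> N)"

end

theory Submission
  imports Defs "HOL-Complex_Analysis.Conformal_Mappings"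
    "HOL-Computational_Algebra.Fundamental_Theorem_Algebra"
begin

text \<open>The fibre bounds come from a dimension count which replaces Bezout's theorem. Let \<open>M\<close>
  points of a generic fibre of the argument map be separated by a linear form \<open>h\<close>. Near them the
  \<open>n\<close> equations \<open>f\<^sub>j(z)\<close>, their conjugates \<open>f\<^sub>j\<^sup>*(w)\<close> and the binomials \<open>z\<^sub>i - t\<^sub>i w\<^sub>i\<close> define an open
  map, so the products of their powers with \<open>h\<^sup>k\<close>, \<open>k < M\<close>, are linearly independent polynomials
  in \<open>(z, w)\<close>; comparing their number in large degree with the dimension of the space of
  polynomials gives \<open>M \<le> \<Prod>d\<^sub>j\<^sup>2\<close>. For the logarithm map the products of powers of the \<open>z\<^sub>i w\<^sub>i\<close>
  with \<open>h\<^sup>k\<close> are independent on the product of the variety with its conjugate, and the Hilbert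
  function of the variety is bounded by its degree.

  Over the amoeba the variety consists of sheets \<open>u \<mapsto> exp (u + \<i> g(u))\<close> with \<open>(Dg)\<^sup>2 = -1\<close>, so a
  sheet and its image in the torus of arguments have the same volume, which bounds the volume of the
  amoeba by \<open>\<pi>\<^sup>2\<^sup>n \<Prod>d\<^sub>j\<^sup>2\<close> divided by the number of points in a generic nonempty fibre. This number
  is at least two: the fibre over \<open>p\<close> is the fixed point set of the involution \<open>z \<mapsto> y / cnj z\<close>,
  \<open>y = exp (2 p)\<close>, of a finite set whose cardinality is the same for all \<open>y\<close> that are generic over
  a countable field of definition. If the cardinality were odd, almost every fibre would be nonempty
  and the amoeba would have infinite volume.\<close>


section \<open>Polynomial functions\<close>

text \<open>The obstacle is that only the dimension of the intersection is known: the equations may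
  be non-reduced, \<open>V\<close> may be singular and its stratification is arbitrary. All analysis
  therefore takes place on charts of codimension exactly \<open>n\<close> contained in
  \<open>V\<close>. The coefficients of the charts lie in one countable ring, so countably many
  charts suffice and Sard's theorem leaves a null set of bad values. The fibre bounds are proved off
  this null set and then carried to every noncritical value: a stratum maps openly at the points
  over it, so finitely many points of the fibre persist over nearby generic values. Moduli and
  arguments are not algebraic. Each fibre is therefore read as the diagonal part of a fibre on pairs
  \<open>(z, z')\<close>, where the conjugate of \<open>z'\<close> is an independent variable. The
  constant \<open>(2n)! / (n!)\<^sup>2\<close> comes from leading coefficients: \<open>M\<close>
  sheets force the square of the Hilbert function of the variety to be at least about
  \<open>M X\<^sup>2\<^sup>n / (2n)!\<close>, while on average this function is at most about
  \<open>(\<Prod>d\<^sub>j) X\<^sup>n / n!\<close>.\<close>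

lemma countable_closure:
  fixes op2 :: "nat \<Rightarrow> 'x \<Rightarrow> 'x \<Rightarrow> 'x"
  assumes "countable S"
  obtains T where "countable T" "S \<subseteq> T" "\<And>k x y. x \<in> T \<Longrightarrow> y \<in> T \<Longrightarrow> op2 k x y \<in> T"
proof -
  define A where "A = rec_nat S (\<lambda>_ B. B \<union> (\<Union>k. (\<lambda>(x, y). op2 k x y) ` (B \<times> B)))"
  have A0: "A 0 = S" and ASuc: "A (Suc n) = A n \<union> (\<Union>k. (\<lambda>(x, y). op2 k x y) ` (A n \<times> A n))" for n
    by (simp_all add: A_def)
  have "countable (A n)" for n
    by (induction n) (auto simp: A0 ASuc assms intro!: countable_SIGMA)
  moreover have mono: "A n \<subseteq> A m" if "n \<le> m" for n m
    using that by (induction rule: dec_induct) (auto simp: ASuc)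
  moreover have "op2 k x y \<in> (\<Union>n. A n)" if xy: "x \<in> (\<Union>n. A n)" "y \<in> (\<Union>n. A n)" for k x y
  proof -
    obtain n m where "x \<in> A n" "y \<in> A m" using xy by auto
    then have "x \<in> A (max n m)" "y \<in> A (max n m)"
      using mono[of n "max n m"] mono[of m "max n m"] by auto
    then have "op2 k x y \<in> A (Suc (max n m))"
      unfolding ASuc by blast
    then show ?thesis by blast
  qed
  ultimately show thesis
    using that[of "\<Union>n. A n"] A0 by (metis UN_upper UNIV_I countable_UN uncountable_def countableI_type)
qed

text \<open>Polynomial functions over the subring generated by \<open>K\<close>;
  \<open>pf_neg1\<close> supplies subtraction and the integers even for empty \<open>K\<close>.
  Coefficients are tracked because a countable \<open>K\<close> leaves only countably many
  polynomials, on which the countable families of charts and the notion of a generic point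
  rest.\<close>

inductive_set pfun :: "complex set \<Rightarrow> (complex ^ 'a::finite \<Rightarrow> complex) set" for K where
  pf_const: "c \<in> K \<Longrightarrow> (\<lambda>_. c) \<in> pfun K"
| pf_neg1: "(\<lambda>_. -1) \<in> pfun K"
| pf_coord: "(\<lambda>x. x $ i) \<in> pfun K"
| pf_add: "f \<in> pfun K \<Longrightarrow> g \<in> pfun K \<Longrightarrow> (\<lambda>x. f x + g x) \<in> pfun K"
| pf_mult: "f \<in> pfun K \<Longrightarrow> g \<in> pfun K \<Longrightarrow> (\<lambda>x. f x * g x) \<in> pfun K"

lemma pf_one: "(\<lambda>_. 1) \<in> pfun K"
  using pf_mult[OF pf_neg1 pf_neg1] by simp

lemma pf_zero: "(\<lambda>_. 0) \<in> pfun K"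
  using pf_add[OF pf_neg1 pf_one] by simp

lemma pf_uminus: "f \<in> pfun K \<Longrightarrow> (\<lambda>x. - f x) \<in> pfun K"
  using pf_mult[OF pf_neg1] by fastforce

lemma pf_diff: "f \<in> pfun K \<Longrightarrow> g \<in> pfun K \<Longrightarrow> (\<lambda>x. f x - g x) \<in> pfun K"
  using pf_add[OF _ pf_uminus] by fastforce

lemma pf_sum: "(\<And>i. i \<in> S \<Longrightarrow> f i \<in> pfun K) \<Longrightarrow> (\<lambda>x. \<Sum>i\<in>S. f i x) \<in> pfun K"
proof (induction S rule: infinite_finite_induct)
  case (insert x S)
  have "(\<lambda>y. f x y + (\<Sum>i\<in>S. f i y)) \<in> pfun K"
    by (rule pf_add) (use insert in auto)
  then show ?case using insert by simp
qed (auto simp: pf_zero)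

lemma pf_prod: "(\<And>i. i \<in> S \<Longrightarrow> f i \<in> pfun K) \<Longrightarrow> (\<lambda>x. \<Prod>i\<in>S. f i x) \<in> pfun K"
proof (induction S rule: infinite_finite_induct)
  case (insert x S)
  have "(\<lambda>y. f x y * (\<Prod>i\<in>S. f i y)) \<in> pfun K"
    by (rule pf_mult) (use insert in auto)
  then show ?case using insert by simp
qed (auto simp: pf_one)

lemma pf_power: "f \<in> pfun K \<Longrightarrow> (\<lambda>x. f x ^ k) \<in> pfun K"
  by (induction k) (auto intro: pf_one pf_mult)

lemma pf_subset: "f \<in> pfun K \<Longrightarrow> K \<subseteq> L \<Longrightarrow> f \<in> pfun L"
  by (induction rule: pfun.induct) (auto intro: pfun.intros)

lemma pf_UNIV: "f \<in> pfun K \<Longrightarrow> f \<in> pfun UNIV"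
  by (erule pf_subset) simp

lemma pf_finite_constants:
  "f \<in> pfun UNIV \<Longrightarrow> \<exists>K. finite K \<and> f \<in> pfun K"
proof (induction rule: pfun.induct)
  case (pf_const c)
  then show ?case by (intro exI[of _ "{c}"]) (auto intro: pfun.pf_const)
next
  case (pf_add f g)
  then obtain K L where "finite K" "f \<in> pfun K" "finite L" "g \<in> pfun L" by blast
  then show ?case
    by (intro exI[of _ "K \<union> L"]) (auto intro!: pfun.pf_add intro: pf_subset)
next
  case (pf_mult f g)
  then obtain K L where "finite K" "f \<in> pfun K" "finite L" "g \<in> pfun L" by blast
  then show ?case
    by (intro exI[of _ "K \<union> L"]) (auto intro!: pfun.pf_mult intro: pf_subset)
qed (auto intro: pfun.intros exI[of _ "{}"])

lemma countable_pfun: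
  assumes "countable K"
  shows "countable (pfun K :: (complex ^ 'a::finite \<Rightarrow> complex) set)"
proof -
  let ?B = "(\<lambda>c. (\<lambda>_::complex^'a. c)) ` K \<union> {\<lambda>_. -1} \<union> range (\<lambda>i x. x $ i)"
  have "countable ?B" using assms by auto
  then obtain T where T: "countable T" "?B \<subseteq> T"
    "\<And>k f g. f \<in> T \<Longrightarrow> g \<in> T \<Longrightarrow> (\<lambda>x. if k = (0::nat) then f x + g x else f x * g x) \<in> T"
    using countable_closure[of ?B "\<lambda>k f g x. if k = (0::nat) then f x + g x else f x * g x"] by auto
  have "f \<in> T" if "f \<in> pfun K" for f
    using that
  proof (induction rule: pfun.induct)
    case (pf_const c) then show ?case by (intro subsetD[OF T(2)]) blast
  next
    case pf_neg1 show ?case by (intro subsetD[OF T(2)]) blast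
  next
    case (pf_coord i) show ?case by (intro subsetD[OF T(2)]) blast
  next
    case (pf_add f g) then show ?case using T(3)[of f g 0] by simp
  next
    case (pf_mult f g) then show ?case using T(3)[of f g 1] by simp
  qed
  then show ?thesis by (intro countable_subset[OF _ T(1)] subsetI)
qed

lemma pf_continuous: "f \<in> pfun K \<Longrightarrow> continuous_on S f"
  by (induction rule: pfun.induct) (auto intro!: continuous_intros)

lemma pf_zeros_closed: "f \<in> pfun K \<Longrightarrow> closed {x. f x = 0}"
  by (intro closed_Collect_eq) (auto intro: pf_continuous continuous_intros)

text \<open>Differentiation must stay over the same coefficients. The partials are quantified
  outside the point, so that each is a single polynomial; \<open>pd\<close> is identified with them
  afterwards by uniqueness of the derivative.\<close>

lemma pf_has_derivative_ex:
  "f \<in> pfun K \<Longrightarrow> \<exists>D. (\<forall>i. D i \<in> pfun K) \<and>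
     (\<forall>x. (f has_derivative (\<lambda>h. \<Sum>i\<in>UNIV. D i x * h $ i)) (at x))"
proof (induction rule: pfun.induct)
  case (pf_const c)
  show ?case
    by (intro exI[of _ "\<lambda>_ _. 0"] conjI allI pf_zero) simp
next
  case pf_neg1
  show ?case
    by (intro exI[of _ "\<lambda>_ _. 0"] conjI allI pf_zero) simp
next
  case (pf_coord j)
  have "(\<lambda>_. if i = j then 1 else 0) \<in> pfun K" for i
    by (simp add: pf_one pf_zero)
  moreover have "((\<lambda>x. x $ j) has_derivative (\<lambda>h. \<Sum>i\<in>UNIV. (if i = j then 1 else 0) * h $ i)) (at x)"
    for x :: "complex ^ 'a"
    by (simp add: if_distrib[of "\<lambda>c. c * _"] bounded_linear_imp_has_derivative bounded_linear_vec_nth cong: if_cong)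
  ultimately show ?case
    by (intro exI[of _ "\<lambda>i _. if i = j then 1 else 0"]) (simp add: pf_one pf_zero)
next
  case (pf_add f g)
  then obtain D E where *: "\<forall>i. D i \<in> pfun K" "\<forall>i. E i \<in> pfun K"
    and **: "\<And>x. (f has_derivative (\<lambda>h. \<Sum>i\<in>UNIV. D i x * h $ i)) (at x)"
    "\<And>x. (g has_derivative (\<lambda>h. \<Sum>i\<in>UNIV. E i x * h $ i)) (at x)" by blast
  have "((\<lambda>x. f x + g x) has_derivative (\<lambda>h. \<Sum>i\<in>UNIV. (D i x + E i x) * h $ i)) (at x)" for x
    using has_derivative_add[OF **[of x]] by (simp add: sum.distrib distrib_right)
  then show ?case
    using * by (intro exI[of _ "\<lambda>i x. D i x + E i x"]) (simp add: pfun.pf_add)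
next
  case (pf_mult f g)
  then obtain D E where *: "\<forall>i. D i \<in> pfun K" "\<forall>i. E i \<in> pfun K"
    and **: "\<And>x. (f has_derivative (\<lambda>h. \<Sum>i\<in>UNIV. D i x * h $ i)) (at x)"
    "\<And>x. (g has_derivative (\<lambda>h. \<Sum>i\<in>UNIV. E i x * h $ i)) (at x)" by blast
  have "((\<lambda>x. f x * g x) has_derivative (\<lambda>h. \<Sum>i\<in>UNIV. (f x * E i x + D i x * g x) * h $ i)) (at x)" for x
    using has_derivative_mult[OF **[of x]]
    by (simp add: sum.distrib algebra_simps sum_distrib_left)
  then show ?case
    using * pf_mult(1,2)
    by (intro exI[of _ "\<lambda>i x. f x * E i x + D i x * g x"]) (simp add: pfun.pf_add pfun.pf_mult)
qed

definition pd :: "'a::finite \<Rightarrow> (complex ^ 'a \<Rightarrow> complex) \<Rightarrow> complex ^ 'a \<Rightarrow> complex" where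
  "pd i f x = frechet_derivative f (at x) (axis i 1)"

lemma pd_eqI:
  assumes "(f has_derivative (\<lambda>h. \<Sum>i\<in>UNIV. D i * h $ i)) (at x)"
  shows "pd j f x = D j"
  using frechet_derivative_at[OF assms, symmetric]
  by (simp add: pd_def axis_def if_distrib[of "\<lambda>c. _ * c"] cong: if_cong)

lemma
  assumes "f \<in> pfun K"
  shows pf_pd: "pd i f \<in> pfun K"
    and pf_has_derivative: "(f has_derivative (\<lambda>h. \<Sum>i\<in>UNIV. pd i f x * h $ i)) (at x)"
proof -
  obtain D where D: "\<forall>i. D i \<in> pfun K"
    "\<And>x. (f has_derivative (\<lambda>h. \<Sum>i\<in>UNIV. D i x * h $ i)) (at x)"
    using pf_has_derivative_ex[OF assms] by blast
  have "pd i f = D i" for i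
    using pd_eqI[OF D(2)] by blast
  then show "pd i f \<in> pfun K" "(f has_derivative (\<lambda>h. \<Sum>i\<in>UNIV. pd i f x * h $ i)) (at x)"
    using D by auto
qed

lemma pd_add:
  assumes "f \<in> pfun K" "g \<in> pfun L"
  shows "pd i (\<lambda>x. f x + g x) x = pd i f x + pd i g x"
  by (rule pd_eqI[where D = "\<lambda>i. pd i f x + pd i g x"])
     (auto intro!: derivative_eq_intros pf_has_derivative[OF assms(1)] pf_has_derivative[OF assms(2)]
       simp: algebra_simps sum.distrib)

lemma pd_mult:
  assumes "f \<in> pfun K" "g \<in> pfun L"
  shows "pd i (\<lambda>x. f x * g x) x = f x * pd i g x + pd i f x * g x"
  by (rule pd_eqI[where D = "\<lambda>i. f x * pd i g x + pd i f x * g x"])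
     (auto intro!: derivative_eq_intros pf_has_derivative[OF assms(1)] pf_has_derivative[OF assms(2)]
       simp: algebra_simps sum.distrib sum_distrib_left)

lemma pd_coord: "pd i (\<lambda>x. x $ j) x = (if i = j then 1 else 0)"
  by (rule pd_eqI[where D = "\<lambda>i. if i = j then 1 else 0"])
     (auto intro!: derivative_eq_intros bounded_linear_imp_has_derivative bounded_linear_vec_nth
          simp: if_distrib[of "\<lambda>c. c * _"] cong: if_cong)

lemma pf_comp_has_field_derivative:
  assumes f: "f \<in> pfun K"
    and c: "\<And>i. ((\<lambda>t. c t $ i) has_field_derivative c' i) (at t within S)"
  shows "((\<lambda>t. f (c t)) has_field_derivative (\<Sum>i\<in>UNIV. pd i f (c t) * c' i)) (at t within S)"
  using f
proof (induction rule: pfun.induct)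
  case (pf_const c)
  have "pd i (\<lambda>_::complex^'a. c) x = 0" for i x
    by (rule pd_eqI) (auto intro!: derivative_eq_intros)
  then show ?case by simp
next
  case pf_neg1
  have "pd i (\<lambda>_::complex^'a. -1) x = 0" for i x
    by (rule pd_eqI) (auto intro!: derivative_eq_intros)
  then show ?case by simp
next
  case (pf_coord i)
  then show ?case using c[of i]
    by (simp add: pd_coord if_distrib[of "\<lambda>c. c * _"] cong: if_cong)
next
  case (pf_add f g)
  have "((\<lambda>t. f (c t) + g (c t)) has_field_derivative
      (\<Sum>i\<in>UNIV. pd i f (c t) * c' i) + (\<Sum>i\<in>UNIV. pd i g (c t) * c' i)) (at t within S)"
    by (intro derivative_intros pf_add)
  then show ?case
    by (simp add: pd_add[OF pf_add(1,2)] sum.distrib distrib_right)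
next
  case (pf_mult f g)
  show ?case
    by (rule derivative_eq_intros pf_mult refl)+
       (simp add: pd_mult[OF pf_mult(1,2)] sum.distrib algebra_simps sum_distrib_left)
qed

lemma pf_comp_holomorphic:
  assumes f: "f \<in> pfun K" and c: "\<And>i. (\<lambda>t. c t $ i) holomorphic_on S"
  shows "(\<lambda>t. f (c t)) holomorphic_on S"
  using f by (induction rule: pfun.induct) (auto intro!: holomorphic_intros c)

text \<open>On the complex line from a point of \<open>U\<close> to \<open>y\<close> the function is
  entire and vanishes near the starting point, so the identity theorem in one variable carries the
  zero to \<open>y\<close>.\<close>

lemma pf_eq_zero_of_open:
  fixes f :: "complex ^ 'a::finite \<Rightarrow> complex"
  assumes f: "f \<in> pfun K" and U: "open U" "U \<noteq> {}" and z: "\<And>x. x \<in> U \<Longrightarrow> f x = 0"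
  shows "f y = 0"
proof -
  obtain x where x: "x \<in> U" using U by auto
  define c where "c t = x + t *s (y - x)" for t :: complex
  have c_hol: "(\<lambda>t. c t $ i) holomorphic_on UNIV" for i
    by (auto simp: c_def intro!: holomorphic_intros)
  have cont: "continuous_on UNIV c"
  proof -
    have "continuous_on UNIV (\<lambda>t. \<chi> i. x $ i + t * (y $ i - x $ i))"
      by (intro continuous_intros)
    moreover have "c = (\<lambda>t. \<chi> i. x $ i + t * (y $ i - x $ i))"
      by (simp add: c_def fun_eq_iff vec_eq_iff algebra_simps)
    ultimately show ?thesis by simp
  qed
  have "open (c -` U)" using cont U(1) by (auto intro: open_vimage)
  moreover have "0 \<in> c -` U" using x by (simp add: c_def)
  ultimately have "f (c 1) = 0"
    using analytic_continuation_open[of "c -` U" UNIV "\<lambda>t. f (c t)" "\<lambda>_. 0" 1]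
      pf_comp_holomorphic[OF f c_hol] z by auto
  then show ?thesis by (simp add: c_def)
qed

section \<open>Polynomial maps and their local inverses\<close>

definition evalv :: "('a \<Rightarrow> (complex ^ 'a \<Rightarrow> complex)) \<Rightarrow> complex ^ 'a::finite \<Rightarrow> complex ^ 'a" where
  "evalv G x = (\<chi> i. G i x)"

definition jac :: "('a \<Rightarrow> (complex ^ 'a \<Rightarrow> complex)) \<Rightarrow> complex ^ 'a::finite \<Rightarrow> complex ^ 'a ^ 'a" where
  "jac G x = (\<chi> i j. pd j (G i) x)"

lemma evalv_nth [simp]: "evalv G x $ i = G i x"
  by (simp add: evalv_def)

lemma jac_mult_nth: "(jac G x *v h) $ i = (\<Sum>j\<in>UNIV. pd j (G i) x * h $ j)"
  by (simp add: jac_def matrix_vector_mult_def)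

lemma bounded_linear_cmatrix: "bounded_linear (\<lambda>h. (A :: complex ^ 'a::finite ^ 'b::finite) *v h)"
  by (rule linear_conv_bounded_linear[THEN iffD1], rule linearI)
     (auto simp: vec_eq_iff matrix_vector_mult_def algebra_simps sum.distrib scaleR_sum_right)

lemma has_derivative_vecI:
  fixes f :: "'x::real_normed_vector \<Rightarrow> 'b::euclidean_space ^ 'a::finite"
  assumes "\<And>i. ((\<lambda>x. f x $ i) has_derivative (\<lambda>h. f' h $ i)) (at x within S)"
  shows "(f has_derivative f') (at x within S)"
proof (subst has_derivative_componentwise_within, intro ballI)
  fix b :: "'b ^ 'a" assume "b \<in> Basis"
  then obtain i u where "b = axis i u" by (auto simp: Basis_vec_def)
  then show "((\<lambda>x. f x \<bullet> b) has_derivative (\<lambda>x. f' x \<bullet> b)) (at x within S)"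
    using has_derivative_inner_left[OF assms[of i], of u] by (simp add: inner_axis)
qed

lemma evalv_has_derivative:
  assumes "\<And>i. G i \<in> pfun K"
  shows "(evalv G has_derivative (\<lambda>h. jac G x *v h)) (at x)"
  by (rule has_derivative_vecI) (simp add: jac_mult_nth pf_has_derivative[OF assms])

lemma evalv_continuous:
  assumes "\<And>i. G i \<in> pfun K"
  shows "continuous_on S (evalv G)"
  unfolding evalv_def using assms by (intro continuous_on_vec_lambda) (auto intro: pf_continuous)

lemma pf_det_jac:
  assumes "\<And>i. G i \<in> pfun K"
  shows "(\<lambda>x. det (jac G x)) \<in> pfun K"
proof -
  have sg: "(\<lambda>_. of_int (sign p)) \<in> pfun K" for p :: "'a \<Rightarrow> 'a"
    by (cases "evenperm p") (auto simp: sign_def intro: pf_one pf_neg1)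
  show ?thesis
    unfolding det_def jac_def using assms
    by (auto intro!: pf_sum pf_mult sg pf_prod pf_pd)
qed

lemma
  fixes A :: "complex ^ 'a::finite ^ 'a"
  assumes "det A \<noteq> 0"
  shows cmatrix_inv_left: "matrix_inv A ** A = mat 1"
    and cmatrix_inv_right: "A ** matrix_inv A = mat 1"
proof -
  have "\<exists>B. A ** B = mat 1 \<and> B ** A = mat 1"
    using assms by (simp add: invertible_det_nz[symmetric] invertible_def)
  then have "A ** matrix_inv A = mat 1 \<and> matrix_inv A ** A = mat 1"
    unfolding matrix_inv_def by (rule someI_ex)
  then show "matrix_inv A ** A = mat 1" "A ** matrix_inv A = mat 1" by auto
qed

text \<open>The derivative of the local inverse is given by the inverse of a complex matrix. In this
  form the real inverse function theorem becomes holomorphic: along complex lines the components of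
  \<open>g\<close> have complex derivatives.\<close>

lemma local_inverse:
  fixes G :: "'a::finite \<Rightarrow> (complex ^ 'a \<Rightarrow> complex)"
  assumes G: "\<And>i. G i \<in> pfun K" and nz: "det (jac G x) \<noteq> 0"
  obtains U V g where "open U" "x \<in> U" "open V" "evalv G x \<in> V" "homeomorphism U V (evalv G) g"
    "\<And>y. y \<in> V \<Longrightarrow> det (jac G (g y)) \<noteq> 0"
    "\<And>y. y \<in> V \<Longrightarrow> (g has_derivative (\<lambda>h. matrix_inv (jac G (g y)) *v h)) (at y)"
proof -
  define f' where "f' x = Blinfun (\<lambda>h. jac G x *v h)" for x
  have f': "blinfun_apply (f' x) = (\<lambda>h. jac G x *v h)" for x
    unfolding f'_def by (rule bounded_linear_Blinfun_apply[OF bounded_linear_cmatrix])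
  define gi where "gi = Blinfun (\<lambda>h. matrix_inv (jac G x) *v h)"
  have gi: "blinfun_apply gi = (\<lambda>h. matrix_inv (jac G x) *v h)"
    unfolding gi_def by (rule bounded_linear_Blinfun_apply[OF bounded_linear_cmatrix])
  have 1: "gi o\<^sub>L f' x = id_blinfun"
    by (rule blinfun_eqI)
       (simp add: f' gi matrix_vector_mul_assoc cmatrix_inv_left[OF nz])
  have 2: "continuous_on UNIV f'"
  proof (rule continuous_on_blinfun_componentwise)
    fix b :: "complex ^ 'a"
    have "continuous_on UNIV (\<lambda>x. \<chi> i. \<Sum>j\<in>UNIV. pd j (G i) x * b $ j)"
      using pf_continuous[OF pf_pd[OF G]] by (intro continuous_intros)
    then show "continuous_on UNIV (\<lambda>x. blinfun_apply (f' x) b)"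
      by (simp add: f' jac_def matrix_vector_mult_def)
  qed
  have 3: "(evalv G has_derivative blinfun_apply (f' x)) (at x)" for x
    unfolding f' by (rule evalv_has_derivative[OF G])
  obtain U V g g' where *: "open U" "x \<in> U" "open V" "evalv G x \<in> V"
    "homeomorphism U V (evalv G) g"
    "\<And>y. y \<in> V \<Longrightarrow> (g has_derivative (g' y)) (at y)"
    "\<And>y. y \<in> V \<Longrightarrow> g' y = inv (blinfun_apply (f' (g y)))"
    "\<And>y. y \<in> V \<Longrightarrow> bij (blinfun_apply (f' (g y)))"
    using inverse_function_theorem[OF open_UNIV 3 2 UNIV_I 1] by metis
  have nz': "det (jac G (g y)) \<noteq> 0" if "y \<in> V" for y
  proof
    assume "det (jac G (g y)) = 0"
    then have "\<not> invertible (jac G (g y))" by (simp add: invertible_det_nz)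
    then obtain h where "jac G (g y) *v h = 0" "h \<noteq> 0"
      using invertible_left_inverse matrix_left_invertible_ker by blast
    moreover have "jac G (g y) *v 0 = 0" by simp
    ultimately show False using *(8)[OF that] unfolding f' bij_def inj_def by metis
  qed
  have "(g has_derivative (\<lambda>h. matrix_inv (jac G (g y)) *v h)) (at y)" if y: "y \<in> V" for y
  proof -
    have "g' y = (\<lambda>h. matrix_inv (jac G (g y)) *v h)"
      unfolding *(7)[OF y] f'
      by (rule inv_unique_comp)
         (auto simp: fun_eq_iff matrix_vector_mul_assoc cmatrix_inv_left[OF nz'[OF y]] cmatrix_inv_right[OF nz'[OF y]])
    then show ?thesis using *(6)[OF y] by simp
  qed
  then show thesis using that *(1-5) nz' by blast
qed

section \<open>Local structure of zero sets\<close>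

text \<open>\<open>I\<close> indexes the equations. The other components are coordinate functions,
  so that where the Jacobian is nonsingular the coordinates outside \<open>I\<close> parametrise the
  zero set of the equations and \<open>card I\<close> is its codimension.\<close>

definition chartp :: "complex set \<Rightarrow> 'a::finite set \<Rightarrow> ('a \<Rightarrow> (complex ^ 'a \<Rightarrow> complex)) \<Rightarrow> bool" where
  "chartp K I G \<longleftrightarrow> (\<forall>i. G i \<in> pfun K) \<and> (\<forall>i. i \<notin> I \<longrightarrow> G i = (\<lambda>x. x $ i))"

definition slice :: "'a::finite set \<Rightarrow> ('a \<Rightarrow> (complex ^ 'a \<Rightarrow> complex)) \<Rightarrow> (complex ^ 'a) set" where
  "slice I G = {x. det (jac G x) \<noteq> 0 \<and> (\<forall>i\<in>I. G i x = 0)}"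

text \<open>By Cramer's rule this is the derivative of \<open>g\<close> along the
  \<open>j\<close>-th coordinate field of the chart \<open>G\<close>, multiplied by the Jacobian
  determinant. The factor clears the denominator, so the result is again a polynomial over the
  coefficients of \<open>G\<close> and \<open>g\<close>.\<close>

definition tder :: "('a \<Rightarrow> (complex ^ 'a \<Rightarrow> complex)) \<Rightarrow> 'a::finite \<Rightarrow> (complex ^ 'a \<Rightarrow> complex) \<Rightarrow> complex ^ 'a \<Rightarrow> complex" where
  "tder G j g x = det (jac (G(j := g)) x)"

definition vder :: "('a \<Rightarrow> (complex ^ 'a \<Rightarrow> complex)) \<Rightarrow> complex ^ 'a::finite \<Rightarrow> (complex ^ 'a \<Rightarrow> complex) \<Rightarrow> complex ^ 'a \<Rightarrow> complex" where
  "vder G v g x = (\<Sum>j\<in>UNIV. v $ j * tder G j g x)"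

lemma jac_upd: "jac (G(j := g)) x = (\<chi> i. if i = j then (\<chi> k. pd k g x) else (\<chi> k. pd k (G i) x))"
  by (simp add: jac_def vec_eq_iff)

lemma tder_pf:
  assumes "\<And>i. G i \<in> pfun K" "g \<in> pfun K"
  shows "tder G j g \<in> pfun K"
proof -
  have "(G(j := g)) i \<in> pfun K" for i using assms by simp
  then have "(\<lambda>x. det (jac (G(j := g)) x)) \<in> pfun K"
    by (rule pf_det_jac)
  then show ?thesis by (simp add: tder_def[abs_def])
qed

lemma tder_add:
  assumes "f \<in> pfun K" "g \<in> pfun L"
  shows "tder G j (\<lambda>x. f x + g x) x = tder G j f x + tder G j g x"
proof -
  have *: "(\<chi> k. pd k (\<lambda>x. f x + g x) x) = (\<chi> k. pd k f x) + (\<chi> k. pd k g x)"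
    by (simp add: vec_eq_iff pd_add[OF assms])
  show ?thesis
    unfolding tder_def jac_upd *
    using det_row_add[of j "\<lambda>_. \<chi> k. pd k f x" "\<lambda>_. \<chi> k. pd k g x" "\<lambda>i. \<chi> k. pd k (G i) x"] by simp
qed

lemma tder_mult:
  assumes "f \<in> pfun K" "g \<in> pfun L"
  shows "tder G j (\<lambda>x. f x * g x) x = f x * tder G j g x + g x * tder G j f x"
proof -
  have *: "(\<chi> k. pd k (\<lambda>x. f x * g x) x) = f x *s (\<chi> k. pd k g x) + g x *s (\<chi> k. pd k f x)"
    by (simp add: vec_eq_iff pd_mult[OF assms] mult_ac)
  have "tder G j (\<lambda>x. f x * g x) x
      = det (\<chi> i. if i = j then f x *s (\<chi> k. pd k g x) else (\<chi> k. pd k (G i) x))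
        + det (\<chi> i. if i = j then g x *s (\<chi> k. pd k f x) else (\<chi> k. pd k (G i) x))"
    unfolding tder_def jac_upd *
    by (rule det_row_add[of j "\<lambda>_. f x *s (\<chi> k. pd k g x)" "\<lambda>_. g x *s (\<chi> k. pd k f x)" "\<lambda>i. \<chi> k. pd k (G i) x"])
  also have "\<dots> = f x * tder G j g x + g x * tder G j f x"
    unfolding tder_def jac_upd
    using det_row_mul[of j "f x" "\<lambda>_. \<chi> k. pd k g x" "\<lambda>i. \<chi> k. pd k (G i) x"]
      det_row_mul[of j "g x" "\<lambda>_. \<chi> k. pd k f x" "\<lambda>i. \<chi> k. pd k (G i) x"] by simp
  finally show ?thesis .
qed

lemma vder_pf:
  assumes "\<And>i. G i \<in> pfun K" "g \<in> pfun L"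
  shows "vder G v g \<in> pfun UNIV"
proof -
  have "(\<lambda>x. \<Sum>j\<in>UNIV. v $ j * tder G j g x) \<in> pfun UNIV"
    using assms by (intro pf_sum pf_mult pf_const tder_pf) (auto intro: pf_UNIV)
  then show ?thesis by (simp add: vder_def[abs_def])
qed

text \<open>The gradient of \<open>g\<close> is a combination of the rows of the Jacobian with
  coefficients \<open>c\<close>. Replacing row \<open>j\<close> by it multiplies the determinant by
  \<open>c $ j\<close>, and \<open>c\<close> is the gradient times the inverse matrix.\<close>

lemma vder_eq:
  assumes nz: "det (jac G x) \<noteq> 0"
  shows "vder G v g x = (\<Sum>k\<in>UNIV. pd k g x * (matrix_inv (jac G x) *v v) $ k) * det (jac G x)"
proof -
  let ?A = "jac G x" and ?w = "\<chi> k. pd k g x"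
  define c where "c = ?w v* matrix_inv ?A"
  have w: "?w = c v* ?A"
    unfolding c_def by (simp add: vector_matrix_mul_assoc cmatrix_inv_left[OF nz])
  have w': "?w = (\<Sum>i\<in>UNIV. c $ i *s row i ?A)"
    unfolding w by (simp add: vec_eq_iff vector_matrix_mult_def row_def mult_ac)
  have "tder G j g x = c $ j * det ?A" for j
    unfolding tder_def jac_upd w' cramer_lemma_transpose[of j c ?A, symmetric]
    by (rule arg_cong[of _ _ det]) (simp add: vec_eq_iff row_def jac_def)
  then have "vder G v g x = (\<Sum>j\<in>UNIV. c $ j * v $ j) * det ?A"
    by (simp add: vder_def sum_distrib_left sum_distrib_right mult_ac)
  also have "(\<Sum>j\<in>UNIV. c $ j * v $ j) = (\<Sum>k\<in>UNIV. ?w $ k * (matrix_inv ?A *v v) $ k)"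
    unfolding c_def vector_matrix_mult_def matrix_vector_mult_def
    by (simp add: sum_distrib_left sum_distrib_right mult_ac) (subst sum.swap, simp add: mult_ac)
  finally show ?thesis by simp
qed

lemma line_component_derivative:
  fixes g :: "complex ^ 'a::finite \<Rightarrow> complex ^ 'a"
  assumes "(g has_derivative (\<lambda>h. A *v h)) (at (y + t *s v))"
  shows "((\<lambda>t. g (y + t *s v) $ i) has_field_derivative (A *v v) $ i) (at t)"
proof -
  have "((\<lambda>t. y + t *s v) has_derivative (\<lambda>s. s *s v)) (at t)"
  proof (rule has_derivative_vecI)
    fix i
    show "((\<lambda>t. (y + t *s v) $ i) has_derivative (\<lambda>s. (s *s v) $ i)) (at t)"
      by (auto intro!: derivative_eq_intros)
  qed
  from diff_chain_at[OF this, of g "\<lambda>h. A *v h"] assms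
  have "((\<lambda>t. g (y + t *s v)) has_derivative (\<lambda>s. A *v (s *s v))) (at t)"
    by (simp add: o_def)
  from bounded_linear.has_derivative[OF bounded_linear_vec_nth this, of i]
  show ?thesis
    unfolding has_field_derivative_def
    by (rule has_derivative_eq_rhs) (simp add: matrix_vector_mult_def sum_distrib_left mult_ac fun_eq_iff)
qed

text \<open>Generators have coefficients in \<open>K\<close>, multipliers are arbitrary. Maximality
  of a chart controls only derivatives of polynomials over \<open>K\<close>, whereas differentiation
  in a complex direction introduces complex multipliers.\<close>

inductive_set ideal_at :: "complex set \<Rightarrow> complex ^ 'a::finite \<Rightarrow> (complex ^ 'a \<Rightarrow> complex) set" for K x where
  gen: "g \<in> pfun K \<Longrightarrow> g x = 0 \<Longrightarrow> g \<in> ideal_at K x"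
| add: "f \<in> ideal_at K x \<Longrightarrow> g \<in> ideal_at K x \<Longrightarrow> (\<lambda>y. f y + g y) \<in> ideal_at K x"
| mult: "a \<in> pfun UNIV \<Longrightarrow> g \<in> ideal_at K x \<Longrightarrow> (\<lambda>y. a y * g y) \<in> ideal_at K x"

lemma ideal_at_pf: "g \<in> ideal_at K x \<Longrightarrow> g \<in> pfun UNIV"
  by (induction rule: ideal_at.induct) (auto intro: pf_UNIV pf_add pf_mult)

lemma ideal_at_zero: "g \<in> ideal_at K x \<Longrightarrow> g x = 0"
  by (induction rule: ideal_at.induct) auto

lemma ideal_at_zero_fun: "(\<lambda>_. 0) \<in> ideal_at K x"
  by (rule ideal_at.gen) (auto intro: pf_zero)

lemma ideal_at_sum:
  "(\<And>i. i \<in> S \<Longrightarrow> f i \<in> ideal_at K x) \<Longrightarrow> (\<lambda>y. \<Sum>i\<in>S. f i y) \<in> ideal_at K x"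
proof (induction S rule: infinite_finite_induct)
  case (insert i S)
  have "(\<lambda>y. f i y + (\<Sum>j\<in>S. f j y)) \<in> ideal_at K x"
    by (rule ideal_at.add) (use insert in auto)
  then show ?case using insert by simp
qed (auto simp: ideal_at_zero_fun)

text \<open>For a generator \<open>g\<close> the polynomial \<open>tder G j g\<close> is again over
  \<open>K\<close> and vanishes at \<open>x\<close>, so it is a generator. In the Leibniz rule for a
  product both terms still contain a member of the ideal.\<close>

lemma tder_ideal_at:
  assumes G: "\<And>i. G i \<in> pfun K"
    and j: "\<And>g. g \<in> pfun K \<Longrightarrow> g x = 0 \<Longrightarrow> tder G j g x = 0"
    and g: "g \<in> ideal_at K x"
  shows "tder G j g \<in> ideal_at K x"
  using g
proof (induction rule: ideal_at.induct)
  case (gen g)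
  then show ?case by (intro ideal_at.gen tder_pf[OF G] j)
next
  case (add f g)
  have "tder G j (\<lambda>y. f y + g y) = (\<lambda>y. tder G j f y + tder G j g y)"
    using tder_add[OF ideal_at_pf ideal_at_pf, OF add(1,2)] by (rule ext)
  then show ?case using ideal_at.add[OF add(3,4)] by simp
next
  case (mult a g)
  have "tder G j (\<lambda>y. a y * g y) = (\<lambda>y. a y * tder G j g y + tder G j a y * g y)"
    using tder_mult[OF mult(1) ideal_at_pf, OF mult(2)] by (simp add: fun_eq_iff mult_ac)
  moreover have "tder G j a \<in> pfun UNIV"
    using G mult(1) by (intro tder_pf) (auto intro: pf_UNIV)
  ultimately show ?case
    using ideal_at.add[OF ideal_at.mult[OF mult(1) mult(3)] ideal_at.mult[OF _ mult(2)]] by simp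
qed

lemma vder_ideal_at:
  assumes G: "\<And>i. G i \<in> pfun K"
    and j: "\<And>j g. j \<notin> I \<Longrightarrow> g \<in> pfun K \<Longrightarrow> g x = 0 \<Longrightarrow> tder G j g x = 0"
    and v: "\<And>i. i \<in> I \<Longrightarrow> v $ i = 0"
    and g: "g \<in> ideal_at K x"
  shows "vder G v g \<in> ideal_at K x"
proof -
  have "(\<lambda>y. v $ j * tder G j g y) \<in> ideal_at K x" for j
  proof (cases "j \<in> I")
    case True
    then show ?thesis using v by (simp add: ideal_at_zero_fun)
  next
    case False
    show ?thesis
      by (rule ideal_at.mult[OF pf_const tder_ideal_at[OF G j[OF False] g]]) auto
  qed
  then have "(\<lambda>y. \<Sum>j\<in>UNIV. v $ j * tder G j g y) \<in> ideal_at K x"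
    by (intro ideal_at_sum)
  then show ?thesis by (simp add: vder_def[abs_def])
qed

text \<open>Along a line in the slice through \<open>x\<close>, the derivative of
  \<open>\<phi> / (det (jac G))\<^sup>l\<close> is again such a quotient with numerator in the ideal,
  so all derivatives at \<open>x\<close> vanish.\<close>

lemma ideal_at_vanishes_on_line:
  assumes G: "\<And>i. G i \<in> pfun K"
    and j: "\<And>j g. j \<notin> I \<Longrightarrow> g \<in> pfun K \<Longrightarrow> g x = 0 \<Longrightarrow> tder G j g x = 0"
    and v: "\<And>i. i \<in> I \<Longrightarrow> v $ i = 0"
    and S: "S = ball 0 R" "R > 0"
    and c: "\<And>t. t \<in> S \<Longrightarrow> det (jac G (c t)) \<noteq> 0"
      "\<And>t i. t \<in> S \<Longrightarrow> ((\<lambda>t. c t $ i) has_field_derivative (matrix_inv (jac G (c t)) *v v) $ i) (at t)"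
    and c0: "c 0 = x"
    and g: "g \<in> ideal_at K x"
    and t: "t \<in> S"
  shows "g (c t) = 0"
proof -
  let ?\<Delta> = "\<lambda>z. det (jac G z)"
  have \<Delta>: "?\<Delta> \<in> pfun UNIV" by (rule pf_UNIV[OF pf_det_jac[OF G]])
  have S0: "open S" "0 \<in> S" using S by auto
  have comp: "((\<lambda>t. f (c t)) has_field_derivative (vder G v f (c t) / ?\<Delta> (c t))) (at t)"
    if f: "f \<in> pfun UNIV" and t: "t \<in> S" for f t
    using pf_comp_has_field_derivative[OF f, of c, OF c(2)[OF t]] c(1)[OF t]
    by (simp add: vder_eq[OF c(1)[OF t]])
  \<comment> \<open>The exponent grows by 2: the quotient rule contributes one factor, and another
    comes from \<open>vder\<close>, which is the derivative along the line multiplied by the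
    determinant.\<close>
  have quot: "((\<lambda>t. f (c t) / ?\<Delta> (c t) ^ l) has_field_derivative
      ((?\<Delta> (c t) * vder G v f (c t) + - of_nat l * vder G v ?\<Delta> (c t) * f (c t)) / ?\<Delta> (c t) ^ (l + 2))) (at t)"
    if f: "f \<in> pfun UNIV" and t: "t \<in> S" for f t l
    apply (rule DERIV_cong[OF DERIV_divide[OF comp[OF f t] DERIV_power[OF comp[OF \<Delta> t]]]])
    using c(1)[OF t] apply simp
    using c(1)[OF t]
    apply (cases l)
    apply (simp add: field_simps power2_eq_square)
    apply (simp add: field_simps power2_eq_square power_add)
    done
  have hol: "(\<lambda>t. f (c t) / ?\<Delta> (c t) ^ l) holomorphic_on S" if "f \<in> pfun UNIV" for f l
    using quot[OF that] S0(1) by (auto simp: holomorphic_on_open)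
  have all: "(deriv ^^ k) (\<lambda>t. f (c t) / ?\<Delta> (c t) ^ l) 0 = 0" if "f \<in> ideal_at K x" for k f l
    using that
  proof (induction k arbitrary: f l)
    case 0
    then show ?case by (simp add: c0 ideal_at_zero)
  next
    case (Suc k)
    define f' where "f' = (\<lambda>y. ?\<Delta> y * vder G v f y + (- of_nat l * vder G v ?\<Delta> y) * f y)"
    have fp: "f \<in> pfun UNIV" using ideal_at_pf Suc.prems by blast
    have "(\<lambda>y. - of_nat l * vder G v ?\<Delta> y) \<in> pfun UNIV"
      by (rule pf_mult[OF pf_const vder_pf[OF G \<Delta>]]) auto
    then have f': "f' \<in> ideal_at K x"
      unfolding f'_def
      by (intro ideal_at.add ideal_at.mult \<Delta> Suc.prems vder_ideal_at[OF G j v])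
    have "deriv (\<lambda>t. f (c t) / ?\<Delta> (c t) ^ l) t = f' (c t) / ?\<Delta> (c t) ^ (l + 2)" if "t \<in> S" for t
      unfolding f'_def by (rule DERIV_imp_deriv[OF quot[OF fp that]])
    then have "(deriv ^^ k) (deriv (\<lambda>t. f (c t) / ?\<Delta> (c t) ^ l)) 0
        = (deriv ^^ k) (\<lambda>t. f' (c t) / ?\<Delta> (c t) ^ (l + 2)) 0"
      by (intro higher_deriv_transform_within_open[OF _ _ S0] holomorphic_deriv[OF hol[OF fp] S0(1)]
          hol[OF ideal_at_pf[OF f']])
    then show ?case
      using Suc.IH[OF f'] by (simp add: funpow_swap1 del: power_Suc add_2_eq_Suc')
  qed
  have gp: "g \<in> pfun UNIV" using ideal_at_pf g by blast
  have "(deriv ^^ k) (\<lambda>t. g (c t)) 0 = 0" for k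
    using all[OF g, of k 0] by simp
  moreover have "(\<lambda>t. g (c t)) holomorphic_on ball 0 R"
    using hol[OF gp, of 0] S by simp
  ultimately show ?thesis
    using holomorphic_fun_eq_0_on_ball[of "\<lambda>t. g (c t)" 0 R t] t S by blast
qed

text \<open>Take a chart over \<open>K\<close> through \<open>x\<close> with \<open>card I\<close>
  as large as possible. A polynomial over \<open>K\<close> vanishing at \<open>x\<close> then has
  zero derivative at \<open>x\<close> along the slice, since otherwise it could serve as a further
  equation; iterated derivatives show that it vanishes on the slice near \<open>x\<close>. At a
  singular point of the zero set the slice is merely of smaller dimension.\<close>

theorem local_structure:
  fixes P :: "'j \<Rightarrow> (complex ^ 'a::finite \<Rightarrow> complex)"
  assumes P: "\<And>j. j \<in> J \<Longrightarrow> P j \<in> pfun K" and x: "\<And>j. j \<in> J \<Longrightarrow> P j x = 0"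
  obtains I G U where "chartp K I G" "x \<in> slice I G" "open U" "x \<in> U"
    "\<And>z j. z \<in> U \<Longrightarrow> (\<And>i. i \<in> I \<Longrightarrow> G i z = 0) \<Longrightarrow> j \<in> J \<Longrightarrow> P j z = 0"
proof -
  define Q where "Q I \<longleftrightarrow> (\<exists>G. chartp K I G \<and> x \<in> slice I G)" for I
  have jac1: "jac (\<lambda>i x. x $ i) x = mat 1"
    by (simp add: jac_def vec_eq_iff mat_def pd_coord)
  have "Q {}"
    unfolding Q_def chartp_def slice_def
    by (intro exI[of _ "\<lambda>i x. x $ i"]) (auto simp: jac1 intro: pf_coord)
  then obtain I where I: "Q I" and max: "\<And>I'. Q I' \<Longrightarrow> card I' \<le> card I"
    using ex_has_greatest_nat[of Q "{}" card "Suc (CARD('a))"] by (metis card_mono finite subset_UNIV le_imp_less_Suc)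
  obtain G where G: "chartp K I G" and xs: "x \<in> slice I G" using I by (auto simp: Q_def)
  have Gp: "G i \<in> pfun K" for i using G by (simp add: chartp_def)
  \<comment> \<open>Otherwise replacing the coordinate \<open>G j\<close> by \<open>g\<close> would
    give a chart with one more equation.\<close>
  have tz: "tder G j g x = 0" if "j \<notin> I" "g \<in> pfun K" "g x = 0" for j g
  proof (rule ccontr)
    assume "tder G j g x \<noteq> 0"
    then have "Q (insert j I)"
      unfolding Q_def using G xs that
      by (intro exI[of _ "G(j := g)"]) (auto simp: chartp_def slice_def tder_def)
    with max[of "insert j I"] that(1) show False by (simp add: card_insert_if)
  qed
  have nz: "det (jac G x) \<noteq> 0" and Gx: "\<And>i. i \<in> I \<Longrightarrow> G i x = 0" using xs by (auto simp: slice_def)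
  obtain U V g where L: "open U" "x \<in> U" "open V" "evalv G x \<in> V" "homeomorphism U V (evalv G) g"
    "\<And>y. y \<in> V \<Longrightarrow> det (jac G (g y)) \<noteq> 0"
    "\<And>y. y \<in> V \<Longrightarrow> (g has_derivative (\<lambda>h. matrix_inv (jac G (g y)) *v h)) (at y)"
    using local_inverse[of G K, OF Gp nz] by blast
  obtain \<rho> where \<rho>: "\<rho> > 0" "ball (evalv G x) \<rho> \<subseteq> V" using L(3,4) openE by blast
  define U' where "U' = U \<inter> evalv G -` ball (evalv G x) \<rho>"
  have "open (evalv G -` ball (evalv G x) \<rho>)"
    using evalv_continuous[OF Gp] by (intro open_vimage) auto
  then have "open U'" using L(1) by (simp add: U'_def open_Int)
  moreover have "x \<in> U'" using L(2) \<rho> by (simp add: U'_def)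
  moreover have "P j z = 0" if z: "z \<in> U'" "\<And>i. i \<in> I \<Longrightarrow> G i z = 0" and jJ: "j \<in> J" for z j
  proof (cases "z = x")
    case True
    then show ?thesis using x jJ by simp
  next
    case False
    \<comment> \<open>The line from \<open>evalv G x\<close> in direction \<open>v\<close> keeps the
      coordinates in \<open>I\<close> at zero. Its preimage \<open>c\<close> runs inside the slice
      from \<open>x\<close> at \<open>t = 0\<close> to \<open>z\<close> at \<open>t = 1\<close>, and
      \<open>R > 1\<close> because \<open>evalv G z\<close> lies in the ball of radius
      \<open>\<rho>\<close>.\<close>
    define v where "v = evalv G z - evalv G x"
    have zU: "z \<in> U" "dist (evalv G x) (evalv G z) < \<rho>" using z(1) by (auto simp: U'_def)
    have gz: "g (evalv G z) = z" and gx: "g (evalv G x) = x"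
      using L(2,5) zU(1) by (auto simp: homeomorphism_def)
    have "v \<noteq> 0" using False gz gx by (auto simp: v_def)
    have nv: "norm v < \<rho>" using zU(2) by (simp add: v_def dist_norm norm_minus_commute)
    have v0: "v $ i = 0" if "i \<in> I" for i using that z(2) Gx by (simp add: v_def)
    have norm_s: "norm (t *s v) = norm t * norm v" for t :: complex
      by (simp add: norm_vec_def norm_mult L2_set_right_distrib)
    define c where "c t = g (evalv G x + t *s v)" for t
    define R where "R = \<rho> / norm v"
    have V: "evalv G x + t *s v \<in> V" if "t \<in> ball 0 R" for t
    proof -
      have "norm (t *s v) < \<rho>"
        using that \<open>v \<noteq> 0\<close> by (simp add: norm_s R_def field_simps)
      then show ?thesis using \<rho>(2) by (auto simp: dist_norm)
    qed
    have "P j (c 1) = 0"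
    proof (rule ideal_at_vanishes_on_line[OF Gp tz v0 refl, where R = R and c = c])
      show "R > 0" using \<rho>(1) \<open>v \<noteq> 0\<close> by (simp add: R_def)
      show "det (jac G (c t)) \<noteq> 0" if "t \<in> ball 0 R" for t
        unfolding c_def by (rule L(6)[OF V[OF that]])
      show "((\<lambda>t. c t $ i) has_field_derivative (matrix_inv (jac G (c t)) *v v) $ i) (at t)"
        if "t \<in> ball 0 R" for t i
        unfolding c_def by (rule line_component_derivative[OF L(7)[OF V[OF that]]])
      show "c 0 = x" by (simp add: c_def gx)
      show "P j \<in> ideal_at K x" using P x jJ by (intro ideal_at.gen)
      have "1 < R" using nv \<open>v \<noteq> 0\<close> by (simp add: R_def)
      then show "(1::complex) \<in> ball 0 R" by simp
    qed
    then show ?thesis by (simp add: c_def v_def gz)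
  qed
  ultimately show thesis using that[OF G xs] by blast
qed

section \<open>Openness of polynomial maps at isolated zeros\<close>

lemma countable_charts:
  assumes "countable K"
  shows "countable {(I, G). chartp K I (G :: 'a::finite \<Rightarrow> (complex ^ 'a \<Rightarrow> complex))}"
proof -
  have "countable (PiE (UNIV::'a set) (\<lambda>_. pfun K :: (complex ^ 'a \<Rightarrow> complex) set))"
    using countable_pfun[OF assms] by (intro countable_PiE) auto
  then have "countable ((UNIV :: 'a set set) \<times> PiE (UNIV::'a set) (\<lambda>_. pfun K :: (complex ^ 'a \<Rightarrow> complex) set))"
    by (intro countable_SIGMA) (auto intro: countable_finite)
  then show ?thesis
    by (rule countable_subset[rotated]) (auto simp: chartp_def)
qed

section \<open>Cones over critical values\<close>

lemma negligible_UN_locally: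
  fixes t :: "'x::second_countable_topology \<Rightarrow> 'y::euclidean_space set"
  assumes "\<And>x. x \<in> S \<Longrightarrow> \<exists>U. open U \<and> x \<in> U \<and> negligible (\<Union>y\<in>S \<inter> U. t y)"
  shows "negligible (\<Union>y\<in>S. t y)"
proof -
  define F where "F = {U. open U \<and> negligible (\<Union>y\<in>S \<inter> U. t y)}"
  obtain F' where F': "F' \<subseteq> F" "countable F'" "\<Union>F' = \<Union>F"
    using Lindelof[of F] by (auto simp: F_def)
  have "(\<Union>y\<in>S. t y) \<subseteq> (\<Union>U\<in>F'. \<Union>y\<in>S \<inter> U. t y)"
  proof
    fix z assume "z \<in> (\<Union>y\<in>S. t y)"
    then obtain y where y: "y \<in> S" "z \<in> t y" by auto
    have "y \<in> \<Union>F" using assms[OF y(1)] by (auto simp: F_def)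
    then show "z \<in> (\<Union>U\<in>F'. \<Union>y\<in>S \<inter> U. t y)" using y F'(3) by auto
  qed
  moreover have "negligible (\<Union>U\<in>F'. \<Union>y\<in>S \<inter> U. t y)"
    by (rule negligible_countable_Union) (use F'(1,2) in \<open>auto simp: F_def\<close>)
  ultimately show ?thesis by (rule negligible_subset[rotated])
qed

lemma negligible_image_locally:
  fixes f :: "'x::second_countable_topology \<Rightarrow> 'y::euclidean_space"
  assumes "\<And>x. x \<in> S \<Longrightarrow> \<exists>U. open U \<and> x \<in> U \<and> negligible (f ` (S \<inter> U))"
  shows "negligible (f ` S)"
  using negligible_UN_locally[of S "\<lambda>x. {f x}"] assms by (simp add: UNION_singleton_eq_range)

text \<open>The slice has real codimension at least two and the cone adds one real dimension. To
  exhibit the cone as the image of a null set, the complex coordinate \<open>i\<close>, which is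
  zero on the slice, carries the real cone parameter: the source lies in the hyperplane where this
  coordinate is real.\<close>

lemma negligible_cone_slice:
  fixes \<Phi> G :: "'a::finite \<Rightarrow> (complex ^ 'a \<Rightarrow> complex)"
  assumes \<Phi>: "\<And>i. \<Phi> i \<in> pfun UNIV" and G: "\<And>i. G i \<in> pfun UNIV" and i: "i \<in> I"
  shows "negligible (\<Union>x\<in>slice I G. {a + s *\<^sub>R (evalv \<Phi> x - a) |s. True})"
proof (rule negligible_UN_locally)
  fix x assume "x \<in> slice I G"
  then have nz: "det (jac G x) \<noteq> 0" by (simp add: slice_def)
  obtain U V g where L: "open U" "x \<in> U" "open V" "evalv G x \<in> V" "homeomorphism U V (evalv G) g"
    "\<And>y. y \<in> V \<Longrightarrow> det (jac G (g y)) \<noteq> 0"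
    "\<And>y. y \<in> V \<Longrightarrow> (g has_derivative (\<lambda>h. matrix_inv (jac G (g y)) *v h)) (at y)"
    using local_inverse[of G UNIV, OF G nz] by blast
  define Z where "Z v = (\<chi> j. if j \<in> I then 0 else v $ j)" for v :: "complex ^ 'a"
  define D where "D = {v. Im (v $ i) = 0 \<and> Z v \<in> V}"
  define \<Lambda> where "\<Lambda> v = a + Re (v $ i) *\<^sub>R (evalv \<Phi> (g (Z v)) - a)" for v
  have linZ: "linear Z"
    by (rule linearI) (auto simp: Z_def vec_eq_iff)
  have "negligible {v :: complex ^ 'a. axis i \<i> \<bullet> v = 0}"
    by (rule negligible_hyperplane) (simp add: axis_eq_0_iff)
  then have "negligible D"
    by (rule negligible_subset) (auto simp: D_def inner_axis' inner_complex_def)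
  moreover have "\<Lambda> differentiable_on D"
  proof (rule differentiable_at_imp_differentiable_on)
    fix v assume v: "v \<in> D"
    have "g differentiable (at (Z v))"
      using L(7)[of "Z v"] v by (auto simp: D_def differentiable_def)
    moreover have "Z differentiable (at v)"
      using linZ linear_imp_differentiable by blast
    ultimately have "(\<lambda>v. g (Z v)) differentiable (at v)"
      using differentiable_chain_at[of Z v g] by (simp add: o_def)
    moreover have "evalv \<Phi> differentiable (at (g (Z v)))"
      using evalv_has_derivative[of \<Phi> UNIV, OF \<Phi>] by (auto simp: differentiable_def)
    ultimately have "(\<lambda>v. evalv \<Phi> (g (Z v))) differentiable (at v)"
      using differentiable_chain_at[of "\<lambda>v. g (Z v)" v "evalv \<Phi>"] by (simp add: o_def)
    moreover have "(\<lambda>v::complex^'a. Re (v $ i)) differentiable (at v)"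
      by (intro linear_imp_differentiable linearI) auto
    ultimately show "\<Lambda> differentiable (at v)"
      unfolding \<Lambda>_def by (intro derivative_intros)
  qed
  ultimately have neg: "negligible (\<Lambda> ` D)"
    by (intro negligible_differentiable_image_negligible) auto
  have "(\<Union>y\<in>slice I G \<inter> U. {a + s *\<^sub>R (evalv \<Phi> y - a) |s. True}) \<subseteq> \<Lambda> ` D"
  proof clarify
    fix y s assume y: "y \<in> slice I G" "y \<in> U"
    define v where "v = (\<chi> j. if j = i then of_real s else evalv G y $ j)"
    have "Z v = evalv G y" using y(1) i by (auto simp: Z_def v_def vec_eq_iff slice_def)
    moreover have "evalv G y \<in> V" "g (evalv G y) = y" using L(5) y(2) by (auto simp: homeomorphism_def)
    ultimately have "v \<in> D" "\<Lambda> v = a + s *\<^sub>R (evalv \<Phi> y - a)"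
      by (auto simp: D_def \<Lambda>_def v_def)
    then show "a + s *\<^sub>R (evalv \<Phi> y - a) \<in> \<Lambda> ` D" by (metis imageI)
  qed
  with neg L(1,2) show "\<exists>U. open U \<and> x \<in> U \<and>
      negligible (\<Union>y\<in>slice I G \<inter> U. {a + s *\<^sub>R (evalv \<Phi> y - a) |s. True})"
    using negligible_subset by blast
qed

text \<open>The critical locus is covered by the slices of charts over a finite set of constants.
  None of those used has \<open>I = {}\<close>, since then the determinant would vanish on an open
  set and hence everywhere, against \<open>nz\<close>.\<close>

lemma negligible_cone_critical:
  fixes \<Phi> :: "'a::finite \<Rightarrow> (complex ^ 'a \<Rightarrow> complex)"
  assumes \<Phi>: "\<And>i. \<Phi> i \<in> pfun UNIV" and nz: "det (jac \<Phi> x0) \<noteq> 0"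
  shows "negligible {a + s *\<^sub>R (evalv \<Phi> x - a) |x s. det (jac \<Phi> x) = 0}"
proof -
  let ?J = "\<lambda>x. det (jac \<Phi> x)"
  let ?t = "\<lambda>x. {a + s *\<^sub>R (evalv \<Phi> x - a) |s. True}"
  have J: "?J \<in> pfun UNIV" by (rule pf_det_jac[OF \<Phi>])
  then obtain K where K: "finite K" "?J \<in> pfun K" using pf_finite_constants by blast
  define C where "C = {(I, G). chartp K I (G :: 'a \<Rightarrow> (complex ^ 'a \<Rightarrow> complex)) \<and> I \<noteq> {}}"
  have cC: "countable C"
    by (rule countable_subset[OF _ countable_charts[OF countable_finite[OF K(1)]]]) (auto simp: C_def)
  have "{a + s *\<^sub>R (evalv \<Phi> x - a) |x s. ?J x = 0} \<subseteq> (\<Union>IG\<in>C. \<Union>x\<in>slice (fst IG) (snd IG). ?t x)"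
  proof clarify
    fix x s assume x: "?J x = 0"
    obtain I G U where IG: "chartp K I G" "x \<in> slice I G" "open U" "x \<in> U"
      "\<And>z j. z \<in> U \<Longrightarrow> (\<And>i. i \<in> I \<Longrightarrow> G i z = 0) \<Longrightarrow> j \<in> {()} \<Longrightarrow> ?J z = 0"
      using local_structure[of "{()}" "\<lambda>_. ?J" K x] K(2) x by (metis (no_types, lifting))
    have "I \<noteq> {}"
    proof
      assume "I = {}"
      then have "?J z = 0" if "z \<in> U" for z using IG(5)[OF that] by simp
      then have "?J x0 = 0" using pf_eq_zero_of_open[OF J IG(3), of x0] IG(4) by blast
      with nz show False by simp
    qed
    then have "(I, G) \<in> C" using IG(1) by (simp add: C_def)
    then show "a + s *\<^sub>R (evalv \<Phi> x - a) \<in> (\<Union>IG\<in>C. \<Union>x\<in>slice (fst IG) (snd IG). ?t x)"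
      using IG(2) by (intro UN_I[of "(I, G)"] UN_I[of x]) auto
  qed
  moreover have "negligible (\<Union>IG\<in>C. \<Union>x\<in>slice (fst IG) (snd IG). ?t x)"
  proof (rule negligible_countable_Union)
    show "countable ((\<lambda>IG. \<Union>x\<in>slice (fst IG) (snd IG). ?t x) ` C)" using cC by simp
    fix S assume "S \<in> (\<lambda>IG. \<Union>x\<in>slice (fst IG) (snd IG). ?t x) ` C"
    then obtain I G where IG: "(I, G) \<in> C" and S: "S = (\<Union>x\<in>slice I G. ?t x)" by auto
    from IG obtain i where "i \<in> I" by (auto simp: C_def)
    moreover have "\<And>i. G i \<in> pfun UNIV" using IG by (auto simp: C_def chartp_def intro: pf_UNIV)
    ultimately show "negligible S" unfolding S by (intro negligible_cone_slice[OF \<Phi>])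
  qed
  ultimately show ?thesis by (rule negligible_subset[rotated])
qed

lemma open_subset_closure_Diff_negligible:
  fixes B :: "'a::euclidean_space set"
  assumes "open B" "negligible N"
  shows "B \<subseteq> closure (B - N)"
proof
  fix y assume y: "y \<in> B"
  show "y \<in> closure (B - N)"
    unfolding closure_approachable
  proof (intro allI impI)
    fix e :: real assume "e > 0"
    then have "open (B \<inter> ball y e)" "B \<inter> ball y e \<noteq> {}" using assms y by auto
    then have "\<not> B \<inter> ball y e \<subseteq> N"
      using negligible_subset[OF assms(2)] open_not_negligible by blast
    then show "\<exists>z\<in>B - N. dist z y < e" by (auto simp: dist_commute)
  qed
qed

lemma evalv_open_at_noncritical:
  assumes \<Phi>: "\<And>i. \<Phi> i \<in> pfun UNIV" and nz: "det (jac \<Phi> x) \<noteq> 0" and W: "open W" "x \<in> W"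
  shows "\<exists>O'. open O' \<and> evalv \<Phi> x \<in> O' \<and> O' \<subseteq> evalv \<Phi> ` W"
proof -
  obtain U V g where L: "open U" "x \<in> U" "open V" "evalv \<Phi> x \<in> V" "homeomorphism U V (evalv \<Phi>) g"
    using local_inverse[of \<Phi> UNIV, OF \<Phi> nz] by metis
  have "open (V \<inter> g -` W)"
    using L(3,5) W(1) by (metis continuous_open_preimage homeomorphism_def)
  moreover have "evalv \<Phi> x \<in> V \<inter> g -` W" using L W by (auto simp: homeomorphism_def)
  moreover have "V \<inter> g -` W \<subseteq> evalv \<Phi> ` W" using L(5) by (force simp: homeomorphism_def)
  ultimately show ?thesis by blast
qed

text \<open>The critical values have real codimension two, so almost every segment from a regular value
  avoids them; along such a segment the set of attained values is open and closed.\<close>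

lemma ball_subset_image_noncritical:
  fixes \<Phi> :: "'a::finite \<Rightarrow> (complex ^ 'a \<Rightarrow> complex)"
  assumes \<Phi>: "\<And>i. \<Phi> i \<in> pfun UNIV" and nz: "det (jac \<Phi> x0) \<noteq> 0"
    and \<rho>: "\<rho> > 0" and x0: "norm (evalv \<Phi> x0) < \<delta>"
    and sph: "\<And>x. dist x0 x = \<rho> \<Longrightarrow> norm (evalv \<Phi> x) \<ge> \<delta>"
  shows "ball 0 \<delta> \<subseteq> evalv \<Phi> ` cball x0 \<rho>"
proof -
  let ?f = "evalv \<Phi>"
  have cont: "continuous_on S ?f" for S by (rule evalv_continuous[OF \<Phi>])
  have comp: "compact (?f ` cball x0 \<rho>)" by (intro compact_continuous_image cont) simp
  obtain O1 where O1: "open O1" "?f x0 \<in> O1" "O1 \<subseteq> ?f ` ball x0 \<rho>"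
    using evalv_open_at_noncritical[OF \<Phi> nz, of "ball x0 \<rho>"] \<rho> by auto
  \<comment> \<open>The critical values lie on the cone with apex \<open>0\<close>, at parameter 1.
    They form a null set, so some value \<open>a\<close> attained near \<open>x0\<close> is
    regular.\<close>
  have "negligible (?f ` {x. det (jac \<Phi> x) = 0})"
    by (rule negligible_subset[OF negligible_cone_critical[OF \<Phi> nz, of 0]])
       (auto intro!: exI[of _ "1::real"])
  moreover have "\<not> negligible (O1 \<inter> ball 0 \<delta>)"
    using O1 x0 by (intro open_not_negligible) auto
  ultimately obtain a where a: "a \<in> O1" "norm a < \<delta>" "\<And>x. det (jac \<Phi> x) = 0 \<Longrightarrow> ?f x \<noteq> a"
    using negligible_subset[of "?f ` {x. det (jac \<Phi> x) = 0}" "O1 \<inter> ball 0 \<delta>"] by fastforce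
  define N where "N = {a + s *\<^sub>R (?f x - a) |x s. det (jac \<Phi> x) = 0}"
  have N: "negligible N" unfolding N_def by (rule negligible_cone_critical[OF \<Phi> nz])
  have main: "b \<in> ?f ` cball x0 \<rho>" if b: "b \<in> ball 0 \<delta> - N" for b
  proof -
    define \<gamma> where "\<gamma> \<tau> = a + \<tau> *\<^sub>R (b - a)" for \<tau> :: real
    define T where "T = {0..1} \<inter> \<gamma> -` (?f ` cball x0 \<rho>)"
    have cg: "continuous_on S \<gamma>" for S unfolding \<gamma>_def by (intro continuous_intros)
    have "closed T"
      unfolding T_def by (rule continuous_closed_preimage[OF cg]) (use comp compact_imp_closed in auto)
    then have "closedin (top_of_set {0..1}) T" by (auto simp: T_def intro: closed_subset)
    moreover have "openin (top_of_set {0..1}) T"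
    proof (subst openin_subopen, intro ballI)
      fix \<tau> assume \<tau>: "\<tau> \<in> T"
      then obtain x where x: "x \<in> cball x0 \<rho>" "\<gamma> \<tau> = ?f x" and t01: "0 \<le> \<tau>" "\<tau> \<le> 1" by (auto simp: T_def)
      have "\<gamma> \<tau> = (1 - \<tau>) *\<^sub>R a + \<tau> *\<^sub>R b" by (simp add: \<gamma>_def algebra_simps)
      then have "\<gamma> \<tau> \<in> ball 0 \<delta>"
        using convexD[OF convex_ball[of 0 \<delta>], of a b "1 - \<tau>" \<tau>] a(2) b t01 by simp
      then have xb: "x \<in> ball x0 \<rho>" using sph[of x] x by fastforce
      \<comment> \<open>Solving \<open>?f x = a + \<tau> (b - a)\<close> for \<open>b\<close> shows
        that a critical \<open>x\<close> would put \<open>b\<close> on the cone \<open>N\<close>;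
        for \<open>\<tau> = 0\<close> it would make \<open>a\<close> a critical value.\<close>
      have "det (jac \<Phi> x) \<noteq> 0"
      proof
        assume d: "det (jac \<Phi> x) = 0"
        show False
        proof (cases "\<tau> = 0")
          case True
          then show False using a(3)[OF d] x(2) by (simp add: \<gamma>_def)
        next
          case False
          then have "b = a + (1 / \<tau>) *\<^sub>R (?f x - a)" using x(2)[symmetric] by (simp add: \<gamma>_def)
          then have "b \<in> N" unfolding N_def using d by blast
          with b show False by simp
        qed
      qed
      then obtain O2 where O2: "open O2" "?f x \<in> O2" "O2 \<subseteq> ?f ` ball x0 \<rho>"
        using evalv_open_at_noncritical[of \<Phi>, OF \<Phi>, where x = x and W = "ball x0 \<rho>"] xb by auto
      have "open (\<gamma> -` O2)" using O2(1) cg by (intro open_vimage)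
      then have "openin (top_of_set {0..1}) ({0..1} \<inter> \<gamma> -` O2)" by (rule openin_open_Int)
      moreover have "\<tau> \<in> {0..1} \<inter> \<gamma> -` O2" using O2(2) x(2) t01 by simp
      moreover have "{0..1} \<inter> \<gamma> -` O2 \<subseteq> T" using O2(3) by (fastforce simp: T_def)
      ultimately show "\<exists>T'. openin (top_of_set {0..1}) T' \<and> \<tau> \<in> T' \<and> T' \<subseteq> T" by blast
    qed
    moreover have "0 \<in> T" using a(1) O1(3) ball_subset_cball[of x0 \<rho>] by (auto simp: T_def \<gamma>_def)
    ultimately have "T = {0..1}"
      using connected_clopen[of "{0..1::real}"] by auto
    then have "1 \<in> T" by simp
    then show ?thesis by (simp add: T_def \<gamma>_def)
  qed
  \<comment> \<open>Targets in \<open>N\<close> are limits of targets outside it, and the image of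
    the closed ball is compact.\<close>
  have "ball 0 \<delta> \<subseteq> closure (ball 0 \<delta> - N)"
    by (rule open_subset_closure_Diff_negligible[OF open_ball N])
  also have "\<dots> \<subseteq> ?f ` cball x0 \<rho>"
    by (rule closure_minimal) (use main comp compact_imp_closed in auto)
  finally show ?thesis .
qed

text \<open>The determinant is entire in \<open>\<epsilon>\<close> and nonzero at
  \<open>B + 1\<close>, where \<open>B\<close> bounds the operator norm of \<open>A\<close>; so it
  cannot vanish on a disc around \<open>0\<close>.\<close>

lemma small_shift_invertible:
  fixes A :: "complex ^ 'a::finite ^ 'a"
  assumes "\<eta> > 0"
  obtains \<epsilon> where "norm \<epsilon> < \<eta>" "det (A + mat \<epsilon>) \<noteq> 0"
proof -
  let ?D = "\<lambda>\<epsilon>. det (A + mat \<epsilon>)"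
  have hol: "?D holomorphic_on UNIV"
  proof -
    have "(\<lambda>\<epsilon>. (A + mat \<epsilon>) $ i $ j) holomorphic_on UNIV" for i j
      by (cases "i = j") (auto simp: mat_def intro!: holomorphic_intros)
    then show ?thesis unfolding det_def by (intro holomorphic_intros)
  qed
  obtain B where B: "B > 0" "\<And>h. norm (A *v h) \<le> B * norm h"
    using bounded_linear.pos_bounded[OF bounded_linear_cmatrix[of A]] by (auto simp: mult.commute)
  have big: "?D (of_real (B + 1)) \<noteq> 0"
  proof
    assume "?D (of_real (B + 1)) = 0"
    then have "\<not> invertible (A + mat (of_real (B + 1)))" by (simp add: invertible_det_nz)
    then obtain h where h: "(A + mat (of_real (B + 1))) *v h = 0" "h \<noteq> 0"
      using invertible_left_inverse matrix_left_invertible_ker by blast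
    have "mat (complex_of_real (B + 1)) *v h = (B + 1) *\<^sub>R h"
      unfolding vec_eq_iff vector_scaleR_component
      by (simp add: scaleR_conv_of_real mat_def matrix_vector_mult_def if_distrib[of "\<lambda>c. c * _"] cong: if_cong)
    then have "A *v h = - ((B + 1) *\<^sub>R h)"
      using h(1) by (simp add: matrix_vector_mult_add_rdistrib add_eq_0_iff2)
    then have "norm (A *v h) = (B + 1) * norm h" using B(1) by simp
    with B(2)[of h] h(2) show False by (simp add: algebra_simps)
  qed
  have "\<exists>\<epsilon>\<in>ball 0 \<eta>. ?D \<epsilon> \<noteq> 0"
  proof (rule ccontr)
    assume "\<not> ?thesis"
    then have "?D (of_real (B + 1)) = 0"
      using analytic_continuation_open[of "ball 0 \<eta>" UNIV ?D "\<lambda>_. 0"] hol assms by auto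
    with big show False by simp
  qed
  then show thesis using that by auto
qed

text \<open>At a multiple zero the Jacobian vanishes. Adding \<open>\<epsilon> (x - x0)\<close>
  keeps the zero, makes the Jacobian there invertible and changes the map on the closed ball
  arbitrarily little. The noncritical case fills a ball whose radius does not depend on
  \<open>\<epsilon>\<close>, and compactness of the image permits the limit.\<close>

theorem polynomial_map_open_at_isolated_zero:
  fixes \<Phi> :: "'a::finite \<Rightarrow> (complex ^ 'a \<Rightarrow> complex)"
  assumes \<Phi>: "\<And>i. \<Phi> i \<in> pfun UNIV" and x0: "evalv \<Phi> x0 = 0"
    and \<rho>: "\<rho> > 0" and sph: "\<And>x. dist x0 x = \<rho> \<Longrightarrow> evalv \<Phi> x \<noteq> 0"
  obtains \<delta> where "\<delta> > 0" "ball 0 \<delta> \<subseteq> evalv \<Phi> ` cball x0 \<rho>"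
proof -
  let ?f = "evalv \<Phi>"
  have cont: "continuous_on S ?f" for S by (rule evalv_continuous[OF \<Phi>])
  \<comment> \<open>The factor 2 leaves room for a perturbation of size \<open>\<delta>\<close> on
    the sphere.\<close>
  obtain \<delta> where \<delta>: "\<delta> > 0" "\<And>x. dist x0 x = \<rho> \<Longrightarrow> norm (?f x) \<ge> 2 * \<delta>"
  proof (cases "sphere x0 \<rho> = {}")
    case True
    then show ?thesis using \<rho> by simp
  next
    case False
    have "continuous_on (sphere x0 \<rho>) (\<lambda>x. norm (?f x))" by (intro continuous_intros cont)
    then obtain x1 where x1: "x1 \<in> sphere x0 \<rho>" "\<And>x. x \<in> sphere x0 \<rho> \<Longrightarrow> norm (?f x1) \<le> norm (?f x)"
      using continuous_attains_inf[OF compact_sphere False] by metis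
    show ?thesis
      by (rule that[of "norm (?f x1) / 2"]) (use x1 sph[of x1] in auto)
  qed
  have comp: "compact (?f ` cball x0 \<rho>)" by (intro compact_continuous_image cont) simp
  have "y \<in> closure (?f ` cball x0 \<rho>)" if y: "y \<in> ball 0 \<delta>" for y
    unfolding closure_approachable
  proof (intro allI impI)
    fix e :: real assume e: "e > 0"
    obtain \<epsilon> where \<epsilon>: "norm \<epsilon> < min \<delta> e / \<rho>" "det (jac \<Phi> x0 + mat \<epsilon>) \<noteq> 0"
      using small_shift_invertible[of "min \<delta> e / \<rho>" "jac \<Phi> x0"] e \<delta>(1) \<rho> by auto
    define \<Psi> where "\<Psi> i x = \<Phi> i x + \<epsilon> * (x $ i - x0 $ i)" for i x
    have sub: "(\<lambda>x. \<epsilon> * (x $ i - x0 $ i)) \<in> pfun UNIV" for i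
      by (intro pf_mult pf_const pf_diff pf_coord) auto
    have \<Psi>: "\<Psi> i \<in> pfun UNIV" for i
      unfolding \<Psi>_def by (intro pf_add \<Phi> sub)
    have pds: "pd j (\<lambda>x. \<epsilon> * (x $ i - x0 $ i)) x = (if i = j then \<epsilon> else 0)" for i j x
    proof -
      have "((\<lambda>x. \<epsilon> * (x $ i - x0 $ i)) has_derivative (\<lambda>h. \<epsilon> * (h $ i))) (at x)"
        by (auto intro!: derivative_eq_intros bounded_linear_imp_has_derivative bounded_linear_vec_nth)
      then show ?thesis
        using pd_eqI[of "\<lambda>x. \<epsilon> * (x $ i - x0 $ i)" "\<lambda>j. if i = j then \<epsilon> else 0" x j]
        by (simp add: if_distrib[of "\<lambda>c. c * _"] cong: if_cong)
    qed
    have "jac \<Psi> x0 = jac \<Phi> x0 + mat \<epsilon>"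
      unfolding jac_def \<Psi>_def by (simp add: vec_eq_iff pd_add[OF \<Phi> sub] pds mat_def)
    then have nz: "det (jac \<Psi> x0) \<noteq> 0" using \<epsilon>(2) by simp
    have diff: "evalv \<Psi> x = ?f x + \<epsilon> *s (x - x0)" for x
      by (simp add: vec_eq_iff \<Psi>_def algebra_simps)
    have norm_s: "norm (t *s v) = norm t * norm v" for t :: complex and v :: "complex ^ 'a"
      by (simp add: norm_vec_def norm_mult L2_set_right_distrib)
    have small: "norm (\<epsilon> *s (x - x0)) < min \<delta> e" if "dist x0 x \<le> \<rho>" for x
    proof -
      have "norm \<epsilon> * norm (x - x0) \<le> norm \<epsilon> * \<rho>"
        using that by (intro mult_left_mono) (auto simp: dist_norm norm_minus_commute)
      also have "\<dots> < min \<delta> e" using \<epsilon>(1) \<rho> by (simp add: field_simps)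
      finally show ?thesis by (simp only: norm_s)
    qed
    have "ball 0 \<delta> \<subseteq> evalv \<Psi> ` cball x0 \<rho>"
    proof (rule ball_subset_image_noncritical[OF \<Psi> nz \<rho>])
      show "norm (evalv \<Psi> x0) < \<delta>" using x0 \<delta>(1) by (simp add: diff)
      fix x assume x: "dist x0 x = \<rho>"
      have "2 * \<delta> \<le> norm (?f x)" by (rule \<delta>(2)[OF x])
      also have "\<dots> \<le> norm (evalv \<Psi> x) + norm (\<epsilon> *s (x - x0))"
        using norm_triangle_sub[of "?f x" "evalv \<Psi> x"] by (simp add: diff norm_minus_commute)
      also have "norm (\<epsilon> *s (x - x0)) \<le> \<delta>" using small[of x] x by simp
      finally show "\<delta> \<le> norm (evalv \<Psi> x)" by simp
    qed
    then obtain x where x: "x \<in> cball x0 \<rho>" "y = evalv \<Psi> x" using y by blast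
    have "dist (?f x) y = norm (\<epsilon> *s (x - x0))"
      unfolding x(2) diff dist_norm by (metis add_diff_cancel_left' norm_minus_commute)
    then have "dist (?f x) y < e" using small[of x] x by simp
    then show "\<exists>z\<in>?f ` cball x0 \<rho>. dist z y < e" using x(1) by blast
  qed
  moreover have "closure (?f ` cball x0 \<rho>) = ?f ` cball x0 \<rho>"
    using comp compact_imp_closed closure_closed by blast
  ultimately have "ball 0 \<delta> \<subseteq> ?f ` cball x0 \<rho>" by (metis subsetI)
  then show thesis by (rule that[OF \<delta>(1)])
qed

section \<open>Counting exponents\<close>

definition exps :: "'i set \<Rightarrow> nat \<Rightarrow> ('i \<Rightarrow> nat) set" where
  "exps S D = {a. (\<forall>i. i \<notin> S \<longrightarrow> a i = 0) \<and> sum a S \<le> D}"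

lemma exps_insert_bij:
  assumes "finite S" "k \<notin> S"
  shows "bij_betw (\<lambda>(e, a). a(k := e)) (Sigma {..D} (\<lambda>e. exps S (D - e))) (exps (insert k S) D)"
proof (rule bij_betw_byWitness[where f' = "\<lambda>a. (a k, a(k := 0))"])
  have 1: "sum (a(k := e)) S = sum a S" "(\<Sum>i\<in>S. if i = k then e else a i) = sum a S" for a :: "'a \<Rightarrow> nat" and e
    using assms by (auto intro!: sum.cong)
  show "\<forall>x\<in>Sigma {..D} (\<lambda>e. exps S (D - e)). (\<lambda>a. (a k, a(k := 0))) ((\<lambda>(e, a). a(k := e)) x) = x"
    using assms(2) by (auto simp: exps_def fun_eq_iff)
  show "\<forall>x\<in>exps (insert k S) D. (\<lambda>(e, a). a(k := e)) ((\<lambda>a. (a k, a(k := 0))) x) = x"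
    by auto
  show "(\<lambda>(e, a). a(k := e)) ` Sigma {..D} (\<lambda>e. exps S (D - e)) \<subseteq> exps (insert k S) D"
    using assms by (auto simp: exps_def 1)
  show "(\<lambda>a. (a k, a(k := 0))) ` exps (insert k S) D \<subseteq> Sigma {..D} (\<lambda>e. exps S (D - e))"
    using assms by (auto simp: exps_def 1)
qed

lemma finite_exps: "finite S \<Longrightarrow> finite (exps S D)"
proof (induction S arbitrary: D rule: finite_induct)
  case empty
  have "{a :: 'a \<Rightarrow> nat. \<forall>i. a i = 0} = {\<lambda>_. 0}" by auto
  then show ?case by (simp add: exps_def)
next
  case (insert k S)
  then show ?case using bij_betw_finite[OF exps_insert_bij[OF insert(1,2)]] by auto
qed

lemma card_exps: "finite S \<Longrightarrow> card (exps S D) = (D + card S) choose card S"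
proof (induction S arbitrary: D rule: finite_induct)
  case empty
  have "{a :: 'a \<Rightarrow> nat. \<forall>i. a i = 0} = {\<lambda>_. 0}" by auto
  then show ?case by (simp add: exps_def)
next
  case (insert k S)
  have "card (exps (insert k S) D) = (\<Sum>e\<le>D. card (exps S (D - e)))"
    using bij_betw_same_card[OF exps_insert_bij[OF insert(1,2), of D]] finite_exps[OF insert(1)] by simp
  also have "\<dots> = (\<Sum>e\<le>D. (D - e + card S) choose card S)"
    by (simp add: insert.IH)
  also have "\<dots> = (\<Sum>e\<le>D. (card S + e) choose card S)"
    by (rule sum.reindex_bij_witness[of _ "\<lambda>e. D - e" "\<lambda>e. D - e"]) (auto simp: add.commute)
  also have "\<dots> = (card S + D + 1) choose (card S + 1)"
    by (rule choose_rising_sum(1))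
  finally show ?case using insert by (simp add: add.commute)
qed

lemma card_exps_UNIV: "card (exps (UNIV :: 'i::finite set) D) = (D + CARD('i)) choose CARD('i)"
  by (rule card_exps) simp

lemma exps_mono: "D \<le> D' \<Longrightarrow> exps S D \<subseteq> exps S D'"
  by (auto simp: exps_def)

lemma card_exps_pairs:
  fixes S :: "'s set" and T :: "'t set"
  assumes "finite S" "finite T"
  shows "card {(b, a). b \<in> exps S D \<and> a \<in> exps T (D - sum b S)} = (D + (card S + card T)) choose (card S + card T)"
proof -
  let ?L = "{(b, a). b \<in> exps S D \<and> a \<in> exps T (D - sum b S)}"
  have "bij_betw (\<lambda>(b, a). case_sum b a) ?L (exps (S <+> T) D)"
  proof (rule bij_betw_byWitness[where f' = "\<lambda>e. (e \<circ> Inl, e \<circ> Inr)"])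
    show "\<forall>x\<in>?L. (\<lambda>e. (e \<circ> Inl, e \<circ> Inr)) ((\<lambda>(b, a). case_sum b a) x) = x"
      by (auto simp: fun_eq_iff)
    show "\<forall>e\<in>exps (S <+> T) D. (\<lambda>(b, a). case_sum b a) ((\<lambda>e. (e \<circ> Inl, e \<circ> Inr)) e) = e"
      by (auto simp: fun_eq_iff split: sum.split)
    show "(\<lambda>(b, a). case_sum b a) ` ?L \<subseteq> exps (S <+> T) D"
    proof clarify
      fix b a assume ba: "b \<in> exps S D" "a \<in> exps T (D - sum b S)"
      have "case_sum b a i = 0" if "i \<notin> S <+> T" for i
        using that ba by (cases i) (auto simp: exps_def)
      moreover have "sum (case_sum b a) (S <+> T) \<le> D"
        using ba assms by (auto simp: exps_def sum.Plus)
      ultimately show "case_sum b a \<in> exps (S <+> T) D" by (simp add: exps_def)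
    qed
    show "(\<lambda>e. (e \<circ> Inl, e \<circ> Inr)) ` exps (S <+> T) D \<subseteq> ?L"
      using assms by (auto simp: exps_def sum.Plus)
  qed
  then have "card ?L = card (exps (S <+> T) D)" by (rule bij_betw_same_card)
  then show ?thesis using assms by (simp add: card_exps card_Plus)
qed

text \<open>Dividing each exponent by its weight is at most \<open>\<Prod>d\<close> to one.\<close>

lemma sum_exps_weighted:
  fixes g :: "nat \<Rightarrow> nat" and d :: "'s \<Rightarrow> nat"
  assumes S: "finite S" and d: "\<And>i. i \<in> S \<Longrightarrow> d i \<ge> 1" and g: "mono g"
  shows "(\<Sum>\<beta>\<in>exps S D. g (D - sum \<beta> S))
    \<le> (\<Prod>i\<in>S. d i) * (\<Sum>b\<in>{b\<in>exps S D. (\<Sum>i\<in>S. b i * d i) \<le> D}. g (D - (\<Sum>i\<in>S. b i * d i)))"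
proof -
  let ?B = "{b\<in>exps S D. (\<Sum>i\<in>S. b i * d i) \<le> D}" and ?P = "PiE S (\<lambda>i. {..<d i})"
  define f where "f \<beta> = ((\<lambda>i. if i \<in> S then \<beta> i div d i else 0), restrict (\<lambda>i. \<beta> i mod d i) S)" for \<beta>
  have inj: "inj_on f (exps S D)"
  proof (rule inj_onI, rule ext)
    fix \<beta> \<gamma> i assume *: "\<beta> \<in> exps S D" "\<gamma> \<in> exps S D" "f \<beta> = f \<gamma>"
    show "\<beta> i = \<gamma> i"
    proof (cases "i \<in> S")
      case True
      then have "\<beta> i div d i = \<gamma> i div d i" "\<beta> i mod d i = \<gamma> i mod d i"
        using *(3) by (auto simp: f_def fun_eq_iff restrict_def split: if_splits)
      then show ?thesis by (metis div_mult_mod_eq)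
    qed (use * in \<open>auto simp: exps_def\<close>)
  qed
  have le: "(\<Sum>i\<in>S. fst (f \<beta>) i * d i) \<le> sum \<beta> S" for \<beta>
    by (intro sum_mono) (auto simp: f_def)
  have im: "f ` exps S D \<subseteq> ?B \<times> ?P"
  proof
    fix y assume "y \<in> f ` exps S D"
    then obtain \<beta> where \<beta>: "\<beta> \<in> exps S D" "y = f \<beta>" by auto
    have "(\<Sum>i\<in>S. fst (f \<beta>) i) \<le> sum \<beta> S"
      by (intro sum_mono) (auto simp: f_def)
    then have "fst (f \<beta>) \<in> ?B"
      using le[of \<beta>] \<beta>(1) by (auto simp: exps_def f_def)
    moreover have "snd (f \<beta>) \<in> ?P" using d by (force simp: f_def intro: mod_less_divisor)
    ultimately show "y \<in> ?B \<times> ?P" using \<beta>(2) by (simp add: mem_Times_iff)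
  qed
  have fin: "finite (?B \<times> ?P)" using S by (intro finite_cartesian_product finite_PiE) (auto simp: finite_exps)
  have "(\<Sum>\<beta>\<in>exps S D. g (D - sum \<beta> S)) \<le> (\<Sum>\<beta>\<in>exps S D. g (D - (\<Sum>i\<in>S. fst (f \<beta>) i * d i)))"
    by (rule sum_mono, rule monoD[OF g], rule diff_le_mono2, rule le)
  also have "\<dots> = (\<Sum>y\<in>f ` exps S D. g (D - (\<Sum>i\<in>S. fst y i * d i)))"
    by (simp add: sum.reindex[OF inj])
  also have "\<dots> \<le> (\<Sum>y\<in>?B \<times> ?P. g (D - (\<Sum>i\<in>S. fst y i * d i)))"
    by (rule sum_mono2[OF fin im]) simp
  also have "\<dots> = card ?P * (\<Sum>b\<in>?B. g (D - (\<Sum>i\<in>S. b i * d i)))"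
    using sum.cartesian_product[of "\<lambda>b _. g (D - (\<Sum>i\<in>S. b i * d i))" ?P ?B, symmetric]
    by (simp add: sum_distrib_left case_prod_unfold)
  also have "card ?P = (\<Prod>i\<in>S. d i)" using S by (simp add: card_PiE)
  finally show ?thesis .
qed

lemma fact_Suc_times_binomial:
  "fact (Suc k) * ((X + Suc k) choose Suc k) = (X + Suc k) * (fact k * ((X + k) choose k) :: nat)"
proof -
  have "fact (Suc k) * ((X + Suc k) choose Suc k) = fact k * (Suc k * (Suc (X + k) choose Suc k))"
    by (simp only: fact_Suc of_nat_id add_Suc_right mult_ac)
  also have "\<dots> = fact k * (Suc (X + k) * ((X + k) choose k))"
    by (simp only: Suc_times_binomial)
  finally show ?thesis by (simp only: add_Suc_right mult_ac)
qed

lemma binomial_lower: "real X ^ k / fact k \<le> real ((X + k) choose k)"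
proof -
  have "X ^ k \<le> fact k * ((X + k) choose k)"
  proof (induction k)
    case (Suc k)
    have "X ^ Suc k \<le> (X + Suc k) * (fact k * ((X + k) choose k))"
      unfolding power_Suc by (rule mult_le_mono) (use Suc in auto)
    also have "\<dots> = fact (Suc k) * ((X + Suc k) choose Suc k)"
      by (rule fact_Suc_times_binomial[symmetric])
    finally show ?case .
  qed simp
  then have "real (X ^ k) \<le> real (fact k * ((X + k) choose k))" by (rule of_nat_mono)
  then show ?thesis by (simp add: field_simps)
qed

lemma binomial_upper: "real ((X + k) choose k) \<le> real (X + k) ^ k / fact k"
proof -
  have "fact k * ((X + k) choose k) \<le> (X + k) ^ k"
  proof (induction k)
    case (Suc k)
    have "fact (Suc k) * ((X + Suc k) choose Suc k) = (X + Suc k) * (fact k * ((X + k) choose k))"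
      by (rule fact_Suc_times_binomial)
    also have "\<dots> \<le> (X + Suc k) * (X + k) ^ k" using Suc by (intro mult_le_mono2)
    also have "\<dots> \<le> (X + Suc k) * (X + Suc k) ^ k" by (intro mult_le_mono2 power_mono) auto
    finally show ?case by simp
  qed simp
  then have "real (fact k * ((X + k) choose k)) \<le> real ((X + k) ^ k)" by (rule of_nat_mono)
  then show ?thesis by (simp add: field_simps)
qed

text \<open>Both sides are compared with \<open>X ^ k / fact k\<close> and \<open>X\<close> tends to
  infinity; the shift by \<open>c\<close> disappears in the limit. Bounded losses of degree in the
  counting arguments are therefore harmless.\<close>

lemma binomial_growth_cancel:
  fixes p q :: real
  assumes le: "\<And>X. p * real ((X + k) choose k) \<le> q * real ((X + c + k) choose k)" and "p \<ge> 0" "q \<ge> 0"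
  shows "p \<le> q"
proof -
  have 1: "p \<le> q * (1 + real (c + k) / real X) ^ k" if "X > 0" for X :: nat
  proof -
    have "p * (real X ^ k / fact k) \<le> p * real ((X + k) choose k)"
      using \<open>p \<ge> 0\<close> binomial_lower by (intro mult_left_mono)
    also have "\<dots> \<le> q * real ((X + c + k) choose k)" by (rule le)
    also have "\<dots> \<le> q * (real (X + c + k) ^ k / fact k)"
      using \<open>q \<ge> 0\<close> binomial_upper by (intro mult_left_mono)
    finally have "p * real X ^ k \<le> q * real (X + c + k) ^ k" by (simp add: field_simps)
    also have "real (X + c + k) = (1 + real (c + k) / real X) * real X"
      using that by (simp add: field_simps)
    finally show ?thesis using that by (simp add: power_mult_distrib)
  qed
  have "(\<lambda>X. q * (1 + real (c + k) / real X) ^ k) \<longlonglongrightarrow> q * (1 + 0) ^ k"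
    by (intro tendsto_intros lim_const_over_n)
  then have "(\<lambda>X. q * (1 + real (c + k) / real X) ^ k) \<longlonglongrightarrow> q" by simp
  then show ?thesis
    by (rule LIMSEQ_le_const) (use 1 in \<open>auto intro!: exI[of _ 1]\<close>)
qed

section \<open>Linear independence of functions\<close>

lemma homogeneous_system_nontrivial:
  fixes B :: "'j \<Rightarrow> 'k \<Rightarrow> complex"
  assumes "finite K" "finite J" "card K < card J"
  shows "\<exists>c. (\<exists>j\<in>J. c j \<noteq> 0) \<and> (\<forall>k\<in>K. (\<Sum>j\<in>J. c j * B j k) = 0)"
  using assms
proof (induction K arbitrary: J B rule: finite_induct)
  case empty
  then have "J \<noteq> {}" by auto
  then show ?case by (intro exI[of _ "\<lambda>_. 1"]) auto
next
  case (insert k K)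
  show ?case
  proof (cases "\<forall>j\<in>J. B j k = 0")
    case True
    then show ?thesis using insert.IH[of J B] insert.prems insert.hyps by auto
  next
    case False
    then obtain p where p: "p \<in> J" "B p k \<noteq> 0" by auto
    have "card K < card (J - {p})" using insert p by (simp add: card_Diff_singleton)
    then obtain c where c: "\<exists>j\<in>J - {p}. c j \<noteq> 0"
      "\<forall>l\<in>K. (\<Sum>j\<in>J - {p}. c j * (B j l - B j k / B p k * B p l)) = 0"
      using insert.IH[of "J - {p}" "\<lambda>j l. B j l - B j k / B p k * B p l"] insert.prems by auto
    define c' where "c' = c(p := - (\<Sum>j\<in>J - {p}. c j * B j k) / B p k)"
    have split: "(\<Sum>j\<in>J. c' j * B j l) = c' p * B p l + (\<Sum>j\<in>J - {p}. c j * B j l)" for l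
      using insert.prems p by (subst sum.remove[of J p]) (auto simp: c'_def intro!: sum.cong)
    have "(\<Sum>j\<in>J. c' j * B j k) = 0"
      unfolding split using p by (simp add: c'_def)
    moreover have "(\<Sum>j\<in>J. c' j * B j l) = 0" if "l \<in> K" for l
    proof -
      have "(\<Sum>j\<in>J - {p}. c j * (B j l - B j k / B p k * B p l))
          = (\<Sum>j\<in>J - {p}. c j * B j l) - (\<Sum>j\<in>J - {p}. c j * B j k) / B p k * B p l"
        by (simp add: sum_subtractf algebra_simps sum_distrib_left sum_distrib_right sum_divide_distrib)
      with c(2) that show ?thesis unfolding split by (simp add: c'_def)
    qed
    ultimately show ?thesis using c(1) by (intro exI[of _ c']) (auto simp: c'_def)
  qed
qed

text \<open>Independence of an indexed family of functions restricted to \<open>A\<close>; indexing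
  makes repetitions dependent, so that dimensions are compared through
  \<open>card J\<close>.\<close>

definition indep_on :: "'x set \<Rightarrow> 'j set \<Rightarrow> ('j \<Rightarrow> 'x \<Rightarrow> complex) \<Rightarrow> bool" where
  "indep_on A J \<phi> \<longleftrightarrow> (\<forall>c. (\<forall>x\<in>A. (\<Sum>j\<in>J. c j * \<phi> j x) = 0) \<longrightarrow> (\<forall>j\<in>J. c j = 0))"

lemma indep_onD:
  "indep_on A J \<phi> \<Longrightarrow> (\<And>x. x \<in> A \<Longrightarrow> (\<Sum>j\<in>J. c j * \<phi> j x) = 0) \<Longrightarrow> j \<in> J \<Longrightarrow> c j = 0"
  by (auto simp: indep_on_def)

lemma indep_on_subset:
  assumes "indep_on A J \<phi>" "I \<subseteq> J" "finite J"
  shows "indep_on A I \<phi>"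
  unfolding indep_on_def
proof (intro allI impI ballI)
  fix c i assume c: "\<forall>x\<in>A. (\<Sum>j\<in>I. c j * \<phi> j x) = 0" and i: "i \<in> I"
  have "(\<Sum>j\<in>J. (if j \<in> I then c j else 0) * \<phi> j x) = (\<Sum>j\<in>I. c j * \<phi> j x)" for x
    using assms(2,3) by (intro sum.mono_neutral_cong_right) auto
  then have "(if i \<in> I then c i else 0) = 0"
    using indep_onD[OF assms(1), of "\<lambda>j. if j \<in> I then c j else 0" i] c i assms(2) by auto
  then show "c i = 0" using i by simp
qed

lemma indep_on_card_le:
  assumes "finite J" "finite K" "indep_on A J \<phi>"
    and span: "\<And>j. j \<in> J \<Longrightarrow> \<exists>b. \<forall>x\<in>A. \<phi> j x = (\<Sum>k\<in>K. b k * \<psi> k x)"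
  shows "card J \<le> card K"
proof (rule ccontr)
  assume neg: "\<not> ?thesis"
  obtain b where b: "\<And>j x. j \<in> J \<Longrightarrow> x \<in> A \<Longrightarrow> \<phi> j x = (\<Sum>k\<in>K. b j k * \<psi> k x)"
    using span by metis
  obtain c where c: "\<exists>j\<in>J. c j \<noteq> 0" "\<forall>k\<in>K. (\<Sum>j\<in>J. c j * b j k) = 0"
    using homogeneous_system_nontrivial[of K J b] assms neg by auto
  have "(\<Sum>j\<in>J. c j * \<phi> j x) = 0" if "x \<in> A" for x
  proof -
    have "(\<Sum>j\<in>J. c j * \<phi> j x) = (\<Sum>j\<in>J. \<Sum>k\<in>K. c j * b j k * \<psi> k x)"
      using that by (intro sum.cong) (auto simp: b sum_distrib_left mult.assoc)
    also have "\<dots> = (\<Sum>k\<in>K. (\<Sum>j\<in>J. c j * b j k) * \<psi> k x)"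
      by (subst sum.swap) (simp add: sum_distrib_right)
    finally show ?thesis using c(2) by simp
  qed
  with indep_onD[OF assms(3), of c] c(1) show False by blast
qed

text \<open>With the variables in \<open>X\<close> fixed, the sum is a polynomial in variable
  \<open>k\<close> with infinitely many roots, and its coefficients are sums of the same kind in
  fewer variables. The exponents are only required to differ on the set of active variables, a
  property that survives fixing the exponent at \<open>k\<close>.\<close>

lemma coefficients_zero:
  fixes z :: "'i \<Rightarrow> complex"
  assumes "finite X" "\<delta> > 0" "finite S"
    and "\<And>a b. a \<in> S \<Longrightarrow> b \<in> S \<Longrightarrow> (\<And>i. i \<in> X \<Longrightarrow> a i = b i) \<Longrightarrow> a = b"
    and "\<And>x. (\<And>i. i \<in> X \<Longrightarrow> dist (z i) (x i) < \<delta>) \<Longrightarrow> (\<Sum>a\<in>S. c a * (\<Prod>i\<in>X. x i ^ a i)) = 0"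
    and "a \<in> S"
  shows "c a = 0"
  using assms(1,3-6)
proof (induction X arbitrary: S a rule: finite_induct)
  case empty
  then have "S = {a}" by auto
  then show ?case using empty.prems(3)[of z] by simp
next
  case (insert k X)
  define N where "N = Max ((\<lambda>a. a k) ` S)"
  have N: "b k \<le> N" if "b \<in> S" for b using that insert.prems(1) by (simp add: N_def)
  have "(\<Sum>b\<in>{b\<in>S. b k = a k}. c b * (\<Prod>i\<in>X. x i ^ b i)) = 0"
    if x: "\<And>i. i \<in> X \<Longrightarrow> dist (z i) (x i) < \<delta>" for x
  proof -
    define C where "C e = (\<Sum>b\<in>{b\<in>S. b k = e}. c b * (\<Prod>i\<in>X. x i ^ b i))" for e
    have "(\<Sum>e\<le>N. C e * t ^ e) = 0" if t: "t \<in> ball (z k) \<delta>" for t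
    proof -
      have "(\<Sum>b\<in>S. c b * (\<Prod>i\<in>insert k X. (x(k := t)) i ^ b i)) = 0"
        using x t insert.hyps by (intro insert.prems(3)) (auto simp: dist_commute)
      moreover have "(\<Prod>i\<in>insert k X. (x(k := t)) i ^ b i) = t ^ b k * (\<Prod>i\<in>X. x i ^ b i)" for b :: "'i \<Rightarrow> nat"
      proof -
        have "(\<Prod>i\<in>X. (x(k := t)) i ^ b i) = (\<Prod>i\<in>X. x i ^ b i)"
          using insert.hyps by (intro prod.cong) auto
        then show ?thesis using insert.hyps by simp
      qed
      ultimately have "0 = (\<Sum>b\<in>S. c b * (t ^ b k * (\<Prod>i\<in>X. x i ^ b i)))" by simp
      also have "(\<Sum>b\<in>S. c b * (t ^ b k * (\<Prod>i\<in>X. x i ^ b i)))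
          = (\<Sum>e\<le>N. \<Sum>b\<in>{b\<in>S. b k = e}. c b * (t ^ b k * (\<Prod>i\<in>X. x i ^ b i)))"
        using insert.prems(1) N by (intro sum.group[symmetric]) auto
      also have "\<dots> = (\<Sum>e\<le>N. C e * t ^ e)"
        by (intro sum.cong refl) (auto simp: C_def sum_distrib_right intro!: sum.cong)
      finally show ?thesis by simp
    qed
    then have "ball (z k) \<delta> \<subseteq> {t. (\<Sum>e\<le>N. C e * t ^ e) = 0}" by auto
    moreover have "infinite (ball (z k) \<delta>)"
      using \<open>\<delta> > 0\<close> by (metis centre_in_ball empty_iff finite_imp_not_open open_ball)
    ultimately have "infinite {t. (\<Sum>e\<le>N. C e * t ^ e) = 0}" using finite_subset by blast
    then have "C e = 0" if "e \<le> N" for e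
      using polyfun_rootbound[of N C] that by blast
    then show ?thesis using N[OF insert.prems(4)] by (simp add: C_def)
  qed
  note vanish = this
  show ?case
  proof (rule insert.IH[of "{b\<in>S. b k = a k}" a])
    show "p = q" if "p \<in> {b\<in>S. b k = a k}" "q \<in> {b\<in>S. b k = a k}" "\<And>i. i \<in> X \<Longrightarrow> p i = q i" for p q
      by (rule insert.prems(2)) (use that in auto)
  qed (use insert.prems vanish in auto)
qed

lemma convergent_subsequence_family:
  fixes \<gamma> :: "nat \<Rightarrow> 'j \<Rightarrow> complex"
  assumes "finite J" "\<And>k j. j \<in> J \<Longrightarrow> norm (\<gamma> k j) \<le> 1"
  shows "\<exists>r l. strict_mono (r :: nat \<Rightarrow> nat) \<and> (\<forall>j\<in>J. (\<lambda>k. \<gamma> (r k) j) \<longlonglongrightarrow> l j)"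
  using assms
proof (induction J rule: finite_induct)
  case empty
  show ?case by (intro exI[of _ id]) (auto simp: strict_mono_def)
next
  case (insert i J)
  then obtain r l where r: "strict_mono r" "\<forall>j\<in>J. (\<lambda>k. \<gamma> (r k) j) \<longlonglongrightarrow> l j" by auto
  have "bounded (range (\<lambda>k. \<gamma> (r k) i))"
    using insert.prems by (auto simp: bounded_iff intro!: exI[of _ 1])
  then obtain l' r' where r': "strict_mono r'" "((\<lambda>k. \<gamma> (r k) i) \<circ> r') \<longlonglongrightarrow> l'"
    using bounded_imp_convergent_subsequence by blast
  have "(\<lambda>k. \<gamma> ((r \<circ> r') k) j) \<longlonglongrightarrow> (l(i := l')) j" if "j \<in> insert i J" for j
    using that r'(2) LIMSEQ_subseq_LIMSEQ[OF _ r'(1), of "\<lambda>k. \<gamma> (r k) j"] r(2) insert.hyps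
    by (cases "j = i") (auto simp: o_def)
  then show ?case using strict_mono_o[OF r(1) r'(1)] by blast
qed

text \<open>If \<open>f\<close> is open at the points of \<open>A\<close> (over the value \<open>0\<close>), a relation between the
  products of powers of \<open>f\<close> with functions \<open>\<phi>\<close> gives, on the fibres over small \<open>s\<close>,
  relations between the \<open>\<phi>\<close>; normalised, these tend to a relation on \<open>A\<close>.\<close>

lemma indep_powers:
  fixes f :: "'s \<Rightarrow> 'x::metric_space \<Rightarrow> complex" and \<phi> :: "'j \<Rightarrow> 'x \<Rightarrow> complex"
  assumes S: "finite S" and J: "finite J" and ind: "indep_on A J \<phi>"
    and cont: "\<And>j. j \<in> J \<Longrightarrow> continuous_on UNIV (\<phi> j)"
    and opn: "\<And>x \<epsilon>. x \<in> A \<Longrightarrow> \<epsilon> > 0 \<Longrightarrow> \<exists>\<delta>>0. \<forall>s. (\<forall>i\<in>S. norm (s i) < \<delta>) \<longrightarrow> (\<exists>x'\<in>ball x \<epsilon>. \<forall>i\<in>S. f i x' = s i)"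
    and B: "finite B" "B \<subseteq> {b. \<forall>i. i \<notin> S \<longrightarrow> b i = (0::nat)}"
  shows "indep_on UNIV (B \<times> J) (\<lambda>(b, j) x. (\<Prod>i\<in>S. f i x ^ b i) * \<phi> j x)"
  unfolding indep_on_def
proof (rule ccontr, clarsimp)
  fix c b0 j0
  assume rel: "\<forall>x. (\<Sum>y\<in>B \<times> J. c y * (case y of (b, j) \<Rightarrow> \<lambda>x. (\<Prod>i\<in>S. f i x ^ b i) * \<phi> j x) x) = 0"
    and b0: "b0 \<in> B" and j0: "j0 \<in> J" and nz: "c (b0, j0) \<noteq> 0"
  define C where "C s j = (\<Sum>b\<in>B. c (b, j) * (\<Prod>i\<in>S. s i ^ b i))" for s j
  have rel': "(\<Sum>j\<in>J. C s j * \<phi> j x) = 0" if "\<And>i. i \<in> S \<Longrightarrow> f i x = s i" for s x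
  proof -
    have "0 = (\<Sum>b\<in>B. \<Sum>j\<in>J. c (b, j) * ((\<Prod>i\<in>S. f i x ^ b i) * \<phi> j x))"
      using rel[rule_format, of x] by (simp add: sum.cartesian_product case_prod_unfold)
    also have "\<dots> = (\<Sum>j\<in>J. \<Sum>b\<in>B. c (b, j) * ((\<Prod>i\<in>S. s i ^ b i) * \<phi> j x))"
      using that by (subst sum.swap) simp
    finally show ?thesis by (simp add: C_def sum_distrib_right mult.assoc)
  qed
  \<comment> \<open>Otherwise the polynomial \<open>\<lambda>s. C s j0\<close> would vanish on a
    polydisc, and its coefficient \<open>c (b0, j0)\<close> would be zero.\<close>
  have "\<exists>s. (\<forall>i\<in>S. norm (s i) < 1 / real (Suc k)) \<and> C s j0 \<noteq> 0" for k
  proof (rule ccontr)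
    assume H: "\<not> ?thesis"
    have "c (b0, j0) = 0"
    proof (rule coefficients_zero[OF S, where z = "\<lambda>_. 0" and \<delta> = "1 / real (Suc k)" and S = B and c = "\<lambda>b. c (b, j0)"])
      show "a = b" if "a \<in> B" "b \<in> B" "\<And>i. i \<in> S \<Longrightarrow> a i = b i" for a b
      proof
        fix i
        have "a \<in> {b. \<forall>i. i \<notin> S \<longrightarrow> b i = 0}" "b \<in> {b. \<forall>i. i \<notin> S \<longrightarrow> b i = 0}" using that B(2) by blast+
        then show "a i = b i" using that(3) by (cases "i \<in> S") auto
      qed
      show "(\<Sum>a\<in>B. c (a, j0) * (\<Prod>i\<in>S. s i ^ a i)) = 0" if "\<And>i. i \<in> S \<Longrightarrow> dist 0 (s i) < 1 / real (Suc k)" for s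
        using H that by (auto simp: C_def dist_norm)
    qed (use B(1) b0 in auto)
    with nz show False by simp
  qed
  then obtain s where s: "\<And>k i. i \<in> S \<Longrightarrow> norm (s k i) < 1 / real (Suc k)" "\<And>k. C (s k) j0 \<noteq> 0" by metis
  define N where "N k = (\<Sum>j\<in>J. norm (C (s k) j))" for k
  have N: "N k > 0" for k
    unfolding N_def using s(2)[of k] j0 by (intro sum_pos2[OF J j0]) auto
  \<comment> \<open>Scaling the coefficients to total size one makes the limit relation
    nontrivial.\<close>
  define \<gamma> where "\<gamma> k j = C (s k) j / of_real (N k)" for k j
  have \<gamma>1: "(\<Sum>j\<in>J. norm (\<gamma> k j)) = 1" for k
    using N[of k] by (simp add: \<gamma>_def norm_divide sum_divide_distrib[symmetric] N_def[symmetric])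
  have \<gamma>b: "norm (\<gamma> k j) \<le> 1" if "j \<in> J" for k j
    unfolding \<gamma>1[of k, symmetric] using that J by (intro member_le_sum) auto
  obtain r l where r: "strict_mono (r :: nat \<Rightarrow> nat)" and l: "\<And>j. j \<in> J \<Longrightarrow> (\<lambda>k. \<gamma> (r k) j) \<longlonglongrightarrow> l j"
    using convergent_subsequence_family[OF J, of \<gamma>] \<gamma>b by blast
  have "(\<lambda>k. \<Sum>j\<in>J. norm (\<gamma> (r k) j)) \<longlonglongrightarrow> (\<Sum>j\<in>J. norm (l j))"
    by (intro tendsto_intros l)
  then have l1: "(\<Sum>j\<in>J. norm (l j)) = 1" using \<gamma>1 LIMSEQ_unique[OF _ tendsto_const] by auto
  have "(\<Sum>j\<in>J. l j * \<phi> j x) = 0" if x: "x \<in> A" for x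
  proof -
    have "norm (\<Sum>j\<in>J. l j * \<phi> j x) \<le> \<eta>" if \<eta>: "\<eta> > 0" for \<eta>
    proof -
      have "continuous_on UNIV (\<lambda>y. \<Sum>j\<in>J. norm (\<phi> j x - \<phi> j y))"
        by (intro continuous_intros cont)
      then have "\<exists>\<epsilon>>0. \<forall>y. dist y x < \<epsilon> \<longrightarrow>
          dist (\<Sum>j\<in>J. norm (\<phi> j x - \<phi> j y)) (\<Sum>j\<in>J. norm (\<phi> j x - \<phi> j x)) < \<eta>"
        using \<eta> unfolding continuous_on_iff by blast
      then obtain \<epsilon> where \<epsilon>: "\<epsilon> > 0" "\<And>y. dist y x < \<epsilon> \<Longrightarrow> (\<Sum>j\<in>J. norm (\<phi> j x - \<phi> j y)) < \<eta>"
        by (auto simp: dist_norm abs_less_iff)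
      obtain \<delta> where \<delta>: "\<delta> > 0" "\<And>s. (\<And>i. i \<in> S \<Longrightarrow> norm (s i) < \<delta>) \<Longrightarrow> \<exists>x'\<in>ball x \<epsilon>. \<forall>i\<in>S. f i x' = s i"
        using opn[OF x \<epsilon>(1)] by blast
      obtain k0 where k0: "1 / real (Suc k0) < \<delta>" using \<delta>(1) nat_approx_posE by blast
      have "norm (\<Sum>j\<in>J. \<gamma> (r k) j * \<phi> j x) \<le> \<eta>" if k: "k \<ge> k0" for k
      proof -
        have "k0 \<le> r k" using k seq_suble[OF r, of k] by simp
        then have "1 / real (Suc (r k)) \<le> 1 / real (Suc k0)" by (simp add: field_simps)
        then have "norm (s (r k) i) < \<delta>" if "i \<in> S" for i using s(1)[OF that, of "r k"] k0 by simp
        then obtain y where y: "y \<in> ball x \<epsilon>" "\<forall>i\<in>S. f i y = s (r k) i" using \<delta>(2) by metis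
        have "(\<Sum>j\<in>J. \<gamma> (r k) j * \<phi> j y) = 0"
          using rel'[of y "s (r k)"] y(2) N[of "r k"]
          by (simp add: \<gamma>_def sum_divide_distrib[symmetric])
        then have "norm (\<Sum>j\<in>J. \<gamma> (r k) j * \<phi> j x) = norm (\<Sum>j\<in>J. \<gamma> (r k) j * (\<phi> j x - \<phi> j y))"
          by (simp add: right_diff_distrib sum_subtractf)
        also have "\<dots> \<le> (\<Sum>j\<in>J. norm (\<phi> j x - \<phi> j y))"
          using \<gamma>b by (intro sum_norm_le) (auto simp: norm_mult intro!: mult_left_le_one_le)
        also have "\<dots> \<le> \<eta>" using \<epsilon>(2)[of y] y(1) by (simp add: dist_commute)
        finally show ?thesis .
      qed
      moreover have "(\<lambda>k. norm (\<Sum>j\<in>J. \<gamma> (r k) j * \<phi> j x)) \<longlonglongrightarrow> norm (\<Sum>j\<in>J. l j * \<phi> j x)"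
        by (intro tendsto_intros l)
      ultimately show ?thesis by (intro LIMSEQ_le_const2) auto
    qed
    then have "norm (\<Sum>j\<in>J. l j * \<phi> j x) \<le> 0" by (rule field_le_epsilon[rule_format, of _ 0, simplified])
    then show ?thesis by simp
  qed
  then have "\<forall>j\<in>J. l j = 0" using indep_onD[OF ind] by blast
  with l1 show False by simp
qed

text \<open>Over each \<open>y\<close> near \<open>y0\<close> a relation is a polynomial of degree
  below \<open>M\<close> in \<open>h\<close> with \<open>M\<close> distinct roots, so its
  coefficients vanish; as functions of \<open>y\<close> these are polynomials that vanish on a
  polydisc.\<close>

lemma indep_sheets:
  fixes \<psi> :: "'t \<Rightarrow> 'x \<Rightarrow> complex" and y0 :: "'t \<Rightarrow> complex"
  assumes T: "finite T" and \<delta>: "\<delta> > 0"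
    and sheets: "\<And>y. (\<And>t. t \<in> T \<Longrightarrow> dist (y0 t) (y t) < \<delta>) \<Longrightarrow>
      \<exists>X\<subseteq>A. finite X \<and> card X = M \<and> inj_on h X \<and> (\<forall>x\<in>X. \<forall>t\<in>T. \<psi> t x = y t)"
    and E: "finite E" "E \<subseteq> {a. \<forall>i. i \<notin> T \<longrightarrow> a i = (0::nat)}"
  shows "indep_on A (E \<times> {..<M}) (\<lambda>(a, i) x. (\<Prod>t\<in>T. \<psi> t x ^ a t) * h x ^ i)"
  unfolding indep_on_def
proof (intro allI impI)
  fix c assume rel: "\<forall>x\<in>A. (\<Sum>y\<in>E \<times> {..<M}. c y * (case y of (a, i) \<Rightarrow> \<lambda>x. (\<Prod>t\<in>T. \<psi> t x ^ a t) * h x ^ i) x) = 0"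
  have "c (a, i) = 0" if ai: "a \<in> E" "i < M" for a i
  proof (rule coefficients_zero[OF T \<delta> E(1), where c = "\<lambda>a. c (a, i)" and z = y0])
    show "a = b" if "a \<in> E" "b \<in> E" "\<And>i. i \<in> T \<Longrightarrow> a i = b i" for a b
    proof
      fix i
      have "a \<in> {b. \<forall>i. i \<notin> T \<longrightarrow> b i = 0}" "b \<in> {b. \<forall>i. i \<notin> T \<longrightarrow> b i = 0}" using that E(2) by blast+
      then show "a i = b i" using that(3) by (cases "i \<in> T") auto
    qed
    fix y assume y: "\<And>t. t \<in> T \<Longrightarrow> dist (y0 t) (y t) < \<delta>"
    obtain X where X: "X \<subseteq> A" "finite X" "card X = M" "inj_on h X" "\<forall>x\<in>X. \<forall>t\<in>T. \<psi> t x = y t"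
      using sheets[OF y] by blast
    define C where "C i = (\<Sum>a\<in>E. c (a, i) * (\<Prod>t\<in>T. y t ^ a t))" for i
    have "(\<Sum>i\<le>M - 1. C i * \<tau> ^ i) = 0" if \<tau>: "\<tau> \<in> h ` X" for \<tau>
    proof -
      obtain x where x: "x \<in> X" "\<tau> = h x" using \<tau> by auto
      have M: "{..M - Suc 0} = {..<M}" using X(2,3) x(1) by (cases M) auto
      have "0 = (\<Sum>a\<in>E. \<Sum>i<M. c (a, i) * ((\<Prod>t\<in>T. \<psi> t x ^ a t) * h x ^ i))"
        using rel[rule_format, of x] X(1) x(1) by (simp add: sum.cartesian_product case_prod_unfold subset_iff)
      also have "\<dots> = (\<Sum>i<M. \<Sum>a\<in>E. c (a, i) * ((\<Prod>t\<in>T. y t ^ a t) * h x ^ i))"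
        using X(5) x(1) by (subst sum.swap) simp
      finally show ?thesis by (simp add: C_def x(2) sum_distrib_right mult.assoc M)
    qed
    then have sub: "h ` X \<subseteq> {\<tau>. (\<Sum>i\<le>M - 1. C i * \<tau> ^ i) = 0}" by auto
    have "C i = 0"
    proof (rule ccontr)
      assume "C i \<noteq> 0"
      then have "finite {\<tau>. (\<Sum>i\<le>M - 1. C i * \<tau> ^ i) = 0}" "card {\<tau>. (\<Sum>i\<le>M - 1. C i * \<tau> ^ i) = 0} \<le> M - 1"
        using polyfun_rootbound[of "M - 1" C] ai(2) by fastforce+
      moreover have "card (h ` X) = M" using X by (simp add: card_image)
      ultimately show False using card_mono[OF _ sub] ai(2) by fastforce
    qed
    then show "(\<Sum>a\<in>E. c (a, i) * (\<Prod>t\<in>T. y t ^ a t)) = 0" by (simp add: C_def)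
  qed (use ai in auto)
  then show "\<forall>j\<in>E \<times> {..<M}. c j = 0" by auto
qed

section \<open>Bounds for the number of sheets\<close>

definition pmon :: "('i::finite \<Rightarrow> 'x \<Rightarrow> complex) \<Rightarrow> ('i \<Rightarrow> nat) \<Rightarrow> 'x \<Rightarrow> complex" where
  "pmon \<xi> a x = (\<Prod>i\<in>UNIV. \<xi> i x ^ a i)"

text \<open>The coordinate functions \<open>\<xi>\<close> are a parameter, so that the same counting
  serves one copy of the complex space and the product of two copies.\<close>

definition pdeg :: "('i::finite \<Rightarrow> 'x \<Rightarrow> complex) \<Rightarrow> nat \<Rightarrow> ('x \<Rightarrow> complex) set" where
  "pdeg \<xi> D = {f. \<exists>c. \<forall>x. f x = (\<Sum>a\<in>exps UNIV D. c a * pmon \<xi> a x)}"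

lemma finite_exps_UNIV [simp]: "finite (exps (UNIV :: 'i::finite set) D)"
  by (simp add: finite_exps)

lemma exps_support: "exps S D \<subseteq> {a. \<forall>i. i \<notin> S \<longrightarrow> a i = 0}"
  by (auto simp: exps_def)

lemma pdeg_pmon:
  assumes "a \<in> exps UNIV D"
  shows "pmon \<xi> a \<in> pdeg \<xi> D"
  unfolding pdeg_def using assms
  by (auto intro!: exI[of _ "\<lambda>b. if b = a then 1 else 0"] simp: if_distrib[of "\<lambda>c. c * _"] cong: if_cong)

lemma pdeg_const:
  fixes \<xi> :: "'i::finite \<Rightarrow> 'x \<Rightarrow> complex"
  shows "(\<lambda>_. k) \<in> pdeg \<xi> D"
proof -
  have "(\<lambda>_. 0) \<in> exps (UNIV :: 'i set) D" by (simp add: exps_def)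
  then have "k = (\<Sum>a\<in>exps UNIV D. (if a = (\<lambda>_. 0) then k else 0) * pmon \<xi> a x)" for x
    by (simp add: if_distrib[of "\<lambda>c. c * _"] pmon_def cong: if_cong)
  then show ?thesis
    unfolding pdeg_def by (intro CollectI exI[of _ "\<lambda>a. if a = (\<lambda>_. 0) then k else 0"] allI)
qed

lemma pdeg_mono: "f \<in> pdeg \<xi> D \<Longrightarrow> D \<le> D' \<Longrightarrow> f \<in> pdeg \<xi> D'"
proof -
  assume f: "f \<in> pdeg \<xi> D" and D: "D \<le> D'"
  obtain c where c: "\<And>x. f x = (\<Sum>a\<in>exps UNIV D. c a * pmon \<xi> a x)" using f by (auto simp: pdeg_def)
  have "f x = (\<Sum>a\<in>exps UNIV D'. (if a \<in> exps UNIV D then c a else 0) * pmon \<xi> a x)" for x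
    unfolding c using exps_mono[OF D] by (intro sum.mono_neutral_cong_left) auto
  then show ?thesis unfolding pdeg_def by (auto intro!: exI[of _ "\<lambda>a. if a \<in> exps UNIV D then c a else 0"])
qed

lemma pdeg_coord:
  assumes "D \<ge> 1"
  shows "\<xi> i \<in> pdeg \<xi> D"
proof -
  have "pmon \<xi> (\<lambda>j. if j = i then 1 else 0) = \<xi> i"
    by (simp add: pmon_def fun_eq_iff if_distrib[of "\<lambda>n. _ ^ n"] cong: if_cong)
  moreover have "(\<lambda>j. if j = i then 1 else 0) \<in> exps UNIV D"
    using assms by (simp add: exps_def)
  ultimately show ?thesis using pdeg_pmon by metis
qed

lemma pdeg_add:
  assumes "f \<in> pdeg \<xi> D" "g \<in> pdeg \<xi> D"
  shows "(\<lambda>x. f x + g x) \<in> pdeg \<xi> D"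
proof -
  obtain c d where "\<And>x. f x = (\<Sum>a\<in>exps UNIV D. c a * pmon \<xi> a x)"
    "\<And>x. g x = (\<Sum>a\<in>exps UNIV D. d a * pmon \<xi> a x)" using assms by (auto simp: pdeg_def)
  then show ?thesis
    unfolding pdeg_def by (auto intro!: exI[of _ "\<lambda>a. c a + d a"] simp: sum.distrib algebra_simps)
qed

lemma pdeg_sum:
  "(\<And>s. s \<in> S \<Longrightarrow> f s \<in> pdeg \<xi> D) \<Longrightarrow> (\<lambda>x. \<Sum>s\<in>S. f s x) \<in> pdeg \<xi> D"
proof (induction S rule: infinite_finite_induct)
  case (insert s S)
  have "(\<lambda>x. f s x + (\<Sum>s\<in>S. f s x)) \<in> pdeg \<xi> D"
    by (rule pdeg_add) (use insert in auto)
  then show ?case using insert by simp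
qed (auto simp: pdeg_const)

lemma pdeg_mult:
  assumes "f \<in> pdeg \<xi> D" "g \<in> pdeg \<xi> D'"
  shows "(\<lambda>x. f x * g x) \<in> pdeg \<xi> (D + D')"
proof -
  obtain c d where c: "\<And>x. f x = (\<Sum>a\<in>exps UNIV D. c a * pmon \<xi> a x)"
    and d: "\<And>x. g x = (\<Sum>a\<in>exps UNIV D'. d a * pmon \<xi> a x)" using assms by (auto simp: pdeg_def)
  let ?P = "exps UNIV D \<times> exps UNIV D'" and ?s = "\<lambda>(a, b) i. a i + b i"
  have mon: "pmon \<xi> a x * pmon \<xi> b x = pmon \<xi> (?s (a, b)) x" for a b x
    by (simp add: pmon_def power_add prod.distrib)
  have im: "?s ` ?P \<subseteq> exps UNIV (D + D')" by (auto simp: exps_def sum.distrib)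
  define e where "e q = (\<Sum>p\<in>{p\<in>?P. ?s p = q}. c (fst p) * d (snd p))" for q
  have "f x * g x = (\<Sum>p\<in>?P. c (fst p) * d (snd p) * pmon \<xi> (?s p) x)" for x
    unfolding c d sum_product sum.cartesian_product
    by (intro sum.cong refl) (auto simp: mon[unfolded case_prod_conv, symmetric])
  also have "(\<Sum>p\<in>?P. c (fst p) * d (snd p) * pmon \<xi> (?s p) x)
      = (\<Sum>q\<in>exps UNIV (D + D'). \<Sum>p\<in>{p\<in>?P. ?s p = q}. c (fst p) * d (snd p) * pmon \<xi> (?s p) x)" for x
    by (rule sum.group[symmetric]) (use im in auto)
  also have "(\<Sum>q\<in>exps UNIV (D + D'). \<Sum>p\<in>{p\<in>?P. ?s p = q}. c (fst p) * d (snd p) * pmon \<xi> (?s p) x)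
      = (\<Sum>q\<in>exps UNIV (D + D'). e q * pmon \<xi> q x)" for x
    by (intro sum.cong refl) (auto simp: e_def sum_distrib_right intro!: sum.cong)
  finally show ?thesis unfolding pdeg_def by blast
qed

lemma pdeg_power: "f \<in> pdeg \<xi> D \<Longrightarrow> (\<lambda>x. f x ^ k) \<in> pdeg \<xi> (k * D)"
  by (induction k) (auto simp: pdeg_const intro: pdeg_mult)

lemma pdeg_prod:
  "(\<And>s. s \<in> S \<Longrightarrow> f s \<in> pdeg \<xi> (D s)) \<Longrightarrow> (\<lambda>x. \<Prod>s\<in>S. f s x) \<in> pdeg \<xi> (\<Sum>s\<in>S. D s)"
proof (induction S rule: infinite_finite_induct)
  case (insert s S)
  have "(\<lambda>x. f s x * (\<Prod>s\<in>S. f s x)) \<in> pdeg \<xi> (D s + (\<Sum>s\<in>S. D s))"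
    by (rule pdeg_mult) (use insert in auto)
  then show ?case using insert by simp
qed (auto simp: pdeg_const)

lemma pdeg_continuous:
  assumes "f \<in> pdeg \<xi> D" "\<And>i. continuous_on U (\<xi> i)"
  shows "continuous_on U f"
proof -
  obtain c where "\<And>x. f x = (\<Sum>a\<in>exps UNIV D. c a * pmon \<xi> a x)" using assms(1) by (auto simp: pdeg_def)
  then have "f = (\<lambda>x. \<Sum>a\<in>exps UNIV D. c a * pmon \<xi> a x)" by (simp add: fun_eq_iff)
  then show ?thesis
    by (auto simp: pmon_def intro!: continuous_intros assms(2))
qed

lemma pdeg_indep_card_le:
  fixes \<xi> :: "'i::finite \<Rightarrow> 'x \<Rightarrow> complex"
  assumes "finite J" "indep_on A J \<phi>" "\<And>j. j \<in> J \<Longrightarrow> \<phi> j \<in> pdeg \<xi> D"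
  shows "card J \<le> card (exps (UNIV :: 'i::finite set) D)"
proof (rule indep_on_card_le[OF assms(1) _ assms(2), where \<psi> = "pmon \<xi>"])
  fix j assume "j \<in> J"
  then obtain c where "\<And>x. \<phi> j x = (\<Sum>a\<in>exps UNIV D. c a * pmon \<xi> a x)"
    using assms(3) unfolding pdeg_def by blast
  then show "\<exists>b. \<forall>x\<in>A. \<phi> j x = (\<Sum>k\<in>exps UNIV D. b k * pmon \<xi> k x)"
    by (intro exI[of _ c]) simp
qed simp

lemma pdeg_powers:
  assumes "\<And>s. s \<in> S \<Longrightarrow> f s \<in> pdeg \<xi> (d s)"
  shows "(\<lambda>x. \<Prod>s\<in>S. f s x ^ b s) \<in> pdeg \<xi> (\<Sum>s\<in>S. b s * d s)"
  by (intro pdeg_prod pdeg_power assms)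

text \<open>Powers of the \<open>f s\<close>, monomials in the \<open>\<psi> t\<close> and the
  \<open>h ^ i\<close> with \<open>i < M\<close> have independent products. Since each
  \<open>f s\<close> uses up \<open>d s\<close> degrees, the number of products of degree about
  \<open>X\<close> is at least \<open>M / (\<Prod>s\<in>S. d s)\<close> times the number of
  monomials of degree at most \<open>X\<close> in all variables. These products are themselves
  polynomials of about that degree, and the leading terms in \<open>X\<close> give the
  bound.\<close>

theorem sheet_bound:
  fixes \<xi> :: "'i::finite \<Rightarrow> 'x::metric_space \<Rightarrow> complex" and f :: "'s \<Rightarrow> 'x \<Rightarrow> complex"
    and \<psi> :: "'t \<Rightarrow> 'x \<Rightarrow> complex"
  assumes S: "finite S" and T: "finite T" and card: "card S + card T = CARD('i)"
    and \<xi>: "\<And>i. continuous_on UNIV (\<xi> i)"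
    and f: "\<And>s. s \<in> S \<Longrightarrow> f s \<in> pdeg \<xi> (d s)" and d: "\<And>s. s \<in> S \<Longrightarrow> d s \<ge> 1"
    and \<psi>: "\<And>t. t \<in> T \<Longrightarrow> \<psi> t \<in> pdeg \<xi> 1" and h: "h \<in> pdeg \<xi> 1"
    and opn: "\<And>x \<epsilon>. x \<in> A \<Longrightarrow> \<epsilon> > 0 \<Longrightarrow> \<exists>\<delta>>0. \<forall>s. (\<forall>i\<in>S. norm (s i) < \<delta>) \<longrightarrow> (\<exists>x'\<in>ball x \<epsilon>. \<forall>i\<in>S. f i x' = s i)"
    and \<delta>: "\<delta> > 0"
    and sheets: "\<And>y. (\<And>t. t \<in> T \<Longrightarrow> dist (y0 t) (y t) < \<delta>) \<Longrightarrow>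
      \<exists>X\<subseteq>A. finite X \<and> card X = M \<and> inj_on h X \<and> (\<forall>x\<in>X. \<forall>t\<in>T. \<psi> t x = y t)"
  shows "M \<le> (\<Prod>s\<in>S. d s)"
proof -
  let ?N = "CARD('i)" and ?e = "\<Prod>s\<in>S. d s"
  have main: "M * ((X + ?N) choose ?N) \<le> ?e * ((X + M + ?N) choose ?N)" for X
  proof -
    let ?J = "exps T X \<times> {..<M}"
    define \<phi> where "\<phi> = (\<lambda>(a, i) x. (\<Prod>t\<in>T. \<psi> t x ^ a t) * h x ^ i)"
    define \<Phi> where "\<Phi> = (\<lambda>(b, j) x. (\<Prod>i\<in>S. f i x ^ b i) * \<phi> j x)"
    let ?w = "\<lambda>b. \<Sum>i\<in>S. b i * d i"
    \<comment> \<open>The powers of \<open>h\<close> are not charged against \<open>X\<close>; they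
      raise the degree by at most \<open>M\<close>, which becomes the shift in the final
      comparison.\<close>
    define I where "I = Sigma {b\<in>exps S X. ?w b \<le> X} (\<lambda>b. exps T (X - ?w b) \<times> {..<M})"
    have \<phi>1: "\<phi> (a, i) \<in> pdeg \<xi> (sum a T + i)" for a i
      unfolding \<phi>_def case_prod_conv
      using pdeg_mult[OF pdeg_powers[of T \<psi> \<xi> "\<lambda>_. 1" a] pdeg_power[OF h, of i]] \<psi> by simp
    have "indep_on A ?J \<phi>"
      unfolding \<phi>_def by (rule indep_sheets[OF T \<delta> sheets]) (simp_all add: finite_exps T exps_support)
    moreover have "continuous_on UNIV (\<phi> j)" for j
      using pdeg_continuous[OF \<phi>1 \<xi>] by (cases j) auto
    ultimately have "indep_on UNIV (exps S X \<times> ?J) \<Phi>"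
      unfolding \<Phi>_def
      by (intro indep_powers[OF S _ _ _ opn]) (simp_all add: finite_exps T S exps_support)
    then have "indep_on UNIV I \<Phi>"
    proof (rule indep_on_subset)
      show "I \<subseteq> exps S X \<times> ?J"
        using exps_mono[of "X - _" X T] by (auto simp: I_def)
      show "finite (exps S X \<times> ?J)" by (simp add: finite_exps S T)
    qed
    moreover have "\<Phi> y \<in> pdeg \<xi> (X + M)" if yI: "y \<in> I" for y
    proof -
      obtain b a i where y: "y = (b, (a, i))" by (cases y) auto
      have "\<Phi> y \<in> pdeg \<xi> (?w b + (sum a T + i))"
        unfolding \<Phi>_def y case_prod_conv by (rule pdeg_mult[OF pdeg_powers[OF f] \<phi>1])
      moreover have "?w b + (sum a T + i) \<le> X + M"
        using yI by (auto simp: y I_def exps_def)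
      ultimately show ?thesis by (rule pdeg_mono)
    qed
    moreover have "finite I" unfolding I_def by (intro finite_SigmaI) (auto simp: finite_exps S T)
    ultimately have "card I \<le> card (exps (UNIV :: 'i set) (X + M))"
      by (intro pdeg_indep_card_le)
    then have I: "card I \<le> ((X + M + ?N) choose ?N)" by (simp add: card_exps_UNIV)
    have cI: "card I = M * (\<Sum>b\<in>{b\<in>exps S X. ?w b \<le> X}. card (exps T (X - ?w b)))"
      unfolding I_def
      by (subst card_SigmaI) (auto simp: finite_exps S T card_cartesian_product sum_distrib_left mult.commute)
    have mono: "mono (\<lambda>k. card (exps T k))"
      using T by (intro monoI card_mono finite_exps exps_mono)
    have "((X + ?N) choose ?N) = card {(b, a). b \<in> exps S X \<and> a \<in> exps T (X - sum b S)}"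
      unfolding card[symmetric] by (rule card_exps_pairs[OF S T, symmetric])
    also have "{(b, a). b \<in> exps S X \<and> a \<in> exps T (X - sum b S)} = Sigma (exps S X) (\<lambda>b. exps T (X - sum b S))"
      by auto
    also have "card \<dots> = (\<Sum>b\<in>exps S X. card (exps T (X - sum b S)))"
      by (rule card_SigmaI) (auto simp: finite_exps S T)
    also have "\<dots> \<le> ?e * (\<Sum>b\<in>{b\<in>exps S X. ?w b \<le> X}. card (exps T (X - ?w b)))"
      by (rule sum_exps_weighted[OF S d mono])
    finally have "M * ((X + ?N) choose ?N) \<le> ?e * card I"
      unfolding cI mult.left_commute[of ?e M] by (rule mult_le_mono2)
    also have "\<dots> \<le> ?e * ((X + M + ?N) choose ?N)" using I by (rule mult_le_mono2)
    finally show ?thesis .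
  qed
  have "real M \<le> real ?e"
  proof (rule binomial_growth_cancel[where k = ?N and c = M])
    show "real M * real ((X + ?N) choose ?N) \<le> real ?e * real ((X + M + ?N) choose ?N)" for X
      unfolding of_nat_mult[symmetric] by (rule of_nat_mono[OF main])
  qed (simp_all only: of_nat_0_le_iff)
  then show ?thesis by linarith
qed

lemma indep_extend_spanning:
  assumes U: "finite U" and T0: "T0 \<subseteq> U" "indep_on A T0 \<phi>"
  shows "\<exists>T. T0 \<subseteq> T \<and> T \<subseteq> U \<and> indep_on A T \<phi> \<and>
    (\<forall>a\<in>U. \<exists>b. \<forall>x\<in>A. \<phi> a x = (\<Sum>t\<in>T. b t * \<phi> t x))"
proof -
  define Q where "Q T \<longleftrightarrow> T0 \<subseteq> T \<and> T \<subseteq> U \<and> indep_on A T \<phi>" for T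
  have "Q T0" using T0 by (simp add: Q_def)
  moreover have "\<forall>T. Q T \<longrightarrow> card T < Suc (card U)" using card_mono[OF U] by (auto simp: Q_def less_Suc_eq_le)
  ultimately obtain T where T: "Q T" and max: "\<And>T'. Q T' \<Longrightarrow> card T' \<le> card T"
    using ex_has_greatest_nat[of Q T0 card "Suc (card U)"] by blast
  have fT: "finite T" using T U finite_subset by (auto simp: Q_def)
  have "\<exists>b. \<forall>x\<in>A. \<phi> a x = (\<Sum>t\<in>T. b t * \<phi> t x)" if a: "a \<in> U" for a
  proof (cases "a \<in> T")
    case True
    then show ?thesis
      using fT by (intro exI[of _ "\<lambda>t. if t = a then 1 else 0"])
        (simp add: if_distrib[of "\<lambda>c. c * _"] cong: if_cong)
  next
    case False
    then have "\<not> Q (insert a T)" using max[of "insert a T"] fT by auto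
    then have "\<not> indep_on A (insert a T) \<phi>" using T a by (auto simp: Q_def)
    then obtain c where c: "\<And>x. x \<in> A \<Longrightarrow> (\<Sum>j\<in>insert a T. c j * \<phi> j x) = 0" "\<exists>j\<in>insert a T. c j \<noteq> 0"
      unfolding indep_on_def by blast
    have c1: "c a * \<phi> a x + (\<Sum>j\<in>T. c j * \<phi> j x) = 0" if "x \<in> A" for x
      using c(1)[OF that] False fT by simp
    have ca: "c a \<noteq> 0"
    proof
      assume "c a = 0"
      then have "\<forall>j\<in>T. c j = 0" using c1 T by (auto simp: Q_def indep_on_def)
      with \<open>c a = 0\<close> c(2) show False by auto
    qed
    have "\<phi> a x = (\<Sum>t\<in>T. (- c t / c a) * \<phi> t x)" if "x \<in> A" for x
    proof -
      have "(\<Sum>t\<in>T. (- c t / c a) * \<phi> t x) = - (\<Sum>j\<in>T. c j * \<phi> j x) / c a"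
        by (simp add: sum_negf sum_divide_distrib)
      also have "\<dots> = \<phi> a x" using c1[OF that] ca by (simp add: field_simps add_eq_0_iff2)
      finally show ?thesis by simp
    qed
    then show ?thesis by (intro exI[of _ "\<lambda>t. - c t / c a"]) blast
  qed
  then show ?thesis using T by (auto simp: Q_def intro!: exI[of _ T])
qed

text \<open>The cardinality of \<open>E k\<close> is the Hilbert function of \<open>Z\<close>. The
  bases are nested so that bases of different degrees lie in one independent family and can be
  combined with different powers of the equations.\<close>

lemma nested_monomial_bases:
  fixes \<xi> :: "'i::finite \<Rightarrow> 'x \<Rightarrow> complex"
  obtains E where "\<And>k. E k \<subseteq> exps UNIV k" "\<And>k. E k \<subseteq> E (Suc k)" "\<And>k. indep_on Z (E k) (pmon \<xi>)"
    "\<And>k f. f \<in> pdeg \<xi> k \<Longrightarrow> \<exists>b. \<forall>x\<in>Z. f x = (\<Sum>t\<in>E k. b t * pmon \<xi> t x)"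
proof -
  define P where "P k T \<longleftrightarrow> T \<subseteq> exps UNIV k \<and> indep_on Z T (pmon \<xi>) \<and>
    (\<forall>a\<in>exps UNIV k. \<exists>b. \<forall>x\<in>Z. pmon \<xi> a x = (\<Sum>t\<in>T. b t * pmon \<xi> t x))" for k T
  have "\<exists>T. P 0 T"
    using indep_extend_spanning[of "exps UNIV 0" "{}" Z "pmon \<xi>"] by (auto simp: P_def indep_on_def)
  moreover have "\<exists>T'. P (Suc k) T' \<and> T \<subseteq> T'" if "P k T" for k T
  proof -
    have "T \<subseteq> exps UNIV (Suc k)" "indep_on Z T (pmon \<xi>)"
      using that exps_mono[of k "Suc k" "UNIV :: 'i set"] by (auto simp: P_def)
    from indep_extend_spanning[OF finite_exps_UNIV this] show ?thesis
      unfolding P_def by metis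
  qed
  ultimately obtain E where E: "\<And>k. P k (E k)" "\<And>k. E k \<subseteq> E (Suc k)"
    using dependent_nat_choice[of P "\<lambda>_ T T'. T \<subseteq> T'"] by metis
  have "\<exists>b. \<forall>x\<in>Z. f x = (\<Sum>t\<in>E k. b t * pmon \<xi> t x)" if f: "f \<in> pdeg \<xi> k" for k f
  proof -
    obtain c where c: "\<And>x. f x = (\<Sum>a\<in>exps UNIV k. c a * pmon \<xi> a x)" using f by (auto simp: pdeg_def)
    obtain b where b: "\<And>a x. a \<in> exps UNIV k \<Longrightarrow> x \<in> Z \<Longrightarrow> pmon \<xi> a x = (\<Sum>t\<in>E k. b a t * pmon \<xi> t x)"
      using E(1)[of k] unfolding P_def by metis
    have "f x = (\<Sum>t\<in>E k. (\<Sum>a\<in>exps UNIV k. c a * b a t) * pmon \<xi> t x)" if "x \<in> Z" for x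
    proof -
      have "f x = (\<Sum>a\<in>exps UNIV k. \<Sum>t\<in>E k. c a * b a t * pmon \<xi> t x)"
        unfolding c using that by (intro sum.cong) (auto simp: b sum_distrib_left mult.assoc)
      then show ?thesis by (subst (asm) sum.swap) (simp add: sum_distrib_right)
    qed
    then show ?thesis
      by (intro exI[of _ "\<lambda>t. \<Sum>a\<in>exps UNIV k. c a * b a t"] ballI)
  qed
  moreover have "E k \<subseteq> exps UNIV k" "indep_on Z (E k) (pmon \<xi>)" for k
    using E(1)[of k] by (simp_all add: P_def)
  ultimately show thesis using that[of E] E(2) by metis
qed

text \<open>Let \<open>g\<close> be the Hilbert function of \<open>Z\<close>. Openness of the
  \<open>f s\<close> bounds sums of values of \<open>g\<close> by the product of the degrees times a
  number of monomials; the sheets on \<open>Z \<times> Z\<close> bound the square of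
  \<open>g\<close> from below by \<open>M\<close> times such a number. Comparing growth gives
  \<open>sqrt (M / (2n)!) * n!\<close> at most the product of the degrees, the square root of the
  claim.\<close>

theorem product_sheet_bound:
  fixes \<xi> :: "'i::finite \<Rightarrow> 'x::metric_space \<Rightarrow> complex" and f :: "'s \<Rightarrow> 'x \<Rightarrow> complex"
  assumes S: "finite S" and card: "card S = n" "CARD('i) = 2 * n"
    and \<xi>: "\<And>i. continuous_on UNIV (\<xi> i)"
    and f: "\<And>s. s \<in> S \<Longrightarrow> f s \<in> pdeg \<xi> (d s)" and d: "\<And>s. s \<in> S \<Longrightarrow> d s \<ge> 1"
    and h: "h \<in> pdeg \<xi> 1"
    and opn: "\<And>x \<epsilon>. x \<in> Z \<Longrightarrow> \<epsilon> > 0 \<Longrightarrow> \<exists>\<delta>>0. \<forall>s. (\<forall>i\<in>S. norm (s i) < \<delta>) \<longrightarrow> (\<exists>x'\<in>ball x \<epsilon>. \<forall>i\<in>S. f i x' = s i)"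
    and indep: "\<And>X. indep_on (Z \<times> Z) (exps UNIV X \<times> {..<M})
      (\<lambda>(a, i) (z, z'). (\<Prod>t\<in>UNIV. (\<xi> t z * cnj (\<xi> t z')) ^ a t) * h z ^ i)"
  shows "real M \<le> fact (2 * n) / (fact n)\<^sup>2 * (\<Prod>s\<in>S. (real (d s))\<^sup>2)"
proof -
  obtain E where E: "\<And>k. E k \<subseteq> exps (UNIV :: 'i set) k" "\<And>k. E k \<subseteq> E (Suc k)" "\<And>k. indep_on Z (E k) (pmon \<xi>)"
    "\<And>k f. f \<in> pdeg \<xi> k \<Longrightarrow> \<exists>b. \<forall>x\<in>Z. f x = (\<Sum>t\<in>E k. b t * pmon \<xi> t x)"
    using nested_monomial_bases[of Z \<xi>] by blast
  define g where "g k = card (E k)" for k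
  have fE: "finite (E k)" for k using E(1) finite_subset finite_exps_UNIV by metis
  have Emono: "k \<le> l \<Longrightarrow> E k \<subseteq> E l" for k l by (rule lift_Suc_mono_le[of E, OF E(2)])
  have gmono: "mono g" unfolding g_def by (intro monoI card_mono fE Emono)
  let ?e = "\<Prod>s\<in>S. d s"
  let ?w = "\<lambda>b. \<Sum>i\<in>S. b i * d i"
  \<comment> \<open>Products of powers of the \<open>f s\<close> with basis monomials of
    \<open>Z\<close> are independent. Passing from the degrees \<open>d s\<close> to unit weights
    costs the factor \<open>?e\<close>.\<close>
  have upper: "(\<Sum>\<beta>\<in>exps S X. g (X - sum \<beta> S)) \<le> ?e * ((X + 2 * n) choose (2 * n))" for X
  proof -
    define \<Phi> where "\<Phi> = (\<lambda>(b, j) x. (\<Prod>i\<in>S. f i x ^ b i) * pmon \<xi> j x)"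
    define I where "I = Sigma {b\<in>exps S X. ?w b \<le> X} (\<lambda>b. E (X - ?w b))"
    have mcont: "continuous_on UNIV (pmon \<xi> j)" for j
      unfolding pmon_def[abs_def] by (intro continuous_intros \<xi>)
    have "indep_on UNIV (exps S X \<times> E X) \<Phi>"
      unfolding \<Phi>_def
      by (intro indep_powers[OF S fE E(3) mcont opn]) (simp_all add: finite_exps S exps_support)
    then have "indep_on UNIV I \<Phi>"
    proof (rule indep_on_subset)
      show "I \<subseteq> exps S X \<times> E X"
        using Emono[of "X - _" X] by (auto simp: I_def)
      show "finite (exps S X \<times> E X)" by (simp add: finite_exps S fE)
    qed
    moreover have "\<Phi> y \<in> pdeg \<xi> X" if yI: "y \<in> I" for y
    proof -
      obtain b a where y: "y = (b, a)" by (cases y) auto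
      have a: "a \<in> exps UNIV (X - ?w b)" "?w b \<le> X" using yI E(1) by (auto simp: I_def y)
      have "\<Phi> y \<in> pdeg \<xi> (?w b + (X - ?w b))"
        unfolding \<Phi>_def y case_prod_conv
        by (rule pdeg_mult[OF pdeg_powers[OF f]]) (use pdeg_pmon[OF a(1)] in auto)
      then show ?thesis using a(2) by simp
    qed
    moreover have "finite I" unfolding I_def by (intro finite_SigmaI) (auto simp: finite_exps S fE)
    ultimately have "card I \<le> card (exps (UNIV :: 'i set) X)"
      by (intro pdeg_indep_card_le)
    then have I: "card I \<le> ((X + 2 * n) choose (2 * n))" by (simp add: card_exps_UNIV card)
    have cI: "card I = (\<Sum>b\<in>{b\<in>exps S X. ?w b \<le> X}. g (X - ?w b))"
      unfolding I_def g_def by (subst card_SigmaI) (auto simp: finite_exps S fE)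
    have "(\<Sum>\<beta>\<in>exps S X. g (X - sum \<beta> S)) \<le> ?e * card I"
      unfolding cI by (rule sum_exps_weighted[OF S d gmono])
    also have "\<dots> \<le> ?e * ((X + 2 * n) choose (2 * n))" using I by (rule mult_le_mono2)
    finally show ?thesis .
  qed
  \<comment> \<open>Both factors of a product function are expanded in the basis
    \<open>E (X + M)\<close>, the second one with conjugated coefficients, so
    \<open>g (X + M) * g (X + M)\<close> functions span.\<close>
  have lower: "M * ((X + 2 * n) choose (2 * n)) \<le> g (X + M) * g (X + M)" for X
  proof -
    let ?\<Psi> = "\<lambda>(e, e') (z, z'). pmon \<xi> e z * cnj (pmon \<xi> e' z')"
    let ?F = "\<lambda>(a, i) (z, z'). (\<Prod>t\<in>UNIV. (\<xi> t z * cnj (\<xi> t z')) ^ a t) * h z ^ i"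
    have "card (exps (UNIV :: 'i set) X \<times> {..<M}) \<le> card (E (X + M) \<times> E (X + M))"
    proof (rule indep_on_card_le[OF _ _ indep, where \<psi> = ?\<Psi>])
      fix j assume j: "j \<in> exps (UNIV :: 'i set) X \<times> {..<M}"
      obtain a i where ai: "j = (a, i)" "a \<in> exps UNIV X" "i < M" using j by (cases j) auto
      have "(\<lambda>z. pmon \<xi> a z * h z ^ i) \<in> pdeg \<xi> (X + M)"
        by (rule pdeg_mono[OF pdeg_mult[OF pdeg_pmon[OF ai(2)] pdeg_power[OF h, of i]]]) (use ai in auto)
      then obtain b where b: "\<And>z. z \<in> Z \<Longrightarrow> pmon \<xi> a z * h z ^ i = (\<Sum>t\<in>E (X + M). b t * pmon \<xi> t z)"
        using E(4) by blast
      have "pmon \<xi> a \<in> pdeg \<xi> (X + M)"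
        by (rule pdeg_mono[OF pdeg_pmon[OF ai(2)]]) auto
      then obtain b' where b': "\<And>z. z \<in> Z \<Longrightarrow> pmon \<xi> a z = (\<Sum>t\<in>E (X + M). b' t * pmon \<xi> t z)"
        using E(4) by blast
      have "?F j (z, z') = (\<Sum>k\<in>E (X + M) \<times> E (X + M). (b (fst k) * cnj (b' (snd k))) * ?\<Psi> k (z, z'))"
        if "z \<in> Z" "z' \<in> Z" for z z'
      proof -
        have "?F j (z, z') = (pmon \<xi> a z * h z ^ i) * cnj (pmon \<xi> a z')"
          by (simp add: ai(1) pmon_def power_mult_distrib prod.distrib)
        also have "\<dots> = (\<Sum>t\<in>E (X + M). b t * pmon \<xi> t z) * (\<Sum>t\<in>E (X + M). cnj (b' t) * cnj (pmon \<xi> t z'))"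
          unfolding b[OF that(1)] b'[OF that(2)] by simp
        also have "\<dots> = (\<Sum>k\<in>E (X + M) \<times> E (X + M). (b (fst k) * pmon \<xi> (fst k) z) * (cnj (b' (snd k)) * cnj (pmon \<xi> (snd k) z')))"
          by (simp add: sum_product sum.cartesian_product case_prod_unfold)
        finally show ?thesis by (simp add: case_prod_unfold mult_ac)
      qed
      then show "\<exists>b. \<forall>x\<in>Z \<times> Z. ?F j x = (\<Sum>k\<in>E (X + M) \<times> E (X + M). b k * ?\<Psi> k x)"
        by (intro exI[of _ "\<lambda>k. b (fst k) * cnj (b' (snd k))"]) auto
    qed (auto simp: fE)
    then show ?thesis by (simp add: card_cartesian_product card_exps_UNIV card g_def mult.commute)
  qed
  \<comment> \<open>The square root of the leading coefficient in \<open>lower\<close>.\<close>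
  define \<kappa> where "\<kappa> = sqrt (real M / fact (2 * n))"
  have \<kappa>: "\<kappa> \<ge> 0" by (simp add: \<kappa>_def)
  have g1: "\<kappa> * real X ^ n \<le> real (g (X + M))" for X
  proof -
    have "(\<kappa> * real X ^ n)\<^sup>2 = real M * (real X ^ (2 * n) / fact (2 * n))"
      by (simp add: \<kappa>_def power_mult_distrib power_mult[symmetric] mult.commute[of n])
    also have "\<dots> \<le> real M * real ((X + 2 * n) choose (2 * n))"
      by (intro mult_left_mono binomial_lower) auto
    also have "\<dots> \<le> real (g (X + M) * g (X + M))"
      unfolding of_nat_mult[symmetric] by (rule of_nat_mono[OF lower])
    finally have "(\<kappa> * real X ^ n)\<^sup>2 \<le> (real (g (X + M)))\<^sup>2" by (simp add: power2_eq_square)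
    then show ?thesis by (rule power2_le_imp_le) simp
  qed
  \<comment> \<open>The factor \<open>fact n\<close> turns \<open>X\<^sup>n\<close> into the number
    of monomials in \<open>n\<close> variables, so that summation over \<open>exps S X\<close>
    yields a count in \<open>2 * n\<close> variables again.\<close>
  have g2: "\<kappa> * fact n * real (card (exps S X)) \<le> real (g (X + n + M))" for X
  proof -
    have "real (card (exps S X)) \<le> real (X + n) ^ n / fact n"
      using binomial_upper[of X n] by (simp add: card_exps[OF S] card)
    then have "fact n * real (card (exps S X)) \<le> real (X + n) ^ n" by (simp add: field_simps)
    then have "\<kappa> * (fact n * real (card (exps S X))) \<le> \<kappa> * real (X + n) ^ n"
      using \<kappa> by (rule mult_left_mono)
    also have "\<dots> \<le> real (g (X + n + M))" by (rule g1)
    finally show ?thesis by (simp add: mult.assoc)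
  qed
  have "\<kappa> * fact n \<le> real ?e"
  proof (rule binomial_growth_cancel[where k = "2 * n" and c = "n + M"])
    fix X
    have "((X + 2 * n) choose (2 * n)) = card {(b, a). b \<in> exps S X \<and> a \<in> exps S (X - sum b S)}"
      unfolding card_exps_pairs[OF S S] card mult_2 ..
    also have "{(b, a). b \<in> exps S X \<and> a \<in> exps S (X - sum b S)} = Sigma (exps S X) (\<lambda>b. exps S (X - sum b S))"
      by auto
    also have "card \<dots> = (\<Sum>b\<in>exps S X. card (exps S (X - sum b S)))"
      by (rule card_SigmaI) (auto simp: finite_exps S)
    finally have "\<kappa> * fact n * real ((X + 2 * n) choose (2 * n))
        = (\<Sum>b\<in>exps S X. \<kappa> * fact n * real (card (exps S (X - sum b S))))"
      by (simp add: sum_distrib_left)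
    also have "\<dots> \<le> (\<Sum>b\<in>exps S X. real (g (X - sum b S + n + M)))"
      by (rule sum_mono, rule g2)
    also have "\<dots> = (\<Sum>b\<in>exps S X. real (g (X + n + M - sum b S)))"
      by (intro sum.cong refl arg_cong[of _ _ real] arg_cong[of _ _ g]) (auto simp: exps_def)
    also have "\<dots> \<le> (\<Sum>b\<in>exps S (X + n + M). real (g (X + n + M - sum b S)))"
      by (intro sum_mono2 finite_exps S exps_mono) auto
    also have "\<dots> = real (\<Sum>b\<in>exps S (X + n + M). g (X + n + M - sum b S))" by simp
    also have "\<dots> \<le> real (?e * ((X + n + M + 2 * n) choose (2 * n)))" by (rule of_nat_mono[OF upper])
    finally show "\<kappa> * fact n * real ((X + 2 * n) choose (2 * n)) \<le> real ?e * real ((X + (n + M) + 2 * n) choose (2 * n))"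
      by (simp add: add.assoc)
  qed (use \<kappa> in \<open>simp_all only: of_nat_0_le_iff mult_nonneg_nonneg fact_ge_zero\<close>)
  then have "(\<kappa> * fact n)\<^sup>2 \<le> (real ?e)\<^sup>2"
    using \<kappa> by (intro power_mono) auto
  then have "real M / fact (2 * n) * (fact n)\<^sup>2 \<le> (real ?e)\<^sup>2"
    by (simp add: \<kappa>_def power_mult_distrib)
  then have "real M \<le> fact (2 * n) / (fact n)\<^sup>2 * (real ?e)\<^sup>2"
    by (simp add: field_simps)
  also have "(real ?e)\<^sup>2 = (\<Prod>s\<in>S. (real (d s))\<^sup>2)"
    by (simp add: prod_power_distrib)
  finally show ?thesis .
qed

section \<open>Sard's theorem on slices\<close>

text \<open>The library's Sard theorem and change of variables need a well-ordered index type.\<close>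

typedef ('a::finite) fin = "{..<CARD('a)}" morphisms fin_nat nat_fin
  by (auto intro: exI[of _ 0])

instance fin :: (finite) finite
proof
  show "finite (UNIV :: 'a fin set)"
    by (rule finite_imageD[of fin_nat])
       (use fin_nat in \<open>auto intro: finite_subset[of _ "{..<CARD('a)}"] simp: inj_on_def fin_nat_inject\<close>)
qed

instantiation fin :: (finite) wellorder
begin

definition less_eq_fin :: "'a fin \<Rightarrow> 'a fin \<Rightarrow> bool" where "a \<le> b \<longleftrightarrow> fin_nat a \<le> fin_nat b"
definition less_fin :: "'a fin \<Rightarrow> 'a fin \<Rightarrow> bool" where "a < b \<longleftrightarrow> fin_nat a < fin_nat b"

instance
proof
  fix P :: "'a fin \<Rightarrow> bool" and a
  assume step: "\<And>x. (\<And>y. y < x \<Longrightarrow> P y) \<Longrightarrow> P x"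
  show "P a"
    by (induction a rule: measure_induct_rule[of fin_nat]) (rule step, simp add: less_fin_def)
qed (auto simp: less_eq_fin_def less_fin_def fin_nat_inject)

end

lemma card_fin [simp]: "CARD('a::finite fin) = CARD('a)"
  using type_definition.card[OF type_definition_fin] by simp

lemma ex_bij_fin: "\<exists>\<sigma> :: 'a::finite fin \<Rightarrow> 'a. bij \<sigma>"
  by (rule finite_same_card_bij) auto

definition fin_idx :: "'a::finite fin \<Rightarrow> 'a" where "fin_idx = (SOME \<sigma>. bij \<sigma>)"

lemma bij_fin_idx: "bij fin_idx"
  unfolding fin_idx_def by (rule someI_ex[OF ex_bij_fin])

definition reindex :: "real ^ 'a::finite \<Rightarrow> real ^ 'a fin" where "reindex x = (\<chi> k. x $ fin_idx k)"
definition unindex :: "real ^ 'a fin \<Rightarrow> real ^ 'a::finite" where "unindex y = (\<chi> i. y $ inv fin_idx i)"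

lemma unindex_reindex [simp]: "unindex (reindex x) = x"
  by (simp add: unindex_def reindex_def vec_eq_iff surj_f_inv_f[OF bij_is_surj[OF bij_fin_idx]])

lemma reindex_unindex [simp]: "reindex (unindex y) = y"
  by (simp add: unindex_def reindex_def vec_eq_iff inv_f_f[OF bij_is_inj[OF bij_fin_idx]])

lemma linear_reindex: "linear reindex" and linear_unindex: "linear unindex"
  by (auto intro!: linearI simp: reindex_def unindex_def vec_eq_iff)

text \<open>Conjugation with the reindexing transfers the statement to a well-ordered index type,
  where failure of injectivity of the derivative is deficiency of rank.\<close>

lemma sard_vec:
  fixes f :: "real ^ 'a::finite \<Rightarrow> real ^ 'a"
  assumes der: "\<And>x. x \<in> S \<Longrightarrow> (f has_derivative f' x) (at x within S)"
    and ninj: "\<And>x. x \<in> S \<Longrightarrow> \<not> inj (f' x)"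
  shows "negligible (f ` S)"
proof -
  let ?g = "\<lambda>y. reindex (f (unindex y))" and ?S = "reindex ` S"
  have "negligible (?g ` ?S)"
  proof (rule baby_Sard[where f' = "\<lambda>y h. reindex (f' (unindex y) (unindex h))"])
    fix y assume y: "y \<in> ?S"
    then have x: "unindex y \<in> S" "unindex ` ?S = S" by (auto simp: image_image)
    have 1: "(unindex has_derivative unindex) (at y within ?S)"
      by (rule linear_imp_has_derivative[OF linear_unindex])
    have "((\<lambda>y. f (unindex y)) has_derivative (\<lambda>h. f' (unindex y) (unindex h))) (at y within ?S)"
      using diff_chain_within[OF 1, of f "f' (unindex y)"] der[OF x(1)] x(2) by (simp add: o_def)
    then show d: "(?g has_derivative (\<lambda>h. reindex (f' (unindex y) (unindex h)))) (at y within ?S)"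
      using bounded_linear.has_derivative[OF linear_reindex[unfolded linear_conv_bounded_linear]] by blast
    let ?h = "\<lambda>h. reindex (f' (unindex y) (unindex h))"
    have lin: "linear ?h" using has_derivative_linear[OF d] .
    show "rank (matrix ?h) < CARD('a fin)"
    proof (rule ccontr)
      assume "\<not> ?thesis"
      then have "rank (matrix ?h) = CARD('a fin)"
        using rank_bound[of "matrix ?h"] by simp
      then have "inj ((*v) (matrix ?h))" using full_rank_injective by metis
      moreover have "(*v) (matrix ?h) = ?h"
        using lin by (simp add: fun_eq_iff matrix_works)
      ultimately have "inj ?h" by simp
      have "inj (f' (unindex y))"
      proof (rule injI)
        fix a b assume "f' (unindex y) a = f' (unindex y) b"
        then have "?h (reindex a) = ?h (reindex b)" by simp
        then have "reindex a = reindex b" using \<open>inj ?h\<close> by (rule injD[rotated])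
        then show "a = b" by (metis unindex_reindex)
      qed
      with ninj[OF x(1)] show False by simp
    qed
  qed simp
  then have "negligible (unindex ` ?g ` ?S)"
    by (rule negligible_differentiable_image_negligible[rotated])
       (auto intro: linear_imp_differentiable_on linear_unindex)
  also have "unindex ` ?g ` ?S = f ` S" by (simp add: image_image)
  finally show ?thesis .
qed

lemma derivative_inj_isolated:
  fixes f :: "'a::euclidean_space \<Rightarrow> 'b::euclidean_space"
  assumes "(f has_derivative f') (at a)" "inj f'"
  obtains \<epsilon> where "\<epsilon> > 0" "\<And>x. x \<in> ball a \<epsilon> \<Longrightarrow> f x = f a \<Longrightarrow> x = a"
proof -
  have lin: "linear f'" using has_derivative_linear[OF assms(1)] .
  obtain B where B: "B > 0" "\<And>h. B * norm h \<le> norm (f' h)"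
    using linear_inj_bounded_below_pos[OF lin assms(2)] by metis
  obtain d where d: "d > 0" "\<And>y. norm (y - a) < d \<Longrightarrow> norm (f y - f a - f' (y - a)) \<le> B / 2 * norm (y - a)"
    using assms(1) B(1) unfolding has_derivative_at_alt by (metis half_gt_zero)
  show thesis
  proof (rule that[OF d(1)])
    fix x assume x: "x \<in> ball a d" "f x = f a"
    have "B * norm (x - a) \<le> norm (f' (x - a))" by (rule B(2))
    also have "\<dots> \<le> B / 2 * norm (x - a)"
      using d(2)[of x] x by (simp add: dist_norm norm_minus_commute)
    finally have "B * norm (x - a) \<le> 0" by simp
    then show "x = a" using B(1) by (simp add: mult_le_0_iff)
  qed
qed

lemma countable_isolated_points:
  fixes S :: "'a::second_countable_topology set"
  assumes "\<And>x. x \<in> S \<Longrightarrow> \<exists>U. open U \<and> x \<in> U \<and> S \<inter> U = {x}"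
  shows "countable S"
proof -
  define F where "F = {U. open U \<and> (\<exists>x. S \<inter> U = {x})}"
  obtain F' where F': "F' \<subseteq> F" "countable F'" "\<Union>F' = \<Union>F"
    using Lindelof[of F] by (auto simp: F_def)
  have "S \<subseteq> (\<Union>U\<in>F'. S \<inter> U)"
  proof
    fix x assume x: "x \<in> S"
    then have "x \<in> \<Union>F" using assms[OF x] by (auto simp: F_def)
    then show "x \<in> (\<Union>U\<in>F'. S \<inter> U)" using x F'(3) by auto
  qed
  moreover have "countable (\<Union>U\<in>F'. S \<inter> U)"
    using F'(1,2) by (intro countable_UN) (auto simp: F_def)
  ultimately show ?thesis by (rule countable_subset)
qed

text \<open>The quotient of determinants makes visible that the inverse depends continuously on the
  matrix, as the derivative of a slice parametrisation must.\<close>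

lemma cmatrix_inv_cramer:
  fixes A :: "complex ^ 'a::finite ^ 'a"
  assumes "det A \<noteq> 0"
  shows "matrix_inv A *v b = (\<chi> k. det (\<chi> i j. if j = k then b $ i else A $ i $ j) / det A)"
proof -
  have "A *v (matrix_inv A *v b) = b"
    by (simp add: matrix_vector_mul_assoc cmatrix_inv_right[OF assms])
  then show ?thesis using cramer[OF assms] by blast
qed

definition tang :: "'a::finite set \<Rightarrow> ('a \<Rightarrow> (complex ^ 'a \<Rightarrow> complex)) \<Rightarrow> complex ^ 'a \<Rightarrow> (complex ^ 'a) set" where
  "tang I G x = {u. \<forall>i\<in>I. (jac G x *v u) $ i = 0}"

text \<open>The source is \<open>real ^ 'a\<close> in every codimension, so that Sard's theorem
  applies between spaces of equal dimension. The subspace has real dimension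
  \<open>2 * (2n - card I)\<close>, which is \<open>2n\<close> exactly when
  \<open>card I = n\<close>; otherwise \<open>Q\<close> has a kernel.\<close>

lemma real_coordinates:
  fixes I :: "'a::finite set"
  assumes "CARD('a) = 2 * n" "n \<le> card I"
  obtains Q :: "real ^ 'a \<Rightarrow> complex ^ 'a" where "linear Q" "range Q = {v. \<forall>i\<in>I. v $ i = 0}"
    "card I = n \<Longrightarrow> inj Q" "card I \<noteq> n \<Longrightarrow> \<exists>h. h \<noteq> 0 \<and> Q h = 0"
proof -
  have card: "card (- I) = 2 * n - card I" using assms by (simp add: Compl_eq_Diff_UNIV card_Diff_subset)
  then have "card ((- I) \<times> (UNIV :: bool set)) \<le> card (UNIV :: 'a set)"
    using assms by (simp add: card_cartesian_product)
  \<comment> \<open>\<open>\<iota> (j, b)\<close> is the real coordinate holding the real part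
    (\<open>b = True\<close>) or the imaginary part of the complex coordinate
    \<open>j\<close>.\<close>
  then obtain \<iota> where \<iota>: "inj_on \<iota> ((- I) \<times> (UNIV :: bool set))" "\<iota> ` ((- I) \<times> UNIV) \<subseteq> (UNIV :: 'a set)"
    using card_le_inj[of "(- I) \<times> (UNIV :: bool set)" "UNIV :: 'a set"] by auto
  define Q :: "real ^ 'a \<Rightarrow> complex ^ 'a" where
    "Q r = (\<chi> j. if j \<in> I then 0 else Complex (r $ \<iota> (j, True)) (r $ \<iota> (j, False)))" for r
  have "linear Q"
    by (rule linearI) (auto simp: Q_def vec_eq_iff complex_eq_iff)
  moreover have "range Q = {v. \<forall>i\<in>I. v $ i = 0}"
  proof (intro equalityI subsetI)
    fix v :: "complex ^ 'a" assume v: "v \<in> {v. \<forall>i\<in>I. v $ i = 0}"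
    define r :: "real ^ 'a" where
      "r = (\<chi> k. let p = inv_into ((- I) \<times> UNIV) \<iota> k in if snd p then Re (v $ fst p) else Im (v $ fst p))"
    have "Q r = v"
      using v by (auto simp: Q_def r_def vec_eq_iff complex_eq_iff inv_into_f_f[OF \<iota>(1)] Let_def)
    then show "v \<in> range Q" by blast
  qed (auto simp: Q_def)
  moreover have "inj Q" if "card I = n"
  proof (rule injI)
    have "card (\<iota> ` ((- I) \<times> (UNIV :: bool set))) = CARD('a)"
      using card that assms by (simp add: card_image[OF \<iota>(1)] card_cartesian_product)
    then have surj: "\<iota> ` ((- I) \<times> UNIV) = UNIV" by (intro card_eq_UNIV_imp_eq_UNIV) auto
    fix r s assume rs: "Q r = Q s"
    show "r = s"
    proof (subst vec_eq_iff, rule allI)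
      fix k
      obtain j b where jb: "j \<notin> I" "k = \<iota> (j, b)" proof -
        have "k \<in> \<iota> ` ((- I) \<times> (UNIV :: bool set))" unfolding surj by simp
        then show thesis using that by blast
      qed
      have "Q r $ j = Q s $ j" using rs by simp
      then show "r $ k = s $ k" using jb by (cases b) (auto simp: Q_def)
    qed
  qed
  moreover have "\<exists>h. h \<noteq> 0 \<and> Q h = 0" if "card I \<noteq> n"
  proof -
    have "n > 0" using assms(1) zero_less_card_finite[where 'a = 'a] by simp
    then have "2 * n - card I < n" using that assms(2) by linarith
    then have "card (\<iota> ` ((- I) \<times> (UNIV :: bool set))) < CARD('a)"
      using card that assms by (simp add: card_image[OF \<iota>(1)] card_cartesian_product)
    then obtain k where "k \<notin> \<iota> ` ((- I) \<times> (UNIV :: bool set))" by (metis UNIV_eq_I less_irrefl)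
    then have "Q (axis k 1) = 0" by (auto simp: Q_def axis_def vec_eq_iff complex_eq_iff)
    then show ?thesis by (intro exI[of _ "axis k 1"]) (simp add: axis_eq_0_iff)
  qed
  ultimately show thesis using that by blast
qed

text \<open>The local inverse of \<open>evalv G\<close> is composed with the real coordinates
  \<open>Q\<close>. For \<open>card I = n\<close> the left inverse \<open>\<kappa>i\<close> is
  continuous on the whole space, so that neighbourhoods of a parameter pull back to neighbourhoods
  of the point.\<close>

lemma slice_param:
  fixes G :: "'a::finite \<Rightarrow> (complex ^ 'a \<Rightarrow> complex)"
  assumes card: "CARD('a) = 2 * n" "n \<le> card I" and G: "\<And>i. G i \<in> pfun UNIV" and x: "x \<in> slice I G"
  obtains \<kappa> :: "real ^ 'a \<Rightarrow> complex ^ 'a" and \<kappa>' D U \<kappa>i where "open D" "open U" "x \<in> U" "\<kappa> ` D = slice I G \<inter> U"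
    "\<And>r. r \<in> D \<Longrightarrow> (\<kappa> has_derivative \<kappa>' r) (at r)"
    "\<And>r. r \<in> D \<Longrightarrow> range (\<kappa>' r) = tang I G (\<kappa> r)"
    "\<And>r. card I = n \<Longrightarrow> r \<in> D \<Longrightarrow> inj (\<kappa>' r)"
    "\<And>r. card I \<noteq> n \<Longrightarrow> \<exists>h. h \<noteq> 0 \<and> \<kappa>' r h = 0"
    "\<And>h. continuous_on D (\<lambda>r. \<kappa>' r h)"
    "continuous_on UNIV \<kappa>i" "\<And>r. card I = n \<Longrightarrow> r \<in> D \<Longrightarrow> \<kappa>i (\<kappa> r) = r"
proof -
  have nz: "det (jac G x) \<noteq> 0" and Gx: "\<And>i. i \<in> I \<Longrightarrow> G i x = 0" using x by (auto simp: slice_def)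
  obtain U V g where L: "open U" "x \<in> U" "open V" "evalv G x \<in> V" "homeomorphism U V (evalv G) g"
    "\<And>y. y \<in> V \<Longrightarrow> det (jac G (g y)) \<noteq> 0"
    "\<And>y. y \<in> V \<Longrightarrow> (g has_derivative (\<lambda>h. matrix_inv (jac G (g y)) *v h)) (at y)"
    using local_inverse[of G UNIV, OF G nz] by blast
  obtain Q :: "real ^ 'a \<Rightarrow> complex ^ 'a" where Q: "linear Q" "range Q = {v. \<forall>i\<in>I. v $ i = 0}"
    "card I = n \<Longrightarrow> inj Q" "card I \<noteq> n \<Longrightarrow> \<exists>h. h \<noteq> 0 \<and> Q h = 0"
    using real_coordinates[OF card] by blast
  obtain L where L': "linear L" "card I = n \<Longrightarrow> L \<circ> Q = id"
  proof (cases "card I = n")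
    case True
    then show thesis using linear_injective_left_inverse[OF Q(1) Q(3)] that by metis
  next
    case False
    then show thesis using that[of "\<lambda>_. 0"] linear_0 by (auto simp: linear_iff)
  qed
  define \<kappa> where "\<kappa> r = g (Q r)" for r
  define \<kappa>' where "\<kappa>' r h = matrix_inv (jac G (\<kappa> r)) *v Q h" for r h
  define D where "D = Q -` V"
  have contQ: "continuous_on S Q" for S
    using Q(1) linear_continuous_on linear_conv_bounded_linear by blast
  show thesis
  proof (rule that)
    show "open D" unfolding D_def using L(3) contQ by (intro open_vimage)
    show "\<kappa> ` D = slice I G \<inter> U"
    proof (intro equalityI subsetI)
      fix z assume "z \<in> \<kappa> ` D"
      then obtain r where r: "Q r \<in> V" "z = g (Q r)" by (auto simp: D_def \<kappa>_def)
      have e: "evalv G z = Q r" using L(5) r by (simp add: homeomorphism_def)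
      have "G i z = 0" if "i \<in> I" for i
      proof -
        have "Q r \<in> {v. \<forall>i\<in>I. v $ i = 0}" using Q(2) by blast
        then show ?thesis using that e by (metis (mono_tags, lifting) evalv_nth mem_Collect_eq)
      qed
      moreover have "z \<in> U" using L(5) r by (auto simp: homeomorphism_def)
      ultimately show "z \<in> slice I G \<inter> U" using L(6)[OF r(1)] r(2) by (simp add: slice_def)
    next
      fix z assume z: "z \<in> slice I G \<inter> U"
      then have "evalv G z \<in> range Q" unfolding Q(2) by (simp add: slice_def)
      then obtain r where r: "evalv G z = Q r" by blast
      moreover have "g (evalv G z) = z" "evalv G z \<in> V" using L(5) z by (auto simp: homeomorphism_def)
      ultimately have "z = \<kappa> r" "r \<in> D" by (simp_all add: \<kappa>_def D_def)
      then show "z \<in> \<kappa> ` D" by blast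
    qed
    show "(\<kappa> has_derivative \<kappa>' r) (at r)" if "r \<in> D" for r
    proof -
      have "(Q has_derivative Q) (at r)" by (rule linear_imp_has_derivative[OF Q(1)])
      from diff_chain_at[OF this, of g] show ?thesis
        using L(7)[of "Q r"] that by (simp add: D_def \<kappa>_def[abs_def] \<kappa>'_def[abs_def] o_def)
    qed
    show "range (\<kappa>' r) = tang I G (\<kappa> r)" if r: "r \<in> D" for r
    proof -
      have nz': "det (jac G (\<kappa> r)) \<noteq> 0" using L(6) r by (simp add: D_def \<kappa>_def)
      show ?thesis
      proof (intro equalityI subsetI)
        fix u assume "u \<in> range (\<kappa>' r)"
        then obtain h where h: "u = \<kappa>' r h" by blast
        have "Q h \<in> {v. \<forall>i\<in>I. v $ i = 0}" using Q(2) by blast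
        moreover have "jac G (\<kappa> r) *v u = Q h"
          by (simp add: h \<kappa>'_def matrix_vector_mul_assoc cmatrix_inv_right[OF nz'])
        ultimately show "u \<in> tang I G (\<kappa> r)" by (simp add: tang_def)
      next
        fix u assume "u \<in> tang I G (\<kappa> r)"
        then have "jac G (\<kappa> r) *v u \<in> range Q" unfolding Q(2) by (simp add: tang_def)
        then obtain h where "jac G (\<kappa> r) *v u = Q h" by blast
        then have "u = \<kappa>' r h"
          by (metis \<kappa>'_def cmatrix_inv_left[OF nz'] matrix_vector_mul_assoc matrix_vector_mul_lid)
        then show "u \<in> range (\<kappa>' r)" by blast
      qed
    qed
    show "inj (\<kappa>' r)" if "card I = n" "r \<in> D" for r
    proof (rule injI)
      have nz': "det (jac G (\<kappa> r)) \<noteq> 0" using L(6) that(2) by (simp add: D_def \<kappa>_def)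
      fix h k assume "\<kappa>' r h = \<kappa>' r k"
      then have "jac G (\<kappa> r) *v \<kappa>' r h = jac G (\<kappa> r) *v \<kappa>' r k" by simp
      then have "Q h = Q k" by (simp add: \<kappa>'_def matrix_vector_mul_assoc cmatrix_inv_right[OF nz'])
      then show "h = k" using Q(3)[OF that(1)] by (simp add: inj_def)
    qed
    show "\<exists>h. h \<noteq> 0 \<and> \<kappa>' r h = 0" if "card I \<noteq> n" for r
      using Q(4)[OF that] by (auto simp: \<kappa>'_def)
    show "continuous_on D (\<lambda>r. \<kappa>' r h)" for h
    proof -
      have "continuous_on V g" using L(5) by (simp add: homeomorphism_def)
      then have cg: "continuous_on D \<kappa>"
        unfolding \<kappa>_def by (rule continuous_on_compose2[OF _ contQ]) (auto simp: D_def)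
      have cj: "continuous_on D (\<lambda>r. pd j (G i) (\<kappa> r))" for i j
        by (rule continuous_on_compose2[OF pf_continuous[OF pf_pd[OF G]] cg]) auto
      have "continuous_on D (\<lambda>r. \<chi> k. det (\<chi> i j. if j = k then Q h $ i else jac G (\<kappa> r) $ i $ j) / det (jac G (\<kappa> r)))"
      proof (intro continuous_on_vec_lambda continuous_on_divide)
        show "\<forall>r\<in>D. det (jac G (\<kappa> r)) \<noteq> 0" using L(6) by (simp add: D_def \<kappa>_def)
        show "continuous_on D (\<lambda>r. det (jac G (\<kappa> r)))"
          unfolding det_def jac_def by (auto intro!: continuous_intros cj)
        show "continuous_on D (\<lambda>r. det (\<chi> i j. if j = k then Q h $ i else jac G (\<kappa> r) $ i $ j))" for k
        proof -
          have "continuous_on D (\<lambda>r. if j = k then Q h $ i else jac G (\<kappa> r) $ i $ j)" for i j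
            by (cases "j = k") (auto simp: jac_def intro: cj)
          then show ?thesis unfolding det_def by (auto intro!: continuous_intros)
        qed
      qed
      then show ?thesis
      proof (rule continuous_on_eq)
        fix r assume "r \<in> D"
        then have "det (jac G (\<kappa> r)) \<noteq> 0" using L(6) by (simp add: D_def \<kappa>_def)
        from cmatrix_inv_cramer[OF this, of "Q h"]
        show "(\<chi> k. det (\<chi> i j. if j = k then Q h $ i else jac G (\<kappa> r) $ i $ j) / det (jac G (\<kappa> r))) = \<kappa>' r h"
          by (simp add: \<kappa>'_def)
      qed
    qed
    show "continuous_on UNIV (\<lambda>z. L (evalv G z))"
      by (rule continuous_on_compose2[OF _ evalv_continuous[OF G]])
         (use L'(1) linear_continuous_on linear_conv_bounded_linear in auto)
    show "L (evalv G (\<kappa> r)) = r" if "card I = n" "r \<in> D" for r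
    proof -
      have "evalv G (\<kappa> r) = Q r" using L(5) that(2) by (simp add: \<kappa>_def D_def homeomorphism_def)
      then show ?thesis using L'(2)[OF that(1)] by (simp add: fun_eq_iff)
    qed
  qed (use L in auto)
qed

text \<open>In the parameters the derivative is nowhere injective on \<open>S\<close>: for
  \<open>card I = n\<close> because of the critical vector, in larger codimension because the
  parametrisation itself has a kernel.\<close>

lemma slice_sard:
  fixes G :: "'a::finite \<Rightarrow> (complex ^ 'a \<Rightarrow> complex)" and f :: "complex ^ 'a \<Rightarrow> real ^ 'a"
  assumes card: "CARD('a) = 2 * n" "n \<le> card I" and G: "\<And>i. G i \<in> pfun UNIV" and S: "S \<subseteq> slice I G"
    and der: "\<And>x. x \<in> S \<Longrightarrow> (f has_derivative f' x) (at x)"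
    and crit: "\<And>x. x \<in> S \<Longrightarrow> card I \<noteq> n \<or> (\<exists>u\<in>tang I G x. u \<noteq> 0 \<and> f' x u = 0)"
  shows "negligible (f ` S)"
proof (rule negligible_image_locally)
  fix x assume x: "x \<in> S"
  obtain \<kappa> :: "real ^ 'a \<Rightarrow> complex ^ 'a" and \<kappa>' D U and \<kappa>i :: "complex ^ 'a \<Rightarrow> real ^ 'a" where K: "open D" "open U" "x \<in> U" "\<kappa> ` D = slice I G \<inter> U"
    "\<And>r. r \<in> D \<Longrightarrow> (\<kappa> has_derivative \<kappa>' r) (at r)"
    "\<And>r. r \<in> D \<Longrightarrow> range (\<kappa>' r) = tang I G (\<kappa> r)"
    "\<And>r. card I = n \<Longrightarrow> r \<in> D \<Longrightarrow> inj (\<kappa>' r)"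
    "\<And>r. card I \<noteq> n \<Longrightarrow> \<exists>h. h \<noteq> 0 \<and> \<kappa>' r h = 0"
    "\<And>h. continuous_on D (\<lambda>r. \<kappa>' r h)"
    "continuous_on UNIV \<kappa>i" "\<And>r. card I = n \<Longrightarrow> r \<in> D \<Longrightarrow> \<kappa>i (\<kappa> r) = r"
    by (rule slice_param[OF card G subsetD[OF S x]]) (rule that; assumption)
  let ?R = "{r \<in> D. \<kappa> r \<in> S}"
  have "negligible ((\<lambda>r. f (\<kappa> r)) ` ?R)"
  proof (rule sard_vec[where f' = "\<lambda>r h. f' (\<kappa> r) (\<kappa>' r h)"])
    fix r assume r: "r \<in> ?R"
    have "((\<lambda>r. f (\<kappa> r)) has_derivative (\<lambda>h. f' (\<kappa> r) (\<kappa>' r h))) (at r)"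
      using diff_chain_at[OF K(5) der] r by (simp add: o_def)
    then show "((\<lambda>r. f (\<kappa> r)) has_derivative (\<lambda>h. f' (\<kappa> r) (\<kappa>' r h))) (at r within ?R)"
      by (rule has_derivative_at_withinI)
    show "\<not> inj (\<lambda>h. f' (\<kappa> r) (\<kappa>' r h))"
    proof
      assume inj: "inj (\<lambda>h. f' (\<kappa> r) (\<kappa>' r h))"
      have lin1: "linear (\<kappa>' r)" and lin2: "linear (f' (\<kappa> r))"
        using K(5) der r has_derivative_linear by blast+
      show False
      proof (cases "card I = n")
        case True
        then obtain u where u: "u \<in> tang I G (\<kappa> r)" "u \<noteq> 0" "f' (\<kappa> r) u = 0" using crit[of "\<kappa> r"] r by auto
        then obtain h where h: "u = \<kappa>' r h" using K(6)[of r] r by blast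
        have "f' (\<kappa> r) (\<kappa>' r h) = f' (\<kappa> r) (\<kappa>' r 0)"
          using u h by (simp add: linear_0[OF lin1] linear_0[OF lin2])
        then have "h = 0" by (rule injD[OF inj])
        then show False using u(2) h by (simp add: linear_0[OF lin1])
      next
        case False
        then obtain h where h: "h \<noteq> 0" "\<kappa>' r h = 0" using K(8) by blast
        then have "f' (\<kappa> r) (\<kappa>' r h) = f' (\<kappa> r) (\<kappa>' r 0)" by (simp add: linear_0[OF lin1])
        then have "h = 0" by (rule injD[OF inj])
        with h(1) show False by simp
      qed
    qed
  qed
  moreover have "f ` (S \<inter> U) \<subseteq> (\<lambda>r. f (\<kappa> r)) ` ?R"
  proof
    fix y assume "y \<in> f ` (S \<inter> U)"
    then obtain z where z: "z \<in> S" "z \<in> U" "y = f z" by auto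
    then obtain r where "r \<in> D" "z = \<kappa> r" using K(4) S by blast
    then show "y \<in> (\<lambda>r. f (\<kappa> r)) ` ?R" using z by auto
  qed
  ultimately show "\<exists>U. open U \<and> x \<in> U \<and> negligible (f ` (S \<inter> U))"
    using K(2,3) negligible_subset by blast
qed

lemma slice_fibre_countable:
  fixes G :: "'a::finite \<Rightarrow> (complex ^ 'a \<Rightarrow> complex)" and f :: "complex ^ 'a \<Rightarrow> real ^ 'a"
  assumes card: "CARD('a) = 2 * n" "n = card I" and G: "\<And>i. G i \<in> pfun UNIV" and S: "S \<subseteq> slice I G"
    and der: "\<And>x. x \<in> S \<Longrightarrow> (f has_derivative f' x) (at x)"
    and reg: "\<And>x u. x \<in> S \<Longrightarrow> u \<in> tang I G x \<Longrightarrow> f' x u = 0 \<Longrightarrow> u = 0"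
    and c: "\<And>x. x \<in> S \<Longrightarrow> f x = c"
  shows "countable S"
proof (rule countable_isolated_points)
  fix x assume x: "x \<in> S"
  have card': "n \<le> card I" using card by simp
  obtain \<kappa> :: "real ^ 'a \<Rightarrow> complex ^ 'a" and \<kappa>' D U and \<kappa>i :: "complex ^ 'a \<Rightarrow> real ^ 'a" where K: "open D" "open U" "x \<in> U" "\<kappa> ` D = slice I G \<inter> U"
    "\<And>r. r \<in> D \<Longrightarrow> (\<kappa> has_derivative \<kappa>' r) (at r)"
    "\<And>r. r \<in> D \<Longrightarrow> range (\<kappa>' r) = tang I G (\<kappa> r)"
    "\<And>r. card I = n \<Longrightarrow> r \<in> D \<Longrightarrow> inj (\<kappa>' r)"
    "\<And>r. card I \<noteq> n \<Longrightarrow> \<exists>h. h \<noteq> 0 \<and> \<kappa>' r h = 0"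
    "\<And>h. continuous_on D (\<lambda>r. \<kappa>' r h)"
    "continuous_on UNIV \<kappa>i" "\<And>r. card I = n \<Longrightarrow> r \<in> D \<Longrightarrow> \<kappa>i (\<kappa> r) = r"
    by (rule slice_param[OF card(1) card' G subsetD[OF S x]]) (rule that; assumption)
  obtain r0 where r0: "r0 \<in> D" "x = \<kappa> r0" using K(3,4) x S by blast
  have der0: "((\<lambda>r. f (\<kappa> r)) has_derivative (\<lambda>h. f' x (\<kappa>' r0 h))) (at r0)"
    using diff_chain_at[OF K(5)[OF r0(1)], of f "f' x"] der[OF x] r0(2) by (simp add: o_def)
  have lin1: "linear (\<kappa>' r0)" and lin2: "linear (\<lambda>h. f' x (\<kappa>' r0 h))"
    using K(5)[OF r0(1)] der0 has_derivative_linear by blast+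
  have "inj (\<lambda>h. f' x (\<kappa>' r0 h))"
  proof (subst linear_injective_0[OF lin2], intro allI impI)
    fix h assume "f' x (\<kappa>' r0 h) = 0"
    then have "\<kappa>' r0 h = 0" using reg[OF x] K(6)[OF r0(1)] r0(2) by blast
    then show "h = 0" using K(7)[OF card(2)[symmetric] r0(1)] lin1 by (metis linear_injective_0)
  qed
  then obtain \<epsilon> where \<epsilon>: "\<epsilon> > 0" "\<And>r. r \<in> ball r0 \<epsilon> \<Longrightarrow> f (\<kappa> r) = f (\<kappa> r0) \<Longrightarrow> r = r0"
    using derivative_inj_isolated[OF der0] by metis
  define U' where "U' = U \<inter> \<kappa>i -` ball r0 \<epsilon>"
  have "open U'" unfolding U'_def using K(2,10) by (intro open_Int open_vimage) auto
  moreover have "x \<in> U'" using K(3) r0 \<epsilon>(1) K(11)[OF card(2)[symmetric]] by (simp add: U'_def)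
  moreover have "z = x" if z: "z \<in> S" "z \<in> U'" for z
  proof -
    obtain r where r: "r \<in> D" "z = \<kappa> r" using K(4) z S by (auto simp: U'_def)
    have "r \<in> ball r0 \<epsilon>" using z(2) K(11)[OF card(2)[symmetric] r(1)] r(2) by (simp add: U'_def)
    moreover have "f (\<kappa> r) = f (\<kappa> r0)" using c z(1) x r r0 by simp
    ultimately have "r = r0" by (rule \<epsilon>(2))
    then show ?thesis using r r0 by simp
  qed
  ultimately show "\<exists>U. open U \<and> x \<in> U \<and> S \<inter> U = {x}" using x by blast
qed

section \<open>Varieties of middle dimension in the torus\<close>

lemma open_ctorus: "open (ctorus :: (complex ^ 'm::finite) set)"
proof -
  have "ctorus = (\<Inter>i. {z :: complex ^ 'm. z $ i \<noteq> 0})" by (auto simp: ctorus_def)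
  moreover have "open (\<Inter>i. {z :: complex ^ 'm. z $ i \<noteq> 0})"
    by (intro open_INT ballI open_Collect_neq continuous_intros) simp
  ultimately show ?thesis by simp
qed

lemma pdeg_pfun:
  assumes "f \<in> pdeg (\<lambda>i z. z $ i) D"
  shows "f \<in> pfun UNIV"
proof -
  obtain c where "\<And>x. f x = (\<Sum>a\<in>exps UNIV D. c a * pmon (\<lambda>i z. z $ i) a x)" using assms by (auto simp: pdeg_def)
  then have "f = (\<lambda>x. \<Sum>a\<in>exps UNIV D. c a * (\<Prod>i\<in>UNIV. (x $ i) ^ a i))" by (simp add: fun_eq_iff pmon_def)
  then show ?thesis by (auto intro!: pf_sum pf_mult pf_const pf_prod pf_power pf_coord)
qed

lemma norm_vec_le_bound:
  fixes v :: "complex ^ 'm::finite"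
  assumes "\<And>i. norm (v $ i) \<le> B"
  shows "norm v \<le> real CARD('m) * B"
proof -
  have "norm v \<le> (\<Sum>i\<in>UNIV. norm (v $ i))"
    unfolding norm_vec_def by (rule L2_set_le_sum) simp
  also have "\<dots> \<le> (\<Sum>i\<in>(UNIV :: 'm set). B)" by (intro sum_mono assms)
  finally show ?thesis by simp
qed

text \<open>\<open>codim\<close> is the form in which the dimension of the complete intersection
  enters: near a point of the torus, no slice of codimension below \<open>n\<close> lies in the zero
  set.\<close>

locale torus_variety =
  fixes n :: nat and f :: "nat \<Rightarrow> complex ^ 'm::finite \<Rightarrow> complex" and d :: "nat \<Rightarrow> nat"
  assumes card: "CARD('m) = 2 * n"
    and fdeg: "\<And>j. j \<in> {1..n} \<Longrightarrow> f j \<in> pdeg (\<lambda>i z. z $ i) (d j)"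
    and dpos: "\<And>j. j \<in> {1..n} \<Longrightarrow> d j \<ge> 1"
    and codim: "\<And>I G x U. chartp UNIV I G \<Longrightarrow> x \<in> slice I G \<Longrightarrow> x \<in> ctorus \<Longrightarrow> open U \<Longrightarrow> x \<in> U \<Longrightarrow>
      (\<And>z j. z \<in> U \<Longrightarrow> (\<And>i. i \<in> I \<Longrightarrow> G i z = 0) \<Longrightarrow> j \<in> {1..n} \<Longrightarrow> f j z = 0) \<Longrightarrow> n \<le> card I"
begin

definition V :: "(complex ^ 'm) set" where
  "V = {z \<in> ctorus. \<forall>j\<in>{1..n}. f j z = 0}"

text \<open>The chart and not the system of the \<open>f j\<close> provides the manifold, because on
  a multiple component the differentials of the \<open>f j\<close> are dependent. Only inclusion of
  the slice in \<open>V\<close> is demanded; further branches of \<open>V\<close> may pass through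
  \<open>x\<close>.\<close>

definition good :: "complex ^ 'm \<Rightarrow> 'm set \<Rightarrow> ('m \<Rightarrow> (complex ^ 'm \<Rightarrow> complex)) \<Rightarrow> (complex ^ 'm) set \<Rightarrow> bool" where
  "good x I G U \<longleftrightarrow> chartp UNIV I G \<and> card I = n \<and> x \<in> slice I G \<and> open U \<and> x \<in> U \<and> U \<subseteq> ctorus \<and>
     (\<forall>z\<in>U. (\<forall>i\<in>I. G i z = 0) \<longrightarrow> z \<in> V)"

definition Z :: "(complex ^ 'm) set" where
  "Z = {x. \<exists>I G U. good x I G U}"

lemma fpf: "j \<in> {1..n} \<Longrightarrow> f j \<in> pfun UNIV"
  using fdeg pdeg_pfun by blast

lemma good_pf: "good x I G U \<Longrightarrow> G i \<in> pfun UNIV"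
  by (simp add: good_def chartp_def)

lemma good_V: "good x I G U \<Longrightarrow> x \<in> V"
  by (auto simp: good_def slice_def)

lemma Z_subset_V: "Z \<subseteq> V"
  using good_V by (auto simp: Z_def)

lemma good_nearby: "good x I G U \<Longrightarrow> z \<in> slice I G \<Longrightarrow> z \<in> U \<Longrightarrow> good z I G U"
  by (auto simp: good_def)

text \<open>The coefficients of the \<open>f j\<close> lie in a countable set \<open>K0\<close>, and
  the local structure theorem yields charts over \<open>K0\<close>, of which there are countably
  many. By \<open>codim\<close> their codimension is at least \<open>n\<close>, and a chart of
  codimension \<open>n\<close> is good.\<close>

lemma ex_charts:
  obtains C where "countable C" "\<And>I G. (I, G) \<in> C \<Longrightarrow> chartp UNIV I G \<and> n \<le> card I"
    "\<And>x. x \<in> V \<Longrightarrow> \<exists>(I, G) \<in> C. x \<in> slice I G \<and> (card I = n \<longrightarrow> (\<exists>U. good x I G U))"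
proof -
  have "\<forall>j\<in>{1..n}. \<exists>K. finite K \<and> f j \<in> pfun K" using fpf pf_finite_constants by blast
  then obtain K where K: "\<And>j. j \<in> {1..n} \<Longrightarrow> finite (K j)" "\<And>j. j \<in> {1..n} \<Longrightarrow> f j \<in> pfun (K j)" by metis
  define K0 where "K0 = (\<Union>j\<in>{1..n}. K j)"
  have K0: "countable K0" unfolding K0_def using K(1) by (intro countable_UN) (auto intro: countable_finite)
  have fK: "f j \<in> pfun K0" if "j \<in> {1..n}" for j
    using K(2)[OF that] that by (rule_tac pf_subset) (auto simp: K0_def)
  define C where "C = {(I, G). chartp K0 I (G :: 'm \<Rightarrow> complex ^ 'm \<Rightarrow> complex) \<and> n \<le> card I}"
  have up: "chartp UNIV I G" if "chartp K0 I G" for I G using that by (auto simp: chartp_def intro: pf_UNIV)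
  show thesis
  proof (rule that[of C])
    show "countable C"
      by (rule countable_subset[OF _ countable_charts[OF K0]]) (auto simp: C_def)
    show "chartp UNIV I G \<and> n \<le> card I" if "(I, G) \<in> C" for I G
      using that up by (auto simp: C_def)
    fix x assume x: "x \<in> V"
    then have x0: "f j x = 0" if "j \<in> {1..n}" for j using that by (simp add: V_def)
    obtain I G U where IG: "chartp K0 I G" "x \<in> slice I G" "open U" "x \<in> U"
      "\<And>z j. z \<in> U \<Longrightarrow> (\<And>i. i \<in> I \<Longrightarrow> G i z = 0) \<Longrightarrow> j \<in> {1..n} \<Longrightarrow> f j z = 0"
      using local_structure[of "{1..n}" f K0 x, OF fK x0] by blast
    have "n \<le> card I"
      using codim[OF up[OF IG(1)] IG(2) _ IG(3,4) IG(5)] x by (simp add: V_def)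
    then have "(I, G) \<in> C" using IG(1) by (simp add: C_def)
    moreover have "good x I G (U \<inter> ctorus)" if "card I = n"
      using IG x that up open_ctorus by (auto simp: good_def V_def)
    ultimately show "\<exists>(I, G) \<in> C. x \<in> slice I G \<and> (card I = n \<longrightarrow> (\<exists>U. good x I G U))"
      using IG(2) by blast
  qed
qed

definition charts :: "('m set \<times> ('m \<Rightarrow> complex ^ 'm \<Rightarrow> complex)) set" where
  "charts = (SOME C. countable C \<and> (\<forall>I G. (I, G) \<in> C \<longrightarrow> chartp UNIV I G \<and> n \<le> card I) \<and>
     (\<forall>x\<in>V. \<exists>(I, G) \<in> C. x \<in> slice I G \<and> (card I = n \<longrightarrow> (\<exists>U. good x I G U))))"

lemma charts:
  shows countable_charts_V: "countable charts"
    and charts_chartp: "(I, G) \<in> charts \<Longrightarrow> chartp UNIV I G \<and> n \<le> card I"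
    and charts_cover: "x \<in> V \<Longrightarrow> \<exists>(I, G) \<in> charts. x \<in> slice I G \<and> (card I = n \<longrightarrow> (\<exists>U. good x I G U))"
proof -
  have ex: "\<exists>C. countable C \<and> (\<forall>I G. (I, G) \<in> C \<longrightarrow> chartp UNIV I G \<and> n \<le> card I) \<and>
     (\<forall>x\<in>V. \<exists>(I, G) \<in> C. x \<in> slice I G \<and> (card I = n \<longrightarrow> (\<exists>U. good x I G U)))" (is "\<exists>C. ?P C")
  proof (rule ex_charts)
    fix C assume c: "countable C" "\<And>I G. (I, G) \<in> C \<Longrightarrow> chartp UNIV I G \<and> n \<le> card I"
      "\<And>x. x \<in> V \<Longrightarrow> \<exists>(I, G) \<in> C. x \<in> slice I G \<and> (card I = n \<longrightarrow> (\<exists>U. good x I G U))"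
    have "?P C" by (intro conjI allI impI ballI c)
    then show ?thesis by (rule exI)
  qed
  note C = someI_ex[OF ex, folded charts_def]
  show "countable charts" using C by (elim conjE)
  show "(I, G) \<in> charts \<Longrightarrow> chartp UNIV I G \<and> n \<le> card I" using conjunct1[OF conjunct2[OF C]] by simp
  show "x \<in> V \<Longrightarrow> \<exists>(I, G) \<in> charts. x \<in> slice I G \<and> (card I = n \<longrightarrow> (\<exists>U. good x I G U))"
    using C by (elim conjE) (rule bspec)
qed

text \<open>\<open>N\<close> collects the critical values of \<open>g\<close> on the slices of
  codimension \<open>n\<close> and the full images of those of larger codimension. A value off
  \<open>N\<close> is attained only at points that a chart exhibits as good and at which
  \<open>g\<close> is immersive on the slice, hence isolated in the fibre on each slice.\<close>

lemma sard_variety: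
  fixes g :: "complex ^ 'm \<Rightarrow> real ^ 'm"
  assumes der: "\<And>x. x \<in> W \<Longrightarrow> (g has_derivative g' x) (at x)"
  obtains N where "negligible N"
    "\<And>x. x \<in> V \<Longrightarrow> x \<in> W \<Longrightarrow> g x \<notin> N \<Longrightarrow> \<exists>I G U. (I, G) \<in> charts \<and> good x I G U \<and> (\<forall>u\<in>tang I G x. g' x u = 0 \<longrightarrow> u = 0)"
    "\<And>c. c \<notin> N \<Longrightarrow> countable {x \<in> V \<inter> W. g x = c}"
proof -
  note C = charts_chartp
  define B where "B I G = {x \<in> slice I G \<inter> W. card I \<noteq> n \<or> (\<exists>u\<in>tang I G x. u \<noteq> 0 \<and> g' x u = 0)}" for I G
  define N where "N = (\<Union>(I, G)\<in>charts. g ` B I G)"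
  have "negligible N"
    unfolding N_def
  proof (rule negligible_countable_Union)
    show "countable ((\<lambda>(I, G). g ` B I G) ` charts)" using countable_charts_V by simp
    fix S assume "S \<in> (\<lambda>(I, G). g ` B I G) ` charts"
    then obtain I G where IG: "(I, G) \<in> charts" "S = g ` B I G" by auto
    have pf: "G i \<in> pfun UNIV" for i using C[OF IG(1)] by (simp add: chartp_def)
    have nI: "n \<le> card I" using C[OF IG(1)] by simp
    show "negligible S"
      unfolding IG(2)
      by (rule slice_sard[OF card nI pf, where f' = g']) (auto simp: B_def intro: der)
  qed
  moreover have "\<exists>I G U. (I, G) \<in> charts \<and> good x I G U \<and> (\<forall>u\<in>tang I G x. g' x u = 0 \<longrightarrow> u = 0)"
    if x: "x \<in> V" "x \<in> W" "g x \<notin> N" for x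
  proof -
    obtain I G where IG: "(I, G) \<in> charts" "x \<in> slice I G" "card I = n \<Longrightarrow> \<exists>U. good x I G U"
      using charts_cover[OF x(1)] by blast
    have "x \<notin> B I G" using x(3) IG(1) by (auto simp: N_def)
    then have "card I = n" "\<And>u. u \<in> tang I G x \<Longrightarrow> g' x u = 0 \<Longrightarrow> u = 0"
      using IG(2) x(2) by (auto simp: B_def)
    with IG(1,3) show ?thesis by blast
  qed
  moreover have "countable {x \<in> V \<inter> W. g x = c}" if c: "c \<notin> N" for c
  proof -
    define D where "D I G = {x \<in> slice I G \<inter> W. card I = n \<and> (\<forall>u\<in>tang I G x. g' x u = 0 \<longrightarrow> u = 0) \<and> g x = c}" for I G
    have "countable (D I G)" if "(I, G) \<in> charts" for I G
    proof (cases "card I = n")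
      case True
      have pf: "G i \<in> pfun UNIV" for i using C[OF that] by (simp add: chartp_def)
      show ?thesis
        by (rule slice_fibre_countable[OF card True[symmetric] pf, where f = g and f' = g' and c = c])
           (auto simp: D_def intro: der)
    qed (auto simp: D_def)
    then have "countable (\<Union>(I, G)\<in>charts. D I G)" using countable_charts_V by (intro countable_UN) auto
    moreover have "{x \<in> V \<inter> W. g x = c} \<subseteq> (\<Union>(I, G)\<in>charts. D I G)"
    proof
      fix x assume x: "x \<in> {x \<in> V \<inter> W. g x = c}"
      obtain I G where IG: "(I, G) \<in> charts" "x \<in> slice I G"
        using charts_cover[of x] x by blast
      have "x \<notin> B I G" using c x IG(1) by (auto simp: N_def)
      then have "x \<in> D I G" using IG(2) x by (auto simp: B_def D_def)
      then show "x \<in> (\<Union>(I, G)\<in>charts. D I G)" using IG(1) by blast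
    qed
    ultimately show ?thesis by (rule countable_subset[rotated])
  qed
  ultimately show thesis using that by blast
qed

text \<open>Completing \<open>f\<close> by the coordinates along a slice near \<open>x\<close>, with generic constants,
  gives a map with isolated zeros arbitrarily near \<open>x\<close>.\<close>

theorem f_open_at_Z:
  assumes x: "x \<in> Z" and \<epsilon>: "\<epsilon> > 0"
  shows "\<exists>\<delta>>0. \<forall>s. (\<forall>j\<in>{1..n}. norm (s j) < \<delta>) \<longrightarrow> (\<exists>x'\<in>ball x \<epsilon>. \<forall>j\<in>{1..n}. f j x' = s j)"
proof -
  obtain I G U where good: "good x I G U" using x by (auto simp: Z_def)
  then have IG: "card I = n" "det (jac G x) \<noteq> 0" "\<And>i. i \<in> I \<Longrightarrow> G i x = 0" "open U" "x \<in> U" "U \<subseteq> ctorus"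
    "\<And>z. z \<in> U \<Longrightarrow> (\<And>i. i \<in> I \<Longrightarrow> G i z = 0) \<Longrightarrow> z \<in> V" "\<And>i. i \<notin> I \<Longrightarrow> G i = (\<lambda>x. x $ i)"
    by (auto simp: good_def slice_def chartp_def)
  obtain U1 V1 g where L: "open U1" "x \<in> U1" "open V1" "evalv G x \<in> V1" "homeomorphism U1 V1 (evalv G) g"
    using local_inverse[of G UNIV, OF good_pf[OF good] IG(2)] by metis
  obtain Q :: "real ^ 'm \<Rightarrow> complex ^ 'm" where Q: "linear Q" "range Q = {v. \<forall>i\<in>I. v $ i = 0}" "inj Q"
    using real_coordinates[OF card, of I] IG(1) by auto
  obtain L where L': "linear L" "L \<circ> Q = id"
    using linear_injective_left_inverse[OF Q(1,3)] by metis
  define Zr where "Zr z = (\<chi> j. if j \<in> I then 0 else z $ j)" for z :: "complex ^ 'm"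
  define \<pi> where "\<pi> z = L (Zr z)" for z
  have linZr: "linear Zr" by (rule linearI) (auto simp: Zr_def vec_eq_iff)
  have lin\<pi>: "linear \<pi>" unfolding \<pi>_def using linear_compose[OF linZr L'(1)] by (simp add: o_def)
  obtain N where N: "negligible N" "\<And>c. c \<notin> N \<Longrightarrow> countable {x \<in> V \<inter> UNIV. \<pi> x = c}"
    using sard_variety[of UNIV \<pi> "\<lambda>_. \<pi>"] linear_imp_has_derivative[OF lin\<pi>] by metis
  have contQ: "continuous_on UNIV Q"
    using Q(1) linear_continuous_on linear_conv_bounded_linear by blast
  have "open (V1 \<inter> g -` (ball x \<epsilon> \<inter> U))"
    using L(3,5) IG(4) by (metis continuous_open_preimage homeomorphism_def open_Int open_ball)
  then have "open (Q -` (V1 \<inter> g -` (ball x \<epsilon> \<inter> U)))"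
    using contQ by (intro open_vimage)
  moreover have "evalv G x \<in> range Q" unfolding Q(2) using IG(3) by simp
  then obtain r0 where r0: "evalv G x = Q r0" by blast
  have "g (evalv G x) = x" using L by (simp add: homeomorphism_def)
  then have "r0 \<in> Q -` (V1 \<inter> g -` (ball x \<epsilon> \<inter> U))"
    using L(4) IG(5) \<epsilon> by (simp add: r0[symmetric])
  ultimately have "\<not> negligible (Q -` (V1 \<inter> g -` (ball x \<epsilon> \<inter> U)))"
    by (intro open_not_negligible) auto
  \<comment> \<open>The parameter is moved off \<open>N\<close> so that the projection
    \<open>\<pi>\<close> has a countable fibre on all of \<open>V\<close>; over \<open>x\<close>
    itself, other branches of \<open>V\<close> could make the fibre uncountable.\<close>
  then obtain c where c: "Q c \<in> V1" "g (Q c) \<in> ball x \<epsilon>" "g (Q c) \<in> U" "c \<notin> N"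
    using negligible_subset[OF N(1), of "Q -` (V1 \<inter> g -` (ball x \<epsilon> \<inter> U))"] by blast
  define y where "y = g (Q c)"
  have ey: "evalv G y = Q c" using L(5) c(1) by (simp add: y_def homeomorphism_def)
  have Gy: "G i y = 0" if "i \<in> I" for i
  proof -
    have "Q c \<in> {v. \<forall>i\<in>I. v $ i = 0}" using Q(2) by blast
    then show ?thesis using that ey by (metis (mono_tags, lifting) evalv_nth mem_Collect_eq)
  qed
  have yV: "y \<in> V" using IG(7) c(3) Gy by (simp add: y_def)
  have "Zr y = Q c"
  proof -
    have "(Q c) $ j = (if j \<in> I then 0 else y $ j)" for j
      using Gy[of j] IG(8)[of j] by (simp add: ey[symmetric])
    then show ?thesis by (simp add: Zr_def vec_eq_iff)
  qed
  then have "\<pi> y = c" using L'(2) by (simp add: \<pi>_def fun_eq_iff)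
  obtain \<beta> where \<beta>: "bij_betw \<beta> I {1..n}"
    using finite_same_card_bij[of I "{1..n}"] IG(1) by auto
  have \<beta>': "\<beta> i \<in> {1..n}" if "i \<in> I" for i using bij_betwE[OF \<beta>] that by blast
  have \<beta>s: "\<exists>i\<in>I. j = \<beta> i" if "j \<in> {1..n}" for j
  proof -
    have "j \<in> \<beta> ` I" using bij_betw_imp_surj_on[OF \<beta>] that by simp
    then show ?thesis by blast
  qed
  \<comment> \<open>A square system: the \<open>n\<close> functions \<open>f j\<close> at the places
    in \<open>I\<close>, and the \<open>n\<close> coordinates outside \<open>I\<close> fixed at
    their values in \<open>y\<close>. Its zeros in the torus lie in the countable fibre.\<close>
  define \<Phi> where "\<Phi> i = (if i \<in> I then f (\<beta> i) else (\<lambda>z. z $ i - y $ i))" for i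
  have pf: "\<Phi> i \<in> pfun UNIV" for i
  proof (cases "i \<in> I")
    case True
    then show ?thesis using fpf[OF \<beta>'] by (simp add: \<Phi>_def)
  next
    case False
    then show ?thesis using pf_diff[OF pf_coord pf_const, of "y $ i" UNIV i] by (simp add: \<Phi>_def)
  qed
  have fy: "f j y = 0" if "j \<in> {1..n}" for j using yV that by (simp add: V_def)
  have y0: "evalv \<Phi> y = 0"
    using fy[OF \<beta>'] by (simp add: vec_eq_iff \<Phi>_def)
  have zeros: "{z \<in> ctorus. evalv \<Phi> z = 0} \<subseteq> {x \<in> V \<inter> UNIV. \<pi> x = c}"
  proof clarify
    fix z assume z: "z \<in> ctorus" "evalv \<Phi> z = 0"
    have zi: "\<Phi> i z = 0" for i using z(2) by (metis evalv_nth zero_index)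
    have "f j z = 0" if jn: "j \<in> {1..n}" for j
    proof -
      obtain i where "i \<in> I" "j = \<beta> i" using \<beta>s[OF jn] by blast
      then show ?thesis using zi[of i] by (simp add: \<Phi>_def)
    qed
    moreover have "z $ i = y $ i" if "i \<notin> I" for i using zi[of i] that by (simp add: \<Phi>_def)
    then have "Zr z = Zr y" by (simp add: Zr_def vec_eq_iff)
    ultimately show "z \<in> V \<inter> UNIV \<and> \<pi> z = c" using z(1) \<open>\<pi> y = c\<close> by (simp add: V_def \<pi>_def)
  qed
  have cnt: "countable {z \<in> ctorus. evalv \<Phi> z = 0}"
    by (rule countable_subset[OF zeros N(2)[OF c(4)]])
  have "open (ball x \<epsilon> \<inter> U)" "y \<in> ball x \<epsilon> \<inter> U" using IG(4) c by (auto simp: y_def)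
  then obtain \<eta> where \<eta>: "\<eta> > 0" "ball y \<eta> \<subseteq> ball x \<epsilon> \<inter> U" using openE by blast
  \<comment> \<open>Countably many zeros have countably many distances from \<open>y\<close>, so
    some small sphere around \<open>y\<close> contains none of them.\<close>
  have "\<not> {0<..<\<eta>} \<subseteq> dist y ` {z \<in> ctorus. evalv \<Phi> z = 0}"
    using countable_subset[of "{0<..<\<eta>}"] cnt uncountable_open_interval[of 0 \<eta>] \<eta>(1) by auto
  then obtain \<rho> where \<rho>: "0 < \<rho>" "\<rho> < \<eta>" "\<rho> \<notin> dist y ` {z \<in> ctorus. evalv \<Phi> z = 0}"
    unfolding subset_iff greaterThanLessThan_iff by blast
  have "evalv \<Phi> z \<noteq> 0" if "dist y z = \<rho>" for z
  proof
    assume "evalv \<Phi> z = 0"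
    moreover have "z \<in> ctorus" using \<eta>(2) \<rho>(2) that IG(6) by auto
    ultimately show False using \<rho>(3) that by blast
  qed
  then obtain \<delta> where \<delta>: "\<delta> > 0" "ball 0 \<delta> \<subseteq> evalv \<Phi> ` cball y \<rho>"
    using polynomial_map_open_at_isolated_zero[of \<Phi> y \<rho>] pf y0 \<rho>(1) by metis
  show ?thesis
  proof (intro exI conjI allI impI)
    \<comment> \<open>The divisor turns a bound on every component into a bound by
      \<open>\<delta>\<close> on the norm.\<close>
    let ?\<delta> = "\<delta> / (real CARD('m) + 1)"
    show "?\<delta> > 0" using \<delta>(1) by simp
    fix s :: "nat \<Rightarrow> complex" assume s: "\<forall>j\<in>{1..n}. norm (s j) < ?\<delta>"
    define v where "v = (\<chi> i. if i \<in> I then s (\<beta> i) else 0)"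
    have "norm (v $ i) \<le> ?\<delta>" for i
      using s[rule_format, OF \<beta>'] \<delta>(1) by (simp add: v_def less_imp_le)
    then have "norm v \<le> real CARD('m) * ?\<delta>" by (rule norm_vec_le_bound)
    also have "\<dots> < \<delta>" using \<delta>(1) by (simp add: field_simps)
    finally have "v \<in> ball 0 \<delta>" by simp
    then obtain z where z: "z \<in> cball y \<rho>" "v = evalv \<Phi> z" using \<delta>(2) by blast
    have "z \<in> ball x \<epsilon>" using z(1) \<rho>(2) \<eta>(2) by (auto simp: subset_iff)
    moreover have "f j z = s j" if jn: "j \<in> {1..n}" for j
    proof -
      obtain i where i: "i \<in> I" "j = \<beta> i" using \<beta>s[OF jn] by blast
      have "v $ i = \<Phi> i z" using z(2) by simp
      then show ?thesis using i by (simp add: v_def \<Phi>_def)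
    qed
    ultimately show "\<exists>x'\<in>ball x \<epsilon>. \<forall>j\<in>{1..n}. f j x' = s j" by blast
  qed
qed

end

section \<open>Etale points\<close>

lemma linear_injective_imp_surj_DIM:
  fixes g :: "'a::euclidean_space \<Rightarrow> 'b::euclidean_space"
  assumes "linear g" "inj g" "DIM('a) = DIM('b)"
  shows "surj g"
proof -
  have "dim (range g) = DIM('b)"
    using dim_image_eq[OF assms(1), of UNIV] assms(2,3) by (simp add: inj_on_subset)
  then have "span (range g) = UNIV" by (simp add: dim_eq_full)
  moreover have "subspace (range g)" by (rule linear_subspace_image[OF assms(1) subspace_UNIV])
  ultimately show ?thesis by (metis span_eq_iff)
qed

text \<open>The forms that identify two given points lie in a real hyperplane of the coefficient
  space, and finitely many null sets do not exhaust it.\<close>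

lemma separating_linear_form:
  fixes X :: "(complex ^ 'm::finite) set"
  assumes "finite X"
  obtains c :: "complex ^ 'm" where "inj_on (\<lambda>z. \<Sum>i\<in>UNIV. c $ i * z $ i) X"
proof -
  define B where "B u = {c :: complex ^ 'm. (\<Sum>i\<in>UNIV. c $ i * u $ i) = 0}" for u :: "complex ^ 'm"
  define D where "D = (\<lambda>(x, y). x - y) ` {(x, y). x \<in> X \<and> y \<in> X \<and> x \<noteq> y}"
  have "finite D"
    unfolding D_def by (rule finite_imageI, rule finite_subset[of _ "X \<times> X"]) (use assms in auto)
  moreover have neg: "negligible (B u)" if "u \<in> D" for u
  proof -
    define w where "w = (\<chi> i. cnj (u $ i))"
    have "u \<noteq> 0" using that by (auto simp: D_def)
    then have "w \<noteq> 0" by (auto simp: w_def vec_eq_iff)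
    then have "negligible {c. w \<bullet> c = 0}" by (intro negligible_hyperplane) simp
    moreover have "B u \<subseteq> {c. w \<bullet> c = 0}"
    proof
      fix c assume "c \<in> B u"
      then have "Re (\<Sum>i\<in>UNIV. c $ i * u $ i) = 0" by (simp add: B_def)
      then show "c \<in> {c. w \<bullet> c = 0}"
        by (simp add: inner_vec_def w_def inner_complex_def mult.commute)
    qed
    ultimately show ?thesis by (rule negligible_subset)
  qed
  ultimately have "negligible (\<Union>u\<in>D. B u)" by (intro negligible_Union) auto
  then have "(\<Union>u\<in>D. B u) \<noteq> UNIV" using non_negligible_UNIV by auto
  then obtain c where c: "c \<notin> (\<Union>u\<in>D. B u)" by blast
  have "inj_on (\<lambda>z. \<Sum>i\<in>UNIV. c $ i * z $ i) X"
  proof (rule inj_onI, rule ccontr)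
    fix x y assume xy: "x \<in> X" "y \<in> X" "(\<Sum>i\<in>UNIV. c $ i * x $ i) = (\<Sum>i\<in>UNIV. c $ i * y $ i)" "x \<noteq> y"
    then have "x - y \<in> D" unfolding D_def by (intro image_eqI[of _ _ "(x, y)"]) auto
    moreover have "c \<in> B (x - y)" using xy(3) by (simp add: B_def sum_subtractf algebra_simps)
    ultimately show False using c by blast
  qed
  then show thesis by (rule that)
qed

lemma tang_scale: "u \<in> tang I G x \<Longrightarrow> c *s u \<in> tang I G x"
  by (auto simp: tang_def matrix_vector_mult_def vector_smult_component mult.left_commute
      sum_distrib_left[symmetric])

lemma tang_add: "u \<in> tang I G x \<Longrightarrow> v \<in> tang I G x \<Longrightarrow> u + v \<in> tang I G x"
  by (auto simp: tang_def matrix_vector_right_distrib)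

text \<open>In logarithmic coordinates the tangent space contains no purely imaginary vector; since it is
  a complex subspace, this is the same as containing no real vector.\<close>

definition transverse :: "'a::finite set \<Rightarrow> ('a \<Rightarrow> (complex ^ 'a \<Rightarrow> complex)) \<Rightarrow> complex ^ 'a \<Rightarrow> bool" where
  "transverse I G x \<longleftrightarrow> (\<forall>u\<in>tang I G x. (\<forall>j. Re (u $ j / x $ j) = 0) \<longrightarrow> u = 0)"

lemma transverse_iff_Im:
  "transverse I G x \<longleftrightarrow> (\<forall>u\<in>tang I G x. (\<forall>j. Im (u $ j / x $ j) = 0) \<longrightarrow> u = 0)"
proof -
  have eq: "Im ((\<i> *s u) $ j / x $ j) = Re (u $ j / x $ j)" "Re ((\<i> *s u) $ j / x $ j) = - Im (u $ j / x $ j)" for u j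
    using Im_i_times[of "u $ j / x $ j"] Re_i_times[of "u $ j / x $ j"] by simp_all
  have z: "\<i> *s u = 0 \<longleftrightarrow> u = 0" for u :: "complex ^ 'a" by (simp add: vec_eq_iff)
  show ?thesis
    unfolding transverse_def
  proof (intro iffI ballI impI)
    fix u assume *: "\<forall>u\<in>tang I G x. (\<forall>j. Re (u $ j / x $ j) = 0) \<longrightarrow> u = 0" "u \<in> tang I G x" "\<forall>j. Im (u $ j / x $ j) = 0"
    then show "u = 0" using tang_scale[OF *(2), of \<i>] eq(2) z by (metis neg_equal_0_iff_equal)
  next
    fix u assume *: "\<forall>u\<in>tang I G x. (\<forall>j. Im (u $ j / x $ j) = 0) \<longrightarrow> u = 0" "u \<in> tang I G x" "\<forall>j. Re (u $ j / x $ j) = 0"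
    then show "u = 0" using tang_scale[OF *(2), of \<i>] eq(1) z by metis
  qed
qed

context torus_variety
begin

text \<open>The chart is taken from the fixed countable family, so that the etale points are later
  covered by countably many sheets.\<close>

definition etale :: "complex ^ 'm \<Rightarrow> bool" where
  "etale x \<longleftrightarrow> (\<exists>I G U. (I, G) \<in> charts \<and> good x I G U \<and> transverse I G x)"

text \<open>On the product of the slice with itself \<open>\<Psi>\<close> is a map between real
  spaces of equal dimension \<open>4n\<close>. Its derivative at the diagonal point is injective and
  so onto, and an open mapping theorem at a single point applies.\<close>

lemma etale_pair_open:
  fixes \<Psi> :: "(complex ^ 'm) \<times> (complex ^ 'm) \<Rightarrow> complex ^ 'm"
  assumes good: "good x I G U" and \<epsilon>: "\<epsilon> > 0" and cont: "continuous_on UNIV \<Psi>"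
    and der: "(\<Psi> has_derivative \<Psi>') (at (x, x))"
    and inj: "\<And>u v. u \<in> tang I G x \<Longrightarrow> v \<in> tang I G x \<Longrightarrow> \<Psi>' (u, v) = 0 \<Longrightarrow> u = 0 \<and> v = 0"
  shows "\<exists>\<delta>>0. \<forall>y\<in>ball (\<Psi> (x, x)) \<delta>. \<exists>z\<in>Z \<inter> ball x \<epsilon>. \<exists>z'\<in>Z \<inter> ball x \<epsilon>. \<Psi> (z, z') = y"
proof -
  have IG: "card I = n" "n \<le> card I" "x \<in> slice I G" "open U" "x \<in> U" using good by (auto simp: good_def)
  obtain \<kappa> :: "real ^ 'm \<Rightarrow> complex ^ 'm" and \<kappa>' D U0 and \<kappa>i :: "complex ^ 'm \<Rightarrow> real ^ 'm" where K: "open D" "open U0" "x \<in> U0" "\<kappa> ` D = slice I G \<inter> U0"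
    "\<And>r. r \<in> D \<Longrightarrow> (\<kappa> has_derivative \<kappa>' r) (at r)"
    "\<And>r. r \<in> D \<Longrightarrow> range (\<kappa>' r) = tang I G (\<kappa> r)"
    "\<And>r. card I = n \<Longrightarrow> r \<in> D \<Longrightarrow> inj (\<kappa>' r)"
    "\<And>r. card I \<noteq> n \<Longrightarrow> \<exists>h. h \<noteq> 0 \<and> \<kappa>' r h = 0"
    "\<And>h. continuous_on D (\<lambda>r. \<kappa>' r h)"
    "continuous_on UNIV \<kappa>i" "\<And>r. card I = n \<Longrightarrow> r \<in> D \<Longrightarrow> \<kappa>i (\<kappa> r) = r"
    by (rule slice_param[OF card IG(2) good_pf[OF good] IG(3)]) (rule that; assumption)
  obtain r0 where r0: "r0 \<in> D" "x = \<kappa> r0" using K(3,4) IG(3) by blast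
  have ck: "continuous_on D \<kappa>"
    by (rule has_derivative_continuous_on, rule has_derivative_at_withinI, rule K(5))
  define D' where "D' = D \<inter> \<kappa> -` (U \<inter> ball x \<epsilon>)"
  have "open D'" unfolding D'_def
    by (rule continuous_open_preimage[OF ck K(1)]) (use IG(4) in auto)
  have r0': "r0 \<in> D'" using r0 IG(5) \<epsilon> by (simp add: D'_def)
  have sub: "D' \<subseteq> D" by (auto simp: D'_def)
  have kZ: "\<kappa> r \<in> Z \<inter> ball x \<epsilon>" if "r \<in> D'" for r
  proof -
    have "\<kappa> r \<in> slice I G" using K(4) that sub by blast
    then have "good (\<kappa> r) I G U" using good_nearby[OF good] that by (simp add: D'_def)
    then show ?thesis using that by (auto simp: Z_def D'_def)
  qed
  define F where "F = (\<lambda>p. \<Psi> (\<kappa> (fst p), \<kappa> (snd p)))"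
  define F' where "F' = (\<lambda>h. \<Psi>' (\<kappa>' r0 (fst h), \<kappa>' r0 (snd h)))"
  have "((\<lambda>p. \<kappa> (fst p)) has_derivative (\<lambda>h. \<kappa>' r0 (fst h))) (at (r0, r0))"
    "((\<lambda>p. \<kappa> (snd p)) has_derivative (\<lambda>h. \<kappa>' r0 (snd h))) (at (r0, r0))"
    using diff_chain_at[OF has_derivative_fst[OF has_derivative_ident], of \<kappa> _ "(r0, r0)"]
      diff_chain_at[OF has_derivative_snd[OF has_derivative_ident], of \<kappa> _ "(r0, r0)"] K(5)[OF r0(1)]
    by (auto simp: o_def)
  from has_derivative_Pair[OF this]
  have dF: "(F has_derivative F') (at (r0, r0))"
    unfolding F_def F'_def using diff_chain_at[of "\<lambda>p. (\<kappa> (fst p), \<kappa> (snd p))" _ "(r0, r0)" \<Psi> \<Psi>'] der r0(2)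
    by (simp add: o_def)
  then have lin: "linear F'" by (rule has_derivative_linear)
  have lin': "linear (\<kappa>' r0)" using K(5)[OF r0(1)] by (rule has_derivative_linear)
  have injF: "inj F'"
  proof (subst linear_injective_0[OF lin], intro allI impI)
    fix h assume "F' h = 0"
    then have "\<kappa>' r0 (fst h) = 0 \<and> \<kappa>' r0 (snd h) = 0"
      unfolding F'_def by (intro inj) (use K(6)[OF r0(1)] r0(2) in auto)
    then have "fst h = 0" "snd h = 0"
      using K(7)[OF IG(1) r0(1)] lin' by (metis linear_injective_0)+
    then show "h = 0" by (simp add: prod_eq_iff)
  qed
  have "surj F'"
    by (rule linear_injective_imp_surj_DIM[OF lin injF]) simp
  then obtain g' where g': "linear g'" "F' \<circ> g' = id"
    using linear_surjective_right_inverse[OF lin] by blast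
  have cF: "continuous_on (D' \<times> D') F"
  proof -
    have "continuous_on (D' \<times> D') (\<lambda>p. (\<kappa> (fst p), \<kappa> (snd p)))"
      by (intro continuous_on_Pair continuous_on_compose2[OF ck] continuous_intros) (use sub in auto)
    then show ?thesis unfolding F_def by (rule continuous_on_compose2[OF cont]) auto
  qed
  have "F (r0, r0) \<in> interior (F ` (D' \<times> D'))"
  proof (rule sussmann_open_mapping[OF _ cF _ dF])
    show "open (D' \<times> D')" using \<open>open D'\<close> by (intro open_Times)
    then show "(r0, r0) \<in> interior (D' \<times> D')" using r0' by (simp add: interior_open)
  qed (use r0' g' linear_conv_bounded_linear in auto)
  then obtain \<delta> where \<delta>: "\<delta> > 0" "ball (F (r0, r0)) \<delta> \<subseteq> F ` (D' \<times> D')"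
    by (auto simp: mem_interior)
  have "\<exists>z\<in>Z \<inter> ball x \<epsilon>. \<exists>z'\<in>Z \<inter> ball x \<epsilon>. \<Psi> (z, z') = y" if "y \<in> ball (\<Psi> (x, x)) \<delta>" for y
  proof -
    have "y \<in> F ` (D' \<times> D')" using \<delta>(2) that r0(2) by (auto simp: F_def)
    then obtain r s where "r \<in> D'" "s \<in> D'" "y = \<Psi> (\<kappa> r, \<kappa> s)" by (auto simp: F_def)
    then show ?thesis using kZ by blast
  qed
  with \<delta>(1) show ?thesis by blast
qed

text \<open>The points of \<open>X\<close>, placed on the diagonal, lie over the same
  \<open>y0\<close> and each persists over all nearby \<open>y\<close>. Since \<open>h\<close>
  separates them by at least \<open>\<eta>\<close> and its values move by less than
  \<open>\<eta> / 2\<close>, the new pairs are still distinguished by \<open>h\<close> of their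
  first components.\<close>

lemma etale_pair_sheets:
  fixes \<Psi> :: "(complex ^ 'm) \<times> (complex ^ 'm) \<Rightarrow> complex ^ 'm"
  assumes X: "finite X" and cont: "continuous_on UNIV \<Psi>" and y0: "\<And>x. x \<in> X \<Longrightarrow> \<Psi> (x, x) = y0"
    and et: "\<And>x. x \<in> X \<Longrightarrow> \<exists>I G U \<Psi>'. good x I G U \<and> (\<Psi> has_derivative \<Psi>') (at (x, x)) \<and>
      (\<forall>u\<in>tang I G x. \<forall>v\<in>tang I G x. \<Psi>' (u, v) = 0 \<longrightarrow> u = 0 \<and> v = 0)"
    and h: "continuous_on UNIV h" "inj_on h X"
  shows "\<exists>\<delta>>0. \<forall>y\<in>ball y0 \<delta>. \<exists>Y\<subseteq>Z \<times> Z. finite Y \<and> card Y = card X \<and>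
    inj_on (\<lambda>p. h (fst p) :: complex) Y \<and> (\<forall>p\<in>Y. \<Psi> p = y)"
proof -
  obtain \<eta> where \<eta>: "\<eta> > 0" "\<And>x x'. x \<in> X \<Longrightarrow> x' \<in> X \<Longrightarrow> x \<noteq> x' \<Longrightarrow> \<eta> \<le> dist (h x) (h x')"
  proof (cases "\<exists>x\<in>X. \<exists>x'\<in>X. x \<noteq> x'")
    case False
    then show ?thesis using that[of 1] by auto
  next
    case True
    define P where "P = {(x, x'). x \<in> X \<and> x' \<in> X \<and> x \<noteq> x'}"
    have "finite P" by (rule finite_subset[of _ "X \<times> X"]) (use X in \<open>auto simp: P_def\<close>)
    moreover have "P \<noteq> {}" using True by (auto simp: P_def)
    moreover have "dist (h x) (h x') > 0" if "(x, x') \<in> P" for x x'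
      using that h(2) by (auto simp: P_def inj_on_def)
    ultimately have pos: "Min ((\<lambda>(x, x'). dist (h x) (h x')) ` P) > 0" by auto
    show ?thesis
    proof (rule that[OF pos])
      fix x x' assume "x \<in> X" "x' \<in> X" "x \<noteq> x'"
      then have "(\<lambda>(x, x'). dist (h x) (h x')) (x, x') \<in> (\<lambda>(x, x'). dist (h x) (h x')) ` P"
        by (intro imageI) (simp add: P_def)
      then show "Min ((\<lambda>(x, x'). dist (h x) (h x')) ` P) \<le> dist (h x) (h x')"
        using \<open>finite P\<close> by (intro Min_le) auto
    qed
  qed
  have "\<exists>\<delta>>0. \<forall>y\<in>ball y0 \<delta>. \<exists>p\<in>Z \<times> Z. dist (h x) (h (fst p)) < \<eta> / 2 \<and> \<Psi> p = y" if x: "x \<in> X" for x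
  proof -
    obtain \<epsilon> where \<epsilon>: "\<epsilon> > 0" "\<And>z. dist z x < \<epsilon> \<Longrightarrow> dist (h z) (h x) < \<eta> / 2"
      using h(1) \<eta>(1) unfolding continuous_on_iff by (metis UNIV_I half_gt_zero)
    obtain I G U \<Psi>' where g: "good x I G U" "(\<Psi> has_derivative \<Psi>') (at (x, x))"
      "\<forall>u\<in>tang I G x. \<forall>v\<in>tang I G x. \<Psi>' (u, v) = 0 \<longrightarrow> u = 0 \<and> v = 0" using et[OF x] by blast
    obtain \<delta> where \<delta>: "\<delta> > 0" "\<forall>y\<in>ball (\<Psi> (x, x)) \<delta>. \<exists>z\<in>Z \<inter> ball x \<epsilon>. \<exists>z'\<in>Z \<inter> ball x \<epsilon>. \<Psi> (z, z') = y"
      using etale_pair_open[OF g(1) \<epsilon>(1) cont g(2)] g(3) by blast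
    have "\<exists>p\<in>Z \<times> Z. dist (h x) (h (fst p)) < \<eta> / 2 \<and> \<Psi> p = y" if y: "y \<in> ball y0 \<delta>" for y
    proof -
      obtain z z' where z: "z \<in> Z" "z \<in> ball x \<epsilon>" "z' \<in> Z" "\<Psi> (z, z') = y"
        using bspec[OF \<delta>(2), of y] y y0[OF x] by auto
      then show ?thesis using \<epsilon>(2)[of z] by (intro bexI[of _ "(z, z')"]) (auto simp: dist_commute)
    qed
    with \<delta>(1) show ?thesis by blast
  qed
  then obtain \<delta>' where \<delta>': "\<And>x. x \<in> X \<Longrightarrow> \<delta>' x > 0"
    "\<And>x y. x \<in> X \<Longrightarrow> y \<in> ball y0 (\<delta>' x) \<Longrightarrow> \<exists>p\<in>Z \<times> Z. dist (h x) (h (fst p)) < \<eta> / 2 \<and> \<Psi> p = y"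
    by metis
  define \<delta> where "\<delta> = Min (insert 1 (\<delta>' ` X))"
  have \<delta>: "\<delta> > 0" "\<And>x. x \<in> X \<Longrightarrow> \<delta> \<le> \<delta>' x" using X \<delta>'(1) by (auto simp: \<delta>_def)
  have "\<exists>Y\<subseteq>Z \<times> Z. finite Y \<and> card Y = card X \<and> inj_on (\<lambda>p. h (fst p)) Y \<and> (\<forall>p\<in>Y. \<Psi> p = y)"
    if y: "y \<in> ball y0 \<delta>" for y
  proof -
    have "\<exists>p\<in>Z \<times> Z. dist (h x) (h (fst p)) < \<eta> / 2 \<and> \<Psi> p = y" if "x \<in> X" for x
      using \<delta>'(2)[OF that, of y] y \<delta>(2)[OF that] by simp
    then obtain p where p: "\<And>x. x \<in> X \<Longrightarrow> p x \<in> Z \<times> Z" "\<And>x. x \<in> X \<Longrightarrow> dist (h x) (h (fst (p x))) < \<eta> / 2"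
      "\<And>x. x \<in> X \<Longrightarrow> \<Psi> (p x) = y" by metis
    have inj: "x = x'" if "x \<in> X" "x' \<in> X" "h (fst (p x)) = h (fst (p x'))" for x x'
    proof (rule ccontr)
      assume "x \<noteq> x'"
      have "dist (h x) (h x') \<le> dist (h x) (h (fst (p x))) + dist (h x') (h (fst (p x')))"
        using dist_triangle[of "h x" "h x'" "h (fst (p x))"] that(3) by (simp add: dist_commute)
      then show False using p(2)[OF that(1)] p(2)[OF that(2)] \<eta>(2)[OF that(1,2) \<open>x \<noteq> x'\<close>] by linarith
    qed
    have "inj_on p X" using inj by (auto simp: inj_on_def)
    then have "card (p ` X) = card X" by (rule card_image)
    moreover have "inj_on (\<lambda>p. h (fst p)) (p ` X)" using inj by (fastforce simp: inj_on_def)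
    ultimately show ?thesis using p X by (intro exI[of _ "p ` X"]) blast
  qed
  with \<delta>(1) show ?thesis by blast
qed

lemma etale_D:
  assumes "etale x"
  obtains I G U where "good x I G U" "\<And>j. x $ j \<noteq> 0"
    "\<And>u. u \<in> tang I G x \<Longrightarrow> (\<And>j. Re (u $ j / x $ j) = 0) \<Longrightarrow> u = 0"
proof -
  obtain I G U where g: "good x I G U" "transverse I G x" using assms unfolding etale_def by blast
  have "x \<in> ctorus" using good_V[OF g(1)] by (simp add: V_def)
  then have "x $ j \<noteq> 0" for j by (simp add: ctorus_def)
  then show thesis by (rule that[OF g(1)]) (use g(2) in \<open>simp add: transverse_def\<close>)
qed

text \<open>If \<open>u / x\<close> and \<open>v / x\<close> are conjugate up to sign, then their difference or sum is imaginary,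
  and so is \<open>\<i>\<close> times the other combination.\<close>

lemma etale_conjugate_zero:
  assumes tr: "\<And>u. u \<in> tang I G x \<Longrightarrow> (\<And>j. Re (u $ j / x $ j) = 0) \<Longrightarrow> u = 0"
    and uv: "u \<in> tang I G x" "v \<in> tang I G x" and \<sigma>: "\<sigma> = 1 \<or> \<sigma> = -1"
    and eq: "\<And>j. u $ j / x $ j = \<sigma> * cnj (v $ j / x $ j)"
  shows "u = 0 \<and> v = 0"
proof -
  have "u + (- \<sigma>) *s v = 0"
  proof (rule tr)
    show "u + (- \<sigma>) *s v \<in> tang I G x" by (intro tang_add tang_scale uv)
    have r: "Re (\<sigma> * cnj b - \<sigma> * b) = 0" for b using \<sigma> by auto
    have "(u + (- \<sigma>) *s v) $ j / x $ j = u $ j / x $ j - \<sigma> * (v $ j / x $ j)" for j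
      by (simp add: add_divide_distrib diff_divide_distrib)
    then show "Re ((u + (- \<sigma>) *s v) $ j / x $ j) = 0" for j
      unfolding eq using r by metis
  qed
  moreover have "\<i> *s (u + \<sigma> *s v) = 0"
  proof (rule tr)
    show "\<i> *s (u + \<sigma> *s v) \<in> tang I G x" by (intro tang_add tang_scale uv)
    have r: "Re (\<i> * (\<sigma> * cnj b + \<sigma> * b)) = 0" for b using \<sigma> by auto
    have "(\<i> *s (u + \<sigma> *s v)) $ j / x $ j = \<i> * (u $ j / x $ j + \<sigma> * (v $ j / x $ j))" for j
      by (simp add: add_divide_distrib distrib_left)
    then show "Re ((\<i> *s (u + \<sigma> *s v)) $ j / x $ j) = 0" for j
      unfolding eq using r by metis
  qed
  ultimately have *: "u $ j = \<sigma> * v $ j \<and> u $ j = - \<sigma> * v $ j" for j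
    by (auto simp: vec_eq_iff add_eq_0_iff2)
  have "u $ j = 0 \<and> v $ j = 0" for j using *[of j] \<sigma> by auto
  then show ?thesis by (simp add: vec_eq_iff)
qed

section \<open>Bound for the fibres of the logarithm map\<close>

lemma linear_form_pdeg:
  "(\<lambda>z. \<Sum>i\<in>UNIV. c i * \<xi> i z) \<in> pdeg \<xi> 1"
proof (rule pdeg_sum)
  fix i
  have "(\<lambda>z. c i * \<xi> i z) \<in> pdeg \<xi> (0 + 1)" by (intro pdeg_mult pdeg_const pdeg_coord) simp
  then show "(\<lambda>z. c i * \<xi> i z) \<in> pdeg \<xi> 1" by simp
qed

text \<open>A fibre of the logarithm map is given by
  \<open>z $ j * cnj (z $ j) = (\<rho> j)\<^sup>2\<close>; the conjugated factor is made
  independent. At \<open>(x, x)\<close> the derivative vanishes on \<open>(u, v)\<close> only if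
  \<open>u / x\<close> is minus the conjugate of \<open>v / x\<close>, which for an etale point
  forces both to vanish.\<close>

lemma Log_pair_sheets:
  assumes X: "finite X" "\<And>x. x \<in> X \<Longrightarrow> etale x"
    and \<rho>: "\<And>x j. x \<in> X \<Longrightarrow> norm (x $ j) = \<rho> j"
    and h: "continuous_on UNIV h" "inj_on h X"
  shows "\<exists>\<delta>>0. \<forall>y\<in>ball (\<chi> j. of_real ((\<rho> j)\<^sup>2)) \<delta>. \<exists>Y\<subseteq>Z \<times> Z. finite Y \<and> card Y = card X \<and>
    inj_on (\<lambda>p. h (fst p) :: complex) Y \<and> (\<forall>p\<in>Y. (\<chi> j. fst p $ j * cnj (snd p $ j)) = y)"
proof (rule etale_pair_sheets[OF X(1) _ _ _ h])
  show "continuous_on UNIV (\<lambda>p :: (complex ^ 'm) \<times> (complex ^ 'm). \<chi> j. fst p $ j * cnj (snd p $ j))"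
    by (intro continuous_intros)
  show "(\<chi> j. fst (x, x) $ j * cnj (snd (x, x) $ j)) = (\<chi> j. of_real ((\<rho> j)\<^sup>2))" if "x \<in> X" for x
    using \<rho>[OF that] by (simp add: vec_eq_iff complex_norm_square[symmetric])
  fix x assume x: "x \<in> X"
  obtain I G U where IG: "good x I G U" "\<And>j. x $ j \<noteq> 0"
    "\<And>u. u \<in> tang I G x \<Longrightarrow> (\<And>j. Re (u $ j / x $ j) = 0) \<Longrightarrow> u = 0"
    using etale_D[OF X(2)[OF x]] by blast
  let ?D = "\<lambda>p. \<chi> j. x $ j * cnj (snd p $ j) + fst p $ j * cnj (x $ j)"
  have der: "((\<lambda>p. \<chi> j. fst p $ j * cnj (snd p $ j)) has_derivative ?D) (at (x, x))"
  proof (rule has_derivative_vecI)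
    fix j
    have 1: "((\<lambda>p :: (complex ^ 'm) \<times> (complex ^ 'm). fst p $ j) has_derivative (\<lambda>p. fst p $ j)) (at (x, x))"
      "((\<lambda>p :: (complex ^ 'm) \<times> (complex ^ 'm). cnj (snd p $ j)) has_derivative (\<lambda>p. cnj (snd p $ j))) (at (x, x))"
      by (auto intro!: linear_imp_has_derivative linearI)
    show "((\<lambda>p. (\<chi> j. fst p $ j * cnj (snd p $ j)) $ j) has_derivative (\<lambda>p. ?D p $ j)) (at (x, x))"
      using has_derivative_mult[OF 1] by simp
  qed
  have "u = 0 \<and> v = 0" if uv: "u \<in> tang I G x" "v \<in> tang I G x" "?D (u, v) = 0" for u v
  proof (rule etale_conjugate_zero[OF IG(3) uv(1,2), of "-1"])
    fix j
    have "x $ j * cnj (v $ j) + u $ j * cnj (x $ j) = 0" using uv(3) by (simp add: vec_eq_iff)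
    then show "u $ j / x $ j = -1 * cnj (v $ j / x $ j)"
      using IG(2)[of j] by (simp add: field_simps add_eq_0_iff)
  qed auto
  then show "\<exists>I G U \<Psi>'. good x I G U \<and> ((\<lambda>p. \<chi> j. fst p $ j * cnj (snd p $ j)) has_derivative \<Psi>') (at (x, x)) \<and>
      (\<forall>u\<in>tang I G x. \<forall>v\<in>tang I G x. \<Psi>' (u, v) = 0 \<longrightarrow> u = 0 \<and> v = 0)"
    using IG(1) der by blast
qed

abbreviation \<xi>0 :: "'m \<Rightarrow> complex ^ 'm \<Rightarrow> complex" where "\<xi>0 \<equiv> \<lambda>i z. z $ i"

definition Log_bound :: real where
  "Log_bound = fact (2 * n) / (fact n)\<^sup>2 * (\<Prod>j=1..n. (real (d j))\<^sup>2)"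

lemma product_bound:
  assumes "h \<in> pdeg \<xi>0 1"
    and "\<And>X. indep_on (Z \<times> Z) (exps UNIV X \<times> {..<M})
      (\<lambda>(a, i) (z, z'). (\<Prod>t\<in>UNIV. (z $ t * cnj (z' $ t)) ^ a t) * h z ^ i)"
  shows "real M \<le> Log_bound"
  unfolding Log_bound_def
  by (rule product_sheet_bound[where \<xi> = \<xi>0 and S = "{1..n}" and f = f and Z = Z and h = h])
     (use assms card fdeg dpos f_open_at_Z in \<open>auto intro!: continuous_intros\<close>)

text \<open>Over a full neighbourhood of the point with coordinates
  \<open>(\<rho> j)\<^sup>2\<close> there are \<open>card X\<close> pairs separated by a linear form
  \<open>h\<close>, so monomials in the products of coordinates times the powers
  \<open>h ^ i\<close> with \<open>i < card X\<close> are independent on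
  \<open>Z \<times> Z\<close>.\<close>

theorem Log_fibre_bound:
  assumes X: "finite X" "\<And>x. x \<in> X \<Longrightarrow> etale x"
    and \<rho>: "\<And>x j. x \<in> X \<Longrightarrow> norm (x $ j) = \<rho> j"
  shows "real (card X) \<le> Log_bound"
proof -
  obtain c where c: "inj_on (\<lambda>z. \<Sum>i\<in>UNIV. c $ i * z $ i) X"
    using separating_linear_form[OF X(1)] by blast
  define h where "h z = (\<Sum>i\<in>UNIV. c $ i * z $ i)" for z
  have hc: "continuous_on UNIV h" unfolding h_def by (intro continuous_intros)
  have hi: "inj_on h X" using c unfolding h_def .
  obtain \<delta> where \<delta>: "\<delta> > 0" "\<And>y. y \<in> ball (\<chi> j. of_real ((\<rho> j)\<^sup>2)) \<delta> \<Longrightarrow> \<exists>Y\<subseteq>Z \<times> Z. finite Y \<and> card Y = card X \<and>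
    inj_on (\<lambda>p. h (fst p) :: complex) Y \<and> (\<forall>p\<in>Y. (\<chi> j. fst p $ j * cnj (snd p $ j)) = y)"
    using Log_pair_sheets[OF X \<rho> hc hi] by blast
  show ?thesis
  proof (rule product_bound[where h = h])
    show "h \<in> pdeg \<xi>0 1" unfolding h_def by (rule linear_form_pdeg)
    fix D
    let ?\<psi> = "\<lambda>t p. fst p $ t * cnj (snd p $ t)"
    have "indep_on (Z \<times> Z) (exps UNIV D \<times> {..<card X}) (\<lambda>(a, i) p. (\<Prod>t\<in>(UNIV::'m set). ?\<psi> t p ^ a t) * h (fst p) ^ i)"
    proof (rule indep_sheets[where h = "\<lambda>p. h (fst p)" and \<delta> = "\<delta> / (real CARD('m) + 1)" and ?y0.0 = "\<lambda>j. of_real ((\<rho> j)\<^sup>2)"])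
      show "\<delta> / (real CARD('m) + 1) > 0" using \<delta>(1) by simp
      fix y :: "'m \<Rightarrow> complex" assume y: "\<And>t. t \<in> UNIV \<Longrightarrow> dist (of_real ((\<rho> t)\<^sup>2)) (y t) < \<delta> / (real CARD('m) + 1)"
      have "norm ((\<chi> j. of_real ((\<rho> j)\<^sup>2)) - (\<chi> j. y j)) \<le> real CARD('m) * (\<delta> / (real CARD('m) + 1))"
        by (rule norm_vec_le_bound) (use y in \<open>simp add: dist_norm less_imp_le\<close>)
      also have "\<dots> < \<delta>" using \<delta>(1) by (simp add: field_simps)
      finally have "(\<chi> j. y j) \<in> ball (\<chi> j. of_real ((\<rho> j)\<^sup>2)) \<delta>" by (simp add: dist_norm)
      from \<delta>(2)[OF this] show "\<exists>Y\<subseteq>Z \<times> Z. finite Y \<and> card Y = card X \<and> inj_on (\<lambda>p. h (fst p)) Y \<and>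
          (\<forall>p\<in>Y. \<forall>t\<in>UNIV. ?\<psi> t p = y t)"
        by (simp add: vec_eq_iff)
    qed (auto simp: exps_support)
    then show "indep_on (Z \<times> Z) (exps UNIV D \<times> {..<card X})
      (\<lambda>(a, i) (z, z'). (\<Prod>t\<in>UNIV. (z $ t * cnj (z' $ t)) ^ a t) * h z ^ i)"
      by (simp add: case_prod_unfold)
  qed
qed

section \<open>Bound for the fibres of the argument map\<close>

definition \<xi>2 :: "'m + 'm \<Rightarrow> (complex ^ 'm) \<times> (complex ^ 'm) \<Rightarrow> complex" where
  "\<xi>2 s p = (case s of Inl i \<Rightarrow> fst p $ i | Inr i \<Rightarrow> snd p $ i)"

lemma pdeg_fst:
  assumes "g \<in> pdeg \<xi>0 D"
  shows "(\<lambda>p. g (fst p)) \<in> pdeg \<xi>2 D"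
proof -
  obtain c where c: "\<And>x. g x = (\<Sum>a\<in>exps UNIV D. c a * pmon \<xi>0 a x)" using assms by (auto simp: pdeg_def)
  have "(\<lambda>p. c a * pmon \<xi>0 a (fst p)) \<in> pdeg \<xi>2 D" if a: "a \<in> exps UNIV D" for a
  proof -
    have le: "(\<Sum>i\<in>UNIV. a i * 1) \<le> D" using a by (simp add: exps_def)
    have "(\<lambda>p. \<Prod>i\<in>UNIV. \<xi>2 (Inl i) p ^ a i) \<in> pdeg \<xi>2 (\<Sum>i\<in>UNIV. a i * 1)"
      by (rule pdeg_powers) (rule pdeg_coord, simp)
    from pdeg_mono[OF this le] have "(\<lambda>p. pmon \<xi>0 a (fst p)) \<in> pdeg \<xi>2 D"
      by (simp add: pmon_def[abs_def] \<xi>2_def)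
    from pdeg_mult[OF pdeg_const[of "c a" \<xi>2 0] this] show ?thesis by simp
  qed
  then show ?thesis unfolding c by (rule pdeg_sum)
qed

text \<open>Conjugating both the argument and the value amounts to conjugating the coefficients,
  which gives a polynomial of the same degree in the second factor.\<close>

lemma pdeg_snd_cnj:
  assumes "g \<in> pdeg \<xi>0 D"
  shows "(\<lambda>p. cnj (g (\<chi> i. cnj (snd p $ i)))) \<in> pdeg \<xi>2 D"
proof -
  obtain c where c: "\<And>x. g x = (\<Sum>a\<in>exps UNIV D. c a * pmon \<xi>0 a x)" using assms by (auto simp: pdeg_def)
  have "(\<lambda>p. cnj (c a) * (\<Prod>i\<in>UNIV. \<xi>2 (Inr i) p ^ a i)) \<in> pdeg \<xi>2 D" if a: "a \<in> exps UNIV D" for a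
  proof -
    have le: "(\<Sum>i\<in>UNIV. a i * 1) \<le> D" using a by (simp add: exps_def)
    have "(\<lambda>p. \<Prod>i\<in>UNIV. \<xi>2 (Inr i) p ^ a i) \<in> pdeg \<xi>2 (\<Sum>i\<in>UNIV. a i * 1)"
      by (rule pdeg_powers) (rule pdeg_coord, simp)
    from pdeg_mono[OF this le] have "(\<lambda>p. \<Prod>i\<in>UNIV. \<xi>2 (Inr i) p ^ a i) \<in> pdeg \<xi>2 D" .
    from pdeg_mult[OF pdeg_const[of "cnj (c a)" \<xi>2 0] this] show ?thesis by simp
  qed
  then have "(\<lambda>p. \<Sum>a\<in>exps UNIV D. cnj (c a) * (\<Prod>i\<in>UNIV. \<xi>2 (Inr i) p ^ a i)) \<in> pdeg \<xi>2 D"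
    by (rule pdeg_sum)
  then show ?thesis unfolding c by (simp add: pmon_def \<xi>2_def)
qed

text \<open>The quotient \<open>x $ j / cnj (x $ j) = t j\<close> determines the argument modulo
  \<open>pi\<close>. The map on pairs is real linear, hence its own derivative, and its kernel
  consists of the pairs for which \<open>u / x\<close> is the conjugate of
  \<open>v / x\<close>.\<close>

lemma Arg_pair_sheets:
  assumes X: "finite X" "\<And>x. x \<in> X \<Longrightarrow> etale x"
    and t: "\<And>x j. x \<in> X \<Longrightarrow> x $ j = t j * cnj (x $ j)"
    and h: "continuous_on UNIV h" "inj_on h X"
  shows "\<exists>\<delta>>0. \<forall>y\<in>ball 0 \<delta>. \<exists>Y\<subseteq>Z \<times> Z. finite Y \<and> card Y = card X \<and>
    inj_on (\<lambda>p. h (fst p) :: complex) Y \<and> (\<forall>p\<in>Y. (\<chi> j. fst p $ j - t j * cnj (snd p $ j)) = y)"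
proof (rule etale_pair_sheets[OF X(1) _ _ _ h])
  show "continuous_on UNIV (\<lambda>p :: (complex ^ 'm) \<times> (complex ^ 'm). \<chi> j. fst p $ j - t j * cnj (snd p $ j))"
    by (intro continuous_intros)
  show "(\<chi> j. fst (x, x) $ j - t j * cnj (snd (x, x) $ j)) = 0" if "x \<in> X" for x
    using t[OF that] by (simp add: vec_eq_iff)
  fix x assume x: "x \<in> X"
  obtain I G U where IG: "good x I G U" "\<And>j. x $ j \<noteq> 0"
    "\<And>u. u \<in> tang I G x \<Longrightarrow> (\<And>j. Re (u $ j / x $ j) = 0) \<Longrightarrow> u = 0"
    using etale_D[OF X(2)[OF x]] by blast
  let ?D = "\<lambda>p. \<chi> j. fst p $ j - t j * cnj (snd p $ j)"
  have "linear ?D" by (rule linearI) (auto simp: vec_eq_iff algebra_simps)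
  then have der: "(?D has_derivative ?D) (at (x, x))" by (rule linear_imp_has_derivative)
  have "u = 0 \<and> v = 0" if uv: "u \<in> tang I G x" "v \<in> tang I G x" "?D (u, v) = 0" for u v
  proof (rule etale_conjugate_zero[OF IG(3) uv(1,2), of 1])
    fix j
    have "u $ j = t j * cnj (v $ j)" using uv(3) by (simp add: vec_eq_iff)
    then have "u $ j / x $ j = t j * cnj (v $ j) / (t j * cnj (x $ j))" using t[OF x, of j] by simp
    also have "t j \<noteq> 0" using t[OF x, of j] IG(2)[of j] by auto
    then have "t j * cnj (v $ j) / (t j * cnj (x $ j)) = 1 * cnj (v $ j / x $ j)" by simp
    finally show "u $ j / x $ j = 1 * cnj (v $ j / x $ j)" .
  qed auto
  then show "\<exists>I G U \<Psi>'. good x I G U \<and> (?D has_derivative \<Psi>') (at (x, x)) \<and>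
      (\<forall>u\<in>tang I G x. \<forall>v\<in>tang I G x. \<Psi>' (u, v) = 0 \<longrightarrow> u = 0 \<and> v = 0)"
    using IG(1) der by blast
qed

text \<open>In the \<open>4n\<close> variables of two copies there are \<open>2n\<close> equations,
  the \<open>f j\<close> and their conjugates, and \<open>2n\<close> linear forms that separate
  sheets. Every degree \<open>d j\<close> occurs twice, whence the squares.\<close>

theorem Arg_fibre_bound:
  assumes X: "finite X" "\<And>x. x \<in> X \<Longrightarrow> etale x"
    and t: "\<And>x j. x \<in> X \<Longrightarrow> x $ j = t j * cnj (x $ j)"
  shows "card X \<le> (\<Prod>j=1..n. (d j)\<^sup>2)"
proof -
  obtain c where c: "inj_on (\<lambda>z. \<Sum>i\<in>UNIV. c $ i * z $ i) X"
    using separating_linear_form[OF X(1)] by blast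
  define h where "h z = (\<Sum>i\<in>UNIV. c $ i * z $ i)" for z
  have hc: "continuous_on UNIV h" unfolding h_def by (intro continuous_intros)
  have hi: "inj_on h X" using c unfolding h_def .
  have hp: "h \<in> pdeg \<xi>0 1" unfolding h_def by (rule linear_form_pdeg)
  obtain \<delta> where \<delta>: "\<delta> > 0" "\<And>y. y \<in> ball 0 \<delta> \<Longrightarrow> \<exists>Y\<subseteq>Z \<times> Z. finite Y \<and> card Y = card X \<and>
    inj_on (\<lambda>p. h (fst p) :: complex) Y \<and> (\<forall>p\<in>Y. (\<chi> j. fst p $ j - t j * cnj (snd p $ j)) = y)"
    using Arg_pair_sheets[OF X t hc hi] by blast
  let ?cj = "\<lambda>w :: complex ^ 'm. \<chi> i. cnj (w $ i)"
  define ff where "ff s p = (if snd s then f (fst s) (fst p) else cnj (f (fst s) (?cj (snd p))))" for s :: "nat \<times> bool" and p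
  \<comment> \<open>The second variable stands for a conjugated point, so this is the product of
    \<open>Z\<close> with its conjugate.\<close>
  define A where "A = {p. fst p \<in> Z \<and> ?cj (snd p) \<in> Z}"
  have "card X \<le> (\<Prod>s\<in>{1..n} \<times> (UNIV :: bool set). d (fst s))"
  proof (rule sheet_bound[where \<xi> = \<xi>2 and f = ff and T = "UNIV :: 'm set" and A = A
        and \<psi> = "\<lambda>i p. fst p $ i - t i * snd p $ i" and h = "\<lambda>p. h (fst p)" and ?y0.0 = "\<lambda>_. 0"
        and \<delta> = "\<delta> / (real CARD('m) + 1)"])
    show "card ({1..n} \<times> (UNIV :: bool set)) + card (UNIV :: 'm set) = CARD('m + 'm)"
      by (simp add: card card_cartesian_product)
    show "continuous_on UNIV (\<xi>2 i)" for i
      by (cases i) (auto simp: \<xi>2_def intro!: continuous_intros)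
    show "ff s \<in> pdeg \<xi>2 (d (fst s))" if "s \<in> {1..n} \<times> UNIV" for s
      using that pdeg_fst[OF fdeg, of "fst s"] pdeg_snd_cnj[OF fdeg, of "fst s"]
      by (cases "snd s") (auto simp: ff_def[abs_def])
    show "d (fst s) \<ge> 1" if "s \<in> {1..n} \<times> UNIV" for s :: "nat \<times> bool" using that dpos[of "fst s"] by auto
    show "(\<lambda>p. fst p $ i - t i * snd p $ i) \<in> pdeg \<xi>2 1" for i
    proof -
      have 1: "(\<lambda>p. - t i * \<xi>2 (Inr i) p) \<in> pdeg \<xi>2 (0 + 1)" by (intro pdeg_mult pdeg_const pdeg_coord) simp
      have 2: "\<xi>2 (Inl i) \<in> pdeg \<xi>2 (0 + 1)" by (rule pdeg_coord) simp
      from pdeg_add[OF 2 1] show ?thesis by (simp add: \<xi>2_def)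
    qed
    show "(\<lambda>p. h (fst p)) \<in> pdeg \<xi>2 1" by (rule pdeg_fst[OF hp])
    show "\<delta> / (real CARD('m) + 1) > 0" using \<delta>(1) by simp
    show "\<exists>\<delta>>0. \<forall>s. (\<forall>i\<in>{1..n} \<times> UNIV. norm (s i) < \<delta>) \<longrightarrow> (\<exists>p'\<in>ball p \<epsilon>. \<forall>i\<in>{1..n} \<times> UNIV. ff i p' = s i)"
      if p: "p \<in> A" and \<epsilon>: "\<epsilon> > 0" for p \<epsilon>
    proof -
      have pZ: "fst p \<in> Z" "?cj (snd p) \<in> Z" using p by (auto simp: A_def)
      have e2: "\<epsilon> / 2 > 0" using \<epsilon> by simp
      obtain \<delta>1 where \<delta>1: "\<delta>1 > 0" "\<forall>s. (\<forall>j\<in>{1..n}. norm (s j) < \<delta>1) \<longrightarrow> (\<exists>x'\<in>ball (fst p) (\<epsilon> / 2). \<forall>j\<in>{1..n}. f j x' = s j)"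
        using f_open_at_Z[OF pZ(1) e2] by (elim exE conjE) (rule that)
      obtain \<delta>2 where \<delta>2: "\<delta>2 > 0" "\<forall>s. (\<forall>j\<in>{1..n}. norm (s j) < \<delta>2) \<longrightarrow> (\<exists>x'\<in>ball (?cj (snd p)) (\<epsilon> / 2). \<forall>j\<in>{1..n}. f j x' = s j)"
        using f_open_at_Z[OF pZ(2) e2] by (elim exE conjE) (rule that)
      show ?thesis
      proof (intro exI conjI allI impI)
        show "min \<delta>1 \<delta>2 > 0" using \<delta>1(1) \<delta>2(1) by simp
        fix s :: "nat \<times> bool \<Rightarrow> complex" assume s: "\<forall>i\<in>{1..n} \<times> UNIV. norm (s i) < min \<delta>1 \<delta>2"
        obtain x where x: "x \<in> ball (fst p) (\<epsilon> / 2)" "\<forall>j\<in>{1..n}. f j x = s (j, True)"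
          using \<delta>1(2)[rule_format, of "\<lambda>j. s (j, True)"] s by auto
        obtain w where w: "w \<in> ball (?cj (snd p)) (\<epsilon> / 2)" "\<forall>j\<in>{1..n}. f j w = cnj (s (j, False))"
          using \<delta>2(2)[rule_format, of "\<lambda>j. cnj (s (j, False))"] s by auto
        have "dist (snd p) (?cj w) = dist (?cj (snd p)) w"
        proof -
          have "norm (snd p - ?cj w) = norm (?cj (snd p) - w)"
            unfolding norm_vec_def by (intro arg_cong[of _ _ "\<lambda>f. L2_set f UNIV"] ext)
              (metis (no_types, lifting) complex_cnj_cnj complex_cnj_diff complex_mod_cnj vec_lambda_beta vector_minus_component)
          then show ?thesis by (simp add: dist_norm)
        qed
        then have "dist p (x, ?cj w) < \<epsilon>"
          using x(1) w(1) sqrt_sum_squares_le_sum[of "dist (fst p) x" "dist (snd p) (?cj w)"]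
          by (simp add: dist_prod_def)
        moreover have "ff i (x, ?cj w) = s i" if "i \<in> {1..n} \<times> UNIV" for i
        proof -
          have "?cj (?cj w) = w" by (simp add: vec_eq_iff)
          then show ?thesis using that x(2) w(2) by (cases i; cases "snd i") (auto simp: ff_def)
        qed
        ultimately show "\<exists>p'\<in>ball p \<epsilon>. \<forall>i\<in>{1..n} \<times> UNIV. ff i p' = s i"
          by (intro bexI[of _ "(x, ?cj w)"]) auto
      qed
    qed
    fix y :: "'m \<Rightarrow> complex" assume y: "\<And>t. t \<in> UNIV \<Longrightarrow> dist 0 (y t) < \<delta> / (real CARD('m) + 1)"
    have "norm (\<chi> j. y j) \<le> real CARD('m) * (\<delta> / (real CARD('m) + 1))"
      by (rule norm_vec_le_bound) (use y in \<open>simp add: less_imp_le\<close>)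
    also have "\<dots> < \<delta>" using \<delta>(1) by (simp add: field_simps)
    finally have "(\<chi> j. y j) \<in> ball 0 \<delta>" by simp
    from \<delta>(2)[OF this] obtain Y where Y: "Y \<subseteq> Z \<times> Z" "finite Y" "card Y = card X" "inj_on (\<lambda>p. h (fst p)) Y"
      "\<And>p j. p \<in> Y \<Longrightarrow> fst p $ j - t j * cnj (snd p $ j) = y j" by (auto simp: vec_eq_iff)
    define c2 where "c2 p = (fst p, ?cj (snd p))" for p :: "(complex ^ 'm) \<times> (complex ^ 'm)"
    have inv: "c2 (c2 p) = p" for p by (simp add: c2_def vec_eq_iff prod_eq_iff)
    have "inj_on c2 Y" by (metis inj_on_inverseI inv)
    then have "card (c2 ` Y) = card X" using Y(3) by (simp add: card_image)
    moreover have "c2 ` Y \<subseteq> A"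
    proof
      fix q assume "q \<in> c2 ` Y"
      then obtain z z' where z: "(z, z') \<in> Y" "q = c2 (z, z')" by auto
      have "?cj (?cj z') = z'" by (simp add: vec_eq_iff)
      then show "q \<in> A" using Y(1) z by (auto simp: A_def c2_def)
    qed
    moreover have "inj_on (\<lambda>p. h (fst p)) (c2 ` Y)"
      using Y(4) by (auto simp: inj_on_def c2_def)
    ultimately show "\<exists>Y\<subseteq>A. finite Y \<and> card Y = card X \<and> inj_on (\<lambda>p. h (fst p)) Y \<and>
        (\<forall>p\<in>Y. \<forall>i\<in>UNIV. fst p $ i - t i * snd p $ i = y i)"
      using Y(2,5) by (intro exI[of _ "c2 ` Y"]) (auto simp: c2_def)
  qed auto
  also have "(\<Prod>s\<in>{1..n} \<times> (UNIV :: bool set). d (fst s)) = (\<Prod>j=1..n. (d j)\<^sup>2)"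
    using prod.cartesian_product[of "\<lambda>j _. d j" "UNIV :: bool set" "{1..n}", symmetric]
    by (simp add: case_prod_unfold power2_eq_square UNIV_bool)
  finally show ?thesis .
qed

end

section \<open>Noncritical values of stratified maps\<close>

lemma residue_eq_iff: "Defs.residue L a = Defs.residue L b \<longleftrightarrow> (\<exists>k::int. a = b + of_int k * L)"
proof -
  have "Defs.residue L a = Defs.residue L b \<longleftrightarrow> [b = a] (rmod L)"
    unfolding Defs.residue_def using rcong_refl rcong_sym rcong_trans by blast
  then show ?thesis by (simp add: rcong_altdef)
qed

lemma residue_vec_eq_iff: "residue_vec L a = residue_vec L b \<longleftrightarrow> (\<forall>i. \<exists>k::int. a $ i = b $ i + of_int k * L)"
  by (simp add: residue_vec_def vec_eq_iff residue_eq_iff)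

text \<open>Two properties common to the identity and the parametrisation of a torus: translations
  descend through \<open>q\<close>, and differences of points with equal image are uniformly
  discrete. The latter makes the difference of two continuous lifts locally constant.\<close>

definition covering :: "('e::euclidean_space \<Rightarrow> 'b) \<Rightarrow> bool" where
  "covering q \<longleftrightarrow> (\<forall>a b e. q a = q b \<longrightarrow> q (a + e) = q (b + e)) \<and>
     (\<exists>\<eta>>0. \<forall>a b a' b'. q a = q b \<longrightarrow> q a' = q b' \<longrightarrow> norm ((a - b) - (a' - b')) < \<eta> \<longrightarrow> a - b = a' - b')"

lemma covering_id: "covering (\<lambda>x. x)"
  by (auto simp: covering_def intro: exI[of _ 1])

lemma covering_residue_vec:
  assumes L: "L > 0"
  shows "covering (residue_vec L :: real ^ 'm::finite \<Rightarrow> _)"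
  unfolding covering_def
proof (intro conjI allI impI)
  fix a b e :: "real ^ 'm"
  assume "residue_vec L a = residue_vec L b"
  then show "residue_vec L (a + e) = residue_vec L (b + e)"
    unfolding residue_vec_eq_iff by (metis (no_types, opaque_lifting) add.commute add.left_commute vector_add_component)
next
  show "\<exists>\<eta>>0. \<forall>a b a' b' :: real ^ 'm. residue_vec L a = residue_vec L b \<longrightarrow> residue_vec L a' = residue_vec L b' \<longrightarrow>
      norm ((a - b) - (a' - b')) < \<eta> \<longrightarrow> a - b = a' - b'"
  proof (intro exI[of _ L] conjI allI impI L)
    fix a b a' b' :: "real ^ 'm"
    assume *: "residue_vec L a = residue_vec L b" "residue_vec L a' = residue_vec L b'"
      "norm ((a - b) - (a' - b')) < L"
    show "a - b = a' - b'"
    proof (subst vec_eq_iff, rule allI)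
      fix i
      obtain k l :: int where kl: "a $ i = b $ i + of_int k * L" "a' $ i = b' $ i + of_int l * L"
        using *(1,2) unfolding residue_vec_eq_iff by blast
      have "\<bar>((a - b) - (a' - b')) $ i\<bar> < L"
        using component_le_norm_cart[of "(a - b) - (a' - b')" i] *(3) by linarith
      then have "\<bar>of_int (k - l) * L\<bar> < L" by (simp add: kl algebra_simps)
      then have "\<bar>of_int (k - l) :: real\<bar> < 1" using L by (simp add: abs_mult)
      then have "k = l" by linarith
      then show "(a - b) $ i = (a' - b') $ i" by (simp add: kl)
    qed
  qed
qed

lemma smooth_on_differentiable: "smooth_on U f \<Longrightarrow> x \<in> U \<Longrightarrow> f differentiable (at x)"
  unfolding smooth_on_def by (metis Ck_on.simps(2))

lemma smooth_on_continuous: "smooth_on U f \<Longrightarrow> continuous_on U f"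
  unfolding smooth_on_def by (metis Ck_on.simps(1))

lemma vector_derivative_in_subspace:
  fixes c :: "real \<Rightarrow> 'a::euclidean_space"
  assumes "(c has_vector_derivative v) (at 0)" "subspace E" "\<forall>\<^sub>F t in at 0. c t \<in> E" "c 0 \<in> E"
  shows "v \<in> E"
proof -
  have "((\<lambda>t. norm (c t - c 0 - t *\<^sub>R v) / norm t) \<longlongrightarrow> 0) (at 0)"
    using assms(1) unfolding has_vector_derivative_def has_derivative_iff_norm by simp
  moreover have "\<forall>\<^sub>F t in at 0. norm (c t - c 0 - t *\<^sub>R v) / norm t = norm ((c t - c 0) /\<^sub>R (t - 0) - v)"
    unfolding eventually_at_filter
  proof (intro always_eventually allI impI)
    fix t :: real assume t: "t \<noteq> 0"
    have "(c t - c 0) /\<^sub>R (t - 0) - v = (c t - c 0 - t *\<^sub>R v) /\<^sub>R t"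
      using t by (simp add: scaleR_diff_right)
    then show "norm (c t - c 0 - t *\<^sub>R v) / norm t = norm ((c t - c 0) /\<^sub>R (t - 0) - v)"
      by (simp add: divide_inverse mult.commute)
  qed
  ultimately have "((\<lambda>t. norm ((c t - c 0) /\<^sub>R (t - 0) - v)) \<longlongrightarrow> 0) (at 0)"
    by (rule Lim_transform_eventually)
  then have lim: "((\<lambda>t. (c t - c 0) /\<^sub>R (t - 0)) \<longlongrightarrow> v) (at 0)"
    by (rule LIM_zero_cancel[OF tendsto_norm_zero_cancel])
  have "\<forall>\<^sub>F t in at 0. (c t - c 0) /\<^sub>R (t - 0) \<in> E"
    using assms(3) by eventually_elim (intro subspace_scale subspace_diff assms(2,4))
  then show ?thesis
    by (rule Lim_in_closed_set[OF closed_subspace[OF assms(2)] _ at_neq_bot lim])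
qed

lemma has_vector_derivative_transform_at_nhds:
  assumes "(f has_vector_derivative v) (at a)" "\<forall>\<^sub>F t in nhds a. g t = f t"
  shows "(g has_vector_derivative v) (at a)"
  unfolding has_vector_derivative_def
proof (rule has_derivative_transform_eventually[OF assms(1)[unfolded has_vector_derivative_def]])
  show "\<forall>\<^sub>F t in at a. f t = g t"
    by (rule filter_leD[OF at_within_le_nhds]) (use assms(2) in \<open>simp add: eq_commute\<close>)
  show "f a = g a" using eventually_nhds_x_imp_x[OF assms(2)] by simp
qed simp

text \<open>The differential is only known through curves and their lifts. Flattening the stratum to
  a linear space \<open>E\<close> turns the hypothesis into surjectivity of
  \<open>D \<circ> \<psi>'\<close> on \<open>E\<close>. With a linear right inverse \<open>T\<close>
  the map \<open>\<lambda>v. F (p v)\<close> has the identity as derivative at \<open>0\<close> and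
  is open there.\<close>

lemma stratum_open:
  fixes f :: "'a::euclidean_space \<Rightarrow> 'b" and F :: "'a \<Rightarrow> 'e::euclidean_space"
  assumes q: "covering q" and S: "smooth_submanifold k S" and x: "x \<in> S"
    and W: "open W" "x \<in> W" "\<And>z. z \<in> W \<Longrightarrow> f z = q (F z)"
    and F: "continuous_on W F" "(F has_derivative D) (at x)"
    and crit: "differential_image q f S x = UNIV" and \<epsilon>: "\<epsilon> > 0"
  shows "\<exists>\<delta>>0. ball (F x) \<delta> \<subseteq> F ` (S \<inter> ball x \<epsilon>)"
proof -
  obtain U W0 \<phi> \<psi> and E :: "'a set" where M: "x \<in> U" "smooth_on U \<phi>" "smooth_on W0 \<psi>"
    "homeomorphism U W0 \<phi> \<psi>" "subspace E" "\<phi> ` (S \<inter> U) = W0 \<inter> E"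
    using bspec[OF S[unfolded smooth_submanifold_def] x] by (elim exE conjE) (rule that; assumption)
  have oU: "open U" "open W0" using M(2,3) by (auto simp: smooth_on_def)
  have px: "\<phi> x \<in> W0" "\<phi> x \<in> E" "\<psi> (\<phi> x) = x" using M x by (auto simp: homeomorphism_def)
  obtain \<phi>' where \<phi>': "(\<phi> has_derivative \<phi>') (at x)"
    using smooth_on_differentiable[OF M(2,1)] by (auto simp: differentiable_def)
  obtain \<psi>' where \<psi>': "(\<psi> has_derivative \<psi>') (at (\<phi> x))"
    using smooth_on_differentiable[OF M(3) px(1)] by (auto simp: differentiable_def)
  have onto: "(\<lambda>e. D (\<psi>' e)) ` E = UNIV"
  proof (intro equalityI subset_UNIV subsetI)
    fix v
    have "v \<in> differential_image q f S x" using crit by simp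
    then obtain g \<gamma> \<epsilon>' where G: "v = vector_derivative g (at 0)" "\<epsilon>' > 0"
      "smooth_on {-\<epsilon>'<..<\<epsilon>'} \<gamma>" "\<gamma> ` {-\<epsilon>'<..<\<epsilon>'} \<subseteq> S" "\<gamma> 0 = x"
      "smooth_on {-\<epsilon>'<..<\<epsilon>'} g" "\<And>t. t \<in> {-\<epsilon>'<..<\<epsilon>'} \<Longrightarrow> f (\<gamma> t) = q (g t)"
      unfolding differential_image_def mem_Collect_eq by (elim exE conjE) (rule that; blast)
    have i0: "(0::real) \<in> {-\<epsilon>'<..<\<epsilon>'}" using G(2) by simp
    have evi: "\<forall>\<^sub>F t in nhds 0. t \<in> {-\<epsilon>'<..<\<epsilon>'}" by (rule eventually_nhds_in_open) (use i0 in auto)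
    have g': "(g has_vector_derivative v) (at 0)"
      using smooth_on_differentiable[OF G(6) i0] unfolding G(1) by (simp add: vector_derivative_works[symmetric])
    obtain w where w: "(\<gamma> has_vector_derivative w) (at 0)"
      using smooth_on_differentiable[OF G(3) i0] vector_derivative_works by blast
    have c\<gamma>: "isCont \<gamma> 0" and cg: "isCont g 0"
      using w g' has_vector_derivative_continuous by blast+
    have lim\<gamma>: "(\<gamma> \<longlongrightarrow> x) (nhds 0)"
      using c\<gamma>[unfolded isCont_def tendsto_at_iff_tendsto_nhds] G(5) by simp
    have evW: "\<forall>\<^sub>F t in nhds 0. \<gamma> t \<in> W"
      by (rule topological_tendstoD[OF lim\<gamma> W(1,2)])
    have evU: "\<forall>\<^sub>F t in nhds 0. \<gamma> t \<in> U"
      by (rule topological_tendstoD[OF lim\<gamma> oU(1) M(1)])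
    obtain \<eta> where \<eta>: "\<eta> > 0" "\<And>a b a' b'. q a = q b \<Longrightarrow> q a' = q b' \<Longrightarrow> norm ((a - b) - (a' - b')) < \<eta> \<Longrightarrow> a - b = a' - b'"
      using conjunct2[OF q[unfolded covering_def]] by (elim exE conjE) (rule that; blast)
    \<comment> \<open>\<open>g\<close> and \<open>F \<circ> \<gamma>\<close> lift the same path near
      \<open>0\<close>, so by uniform discreteness their difference is constant there and their
      velocities agree.\<close>
    define c where "c t = g t - F (\<gamma> t)" for t
    have "isCont F x" using F(2) has_derivative_continuous by blast
    then have "isCont (\<lambda>t. F (\<gamma> t)) 0" using isCont_o2[OF c\<gamma>] G(5) by simp
    then have "isCont c 0" unfolding c_def by (intro continuous_diff cg)
    then have "(c \<longlongrightarrow> c 0) (nhds 0)" unfolding isCont_def tendsto_at_iff_tendsto_nhds .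
    then have "\<forall>\<^sub>F t in nhds 0. dist (c t) (c 0) < \<eta>" by (rule tendstoD[OF _ \<eta>(1)])
    with evi evW have evc: "\<forall>\<^sub>F t in nhds 0. g t = F (\<gamma> t) + c 0"
    proof eventually_elim
      case (elim t)
      have "q (g t) = q (F (\<gamma> t))" using G(7)[OF elim(1)] W(3)[OF elim(2)] by simp
      moreover have "q (g 0) = q (F (\<gamma> 0))" using G(7)[OF i0] W(3)[of "\<gamma> 0"] W(2) G(5) by simp
      ultimately have "c t = c 0" unfolding c_def
        by (rule \<eta>(2)) (use elim(3) in \<open>simp add: c_def dist_norm\<close>)
      then show ?case by (simp add: c_def algebra_simps)
    qed
    have "((\<lambda>t. F (\<gamma> t)) has_vector_derivative D w) (at 0)"
      using diff_chain_at[of \<gamma> "\<lambda>t. t *\<^sub>R w" 0 F D] w F(2) G(5) linear_cmul[OF has_derivative_linear[OF F(2)]]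
      by (simp add: has_vector_derivative_def o_def)
    then have "((\<lambda>t. F (\<gamma> t) + c 0) has_vector_derivative D w) (at 0)"
      using has_vector_derivative_add[OF _ has_vector_derivative_const] by fastforce
    then have "(g has_vector_derivative D w) (at 0)"
      by (rule has_vector_derivative_transform_at_nhds[OF _ evc])
    then have vD: "v = D w" using g' vector_derivative_unique_at by blast
    have p\<gamma>: "((\<lambda>t. \<phi> (\<gamma> t)) has_vector_derivative \<phi>' w) (at 0)"
      using diff_chain_at[of \<gamma> "\<lambda>t. t *\<^sub>R w" 0 \<phi> \<phi>'] w \<phi>' G(5) linear_cmul[OF has_derivative_linear[OF \<phi>']]
      by (simp add: has_vector_derivative_def o_def)
    have "\<forall>\<^sub>F t in at 0. \<phi> (\<gamma> t) \<in> E"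
    proof -
      have "\<forall>\<^sub>F t in nhds 0. \<phi> (\<gamma> t) \<in> E"
        using evi evU by eventually_elim (use G(4) M(6) in blast)
      then show ?thesis by (rule filter_leD[OF at_within_le_nhds])
    qed
    then have eE: "\<phi>' w \<in> E"
      by (rule vector_derivative_in_subspace[OF p\<gamma> M(5)]) (use px G(5) in simp)
    have "((\<lambda>t. \<psi> (\<phi> (\<gamma> t))) has_vector_derivative \<psi>' (\<phi>' w)) (at 0)"
      using diff_chain_at[of "\<lambda>t. \<phi> (\<gamma> t)" "\<lambda>t. t *\<^sub>R \<phi>' w" 0 \<psi> \<psi>'] p\<gamma> \<psi>' G(5) linear_cmul[OF has_derivative_linear[OF \<psi>']]
      by (simp add: has_vector_derivative_def o_def)
    moreover have "\<forall>\<^sub>F t in nhds 0. \<gamma> t = \<psi> (\<phi> (\<gamma> t))"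
      using evU by eventually_elim (use M(4) in \<open>simp add: homeomorphism_def\<close>)
    ultimately have "(\<gamma> has_vector_derivative \<psi>' (\<phi>' w)) (at 0)"
      using has_vector_derivative_transform_at_nhds by blast
    then have "w = \<psi>' (\<phi>' w)" using w vector_derivative_unique_at by blast
    then show "v \<in> (\<lambda>e. D (\<psi>' e)) ` E" using vD eE by (metis imageI)
  qed
  have linL: "linear (\<lambda>e. D (\<psi>' e))"
    using linear_compose[OF has_derivative_linear[OF \<psi>'] has_derivative_linear[OF F(2)]] by (simp add: o_def)
  obtain T where T: "range T \<subseteq> E" "linear T" "\<And>v. D (\<psi>' (T v)) = v"
    using real_vector.linear_exists_right_inverse_on[OF linL M(5)] unfolding onto by auto
  define p where "p v = \<psi> (\<phi> x + T v)" for v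
  have contT: "continuous_on UNIV T" using T(2) linear_continuous_on linear_conv_bounded_linear by blast
  have open1: "open ((\<lambda>v. \<phi> x + T v) -` W0)"
    using oU(2) by (intro open_vimage continuous_intros contT)
  have contp: "continuous_on ((\<lambda>v. \<phi> x + T v) -` W0) p"
    unfolding p_def by (rule continuous_on_compose2[OF smooth_on_continuous[OF M(3)]])
      (auto intro!: continuous_intros continuous_on_subset[OF contT])
  define B where "B = (\<lambda>v. \<phi> x + T v) -` W0 \<inter> p -` (W \<inter> ball x \<epsilon>)"
  have oB: "open B" unfolding B_def
    by (rule continuous_open_preimage[OF contp open1]) (use W(1) in auto)
  have p0: "p 0 = x" using px(3) by (simp add: p_def linear_0[OF T(2)])
  have zB: "0 \<in> B" using px(1) p0 W(2) \<epsilon> by (simp add: B_def linear_0[OF T(2)])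
  have "((\<lambda>v. \<phi> x + T v) has_derivative T) (at 0)"
    using linear_imp_has_derivative[OF T(2)] by (auto intro!: derivative_eq_intros)
  from diff_chain_at[OF this, of \<psi> \<psi>'] have "(p has_derivative (\<lambda>v. \<psi>' (T v))) (at 0)"
    using \<psi>' by (simp add: p_def[abs_def] o_def linear_0[OF T(2)])
  from diff_chain_at[OF this, of F D] have der: "((\<lambda>v. F (p v)) has_derivative (\<lambda>v. v)) (at 0)"
    using F(2) T(3) by (simp add: o_def p0)
  have "F (p 0) \<in> interior ((\<lambda>v. F (p v)) ` B)"
  proof (rule sussmann_open_mapping[OF oB _ zB der])
    show "continuous_on B (\<lambda>v. F (p v))"
      by (rule continuous_on_compose2[OF F(1) continuous_on_subset[OF contp]]) (auto simp: B_def)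
    show "bounded_linear (\<lambda>v::'e. v)" by (rule bounded_linear_ident)
    show "0 \<in> interior B" using oB zB by (simp add: interior_open)
  qed auto
  then obtain \<delta> where \<delta>: "\<delta> > 0" "ball (F x) \<delta> \<subseteq> (\<lambda>v. F (p v)) ` B"
    by (auto simp: mem_interior p0)
  have "(\<lambda>v. F (p v)) ` B \<subseteq> F ` (S \<inter> ball x \<epsilon>)"
  proof clarify
    fix v assume v: "v \<in> B"
    have "\<phi> x + T v \<in> W0 \<inter> E"
      using v px(2) T(1) M(5) by (auto simp: B_def intro!: subspace_add)
    then obtain z where z: "z \<in> S" "z \<in> U" "\<phi> x + T v = \<phi> z" using M(6) by blast
    then have "p v = z" using M(4) by (simp add: p_def homeomorphism_def)
    then show "F (p v) \<in> F ` (S \<inter> ball x \<epsilon>)" using z(1) v by (auto simp: B_def)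
  qed
  with \<delta> show ?thesis by blast
qed

text \<open>Each point of a finite part \<open>X\<close> of a noncritical fibre lies in a stratum
  that maps openly there, so over every parameter near \<open>\<theta>0\<close> the points persist
  in disjoint balls. Some such parameter avoids \<open>N0\<close>, where the bound is
  available.\<close>

lemma covers_at_mostI:
  fixes f :: "'a::euclidean_space \<Rightarrow> 'b" and q :: "'e::euclidean_space \<Rightarrow> 'b"
  assumes q: "covering q" and strat: "stratification \<S> A"
    and lift: "\<And>x. x \<in> A \<Longrightarrow> \<exists>W F D. open W \<and> x \<in> W \<and> (\<forall>z\<in>W. f z = q (F z)) \<and> continuous_on W F \<and> (F has_derivative D) (at x)"
    and N0: "negligible N0"
    and bound: "\<And>X \<theta>. finite X \<Longrightarrow> X \<subseteq> A \<Longrightarrow> \<theta> \<notin> N0 \<Longrightarrow> (\<And>x. x \<in> X \<Longrightarrow> f x = q \<theta>) \<Longrightarrow> real (card X) \<le> B"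
  shows "covers_at_most q f A \<S> B"
  unfolding covers_at_most_def
proof (intro ballI impI)
  fix p assume p: "p \<in> range q" and nc: "\<forall>S\<in>\<S>. p \<notin> critical_values q f S"
  obtain \<theta>0 where \<theta>0: "p = q \<theta>0" using p by blast
  have cover: "\<Union>\<S> = A" using strat unfolding stratification_def by (elim conjE)
  obtain dm where dm: "\<forall>S\<in>\<S>. smooth_submanifold (dm S) S"
    using strat unfolding stratification_def by (elim conjE exE) (rule that)
  have fin: "real (card X) \<le> B" if X: "finite X" "X \<subseteq> {x \<in> A. f x = p}" for X
  proof -
    obtain \<epsilon> where \<epsilon>: "\<epsilon> > 0" "\<And>x x'. x \<in> X \<Longrightarrow> x' \<in> X \<Longrightarrow> x \<noteq> x' \<Longrightarrow> 2 * \<epsilon> \<le> dist x x'"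
    proof -
      define P where "P = {(x, x'). x \<in> X \<and> x' \<in> X \<and> x \<noteq> x'}"
      have "finite P" by (rule finite_subset[of _ "X \<times> X"]) (use X in \<open>auto simp: P_def\<close>)
      define m where "m = Min (insert 1 ((\<lambda>(x, x'). dist x x') ` P))"
      have "m > 0" using \<open>finite P\<close> by (auto simp: m_def P_def)
      moreover have "m \<le> dist x x'" if "x \<in> X" "x' \<in> X" "x \<noteq> x'" for x x'
      proof -
        have "(\<lambda>(x, x'). dist x x') (x, x') \<in> (\<lambda>(x, x'). dist x x') ` P"
          by (rule imageI) (use that in \<open>simp add: P_def\<close>)
        then show ?thesis unfolding m_def using \<open>finite P\<close> by (intro Min_le) auto
      qed
      ultimately show thesis using that[of "m / 2"] by auto
    qed
    have "\<exists>\<delta>>0. \<forall>\<theta>\<in>ball \<theta>0 \<delta>. \<exists>x'\<in>A \<inter> ball x \<epsilon>. f x' = q \<theta>" if x: "x \<in> X" for x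
    proof -
      have xA: "x \<in> A" "f x = p" using x X(2) by auto
      obtain S where S: "S \<in> \<S>" "x \<in> S" using cover xA(1) by blast
      have k: "smooth_submanifold (dm S) S" using dm S(1) by blast
      have SA: "S \<subseteq> A" using cover S(1) by blast
      have di: "differential_image q f S x = UNIV"
        using nc S xA(2) unfolding critical_values_def by blast
      obtain W F D where W: "open W" "x \<in> W" "\<And>z. z \<in> W \<Longrightarrow> f z = q (F z)" "continuous_on W F" "(F has_derivative D) (at x)"
        using lift[OF xA(1)] by blast
      obtain r where r: "r > 0" "ball x r \<subseteq> W" using W(1,2) openE by blast
      obtain \<delta> where \<delta>: "\<delta> > 0" "ball (F x) \<delta> \<subseteq> F ` (S \<inter> ball x (min \<epsilon> r))"
        using stratum_open[OF q k S(2) W(1-5) di, of "min \<epsilon> r"] \<epsilon>(1) r(1) by auto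
      have "\<exists>x'\<in>A \<inter> ball x \<epsilon>. f x' = q \<theta>" if \<theta>: "\<theta> \<in> ball \<theta>0 \<delta>" for \<theta>
      proof -
        \<comment> \<open>\<open>F x\<close> and \<open>\<theta>0\<close> both lie over
          \<open>p\<close>; the displacement \<open>\<theta> - \<theta>0\<close> is transferred from
          one to the other by translation.\<close>
        have "F x + (\<theta> - \<theta>0) \<in> ball (F x) \<delta>" using \<theta> by (simp add: dist_norm norm_minus_commute)
        then obtain z where z: "z \<in> S" "z \<in> ball x (min \<epsilon> r)" "F x + (\<theta> - \<theta>0) = F z" using \<delta>(2) by blast
        have "q (F x) = q \<theta>0" using W(2,3) xA(2) \<theta>0 by metis
        then have "q (F x + (\<theta> - \<theta>0)) = q (\<theta>0 + (\<theta> - \<theta>0))" using q unfolding covering_def by blast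
        then have "f z = q \<theta>" using W(3)[of z] r(2) z by auto
        then show ?thesis using z SA by auto
      qed
      with \<delta>(1) show ?thesis by blast
    qed
    then obtain \<delta>' where \<delta>': "\<And>x. x \<in> X \<Longrightarrow> \<delta>' x > 0"
      "\<And>x \<theta>. x \<in> X \<Longrightarrow> \<theta> \<in> ball \<theta>0 (\<delta>' x) \<Longrightarrow> \<exists>x'\<in>A \<inter> ball x \<epsilon>. f x' = q \<theta>" by metis
    define \<delta> where "\<delta> = Min (insert 1 (\<delta>' ` X))"
    have \<delta>: "\<delta> > 0" "\<And>x. x \<in> X \<Longrightarrow> \<delta> \<le> \<delta>' x" using X(1) \<delta>'(1) by (auto simp: \<delta>_def)
    have "\<not> ball \<theta>0 \<delta> \<subseteq> N0"
      using negligible_subset[OF N0, of "ball \<theta>0 \<delta>"] open_not_negligible[of "ball \<theta>0 \<delta>"] \<delta>(1) by auto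
    then obtain \<theta> where \<theta>: "\<theta> \<in> ball \<theta>0 \<delta>" "\<theta> \<notin> N0" by blast
    have "\<exists>x'\<in>A \<inter> ball x \<epsilon>. f x' = q \<theta>" if "x \<in> X" for x
      using \<delta>'(2)[OF that, of \<theta>] \<theta>(1) \<delta>(2)[OF that] by simp
    then obtain s where s: "\<And>x. x \<in> X \<Longrightarrow> s x \<in> A" "\<And>x. x \<in> X \<Longrightarrow> dist x (s x) < \<epsilon>" "\<And>x. x \<in> X \<Longrightarrow> f (s x) = q \<theta>"
      by (metis IntD1 IntD2 mem_ball)
    have "inj_on s X"
    proof (rule inj_onI, rule ccontr)
      fix x x' assume xx: "x \<in> X" "x' \<in> X" "s x = s x'" "x \<noteq> x'"
      have "dist x x' \<le> dist x (s x) + dist x' (s x')"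
        using dist_triangle[of x x' "s x"] xx(3) by (simp add: dist_commute)
      then show False using s(2)[OF xx(1)] s(2)[OF xx(2)] \<epsilon>(2)[OF xx(1,2,4)] by linarith
    qed
    then have "card X = card (s ` X)" by (simp add: card_image)
    also have "real (card (s ` X)) \<le> B"
      by (rule bound[OF _ _ \<theta>(2)]) (use X(1) s in auto)
    finally show ?thesis by simp
  qed
  have "finite {x \<in> A. f x = p}"
  proof (rule ccontr)
    assume "infinite {x \<in> A. f x = p}"
    then obtain X where X: "X \<subseteq> {x \<in> A. f x = p}" "finite X" "card X = nat \<lceil>B\<rceil> + 1"
      using infinite_arbitrarily_large by blast
    then show False using fin[OF X(2,1)] by linarith
  qed
  then show "finite {x \<in> A. f x = p} \<and> real (card {x \<in> A. f x = p}) \<le> B" using fin by blast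
qed

section \<open>Generic points of the amoeba and of the coamoeba\<close>

definition log_dom :: "complex ^ 'm::finite \<Rightarrow> (complex ^ 'm) set" where
  "log_dom x = {z. \<forall>j. z $ j / x $ j \<notin> \<real>\<^sub>\<le>\<^sub>0}"

text \<open>A branch of the arguments that is smooth on \<open>log_dom x\<close>, where
  \<open>Arg\<close> itself may jump. There it agrees with \<open>Arg\<close> modulo
  \<open>2 * pi\<close> and so lifts both coamoeba maps.\<close>

definition arg_lift :: "complex ^ 'm::finite \<Rightarrow> complex ^ 'm \<Rightarrow> real ^ 'm" where
  "arg_lift x z = (\<chi> j. Arg (x $ j) + Im (Ln (z $ j / x $ j)))"

lemma ctorus_nz: "x \<in> ctorus \<Longrightarrow> x $ j \<noteq> 0"
  by (simp add: ctorus_def)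

lemma open_log_dom:
  fixes x :: "complex ^ 'm::finite"
  shows "open (log_dom x)"
proof -
  have "open ((\<lambda>z :: complex ^ 'm. z $ j / x $ j) -` (- \<real>\<^sub>\<le>\<^sub>0))" for j
    by (cases "x $ j = 0") (auto intro!: open_vimage continuous_intros)
  then have "open (\<Inter>j. (\<lambda>z :: complex ^ 'm. z $ j / x $ j) -` (- \<real>\<^sub>\<le>\<^sub>0))"
    by (intro open_INT) auto
  moreover have "log_dom x = (\<Inter>j. (\<lambda>z :: complex ^ 'm. z $ j / x $ j) -` (- \<real>\<^sub>\<le>\<^sub>0))"
    by (auto simp: log_dom_def)
  ultimately show ?thesis by simp
qed

lemma log_dom_self: "x \<in> ctorus \<Longrightarrow> x \<in> log_dom x"
  by (simp add: log_dom_def ctorus_nz)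

lemma log_dom_ctorus: "log_dom x \<subseteq> ctorus"
proof
  fix z assume "z \<in> log_dom x"
  then have "z $ j / x $ j \<notin> \<real>\<^sub>\<le>\<^sub>0" for j by (simp add: log_dom_def)
  then have "z $ j \<noteq> 0" for j by (metis complex_nonpos_Reals_iff div_0 order_refl zero_complex.sel)
  then show "z \<in> ctorus" by (simp add: ctorus_def)
qed

lemma log_dom_nz: "z \<in> log_dom x \<Longrightarrow> z $ j / x $ j \<noteq> 0"
  unfolding log_dom_def mem_Collect_eq by (drule spec[of _ j]) force

lemma Ln_quotient_has_derivative:
  fixes x z :: "complex ^ 'm::finite"
  assumes z: "z \<in> log_dom x"
  shows "((\<lambda>z. Ln (z $ j / x $ j)) has_derivative (\<lambda>u. u $ j / z $ j)) (at z)"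
proof -
  have nz: "z $ j / x $ j \<notin> \<real>\<^sub>\<le>\<^sub>0" using z by (simp add: log_dom_def)
  have nz': "z $ j \<noteq> 0" "x $ j \<noteq> 0" using log_dom_nz[OF z, of j] by auto
  have 1: "((\<lambda>z. z $ j / x $ j) has_derivative (\<lambda>u. u $ j / x $ j)) (at z)"
    by (intro linear_imp_has_derivative linearI)
      (auto simp: add_divide_distrib scaleR_conv_of_real[where ?'a = complex])
  have 2: "(Ln has_derivative (\<lambda>h. inverse (z $ j / x $ j) * h)) (at (z $ j / x $ j))"
    using has_field_derivative_Ln[OF nz] unfolding has_field_derivative_def .
  show ?thesis
    using diff_chain_at[OF 1 2] nz' by (simp add: o_def field_simps)
qed

lemma Log_map_has_derivative:
  fixes z :: "complex ^ 'm::finite"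
  assumes z: "z \<in> ctorus"
  shows "(Log_map has_derivative (\<lambda>u. \<chi> j. Re (u $ j / z $ j))) (at z)"
proof (rule has_derivative_transform_within_open[OF _ open_log_dom log_dom_self[OF z]])
  show "((\<lambda>w. \<chi> j. Re (Ln (w $ j / z $ j)) + ln (norm (z $ j))) has_derivative (\<lambda>u. \<chi> j. Re (u $ j / z $ j))) (at z)"
  proof (rule has_derivative_vecI)
    fix j
    have "((\<lambda>w. Re (Ln (w $ j / z $ j))) has_derivative (\<lambda>u. Re (u $ j / z $ j))) (at z)"
      by (rule bounded_linear.has_derivative[OF bounded_linear_Re Ln_quotient_has_derivative[OF log_dom_self[OF z]]])
    from has_derivative_add[OF this has_derivative_const]
    show "((\<lambda>w. (\<chi> j. Re (Ln (w $ j / z $ j)) + ln (norm (z $ j))) $ j) has_derivative (\<lambda>u. (\<chi> j. Re (u $ j / z $ j)) $ j)) (at z)"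
      by simp
  qed
  fix w assume w: "w \<in> log_dom z"
  have "Re (Ln (w $ j / z $ j)) + ln (norm (z $ j)) = ln (norm (w $ j))" for j
  proof -
    have "w $ j \<noteq> 0" using w log_dom_ctorus ctorus_nz by blast
    then show ?thesis using ctorus_nz[OF z, of j] by (simp add: norm_divide ln_div)
  qed
  then show "(\<chi> j. Re (Ln (w $ j / z $ j)) + ln (norm (z $ j))) = Log_map w"
    by (simp add: Log_map_def)
qed

lemma arg_lift_has_derivative:
  fixes z :: "complex ^ 'm::finite"
  assumes z: "z \<in> log_dom x"
  shows "(arg_lift x has_derivative (\<lambda>u. \<chi> j. Im (u $ j / z $ j))) (at z)"
proof (rule has_derivative_vecI)
  fix j
  have "((\<lambda>w. Im (Ln (w $ j / x $ j))) has_derivative (\<lambda>u. Im (u $ j / z $ j))) (at z)"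
    by (rule bounded_linear.has_derivative[OF bounded_linear_Im Ln_quotient_has_derivative[OF z]])
  from has_derivative_add[OF has_derivative_const this, of "Arg (x $ j)"]
  show "((\<lambda>w. arg_lift x w $ j) has_derivative (\<lambda>u. (\<chi> j. Im (u $ j / z $ j)) $ j)) (at z)"
    by (simp add: arg_lift_def)
qed

lemma polar: "z = of_real (norm z) * cis (Arg z)"
  by (metis rcis_cmod_Arg rcis_def)

lemma arg_lift_polar:
  assumes x: "x \<in> ctorus" and z: "z \<in> log_dom x"
  shows "z $ j = of_real (norm (z $ j)) * cis (arg_lift x z $ j)"
proof -
  let ?w = "z $ j / x $ j"
  have w: "?w \<noteq> 0" by (rule log_dom_nz[OF z])
  have "?w = exp (Ln ?w)" using w by simp
  also have "\<dots> = of_real (norm ?w) * cis (Im (Ln ?w))"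
    using w by (simp add: exp_eq_polar)
  finally have "z $ j = x $ j * (of_real (norm ?w) * cis (Im (Ln ?w)))"
    using ctorus_nz[OF x, of j] by (simp add: field_simps)
  then have "z $ j = (of_real (norm (x $ j)) * cis (Arg (x $ j))) * (of_real (norm ?w) * cis (Im (Ln ?w)))"
    by (simp only: polar[symmetric])
  also have "\<dots> = of_real (norm (x $ j) * norm ?w) * (cis (Arg (x $ j)) * cis (Im (Ln ?w)))"
    by simp
  also have "norm (x $ j) * norm ?w = norm (z $ j)"
    using ctorus_nz[OF x, of j] by (simp add: norm_divide)
  finally show ?thesis by (simp add: cis_mult arg_lift_def)
qed

lemma cis_eq_imp: "cis a = cis b \<Longrightarrow> \<exists>k::int. a = b + of_int k * (2 * pi)"
  using cis_eq_iff[of b a] by (auto simp: rcong_altdef)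

lemma arg_lift_Arg:
  assumes x: "x \<in> ctorus" and z: "z \<in> log_dom x"
  shows "\<exists>k::int. Arg (z $ j) = arg_lift x z $ j + of_int k * (2 * pi)"
proof -
  have nz: "z $ j \<noteq> 0" using z log_dom_ctorus ctorus_nz by blast
  have "of_real (norm (z $ j)) * cis (Arg (z $ j)) = of_real (norm (z $ j)) * cis (arg_lift x z $ j)"
    using polar[of "z $ j"] arg_lift_polar[OF x z, of j] by simp
  then show ?thesis using nz by (intro cis_eq_imp) simp
qed

lemma Arg_map_lift:
  assumes "x \<in> ctorus" "z \<in> log_dom x"
  shows "Arg_map z = residue_vec (2 * pi) (arg_lift x z)" "Arg_pi_map z = residue_vec pi (arg_lift x z)"
proof -
  show "Arg_map z = residue_vec (2 * pi) (arg_lift x z)"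
    unfolding Arg_map_def residue_vec_eq_iff using arg_lift_Arg[OF assms] by simp
  have "\<exists>k::int. Arg (z $ j) = arg_lift x z $ j + of_int k * pi" for j
  proof -
    obtain k :: int where "Arg (z $ j) = arg_lift x z $ j + of_int k * (2 * pi)" using arg_lift_Arg[OF assms] by blast
    then show ?thesis by (intro exI[of _ "2 * k"]) simp
  qed
  then show "Arg_pi_map z = residue_vec pi (arg_lift x z)"
    unfolding Arg_pi_map_def residue_vec_eq_iff by simp
qed

text \<open>Each coordinate lies on the real line through \<open>cis (\<theta> $ j)\<close>: the
  argument is fixed modulo \<open>pi\<close>, as on the fibres of either coamoeba map.\<close>

definition same_arg :: "real ^ 'm::finite \<Rightarrow> complex ^ 'm \<Rightarrow> bool" where
  "same_arg \<theta> x \<longleftrightarrow> (\<forall>j. Im (x $ j * cis (- (\<theta> $ j))) = 0)"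

lemma same_arg_conj:
  assumes "same_arg \<theta> x"
  shows "x $ j = cis (2 * \<theta> $ j) * cnj (x $ j)"
proof -
  define r where "r = x $ j * cis (- (\<theta> $ j))"
  have "cnj r = r" using assms by (simp add: same_arg_def r_def complex_eq_iff)
  have x: "x $ j = r * cis (\<theta> $ j)" by (simp add: r_def mult.assoc cis_mult)
  have "cis (2 * \<theta> $ j) * cnj (x $ j) = r * (cis (2 * \<theta> $ j) * cis (- (\<theta> $ j)))"
    unfolding x by (simp add: \<open>cnj r = r\<close> cis_cnj)
  also have "\<dots> = x $ j" unfolding x by (simp add: cis_mult)
  finally show ?thesis by simp
qed

lemma same_argI:
  assumes "\<And>j. \<exists>k::int. Arg (x $ j) = \<theta> $ j + of_int k * pi"
  shows "same_arg \<theta> x"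
  unfolding same_arg_def
proof
  fix j
  obtain k :: int where k: "Arg (x $ j) = \<theta> $ j + of_int k * pi" using assms by blast
  have "x $ j * cis (- (\<theta> $ j)) = of_real (norm (x $ j)) * (cis (Arg (x $ j)) * cis (- (\<theta> $ j)))"
    using polar[of "x $ j"] by (simp add: mult.assoc[symmetric])
  also have "\<dots> = of_real (norm (x $ j)) * cis (of_int k * pi)" by (simp add: cis_mult k)
  finally show "Im (x $ j * cis (- (\<theta> $ j))) = 0" by (simp add: sin_zero_iff_int2)
qed

context torus_variety
begin

lemma generic_Log:
  obtains N where "negligible N" "\<And>x. x \<in> V \<Longrightarrow> Log_map x \<notin> N \<Longrightarrow> etale x"
proof -
  obtain N where N: "negligible N"
    "\<And>x. x \<in> V \<Longrightarrow> x \<in> ctorus \<Longrightarrow> Log_map x \<notin> N \<Longrightarrow>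
       \<exists>I G U. (I, G) \<in> charts \<and> good x I G U \<and> (\<forall>u\<in>tang I G x. (\<chi> j. Re (u $ j / x $ j)) = 0 \<longrightarrow> u = 0)"
    apply (rule sard_variety[of ctorus Log_map "\<lambda>z u. \<chi> j. Re (u $ j / z $ j)"])
    subgoal by (rule Log_map_has_derivative)
    subgoal premises p by (rule p(1), rule p(2), rule p(3))
    done
  show thesis
  proof (rule that[OF N(1)])
    fix x assume x: "x \<in> V" "Log_map x \<notin> N"
    then have "x \<in> ctorus" by (simp add: V_def)
    from N(2)[OF x(1) this x(2)] show "etale x"
      unfolding etale_def transverse_def
      by (elim exE conjE) (rule exI, rule exI, rule exI, intro conjI, assumption+, simp add: vec_eq_iff)
  qed
qed

text \<open>Smooth branches of the argument are only local, so Sard's theorem is applied on each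
  \<open>log_dom x0\<close> and the null sets are combined by a countable subcover. A
  \<open>\<theta>\<close> with \<open>same_arg \<theta> y\<close> differs from the branch at
  \<open>y\<close> by integer multiples of \<open>pi\<close>, which explains the translates in
  \<open>?N'\<close>.\<close>

lemma generic_Arg:
  obtains N where "negligible N" "\<And>x \<theta>. x \<in> V \<Longrightarrow> \<theta> \<notin> N \<Longrightarrow> same_arg \<theta> x \<Longrightarrow> etale x"
proof -
  let ?S = "{x \<in> V. \<not> etale x}" and ?t = "\<lambda>x. {\<theta>. same_arg \<theta> x}"
  have "negligible (\<Union>x\<in>?S. ?t x)"
  proof (rule negligible_UN_locally)
    fix x0 assume x0: "x0 \<in> ?S"
    then have x0c: "x0 \<in> ctorus" by (simp add: V_def)
    obtain N where N: "negligible N"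
      "\<And>x. x \<in> V \<Longrightarrow> x \<in> log_dom x0 \<Longrightarrow> arg_lift x0 x \<notin> N \<Longrightarrow>
         \<exists>I G U. (I, G) \<in> charts \<and> good x I G U \<and> (\<forall>u\<in>tang I G x. (\<chi> j. Im (u $ j / x $ j)) = 0 \<longrightarrow> u = 0)"
      apply (rule sard_variety[of "log_dom x0" "arg_lift x0" "\<lambda>z u. \<chi> j. Im (u $ j / z $ j)"])
      subgoal by (rule arg_lift_has_derivative)
      subgoal premises p by (rule p(1), rule p(2), rule p(3))
      done
    let ?N' = "\<Union>k::'m \<Rightarrow> int. (+) (\<chi> j. of_int (k j) * pi) ` N"
    have "negligible ?N'"
      by (rule negligible_countable_Union) (auto intro: negligible_translation N(1))
    moreover have "(\<Union>y\<in>?S \<inter> log_dom x0. ?t y) \<subseteq> ?N'"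
    proof clarify
      fix y \<theta> assume y: "y \<in> V" "\<not> etale y" "y \<in> log_dom x0" and \<theta>: "same_arg \<theta> y"
      have "arg_lift x0 y \<in> N"
      proof (rule ccontr)
        assume "arg_lift x0 y \<notin> N"
        from N(2)[OF y(1,3) this] have "etale y"
          unfolding etale_def transverse_iff_Im
          by (elim exE conjE) (rule exI, rule exI, rule exI, intro conjI, assumption+, simp add: vec_eq_iff)
        with y(2) show False by simp
      qed
      have "\<exists>k::int. \<theta> $ j = of_int k * pi + arg_lift x0 y $ j" for j
      proof -
        let ?\<phi> = "arg_lift x0 y $ j"
        have nz: "y $ j \<noteq> 0" using y(3) log_dom_ctorus ctorus_nz by blast
        have "y $ j * cis (- (\<theta> $ j)) = of_real (norm (y $ j)) * (cis ?\<phi> * cis (- (\<theta> $ j)))"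
          using arg_lift_polar[OF x0c y(3), of j] by (simp add: mult.assoc[symmetric])
        also have "\<dots> = of_real (norm (y $ j)) * cis (?\<phi> - \<theta> $ j)" by (simp add: cis_mult)
        finally have "Im (y $ j * cis (- (\<theta> $ j))) = norm (y $ j) * sin (?\<phi> - \<theta> $ j)"
          by (simp only:) simp
        then have "norm (y $ j) * sin (?\<phi> - \<theta> $ j) = 0"
          using \<theta>[unfolded same_arg_def, rule_format, of j] by simp
        then have "sin (\<theta> $ j - ?\<phi>) = 0" using nz by (simp add: sin_diff mult.commute)
        then obtain k :: int where "\<theta> $ j - ?\<phi> = of_int k * pi" using sin_zero_iff_int2 by blast
        then show ?thesis by (intro exI[of _ k]) simp
      qed
      then obtain k where k: "\<And>j. \<theta> $ j = of_int (k j) * pi + arg_lift x0 y $ j" by metis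
      have "\<theta> = (\<chi> j. of_int (k j) * pi) + arg_lift x0 y" by (simp add: vec_eq_iff k)
      then show "\<theta> \<in> ?N'" using \<open>arg_lift x0 y \<in> N\<close> by blast
    qed
    ultimately show "\<exists>U. open U \<and> x0 \<in> U \<and> negligible (\<Union>y\<in>?S \<inter> U. ?t y)"
      using open_log_dom[of x0] log_dom_self[OF x0c] negligible_subset by blast
  qed
  then show thesis by (rule that) auto
qed

theorem Log_covers:
  assumes "stratification \<S> V"
  shows "covers_at_most (\<lambda>x. x) Log_map V \<S> Log_bound"
proof -
  obtain N where N: "negligible N" "\<And>x. x \<in> V \<Longrightarrow> Log_map x \<notin> N \<Longrightarrow> etale x"
    apply (rule generic_Log)
    subgoal premises p by (rule p(1), rule p(2), rule p(3))
    done
  show ?thesis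
  proof (rule covers_at_mostI[OF covering_id assms _ N(1)])
    fix x assume "x \<in> V"
    then have x: "x \<in> ctorus" by (simp add: V_def)
    have "continuous_on ctorus (Log_map :: complex ^ 'm \<Rightarrow> _)"
      by (rule has_derivative_continuous_on, rule has_derivative_at_withinI, rule Log_map_has_derivative)
    then show "\<exists>W F D. open W \<and> x \<in> W \<and> (\<forall>z\<in>W. Log_map z = F z) \<and> continuous_on W F \<and> (F has_derivative D) (at x)"
      using open_ctorus x Log_map_has_derivative[OF x]
      by (intro exI[of _ ctorus] exI[of _ Log_map] exI) auto
  next
    fix X :: "(complex ^ 'm) set" and \<theta>
    assume X: "finite X" "X \<subseteq> V" "\<theta> \<notin> N" "\<And>x. x \<in> X \<Longrightarrow> Log_map x = \<theta>"
    show "real (card X) \<le> Log_bound"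
    proof (rule Log_fibre_bound[OF X(1), where \<rho> = "\<lambda>j. exp (\<theta> $ j)"])
      show "etale x" if "x \<in> X" for x using N(2)[of x] X that by auto
      show "norm (x $ j) = exp (\<theta> $ j)" if x: "x \<in> X" for x j
      proof -
        have "x \<in> ctorus" using x X(2) by (auto simp: V_def)
        then have "norm (x $ j) > 0" using ctorus_nz by simp
        moreover have "\<theta> $ j = ln (norm (x $ j))" using X(4)[OF x] by (auto simp: Log_map_def)
        ultimately show ?thesis by simp
      qed
    qed
  qed
qed

lemma Arg_fibre_bound_generic:
  assumes "finite X" "X \<subseteq> V" "\<And>x. x \<in> X \<Longrightarrow> etale x" "\<And>x. x \<in> X \<Longrightarrow> same_arg \<theta> x"
  shows "real (card X) \<le> (\<Prod>j=1..n. (real (d j))\<^sup>2)"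
proof -
  have "card X \<le> (\<Prod>j=1..n. (d j)\<^sup>2)"
    by (rule Arg_fibre_bound[OF assms(1,3), where t = "\<lambda>j. cis (2 * \<theta> $ j)"]) (use assms(4) same_arg_conj in auto)
  then have "real (card X) \<le> real (\<Prod>j=1..n. (d j)\<^sup>2)" by (rule of_nat_mono)
  then show ?thesis by simp
qed

text \<open>Equality of arguments modulo \<open>2 * pi\<close> implies equality modulo
  \<open>pi\<close>, so one generic bound serves both maps.\<close>

theorem Arg_covers:
  assumes "stratification \<S> V"
  shows "covers_at_most (residue_vec pi) Arg_pi_map V \<S> (\<Prod>j=1..n. (real (d j))\<^sup>2)"
    and "covers_at_most (residue_vec (2 * pi)) Arg_map V \<S> (\<Prod>j=1..n. (real (d j))\<^sup>2)"
proof -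
  obtain N where N: "negligible N" "\<And>x \<theta>. x \<in> V \<Longrightarrow> \<theta> \<notin> N \<Longrightarrow> same_arg \<theta> x \<Longrightarrow> etale x"
    apply (rule generic_Arg)
    subgoal premises p by (rule p(1), rule p(2), rule p(3))
    done
  have cont: "continuous_on (log_dom x) (arg_lift x)" for x :: "complex ^ 'm"
    by (rule has_derivative_continuous_on, rule has_derivative_at_withinI, rule arg_lift_has_derivative)
  have bound: "real (card X) \<le> (\<Prod>j=1..n. (real (d j))\<^sup>2)"
    if "finite X" "X \<subseteq> V" "\<theta> \<notin> N" "\<And>x. x \<in> X \<Longrightarrow> same_arg \<theta> x" for X \<theta>
    by (rule Arg_fibre_bound_generic[where \<theta> = \<theta>]) (use that N(2) in auto)
  show "covers_at_most (residue_vec pi) Arg_pi_map V \<S> (\<Prod>j=1..n. (real (d j))\<^sup>2)"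
  proof (rule covers_at_mostI[OF covering_residue_vec[OF pi_gt_zero] assms _ N(1)])
    fix x assume "x \<in> V"
    then have x: "x \<in> ctorus" by (simp add: V_def)
    show "\<exists>W F D. open W \<and> x \<in> W \<and> (\<forall>z\<in>W. Arg_pi_map z = residue_vec pi (F z)) \<and> continuous_on W F \<and> (F has_derivative D) (at x)"
      using open_log_dom[of x] log_dom_self[OF x] Arg_map_lift(2)[OF x] cont[of x] arg_lift_has_derivative[OF log_dom_self[OF x]]
      by (intro exI[of _ "log_dom x"] exI[of _ "arg_lift x"] exI) auto
  next
    fix X :: "(complex ^ 'm) set" and \<theta> :: "real ^ 'm"
    assume X: "finite X" "X \<subseteq> V" "\<theta> \<notin> N" "\<And>x. x \<in> X \<Longrightarrow> Arg_pi_map x = residue_vec pi \<theta>"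
    show "real (card X) \<le> (\<Prod>j=1..n. (real (d j))\<^sup>2)"
    proof (rule bound[OF X(1-3)])
      fix x assume "x \<in> X"
      then show "same_arg \<theta> x"
        by (intro same_argI) (use X(4) in \<open>simp add: Arg_pi_map_def residue_vec_eq_iff\<close>)
    qed
  qed
  show "covers_at_most (residue_vec (2 * pi)) Arg_map V \<S> (\<Prod>j=1..n. (real (d j))\<^sup>2)"
  proof (rule covers_at_mostI[OF covering_residue_vec assms _ N(1)])
    show "2 * pi > 0" by simp
    fix x assume "x \<in> V"
    then have x: "x \<in> ctorus" by (simp add: V_def)
    show "\<exists>W F D. open W \<and> x \<in> W \<and> (\<forall>z\<in>W. Arg_map z = residue_vec (2 * pi) (F z)) \<and> continuous_on W F \<and> (F has_derivative D) (at x)"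
      using open_log_dom[of x] log_dom_self[OF x] Arg_map_lift(1)[OF x] cont[of x] arg_lift_has_derivative[OF log_dom_self[OF x]]
      by (intro exI[of _ "log_dom x"] exI[of _ "arg_lift x"] exI) auto
  next
    fix X :: "(complex ^ 'm) set" and \<theta> :: "real ^ 'm"
    assume X: "finite X" "X \<subseteq> V" "\<theta> \<notin> N" "\<And>x. x \<in> X \<Longrightarrow> Arg_map x = residue_vec (2 * pi) \<theta>"
    show "real (card X) \<le> (\<Prod>j=1..n. (real (d j))\<^sup>2)"
    proof (rule bound[OF X(1-3)])
      fix x assume x: "x \<in> X"
      show "same_arg \<theta> x"
      proof (rule same_argI)
        fix j
        obtain k :: int where "Arg (x $ j) = \<theta> $ j + of_int k * (2 * pi)"
          using X(4)[OF x] unfolding Arg_map_def residue_vec_eq_iff by auto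
        then show "\<exists>k::int. Arg (x $ j) = \<theta> $ j + of_int k * pi" by (intro exI[of _ "2 * k"]) simp
      qed
    qed
  qed
qed

end

section \<open>Volume of the amoeba\<close>

lemma measurable_reindex: "reindex \<in> borel_measurable borel"
  by (intro borel_measurable_continuous_onI linear_continuous_on)
     (use linear_reindex linear_conv_bounded_linear in blast)

lemma measurable_unindex: "unindex \<in> borel_measurable borel"
  by (intro borel_measurable_continuous_onI linear_continuous_on)
     (use linear_unindex linear_conv_bounded_linear in blast)

lemma emeasure_lborel_box_cart:
  fixes l u :: "real ^ 'k::finite"
  assumes "\<And>i. l $ i \<le> u $ i"
  shows "emeasure lborel (box l u) = ennreal (\<Prod>i\<in>UNIV. u $ i - l $ i)"
proof -
  have Basis: "(Basis :: (real ^ 'k) set) = range (\<lambda>i. axis i 1)" by (auto simp: Basis_vec_def)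
  have "emeasure lborel (box l u) = ennreal (\<Prod>b\<in>Basis. (u - l) \<bullet> b)"
    by (rule emeasure_lborel_box) (use assms in \<open>auto simp: Basis inner_axis\<close>)
  also have "(\<Prod>b\<in>Basis. (u - l) \<bullet> b) = (\<Prod>i\<in>UNIV. u $ i - l $ i)"
    unfolding Basis by (subst prod.reindex) (auto simp: inj_on_def axis_eq_axis inner_axis)
  finally show ?thesis .
qed

lemma distr_reindex: "distr lborel borel (reindex :: real ^ 'a::finite \<Rightarrow> _) = lborel"
proof (rule lborel_eqI[symmetric])
  fix l u :: "real ^ 'a fin"
  assume "\<And>b. b \<in> Basis \<Longrightarrow> l \<bullet> b \<le> u \<bullet> b"
  then have le: "l $ k \<le> u $ k" for k
    by (metis axis_in_Basis_iff cart_eq_inner_axis Basis_real_def insertI1)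
  have inv: "inv fin_idx (fin_idx k) = k" "fin_idx (inv fin_idx i) = i" for k and i :: 'a
    by (rule inv_f_f[OF bij_is_inj[OF bij_fin_idx]], rule surj_f_inv_f[OF bij_is_surj[OF bij_fin_idx]])
  have all: "(\<forall>k. R k (fin_idx k)) \<longleftrightarrow> (\<forall>i :: 'a. R (inv fin_idx i) i)" for R
    by (metis inv)
  have pre: "reindex -` box l u = box (unindex l) (unindex u)"
    by (simp add: set_eq_iff mem_box_cart reindex_def unindex_def all[of "\<lambda>k i. l $ k < _ $ i \<and> _ $ i < u $ k"])
  have le': "unindex l $ i \<le> unindex u $ i" for i by (simp add: unindex_def le)
  have "emeasure (distr lborel borel reindex) (box l u) = emeasure lborel (box (unindex l) (unindex u))"
    using measurable_reindex by (subst emeasure_distr) (auto simp: pre)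
  also have "\<dots> = ennreal (\<Prod>i\<in>UNIV. unindex u $ i - unindex l $ i)" by (rule emeasure_lborel_box_cart[OF le'])
  also have "(\<Prod>i\<in>UNIV. unindex u $ i - unindex l $ i) = (\<Prod>k\<in>UNIV. u $ k - l $ k)"
    by (rule prod.reindex_bij_witness[of _ fin_idx "inv fin_idx"])
       (auto simp: unindex_def inv)
  also have "ennreal \<dots> = emeasure lborel (box l u)" by (rule emeasure_lborel_box_cart[OF le, symmetric])
  also have "\<dots> = ennreal (\<Prod>b\<in>Basis. (u - l) \<bullet> b)"
    by (rule emeasure_lborel_box) fact
  finally show "emeasure (distr lborel borel reindex) (box l u) = ennreal (\<Prod>b\<in>Basis. (u - l) \<bullet> b)" .
qed simp

lemma emeasure_unindex_vimage:
  fixes A :: "(real ^ 'a::finite) set"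
  assumes "A \<in> sets borel"
  shows "emeasure lborel (unindex -` A) = emeasure lborel A"
proof -
  have m: "unindex -` A \<in> sets borel"
    using measurable_sets[OF measurable_unindex assms] by simp
  have "emeasure lborel (unindex -` A) = emeasure (distr lborel borel reindex) (unindex -` A)"
    by (simp add: distr_reindex)
  also have "\<dots> = emeasure lborel (reindex -` unindex -` A)"
    using measurable_reindex m by (subst emeasure_distr) auto
  also have "reindex -` unindex -` A = A" by auto
  finally show ?thesis .
qed

text \<open>The square of the determinant is the determinant of \<open>-1\<close>, which is 1 in
  even dimension.\<close>

lemma det_matrix_comp_minus_id:
  fixes L :: "real ^ 'a::finite \<Rightarrow> real ^ 'a"
  assumes lin: "linear L" and sq: "\<And>h. L (L h) = - h" and even: "even CARD('a)"
  shows "\<bar>det (matrix L)\<bar> = 1"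
proof -
  have "matrix L ** matrix L = matrix (L \<circ> L)" by (rule matrix_compose[OF lin lin, symmetric])
  also have "L \<circ> L = (\<lambda>h. - h)" using sq by auto
  finally have "det (matrix L) * det (matrix L) = det (matrix (\<lambda>h :: real ^ 'a. - h))"
    by (metis det_mul)
  also have "\<dots> = (-1) ^ CARD('a)"
    using det_matrix_scaleR[of "-1", where ?'n = 'a] by (simp add: scaleR_minus1_left[abs_def])
  also have "\<dots> = 1" using even by simp
  finally have "\<bar>det (matrix L)\<bar> * \<bar>det (matrix L)\<bar> = 1" by (simp add: abs_mult[symmetric])
  then show ?thesis by (metis abs_ge_zero abs_of_nonneg abs_square_eq_1 power2_eq_square)
qed

text \<open>The determinant condition is stated through a square of the derivative being \<open>-1\<close>, which is
  invariant under reindexing.\<close>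

lemma emeasure_image_rotation:
  fixes g :: "real ^ 'a::finite \<Rightarrow> real ^ 'a"
  assumes hom: "homeomorphism P R g gi" and P: "open P" and R: "open R"
    and der: "\<And>x. x \<in> P \<Longrightarrow> (g has_derivative g' x) (at x)"
    and sq: "\<And>x h. x \<in> P \<Longrightarrow> g' x (g' x h) = - h" and even: "even CARD('a)"
    and Q: "Q \<in> sets borel" "Q \<subseteq> P" "bounded Q"
  shows "g ` Q \<in> sets borel" "emeasure lborel (g ` Q) = emeasure lborel Q"
proof -
  have gQ: "g ` Q = {y \<in> R. gi y \<in> Q}"
    using hom Q(2) unfolding homeomorphism_def by force
  have "(\<lambda>y. if y \<in> R then gi y else undefined) \<in> borel_measurable borel"
    using hom R by (intro borel_measurable_continuous_on_if) (auto simp: homeomorphism_def)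
  from measurable_sets[OF this Q(1)]
  have "(\<lambda>y. if y \<in> R then gi y else undefined) -` Q \<inter> R \<in> sets borel" using R by auto
  also have "(\<lambda>y. if y \<in> R then gi y else undefined) -` Q \<inter> R = g ` Q" unfolding gQ by auto
  finally show gQb: "g ` Q \<in> sets borel" .
  let ?g = "\<lambda>y. reindex (g (unindex y))" and ?Q = "unindex -` Q"
  let ?g' = "\<lambda>y h. reindex (g' (unindex y) (unindex h))"
  have Qm: "?Q \<in> sets borel" using measurable_sets[OF measurable_unindex Q(1)] by simp
  have im: "?g ` ?Q = unindex -` (g ` Q)"
  proof (intro equalityI subsetI)
    fix y assume "y \<in> unindex -` (g ` Q)"
    then obtain q where q: "q \<in> Q" "unindex y = g q" by auto
    then have "y = reindex (g (unindex (reindex q)))" by (metis reindex_unindex unindex_reindex)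
    with q(1) show "y \<in> ?g ` ?Q" by (intro image_eqI[of _ _ "reindex q"]) auto
  qed auto
  have "bounded (reindex ` Q)"
    using Q(3) linear_reindex linear_conv_bounded_linear by (blast intro: bounded_linear_image)
  moreover have "?Q = reindex ` Q" by (auto simp: image_iff) (metis reindex_unindex)
  ultimately have lm: "?Q \<in> lmeasurable"
    using Qm by (metis bounded_set_imp_lmeasurable sets_completionI_sets sets_lborel)
  have der': "(?g has_derivative ?g' y) (at y within ?Q)" if "y \<in> ?Q" for y
  proof -
    have "(unindex has_derivative unindex) (at y)" by (rule linear_imp_has_derivative[OF linear_unindex])
    from diff_chain_at[OF this, of g] have "((\<lambda>y. g (unindex y)) has_derivative (\<lambda>h. g' (unindex y) (unindex h))) (at y)"
      using der[of "unindex y"] that Q(2) by (auto simp: o_def)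
    from bounded_linear.has_derivative[OF linear_reindex[unfolded linear_conv_bounded_linear] this]
    show ?thesis by (rule has_derivative_at_withinI)
  qed
  have inj: "inj_on ?g ?Q"
  proof (rule inj_onI)
    fix x y assume xy: "x \<in> ?Q" "y \<in> ?Q" "?g x = ?g y"
    have "g (unindex x) = g (unindex y)" using xy(3) by (metis unindex_reindex)
    then have "unindex x = unindex y" using hom xy(1,2) Q(2) by (metis homeomorphism_apply1 subsetD vimageE)
    then show "x = y" by (metis reindex_unindex)
  qed
  have det: "\<bar>det (matrix (?g' y))\<bar> = 1" if "y \<in> ?Q" for y
  proof (rule det_matrix_comp_minus_id)
    show "linear (?g' y)" using der'[OF that] by (rule has_derivative_linear)
    show "?g' y (?g' y h) = - h" for h
    proof -
      have "unindex y \<in> P" using that Q(2) by auto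
      then have "?g' y (?g' y h) = reindex (- unindex h)" by (simp add: sq)
      also have "\<dots> = - reindex (unindex h)" by (rule linear_neg[OF linear_reindex])
      finally show ?thesis by simp
    qed
    show "even CARD('a fin)" using even by simp
  qed
  have "((\<lambda>x. \<bar>det (matrix (?g' x))\<bar>) has_integral measure lebesgue ?Q) ?Q"
  proof (rule has_integral_eq)
    show "((\<lambda>x. 1) has_integral measure lebesgue ?Q) ?Q"
      using lm by (simp add: lmeasure_integral has_integral_integral[symmetric] lmeasurable_iff_integrable_on)
    show "1 = \<bar>det (matrix (?g' x))\<bar>" if "x \<in> ?Q" for x using det[OF that] by simp
  qed
  then have *: "?g ` ?Q \<in> lmeasurable" "measure lebesgue (?g ` ?Q) = measure lebesgue ?Q"
    using has_measure_differentiable_image[OF _ der' inj, of "measure lebesgue ?Q"] lm by (auto intro: fmeasurableD)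
  have gm: "?g ` ?Q \<in> sets borel" unfolding im using measurable_sets[OF measurable_unindex gQb] by simp
  have "emeasure lborel (g ` Q) = emeasure lborel (unindex -` (g ` Q))" by (rule emeasure_unindex_vimage[OF gQb, symmetric])
  also have "\<dots> = emeasure lebesgue (?g ` ?Q)" using gm by (simp add: im)
  also have "\<dots> = emeasure lebesgue ?Q" 
    by (simp only: emeasure_eq_measure2[OF *(1)] emeasure_eq_measure2[OF lm] *(2))
  also have "\<dots> = emeasure lborel ?Q" using Qm by simp
  also have "\<dots> = emeasure lborel Q" by (rule emeasure_unindex_vimage[OF Q(1)])
  finally show "emeasure lborel (g ` Q) = emeasure lborel Q" .
qed

lemma inverse_function_vec:
  fixes a :: "real ^ 'a::finite \<Rightarrow> real ^ 'a"
  assumes D: "open D" and der: "\<And>r. r \<in> D \<Longrightarrow> (a has_derivative a' r) (at r)"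
    and cont: "\<And>h. continuous_on D (\<lambda>r. a' r h)" and r0: "r0 \<in> D" "inj (a' r0)"
  obtains U V k where "open U" "U \<subseteq> D" "r0 \<in> U" "open V" "homeomorphism U V a k"
    "\<And>y. y \<in> V \<Longrightarrow> (k has_derivative inv (a' (k y))) (at y)" "\<And>y. y \<in> V \<Longrightarrow> bij (a' (k y))"
proof -
  define A where "A r = (if r \<in> D then Blinfun (a' r) else 0)" for r
  have A: "blinfun_apply (A r) = a' r" if "r \<in> D" for r
    using that has_derivative_bounded_linear[OF der[OF that]] by (simp add: A_def bounded_linear_Blinfun_apply)
  have lin: "linear (a' r0)" using der[OF r0(1)] by (rule has_derivative_linear)
  then obtain b where b: "linear b" "b \<circ> a' r0 = id" using linear_injective_left_inverse[OF lin r0(2)] by blast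
  define B where "B = Blinfun b"
  have B: "blinfun_apply B = b"
    unfolding B_def by (rule bounded_linear_Blinfun_apply) (use b(1) linear_conv_bounded_linear in blast)
  have "continuous_on D A"
  proof (rule continuous_on_blinfun_componentwise)
    fix h show "continuous_on D (\<lambda>r. blinfun_apply (A r) h)"
      by (rule continuous_on_eq[OF cont[of h]]) (simp add: A)
  qed
  moreover have "(a has_derivative blinfun_apply (A r)) (at r)" if "r \<in> D" for r
    using der[OF that] A[OF that] by simp
  moreover have "B o\<^sub>L A r0 = id_blinfun"
    using b(2) by (intro blinfun_eqI) (simp add: A[OF r0(1)] B fun_eq_iff)
  ultimately obtain U V k k' where *: "open U" "U \<subseteq> D" "r0 \<in> U" "open V" "homeomorphism U V a k"
    "\<And>y. y \<in> V \<Longrightarrow> (k has_derivative (k' y)) (at y)"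
    "\<And>y. y \<in> V \<Longrightarrow> k' y = inv (blinfun_apply (A (k y)))"
    "\<And>y. y \<in> V \<Longrightarrow> bij (blinfun_apply (A (k y)))"
    using inverse_function_theorem[OF D _ _ r0(1), of a A B] by metis
  have "k y \<in> D" if "y \<in> V" for y using *(2,5) that by (auto simp: homeomorphism_def)
  then show thesis using that[OF *(1-5)] *(6-8) A by simp
qed

lemma negligible_AE_lborel: "negligible N \<Longrightarrow> AE x in lborel. x \<notin> N"
  using AE_not_in[of N lebesgue] by (simp add: negligible_iff_null_sets AE_completion_iff)

lemma overlap_bound:
  assumes I: "finite I" and B: "\<And>i. i \<in> I \<Longrightarrow> B i \<in> sets borel" "\<And>i. i \<in> I \<Longrightarrow> B i \<subseteq> C" and C: "C \<in> sets borel"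
    and ae: "AE x in lborel. real (card {i \<in> I. x \<in> B i}) \<le> b"
  shows "(\<Sum>i\<in>I. emeasure lborel (B i)) \<le> ennreal b * emeasure lborel (C :: 'a::euclidean_space set)"
proof -
  have "(\<Sum>i\<in>I. emeasure lborel (B i)) = (\<Sum>i\<in>I. \<integral>\<^sup>+x. indicator (B i) x \<partial>lborel)"
    using B(1) by (intro sum.cong) auto
  also have "\<dots> = (\<integral>\<^sup>+x. (\<Sum>i\<in>I. indicator (B i) x) \<partial>lborel)"
    using B(1) by (intro nn_integral_sum[symmetric]) auto
  also have "\<dots> \<le> (\<integral>\<^sup>+x. ennreal b * indicator C x \<partial>lborel)"
  proof (rule nn_integral_mono_AE)
    show "AE x in lborel. (\<Sum>i\<in>I. indicator (B i) x) \<le> ennreal b * indicator C x"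
      using ae
    proof eventually_elim
      case (elim x)
      have eq: "(\<Sum>i\<in>I. indicator (B i) x) = (of_nat (card {i \<in> I. x \<in> B i}) :: ennreal)"
        using I by (simp add: indicator_def sum.If_cases Int_def conj_commute cong: conj_cong)
      show ?case
      proof (cases "x \<in> C")
        case True
        have "of_nat (card {i \<in> I. x \<in> B i}) = ennreal (real (card {i \<in> I. x \<in> B i}))"
          by (simp add: ennreal_of_nat_eq_real_of_nat)
        also have "\<dots> \<le> ennreal b" using elim by (rule ennreal_leI)
        finally show ?thesis using True by (simp add: eq)
      next
        case False
        then have "{i \<in> I. x \<in> B i} = {}" using B(2) by auto
        then show ?thesis using eq by simp
      qed
    qed
  qed
  also have "\<dots> = ennreal b * emeasure lborel C" using C by (simp add: nn_integral_cmult)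
  finally show ?thesis .
qed

section \<open>Sheets of the amoeba map\<close>

definition sheet_pt :: "(real ^ 'm \<Rightarrow> real ^ 'm) \<Rightarrow> real ^ 'm \<Rightarrow> complex ^ 'm::finite" where
  "sheet_pt g u = (\<chi> j. of_real (exp (u $ j)) * cis (g u $ j))"

lemma Log_sheet_pt [simp]: "Log_map (sheet_pt g u) = u"
  by (simp add: Log_map_def sheet_pt_def vec_eq_iff norm_mult)

context torus_variety
begin

text \<open>The arguments as functions of the logarithms of the moduli. The condition on
  \<open>g'\<close> says that the tangent vectors \<open>h + \<i> g' h\<close> form a complex
  subspace; boundedness keeps volumes finite and makes the arguments meet finitely many
  periods.\<close>

definition is_sheet :: "(real ^ 'm) set \<Rightarrow> (real ^ 'm \<Rightarrow> real ^ 'm) \<Rightarrow> bool" where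
  "is_sheet P g \<longleftrightarrow> open P \<and> bounded P \<and> bounded (g ` P) \<and> (\<forall>u\<in>P. sheet_pt g u \<in> V) \<and>
     (\<exists>R gi g'. open R \<and> homeomorphism P R g gi \<and> (\<forall>u\<in>P. (g has_derivative g' u) (at u)) \<and>
       (\<forall>u\<in>P. \<forall>h. g' u (g' u h) = - h))"

text \<open>Along the slice, \<open>a\<close> and \<open>b\<close> are the real and imaginary parts
  of the logarithmic coordinates. Transversality makes both local diffeomorphisms, because excluding
  imaginary tangent vectors also excludes real ones, and the sheet is \<open>b\<close> after the
  inverse of \<open>a\<close>.\<close>

lemma sheet_exists:
  assumes good: "good x I G U" and tr: "transverse I G x"
  shows "\<exists>P g W. is_sheet P g \<and> open W \<and> x \<in> W \<and> slice I G \<inter> W \<subseteq> sheet_pt g ` P"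
proof -
  have IG: "card I = n" "n \<le> card I" "x \<in> slice I G" "open U" "x \<in> U" "U \<subseteq> ctorus" using good by (auto simp: good_def)
  have xc: "x \<in> ctorus" using IG by auto
  obtain \<kappa> :: "real ^ 'm \<Rightarrow> complex ^ 'm" and \<kappa>' D U0 and \<kappa>i :: "complex ^ 'm \<Rightarrow> real ^ 'm" where K: "open D" "open U0" "x \<in> U0" "\<kappa> ` D = slice I G \<inter> U0"
    "\<And>r. r \<in> D \<Longrightarrow> (\<kappa> has_derivative \<kappa>' r) (at r)"
    "\<And>r. r \<in> D \<Longrightarrow> range (\<kappa>' r) = tang I G (\<kappa> r)"
    "\<And>r. card I = n \<Longrightarrow> r \<in> D \<Longrightarrow> inj (\<kappa>' r)"
    "\<And>r. card I \<noteq> n \<Longrightarrow> \<exists>h. h \<noteq> 0 \<and> \<kappa>' r h = 0"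
    "\<And>h. continuous_on D (\<lambda>r. \<kappa>' r h)"
    "continuous_on UNIV \<kappa>i" "\<And>r. card I = n \<Longrightarrow> r \<in> D \<Longrightarrow> \<kappa>i (\<kappa> r) = r"
    by (rule slice_param[OF card IG(2) good_pf[OF good] IG(3)]) (rule that; assumption)
  obtain r0 where r0: "r0 \<in> D" "x = \<kappa> r0" using K(3,4) IG(3) by blast
  have ck: "continuous_on D \<kappa>"
    by (rule has_derivative_continuous_on, rule has_derivative_at_withinI, rule K(5))
  define D' where "D' = D \<inter> \<kappa> -` (U \<inter> log_dom x)"
  have oD': "open D'" unfolding D'_def
    by (rule continuous_open_preimage[OF ck K(1)]) (use IG(4) open_log_dom in auto)
  have r0': "r0 \<in> D'" using r0 IG(5) log_dom_self[OF xc] by (simp add: D'_def)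
  have D'D: "r \<in> D" and D'U: "\<kappa> r \<in> U" and D'L: "\<kappa> r \<in> log_dom x" and D'c: "\<kappa> r \<in> ctorus"
    and D'V: "\<kappa> r \<in> V" if "r \<in> D'" for r
  proof -
    show 1: "r \<in> D" "\<kappa> r \<in> U" "\<kappa> r \<in> log_dom x" using that by (auto simp: D'_def)
    show "\<kappa> r \<in> ctorus" using 1(2) IG(6) by blast
    have "\<kappa> r \<in> slice I G" using K(4) 1(1) by blast
    then show "\<kappa> r \<in> V" using good_V[OF good_nearby[OF good]] 1(2) by blast
  qed
  define a where "a r = Log_map (\<kappa> r)" for r
  define b where "b r = arg_lift x (\<kappa> r)" for r
  define a' where "a' r h = (\<chi> j. Re (\<kappa>' r h $ j / \<kappa> r $ j))" for r h
  define b' where "b' r h = (\<chi> j. Im (\<kappa>' r h $ j / \<kappa> r $ j))" for r h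
  have da: "(a has_derivative a' r) (at r)" and db: "(b has_derivative b' r) (at r)" if "r \<in> D'" for r
    using diff_chain_at[OF K(5)[OF D'D[OF that]] Log_map_has_derivative[OF D'c[OF that]]]
      diff_chain_at[OF K(5)[OF D'D[OF that]] arg_lift_has_derivative[OF D'L[OF that]]]
    by (simp_all add: a_def[abs_def] b_def[abs_def] a'_def[abs_def] b'_def[abs_def] o_def)
  have cq: "continuous_on D' (\<lambda>r. \<kappa>' r h $ j / \<kappa> r $ j)" for h j
  proof (rule continuous_on_divide)
    show "continuous_on D' (\<lambda>r. \<kappa>' r h $ j)"
      by (intro continuous_intros continuous_on_subset[OF K(9)]) (auto simp: D'D)
    show "continuous_on D' (\<lambda>r. \<kappa> r $ j)"
      by (intro continuous_intros continuous_on_subset[OF ck]) (auto simp: D'D)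
    show "\<forall>r\<in>D'. \<kappa> r $ j \<noteq> 0" using D'c ctorus_nz by blast
  qed
  have ca': "continuous_on D' (\<lambda>r. a' r h)" and cb': "continuous_on D' (\<lambda>r. b' r h)" for h
    unfolding a'_def b'_def by (intro continuous_intros cq)+
  have lk: "linear (\<kappa>' r0)" by (rule has_derivative_linear[OF K(5)[OF r0(1)]])
  have ia: "inj (a' r0)"
  proof (subst linear_injective_0[OF has_derivative_linear[OF da[OF r0']]], intro allI impI)
    fix h assume "a' r0 h = 0"
    then have "\<forall>j. Re (\<kappa>' r0 h $ j / x $ j) = 0" by (simp add: a'_def vec_eq_iff r0(2))
    moreover have "\<kappa>' r0 h \<in> tang I G x" unfolding r0(2) K(6)[OF r0(1), symmetric] by (rule rangeI)
    ultimately have "\<kappa>' r0 h = 0" using tr unfolding transverse_def by blast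
    then show "h = 0" using K(7)[OF IG(1) r0(1)] lk by (metis linear_injective_0)
  qed
  have ib: "inj (b' r0)"
  proof (subst linear_injective_0[OF has_derivative_linear[OF db[OF r0']]], intro allI impI)
    fix h assume "b' r0 h = 0"
    then have "\<forall>j. Im (\<kappa>' r0 h $ j / x $ j) = 0" by (simp add: b'_def vec_eq_iff r0(2))
    moreover have "\<kappa>' r0 h \<in> tang I G x" unfolding r0(2) K(6)[OF r0(1), symmetric] by (rule rangeI)
    ultimately have "\<kappa>' r0 h = 0" using tr unfolding transverse_iff_Im by blast
    then show "h = 0" using K(7)[OF IG(1) r0(1)] lk by (metis linear_injective_0)
  qed
  obtain Ua Va ka where A: "open Ua" "Ua \<subseteq> D'" "r0 \<in> Ua" "open Va" "homeomorphism Ua Va a ka"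
    "\<And>y. y \<in> Va \<Longrightarrow> (ka has_derivative inv (a' (ka y))) (at y)" "\<And>y. y \<in> Va \<Longrightarrow> bij (a' (ka y))"
    by (rule inverse_function_vec[of D' a a' r0, OF oD' da ca' r0' ia]) (assumption, (rule that; assumption))
  obtain Ub Vb kb where B: "open Ub" "Ub \<subseteq> D'" "r0 \<in> Ub" "open Vb" "homeomorphism Ub Vb b kb"
    "\<And>y. y \<in> Vb \<Longrightarrow> (kb has_derivative inv (b' (kb y))) (at y)" "\<And>y. y \<in> Vb \<Longrightarrow> bij (b' (kb y))"
    by (rule inverse_function_vec[of D' b b' r0, OF oD' db cb' r0' ib]) (assumption, (rule that; assumption))
  have cta: "continuous_on D' a" by (rule has_derivative_continuous_on, rule has_derivative_at_withinI, rule da)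
  have ctb: "continuous_on D' b" by (rule has_derivative_continuous_on, rule has_derivative_at_withinI, rule db)
  \<comment> \<open>The unit balls keep both images bounded.\<close>
  define U1 where "U1 = Ua \<inter> Ub \<inter> (D' \<inter> a -` ball (a r0) 1) \<inter> (D' \<inter> b -` ball (b r0) 1)"
  have oU1: "open U1"
    unfolding U1_def by (intro open_Int A(1) B(1) continuous_open_preimage[OF cta oD'] continuous_open_preimage[OF ctb oD'] open_ball)
  have r1: "r0 \<in> U1" using A(3) B(3) r0' by (simp add: U1_def)
  have U1: "U1 \<subseteq> Ua" "U1 \<subseteq> Ub" "U1 \<subseteq> D'" by (auto simp: U1_def)
  have ka: "ka (a r) = r" "a r \<in> Va" if "r \<in> U1" for r using A(5) U1(1) that by (auto simp: homeomorphism_def)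
  have kb: "kb (b r) = r" "b r \<in> Vb" if "r \<in> U1" for r using B(5) U1(2) that by (auto simp: homeomorphism_def)
  define P where "P = a ` U1"
  define R where "R = b ` U1"
  define g where "g u = b (ka u)" for u
  define gi where "gi v = a (kb v)" for v
  define g' where "g' u h = b' (ka u) (inv (a' (ka u)) h)" for u h
  have Peq: "P = Va \<inter> ka -` U1"
    using A(5) U1(1) unfolding P_def homeomorphism_def by (force simp: image_iff)
  have Req: "R = Vb \<inter> kb -` U1"
    using B(5) U1(2) unfolding R_def homeomorphism_def by (force simp: image_iff)
  have oP: "open P" unfolding Peq using A(4,5) oU1 by (auto simp: homeomorphism_def intro: continuous_open_preimage)
  have oR: "open R" unfolding Req using B(4,5) oU1 by (auto simp: homeomorphism_def intro: continuous_open_preimage)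
  have hom: "homeomorphism P R g gi"
    unfolding homeomorphism_def
  proof (intro conjI ballI)
    show "gi (g u) = u" if "u \<in> P" for u using that ka kb by (auto simp: P_def g_def gi_def)
    show "g (gi v) = v" if "v \<in> R" for v using that ka kb by (auto simp: R_def g_def gi_def)
    show "g ` P = R" using ka by (force simp: P_def R_def g_def image_iff)
    show "gi ` R = P" using kb by (force simp: P_def R_def gi_def image_iff)
    have "continuous_on P ka" using A(5) Peq by (auto simp: homeomorphism_def intro: continuous_on_subset)
    then show "continuous_on P g" unfolding g_def
      by (rule continuous_on_compose2[OF ctb]) (use Peq U1(3) in auto)
    have "continuous_on R kb" using B(5) Req by (auto simp: homeomorphism_def intro: continuous_on_subset)
    then show "continuous_on R gi" unfolding gi_def
      by (rule continuous_on_compose2[OF cta]) (use Req U1(3) in auto)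
  qed
  have pt: "sheet_pt g (a r) = \<kappa> r" if r: "r \<in> U1" for r
  proof -
    have rD: "r \<in> D'" using r U1(3) by blast
    have "\<kappa> r $ j = of_real (exp (a r $ j)) * cis (g (a r) $ j)" for j
    proof -
      have "exp (a r $ j) = norm (\<kappa> r $ j)"
        using ctorus_nz[OF D'c[OF rD], of j] by (simp add: a_def Log_map_def)
      then show ?thesis using arg_lift_polar[OF xc D'L[OF rD], of j] ka(1)[OF r] by (simp add: g_def b_def)
    qed
    then show ?thesis by (simp add: sheet_pt_def vec_eq_iff)
  qed
  have dg: "(g has_derivative g' u) (at u)" if u: "u \<in> P" for u
  proof -
    have "ka u \<in> D'" "u \<in> Va" using u Peq U1(3) by auto
    from diff_chain_at[OF A(6)[OF this(2)] db[OF this(1)]] show ?thesis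
      by (simp add: g_def[abs_def] g'_def[abs_def] o_def)
  qed
  \<comment> \<open>Multiplication by \<open>\<i>\<close> preserves the tangent space and sends
    \<open>(a' h1, b' h1)\<close> to \<open>(- b' h1, a' h1)\<close>; with \<open>h = a' h1\<close>
    this says that \<open>g'\<close> maps \<open>h\<close> to \<open>b' h1\<close> and
    \<open>- b' h1\<close> back to \<open>h\<close>.\<close>
  have sq: "g' u (g' u h) = - h" if u: "u \<in> P" for u h
  proof -
    define r where "r = ka u"
    have r: "r \<in> D'" "u \<in> Va" using u Peq U1(3) by (auto simp: r_def)
    have bij: "bij (a' r)" unfolding r_def by (rule A(7)[OF r(2)])
    define h1 where "h1 = inv (a' r) h"
    have ah1: "a' r h1 = h" unfolding h1_def using bij by (simp add: bij_is_surj surj_f_inv_f)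
    have "\<i> *s \<kappa>' r h1 \<in> range (\<kappa>' r)"
      unfolding K(6)[OF D'D[OF r(1)]] by (rule tang_scale) (use K(6)[OF D'D[OF r(1)]] in blast)
    then obtain h2 where h2: "\<kappa>' r h2 = \<i> *s \<kappa>' r h1" by (metis rangeE)
    have q: "\<kappa>' r h2 $ j / \<kappa> r $ j = \<i> * (\<kappa>' r h1 $ j / \<kappa> r $ j)" for j by (simp add: h2)
    have ah2: "a' r h2 = - b' r h1" unfolding a'_def b'_def q
      by (simp only: vec_eq_iff vec_lambda_beta vector_uminus_component Re_i_times simp_thms)
    have bh2: "b' r h2 = h" unfolding ah1[symmetric] unfolding a'_def b'_def q by (simp only: Im_i_times)
    have "inv (a' r) (- b' r h1) = h2" unfolding ah2[symmetric] using bij by (simp add: bij_is_inj inv_f_f)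
    then have "g' u (- g' u h) = h" unfolding g'_def r_def[symmetric] h1_def[symmetric] by (simp add: bh2)
    moreover have "g' u (- g' u h) = - g' u (g' u h)"
      by (rule linear_neg[OF has_derivative_linear[OF dg[OF u]]])
    ultimately show ?thesis by (metis minus_minus)
  qed
  have "P \<subseteq> ball (a r0) 1" by (auto simp: P_def U1_def)
  then have "bounded P" by (rule bounded_subset[OF bounded_ball])
  moreover have "g ` P = R" using hom by (simp add: homeomorphism_def)
  moreover have "R \<subseteq> ball (b r0) 1" by (auto simp: R_def U1_def)
  then have "bounded R" by (rule bounded_subset[OF bounded_ball])
  moreover have "\<forall>u\<in>P. sheet_pt g u \<in> V" using pt D'V U1(3) by (auto simp: P_def)
  ultimately have "is_sheet P g"
    unfolding is_sheet_def using oP oR hom dg sq by (intro conjI exI[of _ R] exI[of _ gi] exI[of _ g']) simp_all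
  moreover have "open (U0 \<inter> \<kappa>i -` U1)" using K(2,10) oU1 by (intro open_Int open_vimage) auto
  moreover have "x \<in> U0 \<inter> \<kappa>i -` U1" using K(3) r0 r1 K(11)[OF IG(1) r0(1)] by simp
  moreover have "slice I G \<inter> (U0 \<inter> \<kappa>i -` U1) \<subseteq> sheet_pt g ` P"
  proof
    fix z assume z: "z \<in> slice I G \<inter> (U0 \<inter> \<kappa>i -` U1)"
    then obtain r where r: "r \<in> D" "z = \<kappa> r" using K(4) by blast
    then have "r \<in> U1" using z K(11)[OF IG(1) r(1)] by simp
    then show "z \<in> sheet_pt g ` P" using pt r(2) by (metis P_def image_eqI)
  qed
  ultimately show ?thesis by blast
qed

text \<open>For each chart Lindelof's theorem reduces the neighbourhoods supplied by
  \<open>sheet_exists\<close> to countably many, and the charts are countable.\<close>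

lemma countable_sheets:
  obtains P :: "nat \<Rightarrow> (real ^ 'm) set" and g where "\<And>k. is_sheet (P k) (g k)"
    "\<And>x. etale x \<Longrightarrow> \<exists>k. x \<in> sheet_pt (g k) ` P k"
proof -
  define Sh where "Sh = {(P, g). is_sheet P g}"
  have "\<exists>T. countable T \<and> T \<subseteq> Sh \<and> (\<forall>x U. good x I G U \<longrightarrow> transverse I G x \<longrightarrow> (\<exists>(P, g)\<in>T. x \<in> sheet_pt g ` P))" for I G
  proof -
    define E where "E = {x. \<exists>U. good x I G U \<and> transverse I G x}"
    have "\<exists>s W. s \<in> Sh \<and> open W \<and> x \<in> W \<and> slice I G \<inter> W \<subseteq> sheet_pt (snd s) ` fst s" if xE: "x \<in> E" for x
    proof -
      obtain U where "good x I G U" "transverse I G x" using xE by (auto simp: E_def)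
      from sheet_exists[OF this] obtain P g W where "is_sheet P g" "open W" "x \<in> W" "slice I G \<inter> W \<subseteq> sheet_pt g ` P" by blast
      then show ?thesis by (intro exI[of _ "(P, g)"] exI[of _ W]) (simp add: Sh_def)
    qed
    then obtain s W where sW: "\<And>x. x \<in> E \<Longrightarrow> s x \<in> Sh" "\<And>x. x \<in> E \<Longrightarrow> open (W x)" "\<And>x. x \<in> E \<Longrightarrow> x \<in> W x"
      "\<And>x. x \<in> E \<Longrightarrow> slice I G \<inter> W x \<subseteq> sheet_pt (snd (s x)) ` fst (s x)" by metis
    obtain F where F: "F \<subseteq> W ` E" "countable F" "\<Union>F = \<Union>(W ` E)"
      using Lindelof[of "W ` E"] sW(2) by blast
    obtain E' where E': "countable E'" "E' \<subseteq> E" "F = W ` E'"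
      using F(1,2) countable_subset_image[of F W E] by auto
    show ?thesis
    proof (intro exI[of _ "s ` E'"] conjI allI impI)
      show "countable (s ` E')" using E'(1) by simp
      show "s ` E' \<subseteq> Sh" using sW(1) E'(2) by blast
      fix x U assume xU: "good x I G U" "transverse I G x"
      then have "x \<in> E" by (auto simp: E_def)
      then have "x \<in> \<Union>F" unfolding F(3) using sW(3) by blast
      then obtain y where y: "y \<in> E'" "x \<in> W y" unfolding E'(3) by blast
      have "x \<in> slice I G" using xU(1) by (simp add: good_def)
      then have "x \<in> sheet_pt (snd (s y)) ` fst (s y)" using sW(4)[of y] y E'(2) by blast
      then show "\<exists>(P, g)\<in>s ` E'. x \<in> sheet_pt g ` P" using y(1) by (auto simp: case_prod_unfold)
    qed
  qed
  then obtain T where T: "\<And>I G. countable (T I G)" "\<And>I G. T I G \<subseteq> Sh"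
    "\<And>I G x U. good x I G U \<Longrightarrow> transverse I G x \<Longrightarrow> \<exists>(P, g)\<in>T I G. x \<in> sheet_pt g ` P" by metis
  \<comment> \<open>The empty sheet keeps the family nonempty, so that it can be enumerated by the
    natural numbers.\<close>
  define T0 where "T0 = insert ({}, \<lambda>u. u) (\<Union>(I, G)\<in>charts. T I G)"
  have triv: "is_sheet {} (\<lambda>u. u)" by (auto simp: is_sheet_def intro!: exI[of _ "{}"] simp: homeomorphism_def)
  have c0: "countable T0" unfolding T0_def using countable_charts_V T(1) by (auto intro!: countable_UN)
  define e where "e = from_nat_into T0"
  have eT: "e k \<in> T0" for k unfolding e_def by (rule from_nat_into) (simp add: T0_def)
  have surj: "\<exists>k. e k = s" if "s \<in> T0" for s unfolding e_def using from_nat_into_surj[OF c0 that] by blast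
  show thesis
  proof (rule that[of "\<lambda>k. fst (e k)" "\<lambda>k. snd (e k)"])
    have "T0 \<subseteq> Sh" unfolding T0_def using T(2) triv by (auto simp: Sh_def)
    then show "is_sheet (fst (e k)) (snd (e k))" for k using eT[of k] by (auto simp: Sh_def)
    fix x assume "etale x"
    then obtain I G U where IG: "(I, G) \<in> charts" "good x I G U" "transverse I G x" by (auto simp: etale_def)
    obtain P g where Pg: "(P, g) \<in> T I G" "x \<in> sheet_pt g ` P" using T(3)[OF IG(2,3)] by blast
    have "(P, g) \<in> T0" using IG(1) Pg(1) by (auto simp: T0_def)
    then obtain k where "e k = (P, g)" using surj by blast
    then show "\<exists>k. x \<in> sheet_pt (snd (e k)) ` fst (e k)" using Pg(2) by (intro exI[of _ k]) simp
  qed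
qed

lemma sheet_image_measure:
  assumes "is_sheet P g" "Q \<in> sets borel" "Q \<subseteq> P"
  shows "g ` Q \<in> sets borel" "emeasure lborel (g ` Q) = emeasure lborel Q"
proof -
  obtain R gi g' where *: "open R" "homeomorphism P R g gi" "\<And>u. u \<in> P \<Longrightarrow> (g has_derivative g' u) (at u)"
    "\<And>u h. u \<in> P \<Longrightarrow> g' u (g' u h) = - h" using assms(1) unfolding is_sheet_def by blast
  have P: "open P" "bounded P" using assms(1) by (auto simp: is_sheet_def)
  have ev: "even CARD('m)" by (simp add: card)
  have "bounded Q" using P(2) assms(3) bounded_subset by blast
  from emeasure_image_rotation[OF *(2) P(1) *(1) *(3) *(4) ev assms(2,3) this]
  show "g ` Q \<in> sets borel" "emeasure lborel (g ` Q) = emeasure lborel Q" by auto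
qed

text \<open>Over a convergent sequence of values the moduli are bounded and stay away from zero, so
  limits of points of \<open>V\<close> remain in the torus. Closedness is also the source of
  measurability.\<close>

lemma closed_amoeba: "closed (Log_map ` V)"
  unfolding closed_sequential_limits
proof (intro allI impI)
  fix y l assume "(\<forall>k. y k \<in> Log_map ` V) \<and> y \<longlonglongrightarrow> l"
  then have y: "\<And>k. y k \<in> Log_map ` V" "y \<longlonglongrightarrow> l" by auto
  have "\<exists>x. \<forall>k. x k \<in> V \<and> y k = Log_map (x k)"
    by (intro choice allI) (use y(1) in blast)
  then obtain x where x: "\<And>k. x k \<in> V" "\<And>k. y k = Log_map (x k)" by blast
  have nx: "norm (x k $ j) = exp (y k $ j)" for k j
  proof -
    have "x k \<in> ctorus" using x(1) by (simp add: V_def)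
    then show ?thesis using ctorus_nz[of "x k" j] by (simp add: x(2) Log_map_def)
  qed
  have "bounded (range y)" using y(2) convergent_imp_bounded by blast
  then obtain B where B: "\<And>k. norm (y k) \<le> B" by (auto simp: bounded_iff)
  have "norm (x k) \<le> real CARD('m) * exp B" for k
  proof (rule norm_vec_le_bound)
    fix j
    have "y k $ j \<le> B" using component_le_norm_cart[of "y k" j] B[of k] by linarith
    then show "norm (x k $ j) \<le> exp B" by (simp add: nx)
  qed
  then have "bounded (range x)" by (auto simp: bounded_iff)
  then obtain r z where r: "strict_mono r" "(x \<circ> r) \<longlonglongrightarrow> z"
    using bounded_imp_convergent_subsequence by blast
  have yr: "(y \<circ> r) \<longlonglongrightarrow> l" by (rule LIMSEQ_subseq_LIMSEQ[OF y(2) r(1)])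
  have nz: "norm (z $ j) = exp (l $ j)" for j
  proof (rule LIMSEQ_unique)
    show "(\<lambda>k. norm ((x \<circ> r) k $ j)) \<longlonglongrightarrow> norm (z $ j)" by (intro tendsto_intros r(2))
    have "(\<lambda>k. exp ((y \<circ> r) k $ j)) \<longlonglongrightarrow> exp (l $ j)" by (intro tendsto_intros yr)
    then show "(\<lambda>k. norm ((x \<circ> r) k $ j)) \<longlonglongrightarrow> exp (l $ j)" by (simp add: nx)
  qed
  have "z $ j \<noteq> 0" for j using nz[of j] by auto
  then have "z \<in> ctorus" by (simp add: ctorus_def)
  moreover have "f j z = 0" if j: "j \<in> {1..n}" for j
  proof (rule LIMSEQ_unique)
    have "isCont (f j) z" using pf_continuous[OF fpf[OF j], of UNIV] by (simp add: continuous_on_eq_continuous_at)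
    then show "(\<lambda>k. f j ((x \<circ> r) k)) \<longlonglongrightarrow> f j z" using r(2) by (rule isCont_tendsto_compose)
    have "f j ((x \<circ> r) k) = 0" for k using x(1) j by (simp add: V_def)
    then show "(\<lambda>k. f j ((x \<circ> r) k)) \<longlonglongrightarrow> 0" by simp
  qed
  ultimately have "z \<in> V" by (simp add: V_def)
  moreover have "l = Log_map z" by (simp add: Log_map_def vec_eq_iff nz)
  ultimately show "l \<in> Log_map ` V" by blast
qed

definition Arg_bound :: real where "Arg_bound = (\<Prod>j=1..n. (real (d j))\<^sup>2)"

text \<open>Almost every point of the amoeba lies under at least \<open>c\<close> points on
  disjointified sheets, so \<open>c\<close> times the volume is at most the total volume of the
  sheets. A sheet has the same volume as its image in the arguments, and modulo \<open>pi\<close>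
  these images cover a cube of side \<open>pi\<close> at most \<open>Arg_bound\<close> times almost
  everywhere.\<close>

theorem volume_bound:
  assumes N0: "negligible N0"
    and fib: "\<And>u. u \<in> Log_map ` V \<Longrightarrow> u \<notin> N0 \<Longrightarrow> \<exists>X\<subseteq>V. finite X \<and> card X = c \<and> (\<forall>x\<in>X. Log_map x = u)"
  shows "of_nat c * emeasure lborel (Log_map ` V) \<le> ennreal Arg_bound * ennreal (pi ^ CARD('m))"
proof -
  obtain P :: "nat \<Rightarrow> (real ^ 'm) set" and g where Sh: "\<And>k. is_sheet (P k) (g k)"
    and cov: "\<And>x. etale x \<Longrightarrow> \<exists>k. x \<in> sheet_pt (g k) ` P k" using countable_sheets by blast
  obtain N1 where N1: "negligible N1" "\<And>x. x \<in> V \<Longrightarrow> Log_map x \<notin> N1 \<Longrightarrow> etale x" using generic_Log by blast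
  obtain N2 where N2: "negligible N2" "\<And>x \<theta>. x \<in> V \<Longrightarrow> \<theta> \<notin> N2 \<Longrightarrow> same_arg \<theta> x \<Longrightarrow> etale x" using generic_Arg by blast
  have shV: "sheet_pt (g k) u \<in> V" if "u \<in> P k" for k u using Sh[of k] that by (simp add: is_sheet_def)
  have oP: "open (P k)" for k using Sh[of k] by (simp add: is_sheet_def)
  have cg: "continuous_on (P k) (g k)" for k using Sh[of k] by (auto simp: is_sheet_def homeomorphism_def)
  define Eq where "Eq j k = {u \<in> P j \<inter> P k. sheet_pt (g j) u = sheet_pt (g k) u}" for j k
  have Eqm: "Eq j k \<in> sets borel" for j k
  proof -
    have "continuous_on (P j \<inter> P k) (\<lambda>u. sheet_pt (g j) u - sheet_pt (g k) u)"
      unfolding sheet_pt_def cis_conv_exp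
      by (intro continuous_intros continuous_on_subset[OF cg]) auto
    then have "closedin (top_of_set (P j \<inter> P k)) {u \<in> P j \<inter> P k. sheet_pt (g j) u - sheet_pt (g k) u = 0}"
      by (rule continuous_closedin_preimage_constant)
    moreover have "{u \<in> P j \<inter> P k. sheet_pt (g j) u - sheet_pt (g k) u = 0} = Eq j k" by (auto simp: Eq_def)
    ultimately obtain C where "closed C" "Eq j k = (P j \<inter> P k) \<inter> C" by (auto simp: closedin_closed)
    then show ?thesis using oP by simp
  qed
  \<comment> \<open>A point of \<open>V\<close> may lie on several sheets; it is kept only on the
    first of them.\<close>
  define Q where "Q k = P k - (\<Union>j<k. Eq j k)" for k
  have Qm: "Q k \<in> sets borel" for k
    unfolding Q_def using oP[of k] Eqm by (intro sets.Diff sets.finite_UN) auto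
  have QP: "Q k \<subseteq> P k" for k by (auto simp: Q_def)
  have Qdisj: "k = k'" if "u \<in> Q k" "u \<in> Q k'" "sheet_pt (g k) u = sheet_pt (g k') u" for k k' u
  proof (rule ccontr)
    assume "k \<noteq> k'"
    then consider "k < k'" | "k' < k" by linarith
    then show False using that by cases (auto simp: Q_def Eq_def)
  qed
  let ?A = "Log_map ` V"
  have Am: "?A \<in> sets borel" using closed_amoeba by (rule borel_closed)
  have "of_nat c * emeasure lborel ?A = (\<integral>\<^sup>+u. of_nat c * indicator ?A u \<partial>lborel)"
    using Am by (simp add: nn_integral_cmult)
  also have "\<dots> \<le> (\<integral>\<^sup>+u. (suminf (\<lambda>k. indicator (Q k) u)) \<partial>lborel)"
  proof (rule nn_integral_mono_AE)
    show "AE u in lborel. of_nat c * indicator ?A u \<le> suminf (\<lambda>k. indicator (Q k) u :: ennreal)"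
      using negligible_AE_lborel[OF N0] negligible_AE_lborel[OF N1(1)]
    proof eventually_elim
      case (elim u)
      show ?case
      proof (cases "u \<in> ?A")
        case True
        obtain X where X: "X \<subseteq> V" "finite X" "card X = c" "\<And>x. x \<in> X \<Longrightarrow> Log_map x = u"
          using fib[OF True elim(1)] by blast
        have "\<exists>k. u \<in> Q k \<and> sheet_pt (g k) u = x" if x: "x \<in> X" for x
        proof -
          have "etale x" using N1(2)[of x] X x elim(2) by auto
          define k where "k = (LEAST k. x \<in> sheet_pt (g k) ` P k)"
          have k: "x \<in> sheet_pt (g k) ` P k" unfolding k_def by (rule LeastI_ex[OF cov[OF \<open>etale x\<close>]])
          then obtain u' where u': "u' \<in> P k" "x = sheet_pt (g k) u'" by blast
          have "u' = u" using X(4)[OF x] u'(2) by simp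
          have "u \<notin> Eq j k" if "j < k" for j
          proof
            assume "u \<in> Eq j k"
            then have "u \<in> P j" "x = sheet_pt (g j) u" using u'(2) \<open>u' = u\<close> by (simp_all add: Eq_def)
            then have "x \<in> sheet_pt (g j) ` P j" by blast
            then show False using not_less_Least[of j "\<lambda>k. x \<in> sheet_pt (g k) ` P k"] that by (simp add: k_def)
          qed
          then show ?thesis using u' \<open>u' = u\<close> by (intro exI[of _ k]) (auto simp: Q_def)
        qed
        then obtain K where K: "\<And>x. x \<in> X \<Longrightarrow> u \<in> Q (K x)" "\<And>x. x \<in> X \<Longrightarrow> sheet_pt (g (K x)) u = x" by metis
        have "inj_on K X" by (metis K(2) inj_onI)
        then have "card (K ` X) = c" using X(3) by (simp add: card_image)
        have "(\<Sum>k\<in>K ` X. indicator (Q k) u :: ennreal) = (\<Sum>k\<in>K ` X. 1)"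
          by (rule sum.cong[OF refl]) (use K(1) in auto)
        then have "of_nat c = (\<Sum>k\<in>K ` X. indicator (Q k) u :: ennreal)"
          using \<open>card (K ` X) = c\<close> by simp
        also have "\<dots> \<le> (suminf (\<lambda>k. indicator (Q k) u))"
          by (rule sum_le_suminf) (use X(2) in auto)
        finally show ?thesis using True by simp
      qed simp
    qed
  qed
  also have "\<dots> = (suminf (\<lambda>k. emeasure lborel (Q k)))"
    using Qm by (subst nn_integral_suminf) auto
  also have "\<dots> \<le> ennreal Arg_bound * ennreal (pi ^ CARD('m))"
  proof (rule suminf_le_const)
    fix M
    \<comment> \<open>Half-open cubes that tile the space of arguments;
      \<open>cell (\<lambda>_. 0)\<close> is a fundamental domain modulo \<open>pi\<close>.\<close>
    define cell :: "('m \<Rightarrow> int) \<Rightarrow> (real ^ 'm) set" where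
      "cell \<kappa> = {\<theta>. \<forall>j. of_int (\<kappa> j) * pi \<le> \<theta> $ j \<and> \<theta> $ j < (of_int (\<kappa> j) + 1) * pi}" for \<kappa>
    define sh :: "('m \<Rightarrow> int) \<Rightarrow> real ^ 'm" where "sh \<kappa> = (\<chi> j. of_int (\<kappa> j) * pi)" for \<kappa>
    have cellm: "cell \<kappa> \<in> sets borel" for \<kappa>
    proof -
      have "cell \<kappa> = (\<Inter>j. {\<theta>. of_int (\<kappa> j) * pi \<le> \<theta> $ j} \<inter> {\<theta>. \<theta> $ j < (of_int (\<kappa> j) + 1) * pi})"
        by (auto simp: cell_def)
      moreover have "{\<theta> :: real ^ 'm. of_int (\<kappa> j) * pi \<le> \<theta> $ j} \<inter> {\<theta>. \<theta> $ j < (of_int (\<kappa> j) + 1) * pi} \<in> sets borel" for j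
        by (intro sets.Int borel_closed borel_open closed_Collect_le open_Collect_less continuous_intros)
      ultimately show ?thesis by (auto intro!: sets.finite_INT)
    qed
    have cellsh: "\<theta> \<in> cell (\<lambda>_. 0) \<longleftrightarrow> sh \<kappa> + \<theta> \<in> cell \<kappa>" for \<theta> \<kappa>
      by (auto simp: cell_def sh_def algebra_simps)
    have celldisj: "\<kappa> = \<kappa>'" if "\<theta> \<in> cell \<kappa>" "\<theta> \<in> cell \<kappa>'" for \<theta> \<kappa> \<kappa>'
    proof
      fix j
      have "of_int (\<kappa> j) = \<lfloor>\<theta> $ j / pi\<rfloor>" "of_int (\<kappa>' j) = \<lfloor>\<theta> $ j / pi\<rfloor>"
        using that by (auto simp: cell_def field_simps intro!: floor_unique[symmetric])
      then show "\<kappa> j = \<kappa>' j" by simp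
    qed
    \<comment> \<open>A bounded image meets finitely many cubes, so only finitely many translated
      pieces have to be counted.\<close>
    have "\<exists>F. finite F \<and> g k ` Q k \<subseteq> (\<Union>\<kappa>\<in>F. cell \<kappa>)" for k
    proof -
      have "bounded (g k ` Q k)"
        using Sh[of k] QP[of k] bounded_subset[of "g k ` P k" "g k ` Q k"] by (auto simp: is_sheet_def)
      then obtain B where B: "\<And>\<theta>. \<theta> \<in> g k ` Q k \<Longrightarrow> norm \<theta> \<le> B" by (auto simp: bounded_iff)
      define L where "L = \<lceil>\<bar>B\<bar> / pi\<rceil> + 1"
      define F where "F = (PiE (UNIV :: 'm set) (\<lambda>_. {-L..L}))"
      have "finite F" unfolding F_def by (intro finite_PiE) auto
      moreover have "\<theta> \<in> (\<Union>\<kappa>\<in>F. cell \<kappa>)" if \<theta>: "\<theta> \<in> g k ` Q k" for \<theta>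
      proof
        have "\<lfloor>\<theta> $ j / pi\<rfloor> \<in> {-L..L}" for j
        proof -
          have "\<bar>\<theta> $ j\<bar> \<le> \<bar>B\<bar>" using component_le_norm_cart[of \<theta> j] B[OF \<theta>] by linarith
          then have "\<bar>\<theta> $ j / pi\<bar> \<le> \<bar>B\<bar> / pi" by (simp add: abs_divide divide_right_mono)
          also have "\<dots> \<le> of_int \<lceil>\<bar>B\<bar> / pi\<rceil>" by (rule le_of_int_ceiling)
          finally have 1: "\<bar>\<theta> $ j / pi\<bar> \<le> of_int \<lceil>\<bar>B\<bar> / pi\<rceil>" .
          have "of_int (- L) \<le> \<theta> $ j / pi" "\<theta> $ j / pi < of_int L + 1" 
            unfolding L_def of_int_minus of_int_add of_int_1 using 1[unfolded abs_le_iff] by linarith+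
          then show ?thesis by (simp only: atLeastAtMost_iff le_floor_iff floor_le_iff simp_thms)
        qed
        then show "(\<lambda>j. \<lfloor>\<theta> $ j / pi\<rfloor>) \<in> F" by (auto simp: F_def)
        have "of_int \<lfloor>\<theta> $ j / pi\<rfloor> * pi \<le> \<theta> $ j \<and> \<theta> $ j < (of_int \<lfloor>\<theta> $ j / pi\<rfloor> + 1) * pi" for j
          by (intro conjI iffD1[OF pos_le_divide_eq[OF pi_gt_zero] of_int_floor_le]
              iffD1[OF pos_divide_less_eq[OF pi_gt_zero] real_of_int_floor_add_one_gt])
        then show "\<theta> \<in> cell (\<lambda>j. \<lfloor>\<theta> $ j / pi\<rfloor>)" by (simp add: cell_def)
      qed
      ultimately show ?thesis by blast
    qed
    then obtain F where F: "\<And>k. finite (F k)" "\<And>k. g k ` Q k \<subseteq> (\<Union>\<kappa>\<in>F k. cell \<kappa>)" by metis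
    define I where "I = Sigma {..<M} F"
    define B where "B = (\<lambda>(k, \<kappa>). (\<lambda>\<theta>. sh \<kappa> + \<theta>) -` (g k ` Q k) \<inter> cell (\<lambda>_. 0))"
    have finI: "finite I" unfolding I_def using F(1) by (intro finite_SigmaI) auto
    have trm: "(\<lambda>\<theta>. sh \<kappa> + \<theta>) -` A \<in> sets borel" if "A \<in> sets borel" for A \<kappa>
      using measurable_sets[of "\<lambda>\<theta>. sh \<kappa> + \<theta>" borel borel A] that by simp
    have tre: "emeasure lborel ((\<lambda>\<theta>. sh \<kappa> + \<theta>) -` A) = emeasure lborel A" if "A \<in> sets borel" for A \<kappa>
    proof -
      have "emeasure lborel A = emeasure (distr lborel borel ((+) (sh \<kappa>))) A" by (simp add: lborel_distr_plus)
      also have "\<dots> = emeasure lborel ((\<lambda>\<theta>. sh \<kappa> + \<theta>) -` A)" using that by (subst emeasure_distr) auto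
      finally show ?thesis by simp
    qed
    have gQm: "g k ` Q k \<in> sets borel" for k by (rule sheet_image_measure(1)[OF Sh Qm QP])
    have "(\<Sum>k<M. emeasure lborel (Q k)) = (\<Sum>k<M. \<Sum>\<kappa>\<in>F k. emeasure lborel (B (k, \<kappa>)))"
    proof (rule sum.cong[OF refl])
      fix k
      have "emeasure lborel (Q k) = emeasure lborel (g k ` Q k)" by (rule sheet_image_measure(2)[OF Sh Qm QP, symmetric])
      also have "g k ` Q k = (\<Union>\<kappa>\<in>F k. g k ` Q k \<inter> cell \<kappa>)" using F(2) by blast
      also have "emeasure lborel \<dots> = (\<Sum>\<kappa>\<in>F k. emeasure lborel (g k ` Q k \<inter> cell \<kappa>))"
        using F(1) gQm cellm celldisj by (intro sum_emeasure[symmetric]) (auto simp: disjoint_family_on_def)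
      also have "\<dots> = (\<Sum>\<kappa>\<in>F k. emeasure lborel (B (k, \<kappa>)))"
      proof (rule sum.cong[OF refl])
        fix \<kappa>
        have "B (k, \<kappa>) = (\<lambda>\<theta>. sh \<kappa> + \<theta>) -` (g k ` Q k \<inter> cell \<kappa>)"
          using cellsh by (auto simp: B_def)
        then show "emeasure lborel (g k ` Q k \<inter> cell \<kappa>) = emeasure lborel (B (k, \<kappa>))"
          using tre[of "g k ` Q k \<inter> cell \<kappa>"] gQm cellm by simp
      qed
      finally show "emeasure lborel (Q k) = (\<Sum>\<kappa>\<in>F k. emeasure lborel (B (k, \<kappa>)))" .
    qed
    also have "\<dots> = (\<Sum>i\<in>I. emeasure lborel (B i))"
      unfolding I_def using F(1) by (subst sum.Sigma) auto
    also have "\<dots> \<le> ennreal Arg_bound * emeasure lborel (cell (\<lambda>_. 0))"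
    proof (rule overlap_bound[OF finI _ _ cellm])
      show "B i \<in> sets borel" for i using trm[OF gQm] cellm by (cases i) (auto simp: B_def)
      show "B i \<subseteq> cell (\<lambda>_. 0)" for i by (cases i) (auto simp: B_def)
      \<comment> \<open>The translated pieces containing a generic \<open>\<theta>\<close> come from
        distinct points of \<open>V\<close> satisfying \<open>same_arg \<theta>\<close>, whose
        number the fibre bound controls.\<close>
      show "AE \<theta> in lborel. real (card {i \<in> I. \<theta> \<in> B i}) \<le> Arg_bound"
        using negligible_AE_lborel[OF N2(1)]
      proof eventually_elim
        case (elim \<theta>)
        let ?J = "{i \<in> I. \<theta> \<in> B i}"
        define u where "u i = (SOME u. u \<in> Q (fst i) \<and> g (fst i) u = sh (snd i) + \<theta>)" for i
        have u: "u i \<in> Q (fst i)" "g (fst i) (u i) = sh (snd i) + \<theta>" if i: "i \<in> ?J" for i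
        proof -
          have "\<exists>u. u \<in> Q (fst i) \<and> g (fst i) u = sh (snd i) + \<theta>"
            using i by (cases i) (auto simp: B_def)
          from someI_ex[OF this] show "u i \<in> Q (fst i)" "g (fst i) (u i) = sh (snd i) + \<theta>"
            unfolding u_def by (rule conjunct1, rule conjunct2)
        qed
        define p where "p i = sheet_pt (g (fst i)) (u i)" for i
        have pV: "p i \<in> V" if "i \<in> ?J" for i unfolding p_def using u(1)[OF that] QP shV by blast
        have pa: "same_arg \<theta> (p i)" if "i \<in> ?J" for i
          unfolding same_arg_def
        proof
          fix j
          have "p i $ j * cis (- (\<theta> $ j)) = of_real (exp (u i $ j)) * (cis (g (fst i) (u i) $ j) * cis (- (\<theta> $ j)))"
            by (simp add: p_def sheet_pt_def mult.assoc)
          also have "\<dots> = of_real (exp (u i $ j)) * cis (of_int (snd i j) * pi)"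
            by (simp add: cis_mult u(2)[OF that] sh_def)
          finally show "Im (p i $ j * cis (- (\<theta> $ j))) = 0" by (simp add: sin_zero_iff_int2)
        qed
        have "inj_on p ?J"
        proof (rule inj_onI)
          fix i i' assume ii: "i \<in> ?J" "i' \<in> ?J" "p i = p i'"
          have uu: "u i = u i'" using ii(3) Log_sheet_pt unfolding p_def by metis
          have "fst i = fst i'" using Qdisj[of "u i" "fst i" "fst i'"] u(1)[OF ii(1)] u(1)[OF ii(2)] ii(3) uu by (simp add: p_def)
          moreover from this have "sh (snd i) = sh (snd i')" using u(2)[OF ii(1)] u(2)[OF ii(2)] uu by simp
          then have "snd i = snd i'" by (auto simp: sh_def vec_eq_iff fun_eq_iff)
          ultimately show "i = i'" by (simp add: prod_eq_iff)
        qed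
        then have "real (card ?J) = real (card (p ` ?J))" by (simp add: card_image)
        also have "\<dots> \<le> Arg_bound" unfolding Arg_bound_def
          by (rule Arg_fibre_bound_generic[where \<theta> = \<theta>]) (use finI pV pa N2(2) elim in auto)
        finally show ?case .
      qed
    qed
    also have "emeasure lborel (cell (\<lambda>_. 0)) \<le> emeasure lborel (cbox (0 :: real ^ 'm) (\<chi> j. pi))"
      by (intro emeasure_mono) (auto simp: cell_def mem_box_cart less_imp_le)
    also have "emeasure lborel (cbox (0 :: real ^ 'm) (\<chi> j. pi)) = ennreal (pi ^ CARD('m))"
      by (simp add: emeasure_lborel_cbox_eq Basis_vec_def inner_axis prod.UNION_disjoint axis_eq_axis)
    finally show "(\<Sum>k<M. emeasure lborel (Q k)) \<le> ennreal Arg_bound * ennreal (pi ^ CARD('m))"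
      by (simp add: mult_left_mono)
  qed (rule summableI)
  finally show ?thesis .
qed

end

section \<open>Real zeros of polynomials\<close>

definition cvec :: "real ^ 'm::finite \<Rightarrow> complex ^ 'm" where
  "cvec x = (\<chi> j. of_real (x $ j))"

text \<open>The point is that the degree bound is uniform in the line; it will bound the number of
  dilates that meet at a point.\<close>

lemma pf_line:
  assumes "P \<in> pfun K"
  shows "\<exists>D. \<forall>x v. \<exists>q. degree q \<le> D \<and> (\<forall>t. P (x + t *s v) = poly q t)"
  using assms
proof (induction rule: pfun.induct)
  case (pf_const c)
  show ?case by (intro exI[of _ 0] allI exI[of _ "[:c:]"]) simp
next
  case pf_neg1
  show ?case by (intro exI[of _ 0] allI exI[of _ "[:-1:]"]) simp
next
  case (pf_coord i)
  show ?case
  proof (intro exI[of _ "1 :: nat"] allI)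
    fix x v
    show "\<exists>q. degree q \<le> 1 \<and> (\<forall>t. (x + t *s v) $ i = poly q t)"
      by (intro exI[of _ "[:x $ i, v $ i:]"]) simp
  qed
next
  case (pf_add f g)
  then obtain D E where D: "\<And>x v. \<exists>q. degree q \<le> D \<and> (\<forall>t. f (x + t *s v) = poly q t)"
    "\<And>x v. \<exists>q. degree q \<le> E \<and> (\<forall>t. g (x + t *s v) = poly q t)" by blast
  show ?case
  proof (intro exI[of _ "max D E"] allI)
    fix x v
    obtain q r where "degree q \<le> D" "\<And>t. f (x + t *s v) = poly q t" "degree r \<le> E" "\<And>t. g (x + t *s v) = poly r t"
      using D by blast
    then show "\<exists>q. degree q \<le> max D E \<and> (\<forall>t. f (x + t *s v) + g (x + t *s v) = poly q t)"
      by (intro exI[of _ "q + r"]) (auto intro: degree_add_le)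
  qed
next
  case (pf_mult f g)
  then obtain D E where D: "\<And>x v. \<exists>q. degree q \<le> D \<and> (\<forall>t. f (x + t *s v) = poly q t)"
    "\<And>x v. \<exists>q. degree q \<le> E \<and> (\<forall>t. g (x + t *s v) = poly q t)" by blast
  show ?case
  proof (intro exI[of _ "D + E"] allI)
    fix x v
    obtain q r where "degree q \<le> D" "\<And>t. f (x + t *s v) = poly q t" "degree r \<le> E" "\<And>t. g (x + t *s v) = poly r t"
      using D by blast
    then show "\<exists>q. degree q \<le> D + E \<and> (\<forall>t. f (x + t *s v) * g (x + t *s v) = poly q t)"
      by (intro exI[of _ "q * r"]) (auto intro: order_trans[OF degree_mult_le])
  qed
qed

text \<open>On the line through the real part of \<open>w\<close> in the direction of its imaginary
  part, the polynomial vanishes for real \<open>t\<close>, hence for all \<open>t\<close>, and at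
  \<open>t = \<i>\<close> the line passes through \<open>w\<close>.\<close>

lemma pf_zero_of_real:
  assumes P: "P \<in> pfun K" and z: "\<And>x. P (cvec x) = 0"
  shows "P = (\<lambda>_. 0)"
proof
  fix w
  obtain q where q: "\<And>t. P (cvec (\<chi> j. Re (w $ j)) + t *s cvec (\<chi> j. Im (w $ j))) = poly q t"
    using pf_line[OF P] by blast
  have "poly q (of_real t) = 0" for t
  proof -
    have "cvec (\<chi> j. Re (w $ j)) + of_real t *s cvec (\<chi> j. Im (w $ j)) = cvec (\<chi> j. Re (w $ j) + t * Im (w $ j))"
      by (simp add: cvec_def vec_eq_iff)
    then show ?thesis using q[of "of_real t"] z by simp
  qed
  then have "range complex_of_real \<subseteq> {t. poly q t = 0}" by auto
  moreover have "infinite (range complex_of_real)"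
    by (simp add: finite_image_iff inj_of_real infinite_UNIV_char_0)
  ultimately have "q = 0" using poly_roots_finite infinite_super by blast
  moreover have "cvec (\<chi> j. Re (w $ j)) + \<i> *s cvec (\<chi> j. Im (w $ j)) = w"
    by (simp add: cvec_def vec_eq_iff complex_eq_iff)
  ultimately show "P w = 0" using q[of \<i>] by simp
qed

text \<open>Dilations about a point where the polynomial does not vanish move the zero set so that no point
  is covered more often than the degree allows.\<close>

lemma negligible_real_zeros:
  assumes P: "P \<in> pfun K" and nz: "P \<noteq> (\<lambda>_. 0)"
  shows "negligible {x :: real ^ 'm::finite. P (cvec x) = 0}"
proof -
  obtain y0 :: "real ^ 'm" where y0: "P (cvec y0) \<noteq> 0" using pf_zero_of_real[OF P] nz by blast
  obtain D where D: "\<And>x v. \<exists>q. degree q \<le> D \<and> (\<forall>t. P (x + t *s v) = poly q t)" using pf_line[OF P] by blast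
  have cl: "closed {x :: real ^ 'm. P (cvec x) = 0}"
  proof -
    have "continuous_on UNIV (\<lambda>x :: real ^ 'm. P (cvec x))"
      unfolding cvec_def
      by (rule continuous_on_compose2[OF pf_continuous[OF P, of UNIV]]) (auto intro!: continuous_intros)
    then show ?thesis by (intro closed_Collect_eq) (auto intro: continuous_intros)
  qed
  define T where "T R = {x. P (cvec (y0 + x)) = 0} \<inter> cball 0 R" for R
  have T: "closed (T R)" for R
  proof -
    have "{x. P (cvec (y0 + x)) = 0} = (+) y0 -` {x. P (cvec x) = 0}" by auto
    moreover have "closed ((+) y0 -` {x. P (cvec x) = 0})" by (intro closed_vimage cl continuous_intros)
    ultimately show ?thesis by (simp add: T_def closed_Int)
  qed
  have T0: "emeasure lborel (T R) = 0" if R: "R \<ge> 0" for R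
  proof -
    \<comment> \<open>Distinct factors between 1 and 2: dilation by them does not decrease volume
      and stays inside the ball of radius \<open>2 * R\<close>.\<close>
    define c where "c k = 1 + 1 / (real k + 1)" for k
    have c: "1 \<le> c k" "c k \<le> 2" for k by (auto simp: c_def field_simps)
    have cinj: "inj (\<lambda>k. complex_of_real (1 / c k))"
    proof (rule injI)
      fix k k' assume "complex_of_real (1 / c k) = complex_of_real (1 / c k')"
      then have "c k = c k'" by (simp only: of_real_eq_iff) simp
      then show "k = k'" by (simp add: c_def)
    qed
    define B where "B k = (*\<^sub>R) (c k) ` T R" for k
    have Bcl: "closed (B k)" for k unfolding B_def by (rule closed_scaling[OF T])
    have Be: "emeasure lborel (T R) \<le> emeasure lborel (B k)" for k
    proof -
      have "emeasure lebesgue (B k) = ennreal (\<bar>c k\<bar> ^ DIM(real ^ 'm)) * emeasure lebesgue (T R)"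
        using emeasure_lebesgue_affine[of "c k" 0 "T R"] by (simp add: B_def ennreal_power)
      then have "emeasure lborel (B k) = ennreal (\<bar>c k\<bar> ^ DIM(real ^ 'm)) * emeasure lborel (T R)"
        using Bcl T by simp
      moreover have "1 \<le> ennreal (\<bar>c k\<bar> ^ DIM(real ^ 'm))" using c(1)[of k] by (simp add: one_le_power)
      ultimately show ?thesis using mult_right_mono[of 1 _ "emeasure lborel (T R)"] by simp
    qed
    have bound: "of_nat M * emeasure lborel (T R) \<le> ennreal (real D) * emeasure lborel (cball (0 :: real ^ 'm) (2 * R))" for M
    proof -
      have "of_nat M * emeasure lborel (T R) = (\<Sum>k<M. emeasure lborel (T R))" by simp
      also have "\<dots> \<le> (\<Sum>k<M. emeasure lborel (B k))" by (intro sum_mono Be)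
      also have "\<dots> \<le> ennreal (real D) * emeasure lborel (cball (0 :: real ^ 'm) (2 * R))"
      proof (rule overlap_bound)
        show "B k \<subseteq> cball 0 (2 * R)" for k
        proof
          fix y assume "y \<in> B k"
          then obtain x where x: "x \<in> T R" "y = c k *\<^sub>R x" unfolding B_def by blast
          have nx: "norm x \<le> R" using x(1) by (simp add: T_def)
          have "norm y = c k * norm x" using c(1)[of k] x(2) by simp
          also have "\<dots> \<le> 2 * R" using c[of k] nx by (intro mult_mono) auto
          finally show "y \<in> cball 0 (2 * R)" by simp
        qed
        show "AE x in lborel. real (card {k \<in> {..<M}. x \<in> B k}) \<le> real D"
        proof (intro always_eventually allI of_nat_mono)
          fix x :: "real ^ 'm"
          obtain q where q: "degree q \<le> D" "\<And>t. P (cvec y0 + t *s cvec x) = poly q t" using D by blast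
          have q0: "q \<noteq> 0" using q(2)[of 0] y0 by auto
          \<comment> \<open>If \<open>x\<close> lies in the dilate by \<open>c k\<close>, then
            \<open>1 / c k\<close> is a root of the restriction of \<open>P\<close> to the line from
            \<open>y0\<close> in direction \<open>x\<close>. This restriction is nonzero at
            \<open>t = 0\<close>.\<close>
          have "card {k \<in> {..<M}. x \<in> B k} \<le> card {t. poly q t = 0}"
          proof (rule card_inj_on_le[where f = "\<lambda>k. complex_of_real (1 / c k)"])
            show "inj_on (\<lambda>k. complex_of_real (1 / c k)) {k \<in> {..<M}. x \<in> B k}" using cinj by (rule inj_on_subset) simp
            show "finite {t. poly q t = 0}" by (rule poly_roots_finite[OF q0])
            show "(\<lambda>k. complex_of_real (1 / c k)) ` {k \<in> {..<M}. x \<in> B k} \<subseteq> {t. poly q t = 0}"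
            proof clarify
              fix k assume "x \<in> B k"
              then obtain u where "u \<in> T R" and u: "x = c k *\<^sub>R u" unfolding B_def by blast
              then have u0: "P (cvec (y0 + u)) = 0" by (simp add: T_def)
              have "cvec (y0 + u) = cvec y0 + of_real (1 / c k) *s cvec x"
                using c(1)[of k] by (simp add: cvec_def vec_eq_iff u)
              then show "poly q (of_real (1 / c k)) = 0" using u0 q(2)[of "of_real (1 / c k)"] by simp
            qed
          qed
          also have "\<dots> \<le> D" using card_poly_roots_bound[OF q0] q(1) by linarith
          finally show "card {k \<in> {..<M}. x \<in> B k} \<le> D" .
        qed
      qed (use Bcl in auto)
      finally show ?thesis .
    qed
    have fin: "ennreal (real D) * emeasure lborel (cball (0 :: real ^ 'm) (2 * R)) < \<infinity>"
      using emeasure_lborel_cball_finite[of "0 :: real ^ 'm" "2 * R"] by (simp add: ennreal_mult_less_top)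
    \<comment> \<open>The bound for \<open>M\<close> copies of the volume does not depend on
      \<open>M\<close>.\<close>
    show ?thesis
    proof (rule ccontr)
      assume ne: "emeasure lborel (T R) \<noteq> 0"
      have finT: "emeasure lborel (T R) < \<infinity>" using bound[of 1] fin by (simp add: le_less_trans)
      then obtain \<mu> where \<mu>: "emeasure lborel (T R) = ennreal \<mu>" "\<mu> \<ge> 0" by (cases "emeasure lborel (T R)") auto
      obtain b where b: "ennreal (real D) * emeasure lborel (cball (0 :: real ^ 'm) (2 * R)) = ennreal b" "b \<ge> 0"
        using fin by (cases "ennreal (real D) * emeasure lborel (cball (0 :: real ^ 'm) (2 * R))") auto
      have "\<mu> > 0" using ne \<mu> by (cases "\<mu> = 0") auto
      then obtain M :: nat where "b < real M * \<mu>" using reals_Archimedean3 by blast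
      moreover have "ennreal (real M * \<mu>) \<le> ennreal b"
        using bound[of M] unfolding b(1) \<mu>(1) by (simp add: ennreal_mult' ennreal_of_nat_eq_real_of_nat)
      ultimately show False using b(2) by (simp add: ennreal_le_iff)
    qed
  qed
  have "negligible ((+) y0 ` T (real k))" for k
  proof (rule negligible_translation)
    have "T (real k) \<in> null_sets lborel" using T0[of "real k"] T[of "real k"] by (simp add: null_sets_def)
    then show "negligible (T (real k))" by (simp add: negligible_iff_null_sets null_sets_completionI)
  qed
  then have "negligible (\<Union>k. (+) y0 ` T (real k))"
    by (intro negligible_countable_Union) auto
  moreover have "{x. P (cvec x) = 0} \<subseteq> (\<Union>k. (+) y0 ` T (real k))"
  proof
    fix x assume x: "x \<in> {x. P (cvec x) = 0}"
    obtain k where "norm (x - y0) \<le> real k" using real_arch_simple by blast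
    then have "x - y0 \<in> T (real k)" using x by (simp add: T_def)
    then show "x \<in> (\<Union>k. (+) y0 ` T (real k))" by (intro UN_I[of k] image_eqI[of _ _ "x - y0"]) auto
  qed
  ultimately show ?thesis by (rule negligible_subset)
qed

text \<open>On the torus, \<open>Log_map z = p\<close> means that \<open>z $ j * cnj (z $ j)\<close>
  is the \<open>j\<close>-th coordinate of this vector.\<close>

definition sqexp :: "real ^ 'm::finite \<Rightarrow> complex ^ 'm" where
  "sqexp p = cvec (\<chi> j. exp (2 * p $ j))"

lemma negligible_exp_zeros:
  assumes P: "P \<in> pfun K" and nz: "P \<noteq> (\<lambda>_. 0)"
  shows "negligible {p :: real ^ 'm::finite. P (sqexp p) = 0}"
proof -
  let ?S = "{x :: real ^ 'm. P (cvec x) = 0 \<and> (\<forall>j. x $ j > 0)}"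
  define l :: "real ^ 'm \<Rightarrow> real ^ 'm" where "l x = (\<chi> j. ln (x $ j) / 2)" for x
  have "negligible ?S" by (rule negligible_subset[OF negligible_real_zeros[OF P nz]]) auto
  moreover have "l differentiable_on ?S"
    unfolding differentiable_on_def
  proof
    fix x assume x: "x \<in> ?S"
    have "(l has_derivative (\<lambda>h. \<chi> j. (h $ j / x $ j) / 2)) (at x)"
      unfolding l_def
    proof (rule has_derivative_vecI)
      fix j
      have "((\<lambda>x. x $ j) has_derivative (\<lambda>h. h $ j)) (at x)"
        by (rule bounded_linear_imp_has_derivative[OF bounded_linear_vec_nth])
      from has_derivative_ln[OF _ this] x
      have "((\<lambda>x. ln (x $ j)) has_derivative (\<lambda>h. h $ j / x $ j)) (at x)"
        by (auto simp: field_simps)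
      from bounded_linear.has_derivative[OF bounded_linear_divide this, of 2]
      show "((\<lambda>x. (\<chi> j. ln (x $ j) / 2) $ j) has_derivative (\<lambda>h. (\<chi> j. (h $ j / x $ j) / 2) $ j)) (at x)"
        by simp
    qed
    then show "l differentiable at x within ?S"
      using differentiable_def differentiable_at_withinI by blast
  qed
  ultimately have "negligible (l ` ?S)"
    by (intro negligible_differentiable_image_negligible[OF order_refl])
  moreover have "{p. P (sqexp p) = 0} \<subseteq> l ` ?S"
  proof
    fix p assume p: "p \<in> {p. P (sqexp p) = 0}"
    show "p \<in> l ` ?S"
      by (rule image_eqI[of _ _ "\<chi> j. exp (2 * p $ j)"]) (use p in \<open>auto simp: l_def sqexp_def vec_eq_iff\<close>)
  qed
  ultimately show ?thesis by (rule negligible_subset)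
qed

section \<open>Isomorphisms of subfields\<close>

text \<open>An isomorphism between subfields of the complex numbers is represented by its graph.\<close>

definition ring_graph :: "(complex \<times> complex) set \<Rightarrow> bool" where
  "ring_graph G \<longleftrightarrow> (1, 1) \<in> G \<and>
     (\<forall>a b c d. (a, b) \<in> G \<longrightarrow> (c, d) \<in> G \<longrightarrow> (a - c, b - d) \<in> G \<and> (a * c, b * d) \<in> G) \<and>
     (\<forall>a b. (a, b) \<in> G \<longrightarrow> (a = 0 \<longleftrightarrow> b = 0))"

definition field_graph :: "(complex \<times> complex) set \<Rightarrow> bool" where
  "field_graph G \<longleftrightarrow> ring_graph G \<and> (\<forall>a b. (a, b) \<in> G \<longrightarrow> (inverse a, inverse b) \<in> G)"

lemma
  assumes "ring_graph G"
  shows rg_one: "(1, 1) \<in> G"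
    and rg_diff: "(a, b) \<in> G \<Longrightarrow> (c, d) \<in> G \<Longrightarrow> (a - c, b - d) \<in> G"
    and rg_mult: "(a, b) \<in> G \<Longrightarrow> (c, d) \<in> G \<Longrightarrow> (a * c, b * d) \<in> G"
    and rg_zero_iff: "(a, b) \<in> G \<Longrightarrow> a = 0 \<longleftrightarrow> b = 0"
  using assms unfolding ring_graph_def by blast+

lemma rg_zero: "ring_graph G \<Longrightarrow> (0, 0) \<in> G"
  using rg_diff[OF _ rg_one rg_one] by simp

lemma rg_uminus: "ring_graph G \<Longrightarrow> (a, b) \<in> G \<Longrightarrow> (- a, - b) \<in> G"
  using rg_diff[OF _ rg_zero, of G] by fastforce

lemma rg_add: "ring_graph G \<Longrightarrow> (a, b) \<in> G \<Longrightarrow> (c, d) \<in> G \<Longrightarrow> (a + c, b + d) \<in> G"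
  using rg_diff[OF _ _ rg_uminus, of G a b c d] by simp

lemma rg_sum:
  assumes G: "ring_graph G" and "\<And>i. i \<in> S \<Longrightarrow> (u i, v i) \<in> G"
  shows "(sum u S, sum v S) \<in> G"
  using assms(2) by (induction S rule: infinite_finite_induct) (auto simp: rg_zero[OF G] intro: rg_add[OF G])

lemma rg_inj_iff: "ring_graph G \<Longrightarrow> (a, b) \<in> G \<Longrightarrow> (c, d) \<in> G \<Longrightarrow> a = c \<longleftrightarrow> b = d"
  using rg_zero_iff[OF _ rg_diff, of G a b c d] by simp

definition fractions :: "(complex \<times> complex) set \<Rightarrow> (complex \<times> complex) set" where
  "fractions R = {(a / c, b / e) |a b c e. (a, b) \<in> R \<and> (c, e) \<in> R \<and> c \<noteq> 0}"

lemma field_graph_fractions: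
  assumes R: "ring_graph R"
  shows "field_graph (fractions R)"
proof -
  have I: "(x, y) \<in> fractions R" if "x = a / c" "y = b / e" "(a, b) \<in> R" "(c, e) \<in> R" "c \<noteq> 0" for x y a b c e
    using that unfolding fractions_def by blast
  have "(1, 1) \<in> fractions R" by (rule I[OF _ _ rg_one[OF R] rg_one[OF R]]) simp_all
  moreover have "(x - x', y - y') \<in> fractions R" "(x * x', y * y') \<in> fractions R" if xy: "(x, y) \<in> fractions R" "(x', y') \<in> fractions R" for x y x' y'
  proof -
    from xy[unfolded fractions_def] obtain a b c e a' b' c' e' where *: "x = a / c" "y = b / e" "(a, b) \<in> R" "(c, e) \<in> R" "c \<noteq> 0"
      "x' = a' / c'" "y' = b' / e'" "(a', b') \<in> R" "(c', e') \<in> R" "c' \<noteq> 0" by blast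
    have e: "e \<noteq> 0" "e' \<noteq> 0" using rg_zero_iff[OF R *(4)] rg_zero_iff[OF R *(9)] *(5,10) by auto
    show "(x * x', y * y') \<in> fractions R"
      by (rule I[OF _ _ rg_mult[OF R *(3,8)] rg_mult[OF R *(4,9)]]) (use * in auto)
    show "(x - x', y - y') \<in> fractions R"
      by (rule I[OF _ _ rg_diff[OF R rg_mult[OF R *(3,9)] rg_mult[OF R *(8,4)]] rg_mult[OF R *(4,9)]])
         (use * e in \<open>auto simp: field_simps\<close>)
  qed
  moreover have "x = 0 \<longleftrightarrow> y = 0" "(inverse x, inverse y) \<in> fractions R" if xy: "(x, y) \<in> fractions R" for x y
  proof -
    from xy[unfolded fractions_def] obtain a b c e where *: "x = a / c" "y = b / e" "(a, b) \<in> R" "(c, e) \<in> R" "c \<noteq> 0" by blast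
    have z: "a = 0 \<longleftrightarrow> b = 0" "e \<noteq> 0" using rg_zero_iff[OF R *(3)] rg_zero_iff[OF R *(4)] *(5) by auto
    then show "x = 0 \<longleftrightarrow> y = 0" using * by simp
    show "(inverse x, inverse y) \<in> fractions R"
    proof (cases "a = 0")
      case True
      then show ?thesis using * z by (intro I[OF _ _ *(3,4,5)]) auto
    next
      case False
      then show ?thesis using * z by (intro I[OF _ _ *(4,3)]) (auto simp: field_simps)
    qed
  qed
  ultimately show ?thesis unfolding field_graph_def ring_graph_def by simp
qed

lemma fractions_superset:
  assumes R: "ring_graph R"
  shows "R \<subseteq> fractions R"
  unfolding fractions_def
proof clarify
  fix a b assume "(a, b) \<in> R"
  then show "\<exists>a' b' c e. (a, b) = (a' / c, b' / e) \<and> (a', b') \<in> R \<and> (c, e) \<in> R \<and> c \<noteq> 0"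
    using rg_one[OF R] by (intro exI[of _ a] exI[of _ b] exI[of _ 1]) simp
qed

definition poly_graph :: "(complex \<times> complex) set \<Rightarrow> (complex poly \<times> complex poly) set" where
  "poly_graph G = {(p, q). \<forall>i. (coeff p i, coeff q i) \<in> G}"

lemma poly_graph_diff: "ring_graph G \<Longrightarrow> (p, p') \<in> poly_graph G \<Longrightarrow> (q, q') \<in> poly_graph G \<Longrightarrow> (p - q, p' - q') \<in> poly_graph G"
  by (simp add: poly_graph_def rg_diff)

lemma poly_graph_add: "ring_graph G \<Longrightarrow> (p, p') \<in> poly_graph G \<Longrightarrow> (q, q') \<in> poly_graph G \<Longrightarrow> (p + q, p' + q') \<in> poly_graph G"
  by (simp add: poly_graph_def rg_add)

lemma poly_graph_mult: "ring_graph G \<Longrightarrow> (p, p') \<in> poly_graph G \<Longrightarrow> (q, q') \<in> poly_graph G \<Longrightarrow> (p * q, p' * q') \<in> poly_graph G"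
  by (simp add: poly_graph_def coeff_mult rg_mult rg_sum)

lemma poly_graph_monom: "ring_graph G \<Longrightarrow> (a, b) \<in> G \<Longrightarrow> (monom a k, monom b k) \<in> poly_graph G"
  by (simp add: poly_graph_def rg_zero)

lemma poly_graph_sum:
  assumes G: "ring_graph G" and "\<And>i. i \<in> S \<Longrightarrow> (u i, v i) \<in> poly_graph G"
  shows "(sum u S, sum v S) \<in> poly_graph G"
  using assms(2)
proof (induction S rule: infinite_finite_induct)
  case (insert x S)
  then show ?case using poly_graph_add[OF G] by simp
qed (auto simp: poly_graph_def rg_zero[OF G])

lemma poly_graph_mono: "G \<subseteq> G' \<Longrightarrow> (p, q) \<in> poly_graph G \<Longrightarrow> (p, q) \<in> poly_graph G'"
  by (auto simp: poly_graph_def)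

lemma
  assumes G: "ring_graph G" and p: "(p, p') \<in> poly_graph G"
  shows poly_graph_zero_iff: "p = 0 \<longleftrightarrow> p' = 0"
    and poly_graph_degree: "degree p' = degree p"
proof -
  have z: "coeff p i = 0 \<longleftrightarrow> coeff p' i = 0" for i using p by (auto simp: poly_graph_def dest: rg_zero_iff[OF G])
  then show "p = 0 \<longleftrightarrow> p' = 0" by (simp add: poly_eq_iff)
  show "degree p' = degree p" by (intro antisym degree_le) (auto simp: z[symmetric] coeff_eq_0, simp add: z coeff_eq_0)
qed

text \<open>Long division is carried out over both fields at once; degrees agree because
  \<open>G\<close> respects zero. The measure ranks the zero polynomial below the nonzero constants,
  so that a step cancelling \<open>p\<close> completely still decreases it.\<close>

lemma poly_graph_division:
  assumes G: "field_graph G" and q: "(q, q') \<in> poly_graph G" "q \<noteq> 0"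
  shows "(p, p') \<in> poly_graph G \<Longrightarrow> \<exists>s s' r r'. (s, s') \<in> poly_graph G \<and> (r, r') \<in> poly_graph G \<and>
    p = s * q + r \<and> p' = s' * q' + r' \<and> (r = 0 \<or> degree r < degree q)"
proof (induction "if p = 0 then 0 else Suc (degree p)" arbitrary: p p' rule: less_induct)
  case less
  have R: "ring_graph G" using G by (simp add: field_graph_def)
  have inv: "(a, b) \<in> G \<Longrightarrow> (inverse a, inverse b) \<in> G" for a b using G by (simp add: field_graph_def)
  have zz: "(0, 0) \<in> poly_graph G" by (simp add: poly_graph_def rg_zero[OF R])
  show ?case
  proof (cases "p = 0 \<or> degree p < degree q")
    case True
    then show ?thesis using zz less.prems by (intro exI[of _ 0] exI[of _ p] exI[of _ p']) auto
  next
    case False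
    then have pn: "p \<noteq> 0" "degree q \<le> degree p" by auto
    define c where "c = lead_coeff p * inverse (lead_coeff q)"
    define c' where "c' = lead_coeff p' * inverse (lead_coeff q')"
    define t where "t = monom c (degree p - degree q)"
    define t' where "t' = monom c' (degree p - degree q)"
    have cc: "(c, c') \<in> G"
      unfolding c_def c'_def poly_graph_degree[OF R q(1)] poly_graph_degree[OF R less.prems]
      by (intro rg_mult[OF R] inv) (use q(1) less.prems in \<open>auto simp: poly_graph_def\<close>)
    have tt: "(t, t') \<in> poly_graph G" unfolding t_def t'_def by (rule poly_graph_monom[OF R cc])
    have p1: "(p - t * q, p' - t' * q') \<in> poly_graph G"
      by (intro poly_graph_diff poly_graph_mult R tt q(1) less.prems)
    have c0: "c \<noteq> 0" using pn(1) q(2) by (simp add: c_def)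
    then have t0: "t \<noteq> 0" by (simp add: t_def)
    have dt: "degree (t * q) = degree p"
      using t0 q(2) pn(2) c0 by (simp add: degree_mult_eq t_def degree_monom_eq)
    have lc: "lead_coeff (t * q) = lead_coeff p"
      unfolding lead_coeff_mult using q(2) c0 by (simp add: t_def degree_monom_eq c_def)
    have d1: "p - t * q = 0 \<or> degree (p - t * q) < degree p"
    proof (rule disjCI)
      assume n: "\<not> degree (p - t * q) < degree p"
      have "degree (p - t * q) \<le> degree p" using degree_diff_le[of p "degree p" "t * q"] dt by simp
      then have "degree (p - t * q) = degree p" using n by simp
      then have "lead_coeff (p - t * q) = 0" using lc dt by simp
      then show "p - t * q = 0" by (simp only: leading_coeff_0_iff)
    qed
    obtain s s' r r' where *: "(s, s') \<in> poly_graph G" "(r, r') \<in> poly_graph G"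
      "p - t * q = s * q + r" "p' - t' * q' = s' * q' + r'" "r = 0 \<or> degree r < degree q"
      using less.hyps[OF _ p1] d1 pn(1) by (cases "p - t * q = 0") fastforce+
    have "p = (s + t) * q + r" "p' = (s' + t') * q' + r'" using *(3,4) by (simp_all add: algebra_simps)
    then show ?thesis using poly_graph_add[OF R *(1) tt] *(2,5) by blast
  qed
qed

text \<open>For \<open>m\<close> of least degree vanishing at \<open>a\<close>, any root
  \<open>b\<close> of the transported \<open>m'\<close> can correspond to \<open>a\<close>, provided
  that evaluation at \<open>a\<close> and at \<open>b\<close> have corresponding kernels. A
  polynomial \<open>q\<close> of least degree whose transport vanishes at \<open>b\<close> divides
  \<open>m\<close>, and minimality of \<open>m\<close> forces \<open>q\<close> to vanish at
  \<open>a\<close>; this replaces an irreducibility argument.\<close>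

lemma field_graph_extend:
  assumes G: "field_graph G" and p: "(p, p') \<in> poly_graph G" "p \<noteq> 0" "poly p a = 0"
  shows "\<exists>b G'. field_graph G' \<and> G \<subseteq> G' \<and> (a, b) \<in> G'"
proof -
  have R: "ring_graph G" using G by (simp add: field_graph_def)
  define Q where "Q k \<longleftrightarrow> (\<exists>m m'. (m, m') \<in> poly_graph G \<and> m \<noteq> 0 \<and> poly m a = 0 \<and> degree m = k)" for k
  have "Q (degree p)" using p by (auto simp: Q_def)
  then have "Q (LEAST k. Q k)" by (rule LeastI)
  then obtain m m' where m: "(m, m') \<in> poly_graph G" "m \<noteq> 0" "poly m a = 0" "degree m = (LEAST k. Q k)"
    unfolding Q_def by blast
  have min_m: "degree m \<le> degree q" if "(q, q') \<in> poly_graph G" "q \<noteq> 0" "poly q a = 0" for q q'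
    unfolding m(4) by (rule Least_le) (use that in \<open>auto simp: Q_def\<close>)
  have "degree m \<noteq> 0"
  proof
    assume "degree m = 0"
    then obtain c where "m = [:c:]" by (metis degree_eq_zeroE)
    then show False using m(2,3) by simp
  qed
  then have "degree m' \<noteq> 0" using poly_graph_degree[OF R m(1)] by simp
  then obtain b where b: "poly m' b = 0"
    using fundamental_theorem_of_algebra_alt[of m'] by fastforce
  define Q' where "Q' k \<longleftrightarrow> (\<exists>q q'. (q, q') \<in> poly_graph G \<and> q \<noteq> 0 \<and> poly q' b = 0 \<and> degree q = k)" for k
  have "Q' (degree m)" using m b by (auto simp: Q'_def)
  then have "Q' (LEAST k. Q' k)" by (rule LeastI)
  then obtain q q' where q: "(q, q') \<in> poly_graph G" "q \<noteq> 0" "poly q' b = 0" "degree q = (LEAST k. Q' k)"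
    unfolding Q'_def by blast
  have min_q: "degree q \<le> degree u" if "(u, u') \<in> poly_graph G" "u \<noteq> 0" "poly u' b = 0" for u u'
    unfolding q(4) by (rule Least_le) (use that in \<open>auto simp: Q'_def\<close>)
  have div_q: "\<exists>s s'. (s, s') \<in> poly_graph G \<and> u = s * q" if u: "(u, u') \<in> poly_graph G" "poly u' b = 0" for u u'
  proof -
    obtain s s' r r' where *: "(s, s') \<in> poly_graph G" "(r, r') \<in> poly_graph G" "u = s * q + r" "u' = s' * q' + r'"
      "r = 0 \<or> degree r < degree q" using poly_graph_division[OF G q(1,2) u(1)] by blast
    have "poly r' b = 0" using u(2) q(3) *(4) by simp
    then have "r = 0" using min_q[OF *(2)] *(5) by fastforce
    then show ?thesis using * by auto
  qed
  have qa: "poly q a = 0"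
  proof -
    obtain s s' where s: "(s, s') \<in> poly_graph G" "m = s * q" using div_q[OF m(1) b] by blast
    have "degree q \<noteq> 0"
    proof
      assume "degree q = 0"
      then have "degree q' = 0" "q' \<noteq> 0"
        using poly_graph_degree[OF R q(1)] poly_graph_zero_iff[OF R q(1)] q(2) by auto
      then obtain c where "q' = [:c:]" "c \<noteq> 0" by (metis degree_eq_zeroE pCons_0_0)
      then show False using q(3) by simp
    qed
    \<comment> \<open>\<open>q\<close> is not constant, so the cofactor \<open>s\<close> has smaller
      degree than \<open>m\<close> and cannot vanish at \<open>a\<close>.\<close>
    then have "degree s < degree m" using s(2) m(2) by (auto simp: degree_mult_eq)
    then have "poly s a \<noteq> 0" using min_m[OF s(1)] s(2) m(2) by fastforce
    then show ?thesis using m(3) s(2) by simp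
  qed
  define RR where "RR = {(poly u a, poly u' b) |u u'. (u, u') \<in> poly_graph G}"
  have RRI: "(poly u a, poly u' b) \<in> RR" if "(u, u') \<in> poly_graph G" for u u' using that by (auto simp: RR_def)
  have zero_iff: "poly u a = 0 \<longleftrightarrow> poly u' b = 0" if u: "(u, u') \<in> poly_graph G" for u u'
  proof
    assume ua: "poly u a = 0"
    obtain s s' r r' where *: "(s, s') \<in> poly_graph G" "(r, r') \<in> poly_graph G" "u = s * m + r" "u' = s' * m' + r'"
      "r = 0 \<or> degree r < degree m" using poly_graph_division[OF G m(1,2) u] by blast
    have "poly r a = 0" using ua m(3) *(3) by simp
    then have "r = 0" using min_m[OF *(2)] *(5) by fastforce
    then have "r' = 0" using poly_graph_zero_iff[OF R *(2)] by simp
    then show "poly u' b = 0" using b *(4) by simp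
  next
    assume "poly u' b = 0"
    then show "poly u a = 0" using div_q[OF u] qa by auto
  qed
  have "ring_graph RR"
    unfolding ring_graph_def
  proof (intro conjI allI impI)
    have "(1, 1) \<in> poly_graph G" using poly_graph_monom[OF R rg_one[OF R], of 0] by (simp add: monom_0 one_pCons)
    from RRI[OF this] show "(1, 1) \<in> RR" by simp
    fix x y assume "(x, y) \<in> RR"
    then obtain u u' where u: "(u, u') \<in> poly_graph G" "x = poly u a" "y = poly u' b" by (auto simp: RR_def)
    then show "x = 0 \<longleftrightarrow> y = 0" using zero_iff by simp
    fix x1 y1 assume "(x1, y1) \<in> RR"
    then obtain v v' where v: "(v, v') \<in> poly_graph G" "x1 = poly v a" "y1 = poly v' b" by (auto simp: RR_def)
    show "(x - x1, y - y1) \<in> RR" using RRI[OF poly_graph_diff[OF R u(1) v(1)]] by (simp add: u v)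
    show "(x * x1, y * y1) \<in> RR" using RRI[OF poly_graph_mult[OF R u(1) v(1)]] by (simp add: u v)
  qed
  note F = field_graph_fractions[OF this] fractions_superset[OF this]
  have "G \<subseteq> RR"
  proof clarify
    fix x y assume "(x, y) \<in> G"
    then show "(x, y) \<in> RR" using RRI[OF poly_graph_monom[OF R, of x y 0]] by (simp add: poly_monom)
  qed
  moreover have "(a, b) \<in> RR"
    using RRI[OF poly_graph_monom[OF R rg_one[OF R], of 1]] by (simp add: poly_monom)
  ultimately show ?thesis using F by blast
qed

lemma field_graph_extend_finite:
  assumes "finite A" and G: "field_graph G"
    and alg: "\<And>a. a \<in> A \<Longrightarrow> \<exists>p p'. (p, p') \<in> poly_graph G \<and> p \<noteq> 0 \<and> poly p a = 0"
  shows "\<exists>G'. field_graph G' \<and> G \<subseteq> G' \<and> (\<forall>a\<in>A. \<exists>b. (a, b) \<in> G')"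
  using assms(1) alg
proof (induction A rule: finite_induct)
  case empty
  then show ?case using G by blast
next
  case (insert a A)
  then obtain G1 where G1: "field_graph G1" "G \<subseteq> G1" "\<forall>a\<in>A. \<exists>b. (a, b) \<in> G1" by auto
  obtain p p' where p: "(p, p') \<in> poly_graph G" "p \<noteq> 0" "poly p a = 0" using insert.prems by blast
  obtain b G' where "field_graph G'" "G1 \<subseteq> G'" "(a, b) \<in> G'"
    using field_graph_extend[OF G1(1) poly_graph_mono[OF G1(2) p(1)] p(2,3)] by blast
  then show ?case using G1 by (intro exI[of _ G']) blast
qed

text \<open>Algebraic independence of the coordinates over the ring generated by
  \<open>K\<close>.\<close>

definition generic :: "complex set \<Rightarrow> complex ^ 'm::finite \<Rightarrow> bool" where
  "generic K y \<longleftrightarrow> (\<forall>P\<in>pfun K. P y = 0 \<longrightarrow> P = (\<lambda>_. 0))"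

text \<open>Evaluation at a generic point is injective on polynomials over \<open>K\<close>, so
  matching the values at two generic points is a ring isomorphism, which extends to
  fractions.\<close>

lemma generic_field_graph:
  fixes y0 y1 :: "complex ^ 'm::finite"
  assumes "generic K y0" "generic K y1"
  obtains G where "field_graph G" "\<And>P. P \<in> pfun K \<Longrightarrow> (P y0, P y1) \<in> G"
proof -
  define R where "R = {(P y0, P y1) |P. P \<in> pfun K}"
  have I: "(P y0, P y1) \<in> R" if "P \<in> pfun K" for P using that by (auto simp: R_def)
  have "ring_graph R"
    unfolding ring_graph_def
  proof (intro conjI allI impI)
    show "(1, 1) \<in> R" using I[OF pf_one] by simp
    fix x y assume "(x, y) \<in> R"
    then obtain P where P: "P \<in> pfun K" "x = P y0" "y = P y1" by (auto simp: R_def)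
    show "x = 0 \<longleftrightarrow> y = 0"
    proof
      assume "x = 0"
      then have "P = (\<lambda>_. 0)" using P assms(1) by (simp add: generic_def)
      then show "y = 0" using P(3) by simp
    next
      assume "y = 0"
      then have "P = (\<lambda>_. 0)" using P assms(2) by (simp add: generic_def)
      then show "x = 0" using P(2) by simp
    qed
    fix x' y' assume "(x', y') \<in> R"
    then obtain P' where P': "P' \<in> pfun K" "x' = P' y0" "y' = P' y1" by (auto simp: R_def)
    show "(x - x', y - y') \<in> R" using I[OF pf_diff[OF P(1) P'(1)]] by (simp add: P P')
    show "(x * x', y * y') \<in> R" using I[OF pf_mult[OF P(1) P'(1)]] by (simp add: P P')
  qed
  note F = field_graph_fractions[OF this] fractions_superset[OF this]
  show thesis by (rule that[OF F(1)], rule subsetD[OF F(2)], rule I)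
qed

lemma pf_graph:
  assumes R: "ring_graph G" and K: "\<And>c. c \<in> K \<Longrightarrow> (c, c) \<in> G"
    and x: "\<And>i. (x $ i, x' $ i) \<in> G" and P: "P \<in> pfun K"
  shows "(P x, P x') \<in> G"
  using P
proof (induction rule: pfun.induct)
  case pf_neg1
  show ?case using rg_uminus[OF R rg_one[OF R]] by simp
qed (auto intro: K x rg_add[OF R] rg_mult[OF R])

lemma pf_cnj:
  assumes "P \<in> pfun K"
  shows "(\<lambda>x. cnj (P (\<chi> j. cnj (x $ j)))) \<in> pfun (cnj ` K)"
  using assms
proof (induction rule: pfun.induct)
  case pf_neg1
  show ?case using pfun.pf_neg1 by simp
next
  case (pf_coord i)
  show ?case using pfun.pf_coord by simp
next
  case (pf_add f g)
  from pfun.pf_add[OF this(3,4)] show ?case by simp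
next
  case (pf_mult f g)
  from pfun.pf_mult[OF this(3,4)] show ?case by simp
qed (auto intro: pfun.pf_const)

lemma even_card_involution:
  assumes "finite S" and w: "\<And>x. x \<in> S \<Longrightarrow> w x \<in> S" "\<And>x. x \<in> S \<Longrightarrow> w (w x) = x"
  shows "even (card S) \<longleftrightarrow> even (card {x \<in> S. w x = x})"
proof -
  have free: "even (card T)" if "finite T" "\<And>x. x \<in> T \<Longrightarrow> w x \<in> T" "\<And>x. x \<in> T \<Longrightarrow> w (w x) = x" "\<And>x. x \<in> T \<Longrightarrow> w x \<noteq> x" for T
    using that
  proof (induction T rule: finite_psubset_induct)
    case (psubset T)
    show ?case
    proof (cases "T = {}")
      case False
      then obtain x where x: "x \<in> T" by blast
      let ?T = "T - {x, w x}"
      have "even (card ?T)"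
      proof (rule psubset.IH)
        show "?T \<subset> T" using x by blast
        fix y assume y: "y \<in> ?T"
        then have "w y \<noteq> x" "w y \<noteq> w x" using psubset.prems(2) x by (metis DiffE insertCI)+
        then show "w y \<in> ?T" using psubset.prems(1) y by simp
      qed (use psubset.prems in auto)
      moreover have "card T = card ?T + card {x, w x}"
        using psubset.hyps x psubset.prems(1) by (subst card_Diff_subset) (auto intro!: le_add_diff_inverse2[symmetric] card_mono)
      moreover have "card {x, w x} = 2" using psubset.prems(3)[OF x] by simp
      ultimately show ?thesis by simp
    qed simp
  qed
  have "even (card {x \<in> S. w x \<noteq> x})"
    by (rule free) (use assms in auto)
  moreover have "card S = card {x \<in> S. w x = x} + card {x \<in> S. w x \<noteq> x}"
    using assms(1) by (subst card_Un_disjoint[symmetric]) (auto intro: arg_cong[where f = card])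
  ultimately show ?thesis by simp
qed

section \<open>Parity of the fibres of the amoeba map\<close>

context torus_variety
begin

text \<open>The Zariski closure of the good points in the torus.\<close>

definition V1 :: "(complex ^ 'm) set" where
  "V1 = {z \<in> ctorus. \<forall>g\<in>pfun UNIV. (\<forall>x\<in>Z. g x = 0) \<longrightarrow> g z = 0}"

lemma V1_D: "z \<in> V1 \<Longrightarrow> g \<in> pfun UNIV \<Longrightarrow> (\<And>x. x \<in> Z \<Longrightarrow> g x = 0) \<Longrightarrow> g z = 0"
  by (simp add: V1_def)

lemma Z_subset_V1: "Z \<subseteq> V1"
  using Z_subset_V by (auto simp: V1_def V_def)

lemma V1_subset_V: "V1 \<subseteq> V"
proof
  fix z assume z: "z \<in> V1"
  have "f j z = 0" if j: "j \<in> {1..n}" for j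
    by (rule V1_D[OF z fpf[OF j]]) (use Z_subset_V j in \<open>auto simp: V_def\<close>)
  then show "z \<in> V" using z by (simp add: V_def V1_def)
qed

text \<open>The sets where single equations fail form an open cover of where some equation fails,
  and Lindelof's theorem keeps countably many. Countability is what a countable field of definition
  asks for.\<close>

lemma V1_equations:
  obtains S where "countable S" "S \<subseteq> pfun UNIV" "V1 = {z \<in> ctorus. \<forall>g\<in>S. g z = 0}"
proof -
  define I where "I = {g \<in> pfun UNIV. \<forall>x\<in>Z. g x = 0}"
  define N where "N g = {z :: complex ^ 'm. g z \<noteq> 0}" for g :: "complex ^ 'm \<Rightarrow> complex"
  have No: "open (N g)" if "g \<in> I" for g
  proof -
    have "closed {z. g z = 0}" using that by (intro pf_zeros_closed) (auto simp: I_def)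
    moreover have "N g = - {z. g z = 0}" by (auto simp: N_def)
    ultimately show ?thesis by (simp add: open_Compl)
  qed
  obtain F where F: "F \<subseteq> N ` I" "countable F" "\<Union>F = \<Union>(N ` I)"
  proof (rule Lindelof[of "N ` I"])
    fix W assume "W \<in> N ` I"
    then obtain g where "g \<in> I" "W = N g" by (rule imageE)
    then show "open W" using No by simp
  qed
  have "\<exists>S. countable S \<and> S \<subseteq> I \<and> F = N ` S"
    unfolding countable_subset_image[symmetric] using F(1,2) by (rule conjI[rotated])
  then obtain S where S: "countable S" "S \<subseteq> I" "F = N ` S" by (elim exE conjE)
  have 1: "(\<exists>g\<in>S. z \<in> N g) \<longleftrightarrow> (\<exists>g\<in>I. z \<in> N g)" for z
    using arg_cong[OF F(3)[unfolded S(3)], of "\<lambda>W. z \<in> W"] by simp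
  have "(\<forall>g\<in>S. g z = 0) \<longleftrightarrow> (\<forall>g\<in>I. g z = 0)" for z using 1[of z] by (auto simp: N_def)
  then have "V1 = {z \<in> ctorus. \<forall>g\<in>S. g z = 0}" unfolding V1_def I_def by auto
  then show thesis using that[OF S(1)] S(2) by (auto simp: I_def)
qed

text \<open>With more powers \<open>M\<close> of \<open>z $ i\<close> than \<open>Log_bound\<close>
  permits, the family in \<open>product_bound\<close> is dependent in some degree \<open>X\<close>.
  Such a relation ties \<open>z $ i\<close> algebraically to the products
  \<open>z $ t * cnj (z' $ t)\<close>.\<close>

lemma coordinate_relation:
  obtains M X c where "\<exists>p\<in>exps UNIV X \<times> {..<M}. c p \<noteq> 0"
    "\<And>z z'. z \<in> V1 \<Longrightarrow> z' \<in> V1 \<Longrightarrow>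
       (\<Sum>(a, l)\<in>exps UNIV X \<times> {..<M}. c (a, l) * ((\<Prod>t\<in>UNIV. (z $ t * cnj (z' $ t)) ^ a t) * z $ i ^ l)) = 0"
proof -
  obtain M :: nat where M: "Log_bound < real M" using reals_Archimedean2 by blast
  have h: "(\<lambda>z. z $ i) \<in> pdeg (\<lambda>i z :: complex ^ 'm. z $ i) 1"
    by (rule pdeg_coord) simp
  have "\<exists>X. \<not> indep_on (Z \<times> Z) (exps UNIV X \<times> {..<M})
      (\<lambda>(a, l) (z, z'). (\<Prod>t\<in>UNIV. (z $ t * cnj (z' $ t)) ^ a t) * z $ i ^ l)"
    using product_bound[OF h, of M] M by (auto simp: not_le[symmetric])
  then obtain X c where c: "\<exists>p\<in>exps UNIV X \<times> {..<M}. c p \<noteq> 0"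
    "\<And>z z'. z \<in> Z \<Longrightarrow> z' \<in> Z \<Longrightarrow>
       (\<Sum>(a, l)\<in>exps UNIV X \<times> {..<M}. c (a, l) * ((\<Prod>t\<in>UNIV. (z $ t * cnj (z' $ t)) ^ a t) * z $ i ^ l)) = 0"
    unfolding indep_on_def by (auto simp: case_prod_unfold)
  let ?\<Phi> = "\<lambda>z z'. (\<Sum>(a, l)\<in>exps UNIV X \<times> {..<M}. c (a, l) * ((\<Prod>t\<in>UNIV. (z $ t * cnj (z' $ t)) ^ a t) * z $ i ^ l))"
  have 1: "?\<Phi> z z' = 0" if z: "z \<in> V1" and z': "z' \<in> Z" for z z'
  proof -
    have "(\<lambda>z. ?\<Phi> z z') \<in> pfun UNIV"
      unfolding case_prod_unfold
      by (intro pf_sum pf_mult pf_prod pf_power pf_coord pf_const) auto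
    from V1_D[OF z this c(2)[OF _ z']] show ?thesis .
  qed
  \<comment> \<open>The relation is extended from \<open>Z\<close> to \<open>V1\<close> in one
    variable at a time. In the second one it is antiholomorphic, so its conjugate is the polynomial
    to which \<open>V1_D\<close> applies.\<close>
  have "?\<Phi> z z' = 0" if z: "z \<in> V1" and z': "z' \<in> V1" for z z'
  proof -
    have eq: "cnj (?\<Phi> z w) = (\<Sum>(a, l)\<in>exps UNIV X \<times> {..<M}. cnj (c (a, l)) * ((\<Prod>t\<in>UNIV. (cnj (z $ t) * w $ t) ^ a t) * cnj (z $ i) ^ l))" for w
      by (simp add: case_prod_unfold)
    have "(\<lambda>w. \<Sum>(a, l)\<in>exps UNIV X \<times> {..<M}. cnj (c (a, l)) * ((\<Prod>t\<in>UNIV. (cnj (z $ t) * w $ t) ^ a t) * cnj (z $ i) ^ l)) \<in> pfun UNIV"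
      unfolding case_prod_unfold
      by (intro pf_sum pf_mult pf_prod pf_power pf_coord pf_const) auto
    then have "(\<lambda>w. cnj (?\<Phi> z w)) \<in> pfun UNIV" unfolding eq .
    from V1_D[OF z' this] 1[OF z] have "cnj (?\<Phi> z z') = 0" by simp
    then show ?thesis by (simp only: complex_cnj_zero_iff)
  qed
  then show thesis by (rule that[OF c(1)])
qed

text \<open>Countably many equations for \<open>V1\<close> and one relation per coordinate involve
  countably many constants, and closure under conjugation keeps them countable. A coefficient
  \<open>A l\<close> that is not identically zero ensures that the relation survives at generic
  points.\<close>

lemma field_of_definition:
  obtains K S where "countable K" "cnj ` K \<subseteq> K" "S \<subseteq> pfun K" "V1 = {z \<in> ctorus. \<forall>g\<in>S. g z = 0}"
    "\<And>i. \<exists>M A. (\<forall>l. A l \<in> pfun K) \<and> (\<exists>l<M. A l \<noteq> (\<lambda>_. 0)) \<and>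
      (\<forall>z\<in>V1. \<forall>z'\<in>V1. (\<Sum>l<M. A l (\<chi> t. z $ t * cnj (z' $ t)) * z $ i ^ l) = 0)"
proof -
  obtain S where S: "countable S" "S \<subseteq> pfun UNIV" "V1 = {z \<in> ctorus. \<forall>g\<in>S. g z = 0}" by (rule V1_equations)
  have "\<exists>K. \<forall>g\<in>S. finite (K g) \<and> g \<in> pfun (K g)"
    by (rule bchoice) (use S(2) pf_finite_constants in blast)
  then obtain Kg where Kg: "\<And>g. g \<in> S \<Longrightarrow> finite (Kg g)" "\<And>g. g \<in> S \<Longrightarrow> g \<in> pfun (Kg g)" by blast
  define rel where "rel i = (\<lambda>(M, X, c). (\<exists>p\<in>exps UNIV X \<times> {..<M}. c p \<noteq> 0) \<and>
    (\<forall>z\<in>V1. \<forall>z'\<in>V1. (\<Sum>(a, l)\<in>exps UNIV X \<times> {..<M}. c (a, l) * ((\<Prod>t\<in>UNIV. (z $ t * cnj (z' $ t)) ^ a t) * z $ i ^ l)) = 0))" for i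
  have "\<exists>r. rel i r" for i
  proof (rule coordinate_relation[of i])
    fix M :: nat and X c
    assume "\<exists>p\<in>exps UNIV X \<times> {..<M}. c p \<noteq> 0"
      "\<And>z z'. z \<in> V1 \<Longrightarrow> z' \<in> V1 \<Longrightarrow>
       (\<Sum>(a, l)\<in>exps UNIV X \<times> {..<M}. c (a, l) * ((\<Prod>t\<in>UNIV. (z $ t * cnj (z' $ t)) ^ a t) * z $ i ^ l)) = 0"
    then have "rel i (M, X, c)" unfolding rel_def by blast
    then show ?thesis by blast
  qed
  then have "\<exists>r. \<forall>i. rel i (r i)" by (intro choice allI)
  then obtain r where r: "\<And>i. rel i (r i)" by blast
  define M where "M i = fst (r i)" for i
  define X where "X i = fst (snd (r i))" for i
  define c where "c i = snd (snd (r i))" for i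
  have rel: "rel i (M i, X i, c i)" for i using r[of i] by (simp add: M_def X_def c_def)
  define K0 where "K0 = (\<Union>g\<in>S. Kg g) \<union> (\<Union>i. c i ` (exps UNIV (X i) \<times> {..<M i}))"
  define K where "K = K0 \<union> cnj ` K0"
  have K0: "countable K0"
    unfolding K0_def using S(1) Kg(1)
    by (intro countable_Un countable_UN countable_image) (auto intro: countable_finite)
  show thesis
  proof (rule that[of K S])
    show "countable K" using K0 by (simp add: K_def)
    show "cnj ` K \<subseteq> K" by (auto simp: K_def image_iff)
    show "S \<subseteq> pfun K"
    proof
      fix g assume g: "g \<in> S"
      show "g \<in> pfun K" by (rule pf_subset[OF Kg(2)[OF g]]) (use g in \<open>auto simp: K_def K0_def\<close>)
    qed
    show "V1 = {z \<in> ctorus. \<forall>g\<in>S. g z = 0}" by (rule S(3))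
    fix i
    define A where "A l y = (if l < M i then \<Sum>a\<in>exps UNIV (X i). c i (a, l) * (\<Prod>t\<in>UNIV. (y $ t) ^ a t) else 0)" for l and y :: "complex ^ 'm"
    have "A l \<in> pfun K" for l
    proof (cases "l < M i")
      case True
      have "c i (a, l) \<in> K" if "a \<in> exps UNIV (X i)" for a
        using that True by (auto simp: K_def K0_def)
      then show ?thesis
        using True by (auto simp: A_def[abs_def] intro!: pf_sum pf_mult pf_prod pf_power pf_coord pf_const)
    next
      case False
      then show ?thesis by (simp add: A_def[abs_def] pf_zero)
    qed
    moreover have "\<exists>l<M i. A l \<noteq> (\<lambda>_. 0)"
    proof -
      obtain a l where al: "a \<in> exps UNIV (X i)" "l < M i" "c i (a, l) \<noteq> 0"
        using rel[of i] unfolding rel_def by auto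
      have "A l \<noteq> (\<lambda>_. 0)"
      proof
        assume z: "A l = (\<lambda>_. 0)"
        have "c i (a, l) = 0"
        proof (rule coefficients_zero[where X = UNIV and \<delta> = 1 and S = "exps UNIV (X i)" and c = "\<lambda>a. c i (a, l)" and z = "\<lambda>_. 0"])
          fix x :: "'m \<Rightarrow> complex"
          show "(\<Sum>a\<in>exps UNIV (X i). c i (a, l) * (\<Prod>t\<in>UNIV. x t ^ a t)) = 0"
            using fun_cong[OF z, of "\<chi> t. x t"] al(2) by (simp add: A_def)
        qed (use al(1) in \<open>auto simp: fun_eq_iff\<close>)
        with al(3) show False by simp
      qed
      then show ?thesis using al(2) by blast
    qed
    moreover have "(\<Sum>l<M i. A l (\<chi> t. z $ t * cnj (z' $ t)) * z $ i ^ l) = 0" if "z \<in> V1" "z' \<in> V1" for z z'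
    proof -
      have "(\<Sum>l<M i. A l (\<chi> t. z $ t * cnj (z' $ t)) * z $ i ^ l) =
          (\<Sum>l<M i. \<Sum>a\<in>exps UNIV (X i). c i (a, l) * ((\<Prod>t\<in>UNIV. (z $ t * cnj (z' $ t)) ^ a t) * z $ i ^ l))"
        by (simp add: A_def sum_distrib_right mult.assoc)
      also have "\<dots> = (\<Sum>(a, l)\<in>exps UNIV (X i) \<times> {..<M i}. c i (a, l) * ((\<Prod>t\<in>UNIV. (z $ t * cnj (z' $ t)) ^ a t) * z $ i ^ l))"
        by (subst sum.swap) (simp add: sum.cartesian_product)
      also have "\<dots> = 0" using rel[of i] that unfolding rel_def by auto
      finally show ?thesis .
    qed
    ultimately show "\<exists>M A. (\<forall>l. A l \<in> pfun K) \<and> (\<exists>l<M. A l \<noteq> (\<lambda>_. 0)) \<and>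
      (\<forall>z\<in>V1. \<forall>z'\<in>V1. (\<Sum>l<M. A l (\<chi> t. z $ t * cnj (z' $ t)) * z $ i ^ l) = 0)"
      by blast
  qed
qed

text \<open>The fibre over \<open>y\<close> of the product map
  \<open>(z, z') \<mapsto> z * cnj z'\<close> on \<open>V1 \<times> V1\<close>, with
  \<open>z'\<close> eliminated. Unlike a fibre of the logarithm map it is an algebraic condition on
  \<open>z\<close>, so field isomorphisms can transport it.\<close>

definition fib :: "complex ^ 'm \<Rightarrow> (complex ^ 'm) set" where
  "fib y = {z \<in> V1. (\<chi> j. cnj (y $ j / z $ j)) \<in> V1}"

text \<open>On the fibre the products of coordinates equal \<open>y0\<close>, so the relation for
  coordinate \<open>i\<close> becomes the polynomial \<open>p\<close>, nonzero by genericity. Its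
  companion \<open>q\<close> is the same expression at \<open>y1\<close>, fixed before the graph
  \<open>G\<close> is chosen.\<close>

lemma fib_algebraic:
  assumes rel: "\<And>i. \<exists>M A. (\<forall>l. A l \<in> pfun K) \<and> (\<exists>l<M. A l \<noteq> (\<lambda>_. 0)) \<and>
      (\<forall>z\<in>V1. \<forall>z'\<in>V1. (\<Sum>l<M. A l (\<chi> t. z $ t * cnj (z' $ t)) * z $ i ^ l) = 0)"
    and y: "generic K y0"
  shows "\<exists>p q. p \<noteq> 0 \<and> (\<forall>z\<in>fib y0. poly p (z $ i) = 0) \<and>
      (\<forall>G. ring_graph G \<longrightarrow> (\<forall>P\<in>pfun K. (P y0, P y1) \<in> G) \<longrightarrow> (p, q) \<in> poly_graph G)"
proof -
  obtain M A where A: "\<And>l. A l \<in> pfun K" "\<exists>l<M. A l \<noteq> (\<lambda>_. 0)"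
    "\<And>z z'. z \<in> V1 \<Longrightarrow> z' \<in> V1 \<Longrightarrow> (\<Sum>l<M. A l (\<chi> t. z $ t * cnj (z' $ t)) * z $ i ^ l) = 0"
    using rel[of i] by blast
  let ?p = "\<lambda>y. \<Sum>l<M. monom (A l y) l"
  obtain l where l: "l < M" "A l \<noteq> (\<lambda>_. 0)" using A(2) by blast
  have "A l y0 \<noteq> 0" using y A(1) l(2) by (auto simp: generic_def)
  moreover have "coeff (?p y0) l = A l y0" using l(1) by (simp add: coeff_sum)
  ultimately have "?p y0 \<noteq> 0" by auto
  moreover have "poly (?p y0) (z $ i) = 0" if z: "z \<in> fib y0" for z
  proof -
    have z1: "z \<in> V1" "(\<chi> j. cnj (y0 $ j / z $ j)) \<in> V1" using z by (auto simp: fib_def)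
    have "z $ t \<noteq> 0" for t using z1(1) by (simp add: V1_def ctorus_def)
    then have "(\<chi> t. z $ t * cnj ((\<chi> j. cnj (y0 $ j / z $ j)) $ t)) = y0"
      by (simp add: vec_eq_iff)
    then show ?thesis using A(3)[OF z1] by (simp add: poly_sum poly_monom)
  qed
  moreover have "(?p y0, ?p y1) \<in> poly_graph G" if "ring_graph G" "\<forall>P\<in>pfun K. (P y0, P y1) \<in> G" for G
    using that A(1) by (intro poly_graph_sum poly_graph_monom) auto
  ultimately show ?thesis by blast
qed

lemma finite_fib:
  assumes rel: "\<And>i. \<exists>M A. (\<forall>l. A l \<in> pfun K) \<and> (\<exists>l<M. A l \<noteq> (\<lambda>_. 0)) \<and>
      (\<forall>z\<in>V1. \<forall>z'\<in>V1. (\<Sum>l<M. A l (\<chi> t. z $ t * cnj (z' $ t)) * z $ i ^ l) = 0)"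
    and y: "generic K y0"
  shows "finite (fib y0)"
proof -
  have "\<exists>p. p \<noteq> 0 \<and> (\<forall>z\<in>fib y0. poly p (z $ i) = 0)" for i using fib_algebraic[OF rel y, of i] by blast
  then have "\<exists>p. \<forall>i. p i \<noteq> 0 \<and> (\<forall>z\<in>fib y0. poly (p i) (z $ i) = 0)" by (intro choice allI)
  then obtain p where p: "\<And>i. p i \<noteq> 0" "\<And>i z. z \<in> fib y0 \<Longrightarrow> poly (p i) (z $ i) = 0" by blast
  let ?B = "PiE UNIV (\<lambda>i. {t. poly (p i) t = 0})"
  have "finite ?B" using poly_roots_finite[OF p(1)] by (intro finite_PiE) auto
  moreover have "fib y0 \<subseteq> (\<lambda>u. \<chi> i. u i) ` ?B"
  proof
    fix z assume z: "z \<in> fib y0"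
    show "z \<in> (\<lambda>u. \<chi> i. u i) ` ?B"
      by (rule image_eqI[of _ _ "\<lambda>i. z $ i"]) (use p(2)[OF z] in \<open>auto simp: vec_eq_iff\<close>)
  qed
  ultimately show ?thesis using finite_subset by blast
qed

text \<open>The isomorphism taking \<open>y0\<close> to \<open>y1\<close> over \<open>K\<close>
  extends to the finitely many coordinates of points of \<open>fib y0\<close>, which are algebraic,
  and carries these points injectively into \<open>fib y1\<close>. Exchanging \<open>y0\<close> and
  \<open>y1\<close> yields equality.\<close>

lemma fib_card_le:
  assumes K: "cnj ` K \<subseteq> K" "S \<subseteq> pfun K" "V1 = {z \<in> ctorus. \<forall>g\<in>S. g z = 0}"
    and rel: "\<And>i. \<exists>M A. (\<forall>l. A l \<in> pfun K) \<and> (\<exists>l<M. A l \<noteq> (\<lambda>_. 0)) \<and>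
      (\<forall>z\<in>V1. \<forall>z'\<in>V1. (\<Sum>l<M. A l (\<chi> t. z $ t * cnj (z' $ t)) * z $ i ^ l) = 0)"
    and y: "generic K y0" "generic K y1"
  shows "card (fib y0) \<le> card (fib y1)"
proof -
  obtain G0 where G0: "field_graph G0" "\<And>P. P \<in> pfun K \<Longrightarrow> (P y0, P y1) \<in> G0"
    by (rule generic_field_graph[OF y(1,2)]) (rule that; assumption)
  have R0: "ring_graph G0" using G0(1) by (simp add: field_graph_def)
  define A where "A = (\<Union>z\<in>fib y0. range (\<lambda>i. z $ i))"
  have "finite A" unfolding A_def using finite_fib[OF rel y(1)] by auto
  moreover have "\<exists>p p'. (p, p') \<in> poly_graph G0 \<and> p \<noteq> 0 \<and> poly p a = 0" if a: "a \<in> A" for a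
  proof -
    obtain z i where z: "z \<in> fib y0" "a = z $ i" using a by (auto simp: A_def)
    obtain p q where pq: "p \<noteq> 0" "\<forall>z\<in>fib y0. poly p (z $ i) = 0"
      "\<forall>G. ring_graph G \<longrightarrow> (\<forall>P\<in>pfun K. (P y0, P y1) \<in> G) \<longrightarrow> (p, q) \<in> poly_graph G" using fib_algebraic[OF rel y(1), of i] by blast
    have "(p, q) \<in> poly_graph G0" using pq(3) R0 G0(2) by blast
    then show ?thesis using pq(1,2) z by blast
  qed
  ultimately have "\<exists>G. field_graph G \<and> G0 \<subseteq> G \<and> (\<forall>a\<in>A. \<exists>b. (a, b) \<in> G)"
    by (rule field_graph_extend_finite[OF _ G0(1)])
  then obtain G where G: "field_graph G" "G0 \<subseteq> G" "\<forall>a\<in>A. \<exists>b. (a, b) \<in> G" by (elim exE conjE)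
  have R: "ring_graph G" using G(1) by (simp add: field_graph_def)
  define \<sigma> where "\<sigma> a = (SOME b. (a, b) \<in> G)" for a
  have \<sigma>: "(z $ i, \<sigma> (z $ i)) \<in> G" if "z \<in> fib y0" for z i
  proof -
    have "\<exists>b. (z $ i, b) \<in> G" using G(3) that by (auto simp: A_def)
    then show ?thesis unfolding \<sigma>_def by (rule someI_ex)
  qed
  have Kc: "(c, c) \<in> G" if "c \<in> K" for c by (rule subsetD[OF G(2) G0(2)[OF pf_const[OF that]]])
  have yG: "(y0 $ j, y1 $ j) \<in> G" for j by (rule subsetD[OF G(2) G0(2)[OF pf_coord]])
  have V1I: "x' \<in> V1" if x: "x \<in> V1" "\<And>i. (x $ i, x' $ i) \<in> G" for x x'
  proof -
    have "g x' = 0" if g: "g \<in> S" for g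
    proof -
      have "(g x, g x') \<in> G" by (rule pf_graph[OF R Kc x(2)]) (use g K(2) in auto)
      then show ?thesis using rg_zero_iff[OF R] x(1) g unfolding K(3) by auto
    qed
    moreover have "x' $ i \<noteq> 0" for i using x rg_zero_iff[OF R x(2)] by (auto simp: V1_def ctorus_def)
    ultimately show ?thesis unfolding K(3) by (simp add: ctorus_def)
  qed
  \<comment> \<open>A field isomorphism need not commute with conjugation. For the second point it
    transports the conjugate coordinates \<open>y / z\<close>, which satisfy the equations with
    conjugated coefficients; these are again over \<open>K\<close>.\<close>
  have V1I': "x' \<in> V1" if x: "x \<in> V1" "\<And>i. (cnj (x $ i), cnj (x' $ i)) \<in> G" for x x'
  proof -
    have "g x' = 0" if g: "g \<in> S" for g
    proof -
      let ?g = "\<lambda>x. cnj (g (\<chi> j. cnj (x $ j)))"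
      have gK: "?g \<in> pfun K" by (rule pf_subset[OF pf_cnj K(1)]) (use g K(2) in auto)
      have "((\<chi> i. cnj (x $ i)) $ i, (\<chi> i. cnj (x' $ i)) $ i) \<in> G" for i using x(2) by simp
      from pf_graph[OF R Kc this gK] have "(?g (\<chi> i. cnj (x $ i)), ?g (\<chi> i. cnj (x' $ i))) \<in> G" .
      then have "(cnj (g x), cnj (g x')) \<in> G" by simp
      then show ?thesis using rg_zero_iff[OF R] x(1) g unfolding K(3) by auto
    qed
    moreover have "x' $ i \<noteq> 0" for i using x(1) rg_zero_iff[OF R x(2)[of i]] by (auto simp: V1_def ctorus_def)
    ultimately show ?thesis unfolding K(3) by (simp add: ctorus_def)
  qed
  show "card (fib y0) \<le> card (fib y1)"
  proof (rule card_inj_on_le[where f = "\<lambda>z. \<chi> i. \<sigma> (z $ i)"])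
    show "finite (fib y1)" by (rule finite_fib[OF rel y(2)])
    show "inj_on (\<lambda>z. \<chi> i. \<sigma> (z $ i)) (fib y0)"
    proof (rule inj_onI)
      fix z z' assume z: "z \<in> fib y0" "z' \<in> fib y0" and eq: "(\<chi> i. \<sigma> (z $ i)) = (\<chi> i. \<sigma> (z' $ i))"
      have "\<sigma> (z $ i) = \<sigma> (z' $ i)" for i using eq by (simp add: vec_eq_iff)
      then have "z $ i = z' $ i" for i using rg_inj_iff[OF R \<sigma>[OF z(1)] \<sigma>[OF z(2)]] by blast
      then show "z = z'" by (simp add: vec_eq_iff)
    qed
    show "(\<lambda>z. \<chi> i. \<sigma> (z $ i)) ` fib y0 \<subseteq> fib y1"
    proof
      fix z' assume "z' \<in> (\<lambda>z. \<chi> i. \<sigma> (z $ i)) ` fib y0"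
      then obtain z where z: "z \<in> fib y0" "z' = (\<chi> i. \<sigma> (z $ i))" by blast
      have "z' \<in> V1" by (rule V1I[of z]) (use z \<sigma> in \<open>auto simp: fib_def\<close>)
      moreover have "(\<chi> j. cnj (y1 $ j / z' $ j)) \<in> V1"
      proof (rule V1I'[of "\<chi> j. cnj (y0 $ j / z $ j)"])
        show "(\<chi> j. cnj (y0 $ j / z $ j)) \<in> V1" using z(1) by (simp add: fib_def)
        fix i
        have "(inverse (z $ i), inverse (\<sigma> (z $ i))) \<in> G" using G(1) \<sigma>[OF z(1)] by (auto simp: field_graph_def)
        from rg_mult[OF R yG this, of i]
        show "(cnj ((\<chi> j. cnj (y0 $ j / z $ j)) $ i), cnj ((\<chi> j. cnj (y1 $ j / z' $ j)) $ i)) \<in> G"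
          by (simp add: z(2) divide_inverse)
      qed
      ultimately show "z' \<in> fib y1" by (simp add: fib_def)
    qed
  qed
qed

text \<open>Since \<open>sqexp p\<close> is real, \<open>?w\<close> exchanges the two points of a
  pair. It is an involution of the fibre whose fixed points satisfy
  \<open>z $ j * cnj (z $ j) = exp (2 * p $ j)\<close>.\<close>

lemma fib_parity:
  assumes fin: "finite (fib (sqexp p))"
  shows "even (card (fib (sqexp p))) \<longleftrightarrow> even (card {z \<in> V1. Log_map z = p})"
proof -
  let ?y = "sqexp p" and ?w = "\<lambda>z. \<chi> j. cnj (sqexp p $ j / z $ j)"
  have nz: "z $ j \<noteq> 0" if "z \<in> V1" for z j using that by (simp add: V1_def ctorus_def)
  have yj: "?y $ j = of_real (exp (2 * p $ j))" for j by (simp add: sqexp_def cvec_def)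
  have ww: "?w (?w z) = z" if "z \<in> V1" for z
    using nz[OF that] by (simp add: vec_eq_iff yj)
  have "even (card (fib ?y)) \<longleftrightarrow> even (card {z \<in> fib ?y. ?w z = z})"
    by (rule even_card_involution[OF fin]) (use ww in \<open>auto simp: fib_def\<close>)
  also have "{z \<in> fib ?y. ?w z = z} = {z \<in> V1. ?w z = z}" by (auto simp: fib_def)
  also have "\<dots> = {z \<in> V1. Log_map z = p}"
  proof -
    have "?w z = z \<longleftrightarrow> Log_map z = p" if z: "z \<in> V1" for z
    proof -
      have "cnj (?y $ j / z $ j) = z $ j \<longleftrightarrow> ln (norm (z $ j)) = p $ j" for j
      proof -
        have "cnj (?y $ j / z $ j) = z $ j \<longleftrightarrow> of_real (exp (2 * p $ j)) = z $ j * cnj (z $ j)"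
          using nz[OF z, of j] by (auto simp: yj field_simps)
        also have "\<dots> \<longleftrightarrow> exp (2 * p $ j) = (norm (z $ j))\<^sup>2"
          by (simp only: complex_norm_square[symmetric] of_real_eq_iff)
        also have "(norm (z $ j))\<^sup>2 = exp (2 * ln (norm (z $ j)))"
          using nz[OF z, of j] by (simp add: exp_double)
        also have "exp (2 * p $ j) = exp (2 * ln (norm (z $ j))) \<longleftrightarrow> ln (norm (z $ j)) = p $ j" by auto
        finally show ?thesis .
      qed
      then show ?thesis by (simp add: vec_eq_iff Log_map_def)
    qed
    then show ?thesis by auto
  qed
  finally show ?thesis .
qed

text \<open>The volume bound with one point per fibre already makes the volume of the amoeba finite,
  which excludes covering almost all of the space.\<close>

lemma infinite_volume:
  assumes N: "negligible N" and cov: "\<And>p. p \<notin> N \<Longrightarrow> p \<in> Log_map ` V"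
  shows False
proof -
  have "negligible {}" by simp
  have "of_nat 1 * emeasure lborel (Log_map ` V) \<le> ennreal Arg_bound * ennreal (pi ^ CARD('m))"
  proof (rule volume_bound[OF \<open>negligible {}\<close>])
    fix u assume "u \<in> Log_map ` V"
    then obtain x where "x \<in> V" "Log_map x = u" by blast
    then show "\<exists>X\<subseteq>V. finite X \<and> card X = 1 \<and> (\<forall>x\<in>X. Log_map x = u)"
      by (intro exI[of _ "{x}"]) auto
  qed
  moreover have "emeasure lborel (Log_map ` V) = emeasure lborel (UNIV :: (real ^ 'm) set)"
  proof (rule emeasure_eq_AE)
    show "AE p in lborel. p \<in> Log_map ` V \<longleftrightarrow> p \<in> (UNIV :: (real ^ 'm) set)"
      using negligible_AE_lborel[OF N] by eventually_elim (use cov in auto)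
    show "Log_map ` V \<in> sets lborel" using closed_amoeba by simp
  qed simp
  ultimately show False by (simp add: ennreal_mult[symmetric] Arg_bound_def prod_nonneg top_unique)
qed

theorem generic_fibre_two_points:
  obtains N where "negligible N"
    "\<And>u. u \<in> Log_map ` V \<Longrightarrow> u \<notin> N \<Longrightarrow> \<exists>X\<subseteq>V. finite X \<and> card X = 2 \<and> (\<forall>x\<in>X. Log_map x = u)"
proof -
  obtain K S where K: "countable K" "cnj ` K \<subseteq> K" "S \<subseteq> pfun K" "V1 = {z \<in> ctorus. \<forall>g\<in>S. g z = 0}"
    and rel: "\<And>i. \<exists>M A. (\<forall>l. A l \<in> pfun K) \<and> (\<exists>l<M. A l \<noteq> (\<lambda>_. 0)) \<and>
      (\<forall>z\<in>V1. \<forall>z'\<in>V1. (\<Sum>l<M. A l (\<chi> t. z $ t * cnj (z' $ t)) * z $ i ^ l) = 0)"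
    by (rule field_of_definition) (rule that; assumption)
  obtain N1 where N1: "negligible N1" "\<And>x. x \<in> V \<Longrightarrow> Log_map x \<notin> N1 \<Longrightarrow> etale x"
    apply (rule generic_Log)
    subgoal premises p by (rule p(1), rule p(2), rule p(3))
    done
  define N2 where "N2 = (\<Union>P\<in>pfun K - {\<lambda>_. 0}. {p :: real ^ 'm. P (sqexp p) = 0})"
  have "negligible N2"
    unfolding N2_def
  proof (rule negligible_countable_Union)
    show "countable ((\<lambda>P. {p :: real ^ 'm. P (sqexp p) = 0}) ` (pfun K - {\<lambda>_. 0}))"
      using countable_pfun[OF K(1)] by (intro countable_image) (auto intro: countable_subset)
  qed (use negligible_exp_zeros in blast)
  have gen: "generic K (sqexp p)" if "p \<notin> N2" for p using that by (auto simp: N2_def generic_def)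
  \<comment> \<open>Off \<open>N1\<close> all points of the fibre are etale, hence good, and so
    belong to \<open>V1\<close>.\<close>
  have eq: "{z \<in> V1. Log_map z = p} = {z \<in> V. Log_map z = p}" if "p \<notin> N1" for p
  proof -
    have "z \<in> V1" if z: "z \<in> V" "Log_map z = p" for z
    proof -
      have "etale z" using N1(2) z \<open>p \<notin> N1\<close> by blast
      then obtain I G U where "good z I G U" by (auto simp: etale_def)
      then show ?thesis using Z_subset_V1 by (auto simp: Z_def)
    qed
    then show ?thesis using V1_subset_V by auto
  qed
  define N where "N = N1 \<union> N2"
  have N: "negligible N" using N1(1) \<open>negligible N2\<close> by (simp add: N_def negligible_Un)
  have two: "\<exists>X\<subseteq>V. finite X \<and> card X = 2 \<and> (\<forall>x\<in>X. Log_map x = u)" if u: "u \<in> Log_map ` V" "u \<notin> N" for u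
  proof (rule ccontr)
    assume no: "\<not> ?thesis"
    obtain x where x: "x \<in> V" "Log_map x = u" using u(1) by blast
    have "x' = x" if "x' \<in> V" "Log_map x' = u" for x'
    proof (rule ccontr)
      assume "x' \<noteq> x"
      then have "\<exists>X\<subseteq>V. finite X \<and> card X = 2 \<and> (\<forall>x\<in>X. Log_map x = u)"
        using x that by (intro exI[of _ "{x, x'}"]) auto
      with no show False ..
    qed
    then have "{z \<in> V. Log_map z = u} = {x}" using x by blast
    then have odd1: "card {z \<in> V1. Log_map z = u} = 1" using eq[of u] u(2) by (simp add: N_def)
    have same: "finite (fib (sqexp p))" "card (fib (sqexp p)) = card (fib (sqexp u))" if p: "p \<notin> N" for p
    proof -
      have g: "generic K (sqexp p)" "generic K (sqexp u)" using gen p u(2) by (auto simp: N_def)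
      show "finite (fib (sqexp p))" by (rule finite_fib[OF rel g(1)])
      show "card (fib (sqexp p)) = card (fib (sqexp u))"
        by (rule antisym) (rule fib_card_le[OF K(2-4) rel], rule g, rule g)+
    qed
    have "odd (card (fib (sqexp u)))" using fib_parity[OF same(1)[OF u(2)]] odd1 by simp
    then have ne: "card {z \<in> V1. Log_map z = p} \<noteq> 0" if "p \<notin> N" for p
      using fib_parity[OF same(1)[OF that]] same(2)[OF that] by (metis even_zero)
    show False
    proof (rule infinite_volume[OF N])
      fix p assume "p \<notin> N"
      then have "{z \<in> V1. Log_map z = p} \<noteq> {}" using ne[of p] by (intro notI) simp
      then obtain z where "z \<in> V1" "Log_map z = p" by blast
      then show "p \<in> Log_map ` V" using V1_subset_V by blast
    qed
  qed
  show thesis by (rule that[OF N two])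
qed

end

section \<open>Projective dimension and codimension of charts\<close>

definition emb :: "complex ^ 'm::finite \<Rightarrow> complex ^ 'm option" where
  "emb z = (\<chi> i. case i of None \<Rightarrow> 1 | Some j \<Rightarrow> z $ j)"

lemma emb_nth [simp]: "emb z $ None = 1" "emb z $ Some j = z $ j"
  by (simp_all add: emb_def)

lemma emb_nz: "emb z \<noteq> 0"
  by (metis emb_nth(1) zero_index zero_neq_one)

lemma poly_eval_scale:
  assumes "homogeneous D P"
  shows "poly_eval P (c *s x) = c ^ D * poly_eval P x"
proof -
  have "Poly_Mapping.lookup P m * (\<Prod>i\<in>UNIV. ((c *s x) $ i) ^ Poly_Mapping.lookup m i) = c ^ D * (Poly_Mapping.lookup P m * (\<Prod>i\<in>UNIV. (x $ i) ^ Poly_Mapping.lookup m i))"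
    if m: "m \<in> Poly_Mapping.keys P" for m
  proof -
    have "(\<Prod>i\<in>UNIV. ((c *s x) $ i) ^ Poly_Mapping.lookup m i) = (\<Prod>i\<in>UNIV. c ^ Poly_Mapping.lookup m i) * (\<Prod>i\<in>UNIV. (x $ i) ^ Poly_Mapping.lookup m i)"
      by (simp add: power_mult_distrib prod.distrib)
    also have "(\<Prod>i\<in>UNIV. c ^ Poly_Mapping.lookup m i) = c ^ D"
      using assms m by (simp add: homogeneous_def power_sum[symmetric])
    finally show ?thesis by simp
  qed
  then show ?thesis unfolding poly_eval_def sum_distrib_left by (rule sum.cong[OF refl])
qed

lemma proj_point_eq: "proj_point z = range (\<lambda>c. c *s emb z)"
  by (simp add: proj_point_def emb_def[symmetric] vec.span_singleton)

lemma proj_point_space: "proj_point z \<in> proj_space"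
  using vec.dim_span[of "{emb z}"] vec.dim_eq_card_independent[of "{emb z}"] emb_nz
  by (simp add: proj_space_def proj_point_def emb_def[symmetric] vec.subspace_span)

lemma proj_point_zeros:
  assumes "\<And>P. P \<in> T \<Longrightarrow> \<exists>D. homogeneous D P"
  shows "proj_point z \<in> proj_zeros T \<longleftrightarrow> (\<forall>P\<in>T. poly_eval P (emb z) = 0)"
proof -
  have "(\<forall>x\<in>proj_point z. poly_eval P x = 0) \<longleftrightarrow> poly_eval P (emb z) = 0" if P: "P \<in> T" for P
  proof -
    obtain D where D: "homogeneous D P" using assms[OF P] by blast
    have "emb z \<in> proj_point z" unfolding proj_point_eq by (rule image_eqI[of _ _ 1]) simp_all
    then show ?thesis unfolding proj_point_eq by (auto simp: poly_eval_scale[OF D])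
  qed
  then show ?thesis using proj_point_space by (auto simp: proj_zeros_def)
qed

lemma poly_eval_emb:
  "poly_eval P (emb z) = (\<Sum>m\<in>Poly_Mapping.keys P. Poly_Mapping.lookup P m * (\<Prod>j\<in>UNIV. (z $ j) ^ Poly_Mapping.lookup m (Some j)))"
proof -
  have "(\<Prod>i\<in>UNIV. (emb z $ i) ^ Poly_Mapping.lookup m i) = (\<Prod>j\<in>UNIV. (z $ j) ^ Poly_Mapping.lookup m (Some j))" for m
    unfolding UNIV_option_conv by (simp add: prod.reindex)
  then show ?thesis by (simp add: poly_eval_def)
qed

lemma poly_eval_emb_pfun: "(\<lambda>z. poly_eval P (emb z)) \<in> pfun UNIV"
  unfolding poly_eval_emb by (intro pf_sum pf_mult pf_const pf_prod pf_power pf_coord) simp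

lemma poly_eval_emb_pdeg:
  assumes "homogeneous D P"
  shows "(\<lambda>z. poly_eval P (emb z)) \<in> pdeg (\<lambda>i z. z $ i) D"
  unfolding poly_eval_emb
proof (rule pdeg_sum)
  fix m assume m: "m \<in> Poly_Mapping.keys P"
  have "(\<Sum>i\<in>UNIV. Poly_Mapping.lookup m i) = Poly_Mapping.lookup m None + (\<Sum>j\<in>UNIV. Poly_Mapping.lookup m (Some j))"
    unfolding UNIV_option_conv by (simp add: sum.reindex)
  then have "(\<Sum>j\<in>UNIV. Poly_Mapping.lookup m (Some j)) \<le> D" using assms m by (simp add: homogeneous_def)
  then have "pmon (\<lambda>i z. z $ i) (\<lambda>j. Poly_Mapping.lookup m (Some j)) \<in> pdeg (\<lambda>i z. z $ i) D"
    by (intro pdeg_pmon) (simp add: exps_def)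
  from pdeg_mult[OF pdeg_const[where D = 0 and k = "Poly_Mapping.lookup P m"] this]
  show "(\<lambda>z. Poly_Mapping.lookup P m * (\<Prod>j\<in>UNIV. (z $ j) ^ Poly_Mapping.lookup m (Some j))) \<in> pdeg (\<lambda>i z. z $ i) D"
    by (simp add: pmon_def)
qed

text \<open>The homogenisation of \<open>z $ j - a\<close>; it will separate consecutive members of
  a chain of closed sets.\<close>

definition coord_form :: "'m \<Rightarrow> complex \<Rightarrow> 'm::finite option cpoly" where
  "coord_form j a = Poly_Mapping.single (Poly_Mapping.single (Some j) 1) 1 +
     Poly_Mapping.single (Poly_Mapping.single None 1) (- a)"

lemma
  fixes j :: "'m::finite"
  shows homogeneous_coord_form: "homogeneous 1 (coord_form j a)"
    and coord_form_eval: "poly_eval (coord_form j a) (emb z) = z $ j - a"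
proof -
  let ?s = "Poly_Mapping.single (Some j) (1 :: nat)" and ?n = "Poly_Mapping.single (None :: 'm option) (1 :: nat)"
  have ne: "?s \<noteq> ?n" by (metis lookup_single_eq lookup_single_not_eq option.distinct(1) zero_neq_one)
  have keys: "Poly_Mapping.keys (coord_form j a) \<subseteq> {?s, ?n}"
    unfolding coord_form_def by (rule order_trans[OF Poly_Mapping.keys_add]) auto
  have one: "(\<Sum>i\<in>UNIV. Poly_Mapping.lookup (Poly_Mapping.single k (1 :: nat)) i) = 1" for k :: "'m option"
    by (simp add: lookup_single when_def)
  show "homogeneous 1 (coord_form j a)" unfolding homogeneous_def using keys one by auto
  have mono: "(\<Prod>i\<in>UNIV. (x $ i) ^ Poly_Mapping.lookup (Poly_Mapping.single k (1 :: nat)) i) = x $ k" for k and x :: "complex ^ 'm option"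
    by (simp add: lookup_single when_def if_distrib[of "\<lambda>e. _ ^ e"] cong: if_cong)
  have "poly_eval (coord_form j a) (emb z) = (\<Sum>m\<in>{?s, ?n}. Poly_Mapping.lookup (coord_form j a) m * (\<Prod>i\<in>UNIV. (emb z $ i) ^ Poly_Mapping.lookup m i))"
    unfolding poly_eval_def by (rule sum.mono_neutral_left) (use keys in \<open>auto simp: in_keys_iff\<close>)
  also have "\<dots> = z $ j - a"
    using ne mono[of "emb z" "Some j"] mono[of "emb z" None]
    by (simp add: coord_form_def lookup_add lookup_single_not_eq)
  finally show "poly_eval (coord_form j a) (emb z) = z $ j - a" .
qed

lemma product_vanishing_segment:
  fixes h1 h2 :: "complex \<Rightarrow> complex"
  assumes hol: "h1 holomorphic_on S" "h2 holomorphic_on S" and S: "open S" "connected S"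
    and z: "\<And>t. t \<in> S \<Longrightarrow> h1 t = 0 \<or> h2 t = 0" and ab: "a \<in> S" "b \<in> S" "h1 a \<noteq> 0"
  shows "h2 b = 0"
proof -
  let ?U = "S \<inter> h1 -` (- {0})"
  have "open ?U"
    by (rule continuous_open_preimage[OF holomorphic_on_imp_continuous_on[OF hol(1)] S(1)]) auto
  then show ?thesis
    using analytic_continuation_open[of ?U S h2 "\<lambda>_. 0" b] S ab z hol(2) by auto
qed

text \<open>The zero set of these forms is the projective closure of \<open>B\<close> placed in the
  chart \<open>[1 : z]\<close>.\<close>

definition image_ideal :: "(complex ^ 'm::finite) set \<Rightarrow> 'm option cpoly set" where
  "image_ideal B = {P. (\<exists>D. homogeneous D P) \<and> (\<forall>z\<in>B. poly_eval P (emb z) = 0)}"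

lemma image_ideal_antimono: "B \<subseteq> B' \<Longrightarrow> image_ideal B' \<subseteq> image_ideal B"
  by (auto simp: image_ideal_def)

lemma image_ideal_homogeneous: "P \<in> image_ideal B \<Longrightarrow> \<exists>D. homogeneous D P"
  by (simp add: image_ideal_def)

text \<open>If two closed sets cover the closure but neither contains it, there are forms
  \<open>P\<close> and \<open>Q\<close> with vanishing product on \<open>B\<close>, nonzero at
  points \<open>z\<close> and \<open>w\<close> of \<open>B\<close>. On a holomorphic curve in
  \<open>B\<close> joining these points the identity theorem makes \<open>Q\<close> vanish at
  \<open>w\<close>.\<close>

lemma irreducible_closure:
  assumes ne: "B \<noteq> {}"
    and path: "\<And>z w. z \<in> B \<Longrightarrow> w \<in> B \<Longrightarrow> \<exists>S c a b. open S \<and> connected S \<and> c ` S \<subseteq> B \<and>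
      (\<forall>i. (\<lambda>t. c t $ i) holomorphic_on S) \<and> a \<in> S \<and> b \<in> S \<and> c a = z \<and> c b = w"
  shows "zariski_irreducible (proj_zeros (image_ideal B))"
  unfolding zariski_irreducible_def
proof (intro conjI allI impI)
  let ?C = "proj_zeros (image_ideal B)"
  have mem: "proj_point z \<in> ?C" if "z \<in> B" for z
    using that by (subst proj_point_zeros) (auto simp: image_ideal_def)
  show "zariski_closed ?C" unfolding zariski_closed_def using image_ideal_homogeneous by blast
  show "?C \<noteq> {}" using ne mem by blast
  fix Y Z assume Y: "zariski_closed Y" and Z: "zariski_closed Z" and C: "?C = Y \<union> Z"
  obtain S where S: "\<And>P. P \<in> S \<Longrightarrow> \<exists>D. homogeneous D P" "Y = proj_zeros S" using Y unfolding zariski_closed_def by blast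
  obtain T where T: "\<And>P. P \<in> T \<Longrightarrow> \<exists>D. homogeneous D P" "Z = proj_zeros T" using Z unfolding zariski_closed_def by blast
  have sub: "?C \<subseteq> proj_zeros R" if "R \<subseteq> image_ideal B" for R using that by (auto simp: proj_zeros_def)
  show "?C = Y \<or> ?C = Z"
  proof (rule ccontr)
    assume "\<not> (?C = Y \<or> ?C = Z)"
    then have "\<not> ?C \<subseteq> Y" "\<not> ?C \<subseteq> Z" using C by auto
    then obtain P Q where PQ: "P \<in> S" "P \<notin> image_ideal B" "Q \<in> T" "Q \<notin> image_ideal B"
      using sub unfolding S(2) T(2) by blast
    obtain z w where zw: "z \<in> B" "poly_eval P (emb z) \<noteq> 0" "w \<in> B" "poly_eval Q (emb w) \<noteq> 0"
      using PQ(2,4) S(1)[OF PQ(1)] T(1)[OF PQ(3)] by (auto simp: image_ideal_def)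
    obtain R c a b where c: "open R" "connected R" "c ` R \<subseteq> B" "\<forall>i. (\<lambda>t. c t $ i) holomorphic_on R"
      "a \<in> R" "b \<in> R" "c a = z" "c b = w"
      using path[OF zw(1,3)] by (elim exE conjE)
    have prod: "poly_eval P (emb u) = 0 \<or> poly_eval Q (emb u) = 0" if u: "u \<in> B" for u
    proof -
      have "proj_point u \<in> proj_zeros S \<or> proj_point u \<in> proj_zeros T" using mem[OF u] C unfolding S(2) T(2) by blast
      then show ?thesis using proj_point_zeros[OF S(1)] proj_point_zeros[OF T(1)] PQ(1,3) by blast
    qed
    have "poly_eval Q (emb (c b)) = 0"
    proof (rule product_vanishing_segment[where S = R and a = a and ?h1.0 = "\<lambda>t. poly_eval P (emb (c t))" and ?h2.0 = "\<lambda>t. poly_eval Q (emb (c t))"])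
      show "(\<lambda>t. poly_eval P (emb (c t))) holomorphic_on R" "(\<lambda>t. poly_eval Q (emb (c t))) holomorphic_on R"
        using c(4) by (auto intro: pf_comp_holomorphic[OF poly_eval_emb_pfun])
      show "poly_eval P (emb (c t)) = 0 \<or> poly_eval Q (emb (c t)) = 0" if "t \<in> R" for t
        using prod c(3) that by blast
    qed (use c zw in auto)
    then show False using zw(4) c(8) by simp
  qed
qed

text \<open>A chart of codimension less than \<open>n\<close> contains the images of coordinate slices of the dimensions
  \<open>0, \<dots>, n + 1\<close>; their closures form a chain that is too long.\<close>

lemma codim_le:
  fixes F :: "nat \<Rightarrow> 'm::finite option cpoly"
  assumes card: "CARD('m) = 2 * n"
    and hom: "\<And>j. j \<in> {1..n} \<Longrightarrow> homogeneous (d j) (F j)"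
    and dim: "has_proj_dim (\<Inter>j\<in>{1..n}. proj_zeros {F j}) n"
    and chart: "chartp UNIV I G" "x \<in> slice I G" and U: "open U" "x \<in> U"
    and van: "\<And>z j. z \<in> U \<Longrightarrow> (\<And>i. i \<in> I \<Longrightarrow> G i z = 0) \<Longrightarrow> j \<in> {1..n} \<Longrightarrow> poly_eval (F j) (emb z) = 0"
  shows "n \<le> card I"
proof (rule ccontr)
  assume "\<not> n \<le> card I"
  \<comment> \<open>At least \<open>n + 1\<close> coordinates remain free, one more than the
    dimension allows.\<close>
  then have cI: "Suc n \<le> card (- I)" using card by (simp add: Compl_eq_Diff_UNIV card_Diff_subset)
  have Gp: "G i \<in> pfun UNIV" and Gc: "i \<notin> I \<Longrightarrow> G i = (\<lambda>x. x $ i)" for i using chart(1) by (auto simp: chartp_def)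
  have nz: "det (jac G x) \<noteq> 0" and Gx: "i \<in> I \<Longrightarrow> G i x = 0" for i using chart(2) by (auto simp: slice_def)
  obtain U1 V1 g where L: "open U1" "x \<in> U1" "open V1" "evalv G x \<in> V1" "homeomorphism U1 V1 (evalv G) g"
    "\<And>y. y \<in> V1 \<Longrightarrow> (g has_derivative (\<lambda>h. matrix_inv (jac G (g y)) *v h)) (at y)"
    by (rule local_inverse[OF Gp nz]) (rule that; assumption)
  define y0 where "y0 = evalv G x"
  have gy0: "g y0 = x" using L(2,5) by (simp add: y0_def homeomorphism_def)
  have Gg: "evalv G (g y) = y" if "y \<in> V1" for y using L(5) that by (simp add: homeomorphism_def)
  have "open (V1 \<inter> g -` U)"
    using L(3,5) U(1) by (intro continuous_open_preimage) (auto simp: homeomorphism_def)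
  moreover have "y0 \<in> V1 \<inter> g -` U" using L(4) gy0 U(2) by (simp add: y0_def)
  ultimately obtain \<delta> where \<delta>: "\<delta> > 0" "ball y0 \<delta> \<subseteq> V1 \<inter> g -` U" by (meson openE)
  obtain e where e: "bij_betw e {0..<card (- I)} (- I)" using ex_bij_betw_nat_finite[of "- I"] by auto
  define J where "J s = e ` {0..<s}" for s
  have JI: "J s \<subseteq> - I" if "s \<le> Suc n" for s
    using that cI e by (auto simp: J_def bij_betw_def)
  \<comment> \<open>A disc in the first \<open>s\<close> free coordinates; \<open>B 0\<close> is the
    single point \<open>x\<close>.\<close>
  define B where "B s = g ` {v \<in> ball y0 \<delta>. \<forall>i. i \<notin> J s \<longrightarrow> v $ i = y0 $ i}" for s
  have BU: "poly_eval (F j) (emb z) = 0" if z: "z \<in> B s" and s: "s \<le> Suc n" and j: "j \<in> {1..n}" for z s j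
  proof -
    obtain v where v: "z = g v" "v \<in> ball y0 \<delta>" "\<And>i. i \<notin> J s \<Longrightarrow> v $ i = y0 $ i" using z by (auto simp: B_def)
    have vV: "v \<in> V1" "g v \<in> U" using v(2) \<delta>(2) by auto
    show ?thesis
    proof (rule van[OF _ _ j])
      show "z \<in> U" using vV(2) v(1) by simp
      fix i assume i: "i \<in> I"
      have "G i z = v $ i" using arg_cong[OF Gg[OF vV(1)], of "\<lambda>w. w $ i"] v(1) by simp
      also have "\<dots> = y0 $ i" using v(3) JI[OF s] i by blast
      also have "\<dots> = 0" using Gx[OF i] by (simp add: y0_def)
      finally show "G i z = 0" .
    qed
  qed
  define C where "C s = proj_zeros (image_ideal (B s))" for s
  have mem: "proj_point z \<in> C s" if "z \<in> B s" for z s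
    unfolding C_def by (subst proj_point_zeros) (use that in \<open>auto simp: image_ideal_def\<close>)
  have irr: "zariski_irreducible (C s)" for s
    unfolding C_def
  proof (rule irreducible_closure)
    have "g y0 \<in> B s" unfolding B_def using \<delta>(1) by (intro imageI) simp
    then show "B s \<noteq> {}" by blast
    fix z w assume "z \<in> B s" "w \<in> B s"
    then obtain v u where v: "z = g v" "v \<in> ball y0 \<delta>" "\<And>i. i \<notin> J s \<Longrightarrow> v $ i = y0 $ i"
      and u: "w = g u" "u \<in> ball y0 \<delta>" "\<And>i. i \<notin> J s \<Longrightarrow> u $ i = y0 $ i" by (auto simp: B_def)
    let ?l = "\<lambda>t. v + t *s (u - v)"
    let ?S = "?l -` ball y0 \<delta>"
    have lin: "?l t = (\<chi> i. v $ i + t * (u $ i - v $ i))" for t by (simp add: vec_eq_iff algebra_simps)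
    have cont: "continuous_on UNIV ?l" unfolding lin by (intro continuous_intros)
    have S: "open ?S" by (rule open_vimage[OF open_ball cont])
    have "convex ?S"
    proof (rule convexI)
      fix a b :: complex and p q :: real assume ab: "a \<in> ?S" "b \<in> ?S" "0 \<le> p" "0 \<le> q" "p + q = 1"
      have "?l (p *\<^sub>R a + q *\<^sub>R b) = p *\<^sub>R ?l a + q *\<^sub>R ?l b"
      proof -
        have "v = (p + q) *\<^sub>R v" using ab(5) by simp
        then show ?thesis
          by (simp add: vec_eq_iff scaleR_conv_of_real[where ?'a = complex] algebra_simps)
      qed
      moreover have "p *\<^sub>R ?l a + q *\<^sub>R ?l b \<in> ball y0 \<delta>"
        using convexD[OF convex_ball, of "?l a" y0 \<delta> "?l b" p q] ab by auto
      ultimately show "p *\<^sub>R a + q *\<^sub>R b \<in> ?S" by simp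
    qed
    then have "connected ?S" by (rule convex_connected)
    moreover have "(\<lambda>t. g (?l t)) ` ?S \<subseteq> B s"
    proof clarify
      fix t assume "?l t \<in> ball y0 \<delta>"
      then show "g (?l t) \<in> B s" unfolding B_def by (intro imageI) (use v(3) u(3) in auto)
    qed
    moreover have "(\<lambda>t. g (?l t) $ i) holomorphic_on ?S" for i
      unfolding holomorphic_on_open[OF S]
    proof (intro ballI exI)
      fix t assume "t \<in> ?S"
      then have "?l t \<in> V1" using \<delta>(2) by auto
      then show "((\<lambda>t. g (?l t) $ i) has_field_derivative (matrix_inv (jac G (g (?l t))) *v (u - v)) $ i) (at t)"
        by (intro line_component_derivative L(6))
    qed
    ultimately show "\<exists>S c a b. open S \<and> connected S \<and> c ` S \<subseteq> B s \<and>
      (\<forall>i. (\<lambda>t. c t $ i) holomorphic_on S) \<and> a \<in> S \<and> b \<in> S \<and> c a = z \<and> c b = w"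
      using S v u by (intro exI[of _ ?S] exI[of _ "\<lambda>t. g (?l t)"] exI[of _ 0] exI[of _ 1]) auto
  qed
  have "irreducible_chain (\<Inter>j\<in>{1..n}. proj_zeros {F j}) (Suc n)"
    unfolding irreducible_chain_def
  proof (intro exI[of _ C] conjI allI impI)
    show "zariski_irreducible (C s)" for s by (rule irr)
    show "C s \<subseteq> (\<Inter>j\<in>{1..n}. proj_zeros {F j})" if s: "s \<le> Suc n" for s
    proof -
      have "F j \<in> image_ideal (B s)" if j: "j \<in> {1..n}" for j
        using hom[OF j] BU[OF _ s j] by (auto simp: image_ideal_def)
      then show ?thesis by (auto simp: C_def proj_zeros_def)
    qed
    fix s assume s: "s < Suc n"
    have JJ: "J (Suc s) = insert (e s) (J s)" by (auto simp: J_def less_Suc_eq)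
    have eJ: "e s \<notin> J s"
    proof
      assume "e s \<in> J s"
      then obtain k where "k < s" "e s = e k" by (auto simp: J_def)
      then show False using inj_onD[OF bij_betw_imp_inj_on[OF e], of s k] s cI by simp
    qed
    have eI: "e s \<notin> I" using JI[of "Suc s"] s JJ by auto
    have BB: "B s \<subseteq> B (Suc s)" unfolding B_def JJ by (intro image_mono) auto
    have sub: "C s \<subseteq> C (Suc s)"
      unfolding C_def proj_zeros_def using image_ideal_antimono[OF BB] by blast
    \<comment> \<open>The coordinate \<open>e s\<close> is constant on \<open>B s\<close> and varies
      on \<open>B (Suc s)\<close>, so this form separates their closures.\<close>
    let ?P = "coord_form (e s) (x $ e s)"
    have ge: "g v $ e s = v $ e s" if "v \<in> ball y0 \<delta>" for v
      using arg_cong[OF Gg, of v "\<lambda>w. w $ e s"] that \<delta>(2) Gc[OF eI] by auto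
    have y0e: "y0 $ e s = x $ e s" using Gc[OF eI] by (simp add: y0_def)
    have "?P \<in> image_ideal (B s)"
      using eJ homogeneous_coord_form[of "e s" "x $ e s"]
      by (auto simp: image_ideal_def B_def coord_form_eval ge y0e)
    moreover define v where "v = y0 + axis (e s) (of_real (\<delta> / 2))"
    have "norm (axis (e s) c :: complex ^ 'm) = norm c" for c
      by (simp add: norm_eq_sqrt_inner inner_axis_axis)
    from this[of "of_real (\<delta> / 2)"] have vb: "v \<in> ball y0 \<delta>" using \<delta>(1) by (simp add: v_def dist_norm norm_divide)
    have vB: "g v \<in> B (Suc s)"
      unfolding B_def JJ by (intro imageI) (use vb in \<open>auto simp: v_def axis_def\<close>)
    have "poly_eval ?P (emb (g v)) \<noteq> 0"
      unfolding coord_form_eval ge[OF vb] using \<delta>(1) by (simp add: v_def y0e)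
    ultimately have "proj_point (g v) \<notin> C s"
      unfolding C_def by (subst proj_point_zeros) (auto simp: image_ideal_def)
    then show "C s \<subset> C (Suc s)" using sub mem[OF vB] by blast
  qed
  then show False using dim by (simp add: has_proj_dim_def)
qed

theorem corollary3:
  fixes n :: nat
    and d :: "nat \<Rightarrow> nat"
    and F :: "nat \<Rightarrow> 'm::finite option cpoly"
    and H :: "nat \<Rightarrow> (complex ^ 'm option) set set"
    and Vbar :: "(complex ^ 'm option) set set"
    and V :: "(complex ^ 'm) set"
  assumes "n \<ge> 1"
    and "CARD('m) = 2 * n"
    and "\<And>j. j \<in> {1..n} \<Longrightarrow> hypersurface (d j) (F j) (H j)"
    and "Vbar = (\<Inter>j\<in>{1..n}. H j)"
    and "has_proj_dim Vbar n"
    and "V = torus_part Vbar"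
  shows "(\<forall>\<S>. stratification \<S> V \<longrightarrow>
            covers_at_most (\<lambda>x. x) Log_map V \<S>
              (fact (2 * n) / (fact n)^2 * (\<Prod>j=1..n. (real (d j))^2)) \<and>
            covers_at_most (residue_vec pi) Arg_pi_map V \<S> (\<Prod>j=1..n. (real (d j))^2) \<and>
            covers_at_most (residue_vec (2 * pi)) Arg_map V \<S> (\<Prod>j=1..n. (real (d j))^2))
       \<and> Log_map ` V \<in> lmeasurable
       \<and> measure lebesgue (Log_map ` V) \<le> pi ^ (2 * n) / 2 * (\<Prod>j=1..n. (real (d j))^2)"
proof -
  have hs: "d j \<ge> 1" "homogeneous (d j) (F j)" "H j = proj_zeros {F j}" if "j \<in> {1..n}" for j
    using assms(3)[OF that] by (auto simp: hypersurface_def)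
  have Vb: "Vbar = (\<Inter>j\<in>{1..n}. proj_zeros {F j})" using assms(4) hs(3) by simp
  define f where "f j z = poly_eval (F j) (emb z)" for j z
  \<comment> \<open>The forms are dehomogenised in the chart \<open>[1 : z]\<close>, where degrees
    do not grow; the dimension hypothesis enters through \<open>codim_le\<close>.\<close>
  interpret T: torus_variety n f d
  proof
    show "CARD('m) = 2 * n" by fact
    show "f j \<in> pdeg (\<lambda>i z. z $ i) (d j)" if "j \<in> {1..n}" for j
      unfolding f_def[abs_def] by (rule poly_eval_emb_pdeg[OF hs(2)[OF that]])
    show "d j \<ge> 1" if "j \<in> {1..n}" for j by (rule hs(1)[OF that])
    show "n \<le> card I" if "chartp UNIV I G" "x \<in> slice I G" "x \<in> ctorus" "open U" "x \<in> U"
      "\<And>z j. z \<in> U \<Longrightarrow> (\<And>i. i \<in> I \<Longrightarrow> G i z = 0) \<Longrightarrow> j \<in> {1..n} \<Longrightarrow> f j z = 0" for I G x U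
      by (rule codim_le[OF assms(2) hs(2) assms(5)[unfolded Vb] that(1,2,4,5)]) (use that(6) in \<open>simp_all add: f_def\<close>)
  qed
  have V: "V = T.V"
  proof -
    have "proj_point z \<in> proj_zeros {F j} \<longleftrightarrow> f j z = 0" if "j \<in> {1..n}" for j z
      using proj_point_zeros[of "{F j}" z] hs(2)[OF that] by (auto simp: f_def)
    then have "proj_point z \<in> Vbar \<longleftrightarrow> (\<forall>j\<in>{1..n}. f j z = 0)" for z
      unfolding Vb by simp
    then show ?thesis unfolding assms(6) torus_part_def T.V_def by simp
  qed
  obtain N where N: "negligible N"
    "\<And>u. u \<in> Log_map ` V \<Longrightarrow> u \<notin> N \<Longrightarrow> \<exists>X\<subseteq>V. finite X \<and> card X = 2 \<and> (\<forall>x\<in>X. Log_map x = u)"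
    unfolding V
    apply (rule T.generic_fibre_two_points)
    subgoal premises p by (rule p(1), rule p(2), rule p(3))
    done
  let ?A = "Log_map ` V" and ?b = "\<Prod>j=1..n. (real (d j))\<^sup>2"
  have b0: "?b \<ge> 0" by (intro prod_nonneg) simp
  \<comment> \<open>Two points in a generic nonempty fibre are the source of the factor
    \<open>1 / 2\<close> in the volume.\<close>
  have "of_nat 2 * emeasure lborel ?A \<le> ennreal ?b * ennreal (pi ^ (2 * n))"
    using T.volume_bound[OF N(1)[unfolded V], of 2] N(2) unfolding V T.Arg_bound_def assms(2) by blast
  then have two: "2 * emeasure lborel ?A \<le> ennreal (?b * pi ^ (2 * n))"
    using b0 by (simp add: ennreal_mult)
  have Am: "?A \<in> sets borel" using T.closed_amoeba unfolding V by (rule borel_closed)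
  have fin: "emeasure lborel ?A < \<infinity>"
  proof (rule ccontr)
    assume "\<not> emeasure lborel ?A < \<infinity>"
    then have "emeasure lborel ?A = \<infinity>" by (metis top.not_eq_extremum infinity_ennreal_def)
    then show False using two by (simp add: ennreal_mult_top top_unique)
  qed
  have lm: "?A \<in> lmeasurable" using Am fin by (intro fmeasurableI) auto
  have "emeasure lborel ?A = ennreal (measure lebesgue ?A)"
    using emeasure_eq_measure2[OF lm] Am by simp
  then have "ennreal (2 * measure lebesgue ?A) \<le> ennreal (?b * pi ^ (2 * n))"
    using two by (simp add: ennreal_mult)
  then have "2 * measure lebesgue ?A \<le> ?b * pi ^ (2 * n)"
    using b0 by (subst (asm) ennreal_le_iff) auto
  moreover have "covers_at_most (\<lambda>x. x) Log_map V \<S> (fact (2 * n) / (fact n)^2 * ?b)" if "stratification \<S> V" for \<S>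
    using T.Log_covers[of \<S>] that unfolding V T.Log_bound_def .
  moreover have "covers_at_most (residue_vec pi) Arg_pi_map V \<S> ?b" "covers_at_most (residue_vec (2 * pi)) Arg_map V \<S> ?b"
    if "stratification \<S> V" for \<S>
    using T.Arg_covers[of \<S>] that unfolding V by simp_all
  ultimately show ?thesis using lm by (simp add: mult.commute)
qed

end
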